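(* Let $n\ge2$, let $\delta\in(0,1)$, and set $\Omega_2=B_2\setminus\overline{B_{1/2}}$, $\Omega_1=B_1\setminus\overline{B_{1/2}}$ and $\tilde\Omega_1=B_{1+\delta}\setminus\overline{B_{1/2}}$ in $\mathbb{R}^n$. Let $V\in L^\infty(\Omega_2)$ be such that zero is not a Dirichlet eigenvalue of $\Delta+V$ in $\Omega_2$, and let $q\in C^1(\Omega_2)$ satisfy $\kappa^{-1}\le q\le\kappa$ for some $\kappa>1$ and $\nabla q(x)\cdot x\ge0$ in $\Omega_2$. There exist parameters $\nu>1$, $s>3$ and a constant $C>1$, depending on $n,\delta,\|V\|_{L^\infty(\Omega_2)},\kappa$ and $\|q\|_{C^1(\Omega_2)}$, such that for any $k\ge1$ with $\operatorname{dist}(k^2,\Sigma_{V,q})>c\,k^{2-n}$, any solution $\tilde v\in H^1(\tilde\Omega_1)$ of $$(\Delta+k^2q+V)\tilde v=0\ \text{ in }\tilde\Omega_1,\qquad \tilde v=0\ \text{ on }\partial B_{1/2},$$ and any $\epsilon>0$, there exists a solution $u$ to $$(\Delta+k^2q+V)u=0\ \text{ in }\Omega_2,\qquad u=0\ \text{ on }\partial B_{1/2},$$ such that $$\|u-\tilde v\|_{L^2(\Omega_1)}\le\epsilon\,\|\tilde v\|_{H^1(\tilde\Omega_1)},\qquad \|u\|_{H^{1/2}(\partial B_2)}\le C k^s\epsilon^{-\nu}\|\tilde v\|_{L^2(\Omega_1)}.$$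
   Context: $B_r\subset\mathbb{R}^n$ is the ball of radius $r$ centred at the origin. $V$ and $q$ are real-valued, and $\|q\|_{C^1(\Omega_2)}$ is finite. Solutions are weak ($H^1$) solutions and boundary values are traces. $\Sigma_{V,q}\subset\mathbb{R}$ is the set of inverses $\alpha^{-1}$ of the eigenvalues $\alpha$ of the operator $T=(-\Delta-V)^{-1}M_q$ on $H^1_0(\Omega_2)$, where $(-\Delta-V)^{-1}$ is the solution operator in $\Omega_2$ with homogeneous Dirichlet conditions and $M_q$ is multiplication by $q$. The number $c\in(0,1)$, $c\ll1$, is a small constant fixed throughout; constants may depend on it. *)

theory Defs
  imports "HOL-Analysis.Analysis" "HOL-Probability.Essential_Supremum"
begin

section \<open>Classical derivatives and test functions\<close>

definition annulus :: "real \<Rightarrow> real \<Rightarrow> 'a::euclidean_space set"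
  where "annulus r R = ball 0 R - cball 0 r"

definition dirderiv :: "'a::euclidean_space \<Rightarrow> ('a \<Rightarrow> 'b::euclidean_space) \<Rightarrow> 'a \<Rightarrow> 'b"
  where "dirderiv b f x = frechet_derivative f (at x) b"

definition grad :: "('a::euclidean_space \<Rightarrow> real) \<Rightarrow> 'a \<Rightarrow> 'a"
  where "grad f x = (\<Sum>b\<in>Basis. dirderiv b f x *\<^sub>R b)"

text \<open>Meant for open \<open>S\<close> only, since the derivatives are taken at interior points.\<close>

fun Ck_on :: "nat \<Rightarrow> 'a::euclidean_space set \<Rightarrow> ('a \<Rightarrow> 'b::euclidean_space) \<Rightarrow> bool" where
  "Ck_on 0 S f \<longleftrightarrow> continuous_on S f"
| "Ck_on (Suc k) S f \<longleftrightarrow>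
     (\<forall>x\<in>S. f differentiable (at x)) \<and> (\<forall>b. Ck_on k S (dirderiv b f))"

definition smooth_on :: "'a::euclidean_space set \<Rightarrow> ('a \<Rightarrow> 'b::euclidean_space) \<Rightarrow> bool"
  where "smooth_on S f \<longleftrightarrow> (\<forall>k. Ck_on k S f)"

definition test_function :: "'a::euclidean_space set \<Rightarrow> ('a \<Rightarrow> 'b::euclidean_space) \<Rightarrow> bool"
  where "test_function \<Omega> \<phi> \<longleftrightarrow> smooth_on UNIV \<phi> \<and>
    compact (closure {x. \<phi> x \<noteq> 0}) \<and> closure {x. \<phi> x \<noteq> 0} \<subseteq> \<Omega>"

text \<open>Functions of class \<open>C\<^sup>1\<close> with finite \<open>C\<^sup>1\<close> norm; without the boundedness
  requirement the suprema in the norm would be meaningless.\<close>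

definition C1_bounded :: "'a::euclidean_space set \<Rightarrow> ('a \<Rightarrow> real) \<Rightarrow> bool"
  where "C1_bounded \<Omega> q \<longleftrightarrow> Ck_on 1 \<Omega> q \<and> bounded (q ` \<Omega>) \<and> bounded (grad q ` \<Omega>)"

definition C1_norm :: "'a::euclidean_space set \<Rightarrow> ('a \<Rightarrow> real) \<Rightarrow> real"
  where "C1_norm \<Omega> q = (SUP x\<in>\<Omega>. \<bar>q x\<bar>) + (SUP x\<in>\<Omega>. norm (grad q x))"

section \<open>Lebesgue and Sobolev spaces on an open set\<close>

text \<open>Elements of these spaces are represented by functions on the whole ambient space whose
  values outside \<open>\<Omega>\<close> are irrelevant; equality is equality almost everywhere in \<open>\<Omega>\<close>.\<close>

definition Linf_norm :: "'a::euclidean_space set \<Rightarrow> ('a \<Rightarrow> real) \<Rightarrow> ereal"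
  where "Linf_norm \<Omega> V = esssup (lebesgue_on \<Omega>) (\<lambda>x. ereal \<bar>V x\<bar>)"

definition in_Linf :: "'a::euclidean_space set \<Rightarrow> ('a \<Rightarrow> real) \<Rightarrow> bool"
  where "in_Linf \<Omega> V \<longleftrightarrow> V \<in> borel_measurable (lebesgue_on \<Omega>) \<and> Linf_norm \<Omega> V < \<infinity>"

definition in_L2 :: "'a measure \<Rightarrow> ('a \<Rightarrow> 'b::euclidean_space) \<Rightarrow> bool"
  where "in_L2 M f \<longleftrightarrow> f \<in> borel_measurable M \<and> integrable M (\<lambda>x. (norm (f x))\<^sup>2)"

definition L2_norm :: "'a measure \<Rightarrow> ('a \<Rightarrow> 'b::euclidean_space) \<Rightarrow> real"
  where "L2_norm M f = sqrt (\<integral>x. (norm (f x))\<^sup>2 \<partial>M)"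

definition is_weak_deriv ::
  "'a::euclidean_space set \<Rightarrow> 'a \<Rightarrow> ('a \<Rightarrow> 'b::euclidean_space) \<Rightarrow> ('a \<Rightarrow> 'b) \<Rightarrow> bool"
  where "is_weak_deriv \<Omega> b u g \<longleftrightarrow>
    (\<forall>\<phi> :: 'a \<Rightarrow> real. test_function \<Omega> \<phi> \<longrightarrow>
      (\<integral>x. dirderiv b \<phi> x *\<^sub>R u x \<partial>lebesgue_on \<Omega>) = - (\<integral>x. \<phi> x *\<^sub>R g x \<partial>lebesgue_on \<Omega>))"

definition in_H1 :: "'a::euclidean_space set \<Rightarrow> ('a \<Rightarrow> 'b::euclidean_space) \<Rightarrow> bool"
  where "in_H1 \<Omega> u \<longleftrightarrow> in_L2 (lebesgue_on \<Omega>) u \<and>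
    (\<forall>b\<in>Basis. \<exists>g. in_L2 (lebesgue_on \<Omega>) g \<and> is_weak_deriv \<Omega> b u g)"

text \<open>For \<open>u\<close> in \<open>H\<^sup>1\<close> the weak derivative is unique up to null sets.\<close>

definition weak_deriv ::
  "'a::euclidean_space set \<Rightarrow> 'a \<Rightarrow> ('a \<Rightarrow> 'b::euclidean_space) \<Rightarrow> 'a \<Rightarrow> 'b"
  where "weak_deriv \<Omega> b u = (SOME g. in_L2 (lebesgue_on \<Omega>) g \<and> is_weak_deriv \<Omega> b u g)"

definition H1_norm :: "'a::euclidean_space set \<Rightarrow> ('a \<Rightarrow> 'b::euclidean_space) \<Rightarrow> real"
  where "H1_norm \<Omega> u = sqrt ((L2_norm (lebesgue_on \<Omega>) u)\<^sup>2 +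
    (\<Sum>b\<in>Basis. (L2_norm (lebesgue_on \<Omega>) (weak_deriv \<Omega> b u))\<^sup>2))"

definition in_H10 :: "'a::euclidean_space set \<Rightarrow> ('a \<Rightarrow> 'b::euclidean_space) \<Rightarrow> bool"
  where "in_H10 \<Omega> u \<longleftrightarrow> in_H1 \<Omega> u \<and>
    (\<exists>\<phi> :: nat \<Rightarrow> 'a \<Rightarrow> 'b. (\<forall>m. test_function \<Omega> (\<phi> m)) \<and>
      (\<lambda>m. H1_norm \<Omega> (\<lambda>x. u x - \<phi> m x)) \<longlonglongrightarrow> 0)"

section \<open>Traces on spheres\<close>

text \<open>Surface measure of the sphere of radius \<open>R > 0\<close> centred at the origin, as a Borel measure
  on the ambient space carried by that sphere. It is given by the cone formula
  \<open>\<sigma>(A) = (n / R) * vol {x \<in> B\<^sub>R. R x / |x| \<in> A}\<close>, which is integration in polar coordinates.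
  The origin is sent to itself by the radial projection, and is a null set.\<close>

definition sphere_measure :: "real \<Rightarrow> 'a::euclidean_space measure"
  where "sphere_measure R = scale_measure (ennreal (real DIM('a) / R))
    (distr (lebesgue_on (ball 0 R)) borel (\<lambda>x. (R / norm x) *\<^sub>R x))"

text \<open>\<open>g\<close> is the trace of \<open>u \<in> H\<^sup>1(\<Omega>)\<close> on \<open>sphere 0 R\<close>: the continuous extension to \<open>H\<^sup>1\<close> of the
  restriction of functions smooth up to the boundary. Used when \<open>\<Omega>\<close> is an annulus and
  \<open>sphere 0 R\<close> is one of its two boundary components, where it determines \<open>g\<close> almost everywhere.\<close>

definition has_trace ::
  "'a::euclidean_space set \<Rightarrow> real \<Rightarrow> ('a \<Rightarrow> 'b::euclidean_space) \<Rightarrow> ('a \<Rightarrow> 'b) \<Rightarrow> bool"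
  where "has_trace \<Omega> R u g \<longleftrightarrow> in_H1 \<Omega> u \<and> in_L2 (sphere_measure R) g \<and>
    (\<exists>w :: nat \<Rightarrow> 'a \<Rightarrow> 'b. (\<forall>m. smooth_on UNIV (w m)) \<and>
      (\<lambda>m. H1_norm \<Omega> (\<lambda>x. w m x - u x)) \<longlonglongrightarrow> 0 \<and>
      (\<lambda>m. L2_norm (sphere_measure R) (\<lambda>x. w m x - g x)) \<longlonglongrightarrow> 0)"

text \<open>The Sobolev--Slobodeckij space \<open>H\<^sup>1\<^sup>/\<^sup>2\<close> of the sphere: the exponent of the distance is
  \<open>(n - 1) + 2 * (1 / 2) = n\<close>.\<close>

definition Hhalf_kernel :: "('a::euclidean_space \<Rightarrow> 'b::euclidean_space) \<Rightarrow> 'a \<times> 'a \<Rightarrow> real"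
  where "Hhalf_kernel g = (\<lambda>(x, y). (norm (g x - g y))\<^sup>2 / dist x y ^ DIM('a))"

definition in_Hhalf :: "real \<Rightarrow> ('a::euclidean_space \<Rightarrow> 'b::euclidean_space) \<Rightarrow> bool"
  where "in_Hhalf R g \<longleftrightarrow> in_L2 (sphere_measure R) g \<and>
    integrable (sphere_measure R \<Otimes>\<^sub>M sphere_measure R) (Hhalf_kernel g)"

definition Hhalf_norm :: "real \<Rightarrow> ('a::euclidean_space \<Rightarrow> 'b::euclidean_space) \<Rightarrow> real"
  where "Hhalf_norm R g = sqrt ((L2_norm (sphere_measure R) g)\<^sup>2 +
    (\<integral>z. Hhalf_kernel g z \<partial>(sphere_measure R \<Otimes>\<^sub>M sphere_measure R)))"

section \<open>Weak solutions and the Dirichlet spectrum\<close>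

text \<open>\<open>u \<in> H\<^sup>1(\<Omega>)\<close> solves \<open>\<Delta>u + a u = f\<close> in \<open>\<Omega>\<close> in the weak sense. The coefficient \<open>a\<close> and the
  test functions are real; as the equation is linear this is also the right notion for complex
  valued \<open>u\<close>.\<close>

definition weak_solution ::
  "'a::euclidean_space set \<Rightarrow> ('a \<Rightarrow> real) \<Rightarrow> ('a \<Rightarrow> 'b::euclidean_space) \<Rightarrow> ('a \<Rightarrow> 'b) \<Rightarrow> bool"
  where "weak_solution \<Omega> a f u \<longleftrightarrow> in_H1 \<Omega> u \<and>
    (\<forall>\<phi> :: 'a \<Rightarrow> real. test_function \<Omega> \<phi> \<longrightarrow>
      (\<integral>x. (a x * \<phi> x) *\<^sub>R u x - (\<Sum>b\<in>Basis. dirderiv b \<phi> x *\<^sub>R weak_deriv \<Omega> b u x)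
         \<partial>lebesgue_on \<Omega>) = (\<integral>x. \<phi> x *\<^sub>R f x \<partial>lebesgue_on \<Omega>))"

text \<open>\<open>\<mu>\<close> is a Dirichlet eigenvalue of \<open>\<Delta> + V\<close> in \<open>\<Omega>\<close>, that is \<open>\<Delta>u + V u = \<mu> u\<close> with
  \<open>0 \<noteq> u \<in> H\<^sup>1\<^sub>0(\<Omega>)\<close>.\<close>

definition dirichlet_eigenvalue ::
  "'a::euclidean_space set \<Rightarrow> ('a \<Rightarrow> real) \<Rightarrow> real \<Rightarrow> bool"
  where "dirichlet_eigenvalue \<Omega> V \<mu> \<longleftrightarrow>
    (\<exists>u :: 'a \<Rightarrow> real. in_H10 \<Omega> u \<and> \<not> (AE x in lebesgue_on \<Omega>. u x = 0) \<and>
      weak_solution \<Omega> V (\<lambda>x. \<mu> * u x) u)"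

text \<open>The solution operator \<open>(-\<Delta> - V)\<^sup>-\<^sup>1\<close> with homogeneous Dirichlet data. It is well defined
  (almost everywhere, on \<open>L\<^sup>2(\<Omega>)\<close>) when zero is not a Dirichlet eigenvalue of \<open>\<Delta> + V\<close>.\<close>

definition dirichlet_solution ::
  "'a::euclidean_space set \<Rightarrow> ('a \<Rightarrow> real) \<Rightarrow> ('a \<Rightarrow> real) \<Rightarrow> 'a \<Rightarrow> real"
  where "dirichlet_solution \<Omega> V f = (SOME w. in_H10 \<Omega> w \<and> weak_solution \<Omega> V (\<lambda>x. - f x) w)"

definition T_op ::
  "'a::euclidean_space set \<Rightarrow> ('a \<Rightarrow> real) \<Rightarrow> ('a \<Rightarrow> real) \<Rightarrow> ('a \<Rightarrow> real) \<Rightarrow> 'a \<Rightarrow> real"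
  where "T_op \<Omega> V q u = dirichlet_solution \<Omega> V (\<lambda>x. q x * u x)"

definition T_eigenvalue ::
  "'a::euclidean_space set \<Rightarrow> ('a \<Rightarrow> real) \<Rightarrow> ('a \<Rightarrow> real) \<Rightarrow> real \<Rightarrow> bool"
  where "T_eigenvalue \<Omega> V q \<alpha> \<longleftrightarrow>
    (\<exists>u. in_H10 \<Omega> u \<and> \<not> (AE x in lebesgue_on \<Omega>. u x = 0) \<and>
      (AE x in lebesgue_on \<Omega>. T_op \<Omega> V q u x = \<alpha> * u x))"

text \<open>For \<open>q > 0\<close> the operator is injective, so that \<open>\<alpha> \<noteq> 0\<close> excludes nothing; it only rules out
  the convention \<open>inverse 0 = 0\<close>.\<close>

definition Sigma_spec ::
  "'a::euclidean_space set \<Rightarrow> ('a \<Rightarrow> real) \<Rightarrow> ('a \<Rightarrow> real) \<Rightarrow> real set"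
  where "Sigma_spec \<Omega> V q = {inverse \<alpha> | \<alpha>. T_eigenvalue \<Omega> V q \<alpha> \<and> \<alpha> \<noteq> 0}"

end

theory Submission
  imports Defs
begin

text \<open>Let \<open>\<eta>\<close> cut off between the spheres of radius \<open>1 + \<delta>/4\<close> and \<open>1 + \<delta>\<close>, and look for \<open>u = \<eta> v + r\<close>. Then
  \<open>r\<close> has to solve \<open>(\<Delta> + k\<^sup>2 q + V) r = f\<close> with \<open>f = -(2 \<nabla>\<eta> \<bullet> \<nabla>v + v \<Delta>\<eta>)\<close> supported in \<open>|x| \<ge> 1 + \<delta>/4\<close>. As
  \<open>k\<^sup>2 q\<close> is nondecreasing along rays, a Carleman estimate with the weight \<open>exp (t |x|\<^sup>2)\<close> holds with constants
  independent of \<open>k\<close>; its dual provides a solution with \<open>\<parallel>exp (-t |x|\<^sup>2) r\<parallel> \<le> \<parallel>exp (-t |x|\<^sup>2) f\<parallel>\<close>. Hence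
  \<open>r\<close> is of size \<open>exp (-t \<delta>/2)\<close> in the unit ball and at most of size \<open>exp (16 t)\<close> elsewhere. Interior energy
  estimates and Gagliardo's trace inequality bound the boundary values of \<open>r\<close> at the price of a factor \<open>k\<close>.
  It remains to choose \<open>t\<close> proportional to \<open>ln (c/\<epsilon>)\<close>. If \<open>\<parallel>v\<parallel> \<le> \<epsilon> \<parallel>v\<parallel>\<^sub>H\<^sub>1\<close> then \<open>u = 0\<close> will do;
  otherwise the norm in \<open>H\<^sup>1\<close> is absorbed into \<open>\<parallel>v\<parallel>/\<epsilon>\<close>.\<close>

text \<open>The correction has to vanish on the inner sphere although it is not posed as a boundary
  value problem. An ever deeper negative well in the inner ball serves as a penalty; lowering a
  coefficient near the origin preserves monotonicity along rays, so the Carleman bounds do not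
  notice the depth. The limit of infinite depth would call for weak compactness. Instead the pairs
  (function, gradient) are placed in decreasing convex sets, and a strongly convergent sequence is
  selected by almost minimal norms. The coefficient is extended to the whole space, by
  \<open>k^2 \<kappa>\<close> outside the ball of radius 2. Corrections live in the ball of radius
  4, so that interior regularity gives a gradient in radius 3 and a trace on radius 2. The factor
  \<open>exp (16 t)\<close> is the weight at radius 4; with \<open>t\<close> about
  \<open>2 / \<delta> * ln (c / \<epsilon>)\<close> it produces the exponent
  \<open>32 / \<delta>\<close>, and absorbing the norm in \<open>H^1\<close> adds one.\<close>

abbreviation lborel_integral (binder "\<integral>" 10) where "lborel_integral f \<equiv> integral\<^sup>L lborel f"

abbreviation lborel_nn_integral (binder "\<integral>\<^sup>+" 10) where "lborel_nn_integral f \<equiv> integral\<^sup>N lborel f"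

abbreviation Borel where "Borel \<equiv> borel_measurable borel"

abbreviation L1 where "L1 \<equiv> integrable lborel"

abbreviation L2 where "L2 \<equiv> in_L2 lborel"

abbreviation norm2 where "norm2 \<equiv> L2_norm lborel"

abbreviation (input) L2_dist where "L2_dist M f g \<equiv> L2_norm M (\<lambda>x. f x - g x)"

abbreviation dist2 where "dist2 \<equiv> L2_dist lborel"

abbreviation L2_lim where "L2_lim M f g \<equiv> (\<lambda>n. L2_dist M (f n) g) \<longlonglongrightarrow> 0"

abbreviation lim2 where "lim2 \<equiv> L2_lim lborel"

abbreviation ae_eq where "ae_eq \<Omega> f g \<equiv> AE x in lebesgue_on \<Omega>. f x = g x"

notation scaleR (infixr "*R" 75)

abbreviation gauss where "gauss t x \<equiv> exp (- t * (norm x)^2)"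

abbreviation tends_to (infix "---->" 60) where "f ----> l \<equiv> f \<longlonglongrightarrow> l"

abbreviation cut where "cut S f \<equiv> \<lambda>x. indicator S x *R f x"

section \<open>Smooth functions and test functions\<close>

lemma dirderiv_eqI: "(f has_derivative D) (at x) \<Longrightarrow> dirderiv b f x = D b"
  unfolding dirderiv_def using frechet_derivative_at by metis

lemma has_derivative_dirderiv:
  "f differentiable (at x) \<Longrightarrow> (f has_derivative (\<lambda>h. dirderiv h f x)) (at x)"
  unfolding dirderiv_def using frechet_derivative_works by (metis eta_contract_eq)

lemma dirderiv_add:
  "f differentiable (at x) \<Longrightarrow> g differentiable (at x) \<Longrightarrow>
    dirderiv b (\<lambda>x. f x + g x) x = dirderiv b f x + dirderiv b g x"
  by (rule dirderiv_eqI) (intro has_derivative_add has_derivative_dirderiv)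

lemma dirderiv_mult:
  fixes f g :: "'a::euclidean_space \<Rightarrow> real"
  shows "f differentiable (at x) \<Longrightarrow> g differentiable (at x) \<Longrightarrow>
    dirderiv b (\<lambda>x. f x * g x) x = f x * dirderiv b g x + dirderiv b f x * g x"
  by (rule dirderiv_eqI) (intro has_derivative_mult has_derivative_dirderiv)

lemma dirderiv_const: "dirderiv b (\<lambda>x. c) x = 0"
  by (rule dirderiv_eqI) (rule has_derivative_const)

lemma dirderiv_linear: "bounded_linear L \<Longrightarrow> dirderiv b L x = L b"
  by (rule dirderiv_eqI) (rule bounded_linear_imp_has_derivative)

lemma dirderiv_compose_linear:
  "bounded_linear L \<Longrightarrow> f differentiable (at x) \<Longrightarrow> dirderiv b (\<lambda>x. L (f x)) x = L (dirderiv b f x)"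
  by (rule dirderiv_eqI, rule bounded_linear.has_derivative) (auto intro: has_derivative_dirderiv)

lemma dirderiv_chain_real:
  fixes g :: "'a::euclidean_space \<Rightarrow> real"
  assumes "(F has_real_derivative F' (g x)) (at (g x))" "g differentiable (at x)"
  shows "dirderiv b (\<lambda>x. F (g x)) x = F' (g x) * dirderiv b g x"
  using has_derivative_compose[OF has_derivative_dirderiv[OF assms(2)]
      assms(1)[unfolded has_field_derivative_def]]
  by (rule dirderiv_eqI)

lemma dirderiv_sum_Basis:
  assumes "f differentiable (at x)"
  shows "dirderiv h f x = (\<Sum>b\<in>Basis. (h \<bullet> b) *R dirderiv b f x)"
proof -
  interpret linear "\<lambda>h. dirderiv h f x"
    using has_derivative_dirderiv[OF assms] by (rule has_derivative_linear)
  have "dirderiv h f x = dirderiv (\<Sum>b\<in>Basis. (h \<bullet> b) *R b) f x"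
    by (simp add: euclidean_representation)
  also have "\<dots> = (\<Sum>b\<in>Basis. (h \<bullet> b) *R dirderiv b f x)"
    by (simp add: sum scale)
  finally show ?thesis .
qed

lemma grad_inner_Basis: "b \<in> Basis \<Longrightarrow> grad f x \<bullet> b = dirderiv b f x"
  unfolding grad_def by (simp add: inner_sum_left inner_Basis if_distrib cong: if_cong)

lemma grad_inner: "f differentiable (at x) \<Longrightarrow> grad f x \<bullet> h = dirderiv h f x"
  unfolding dirderiv_sum_Basis[of f x h] grad_def
  by (simp add: inner_sum_left inner_commute[of h] mult.commute)

lemma norm_grad_sq: "(norm (grad f x))^2 = (\<Sum>b\<in>Basis. (dirderiv b f x)^2)"
  unfolding power2_norm_eq_inner euclidean_inner[of "grad f x" "grad f x"]
  by (simp add: grad_inner_Basis power2_eq_square)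

abbreviation smooth :: "('a::euclidean_space \<Rightarrow> 'b::euclidean_space) \<Rightarrow> bool"
  where "smooth \<equiv> smooth_on UNIV"

text \<open>Smoothness by coinduction: a family \<open>P\<close> of differentiable functions closed
  under every \<open>dirderiv\<close> lies in all classes \<open>Ck_on k\<close>, by induction on
  \<open>k\<close> with the function left arbitrary. Sums, linear images, reflections and
  convolutions are handled by naming such a family.\<close>

lemma smooth_coinduct:
  assumes "P f" and diff: "\<And>f x. P f \<Longrightarrow> f differentiable (at x)"
    and step: "\<And>f b. P f \<Longrightarrow> P (dirderiv b f)"
  shows "smooth f"
proof -
  have "Ck_on k UNIV f" if "P f" for k f
    using that
  proof (induction k arbitrary: f)
    case 0
    then show ?case
      by (simp add: continuous_at_imp_continuous_on diff differentiable_imp_continuous_within)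
  qed (simp add: diff step)
  then show ?thesis using assms(1) by (simp add: smooth_on_def)
qed

lemma smoothD: "smooth f \<Longrightarrow> f differentiable (at x)"
  unfolding smooth_on_def by (metis Ck_on.simps(2) UNIV_I)

lemma smooth_dirderiv: "smooth f \<Longrightarrow> smooth (dirderiv b f)"
  unfolding smooth_on_def by (metis Ck_on.simps(2))

lemma smooth_continuous: "smooth f \<Longrightarrow> continuous_on S f"
  by (simp add: continuous_at_imp_continuous_on differentiable_imp_continuous_within
      smoothD)

lemma smooth_measurable: "smooth f \<Longrightarrow> f \<in> Borel"
  by (intro borel_measurable_continuous_onI smooth_continuous)

lemma smooth_const: "smooth (\<lambda>x. c)"
proof (rule smooth_coinduct[where P="\<lambda>f. \<exists>c. f = (\<lambda>x. c)"])
  fix f :: "'a \<Rightarrow> 'b" and b assume "\<exists>c. f = (\<lambda>x. c)"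
  then have "dirderiv b f = (\<lambda>x. 0)" using dirderiv_const by blast
  then show "\<exists>c. dirderiv b f = (\<lambda>x. c)" by blast
qed auto

text \<open>The family has to contain the constants too, because the derivative of a linear map in a
  fixed direction is one.\<close>

lemma smooth_linear: "bounded_linear L \<Longrightarrow> smooth L"
proof (rule smooth_coinduct[where P="\<lambda>f. bounded_linear f \<or> (\<exists>c. f = (\<lambda>x. c))"])
  fix f :: "'a \<Rightarrow> 'b" and b assume "bounded_linear f \<or> (\<exists>c. f = (\<lambda>x. c))"
  then have "dirderiv b f = (\<lambda>x. f b) \<or> dirderiv b f = (\<lambda>x. 0)"
    using dirderiv_const dirderiv_linear by blast
  then show "bounded_linear (dirderiv b f) \<or> (\<exists>c. dirderiv b f = (\<lambda>x. c))" by blast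
qed (auto intro: bounded_linear_imp_differentiable)

lemma smooth_add: "smooth f \<Longrightarrow> smooth g \<Longrightarrow> smooth (\<lambda>x. f x + g x)"
proof (rule smooth_coinduct[where P="\<lambda>h. \<exists>f g. smooth f \<and> smooth g \<and> h = (\<lambda>x. f x + g x)"])
  fix h :: "'a \<Rightarrow> 'b" and b assume "\<exists>f g. smooth f \<and> smooth g \<and> h = (\<lambda>x. f x + g x)"
  then obtain f g where fg: "smooth f" "smooth g" "h = (\<lambda>x. f x + g x)" by blast
  then have "dirderiv b h = (\<lambda>x. dirderiv b f x + dirderiv b g x)"
    by (auto simp: dirderiv_add smoothD)
  then show "\<exists>f g. smooth f \<and> smooth g \<and> dirderiv b h = (\<lambda>x. f x + g x)"
    using fg smooth_dirderiv by blast
qed (auto intro: smoothD differentiable_add)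

lemma smooth_sum: "(\<And>i. i \<in> I \<Longrightarrow> smooth (f i)) \<Longrightarrow> smooth (\<lambda>x. \<Sum>i\<in>I. f i x)"
  by (induction I rule: infinite_finite_induct) (auto simp: smooth_const smooth_add)

lemma smooth_compose_linear: "bounded_linear L \<Longrightarrow> smooth f \<Longrightarrow> smooth (\<lambda>x. L (f x))"
proof (rule smooth_coinduct[where P="\<lambda>h. \<exists>f. smooth f \<and> h = (\<lambda>x. L (f x))"], blast)
  fix h b assume L: "bounded_linear L" and "\<exists>f. smooth f \<and> h = (\<lambda>x. L (f x))"
  then obtain f where f: "smooth f" "h = (\<lambda>x. L (f x))" by blast
  then have "dirderiv b h = (\<lambda>x. L (dirderiv b f x))"
    by (auto simp: dirderiv_compose_linear smoothD L)
  then show "\<exists>f. smooth f \<and> dirderiv b h = (\<lambda>x. L (f x))"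
    using f smooth_dirderiv by blast
next
  fix h x assume L: "bounded_linear L" and "\<exists>f. smooth f \<and> h = (\<lambda>x. L (f x))"
  then obtain f where f: "smooth f" "h = (\<lambda>x. L (f x))" by blast
  then show "h differentiable (at x)"
    using bounded_linear.has_derivative[OF L has_derivative_dirderiv[OF smoothD]]
    by (auto simp: differentiable_def)
qed

text \<open>Products are treated order by order: the Leibniz rule pairs a derivative with an
  undifferentiated factor, whose order then has to be lowered by one.\<close>

lemma Ck_on_Suc_imp: "Ck_on (Suc k) UNIV f \<Longrightarrow> Ck_on k UNIV f"
proof (induction k arbitrary: f)
  case 0
  then show ?case
    by (simp add: continuous_at_imp_continuous_on differentiable_imp_continuous_within)
qed (metis Ck_on.simps(2))

lemma Ck_on_add:
  "Ck_on k UNIV f \<Longrightarrow> Ck_on k UNIV g \<Longrightarrow> Ck_on k UNIV (\<lambda>x. f x + g x)"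
proof (induction k arbitrary: f g)
  case (Suc k)
  then have "dirderiv b (\<lambda>x. f x + g x) = (\<lambda>x. dirderiv b f x + dirderiv b g x)" for b
    by (auto simp: dirderiv_add)
  with Suc show ?case by simp
qed (simp add: continuous_on_add)

lemma Ck_on_mult:
  fixes f g :: "'a::euclidean_space \<Rightarrow> real"
  shows "Ck_on k UNIV f \<Longrightarrow> Ck_on k UNIV g \<Longrightarrow> Ck_on k UNIV (\<lambda>x. f x * g x)"
proof (induction k arbitrary: f g)
  case (Suc k)
  then have "dirderiv b (\<lambda>x. f x * g x) = (\<lambda>x. f x * dirderiv b g x + dirderiv b f x * g x)" for b
    by (auto simp: dirderiv_mult)
  moreover have "Ck_on k UNIV f" "Ck_on k UNIV g"
    using Suc.prems Ck_on_Suc_imp by blast+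
  ultimately show ?case using Suc by (simp add: Ck_on_add)
qed (simp add: continuous_on_mult)

lemma smooth_mult:
  fixes f g :: "'a::euclidean_space \<Rightarrow> real"
  shows "smooth f \<Longrightarrow> smooth g \<Longrightarrow> smooth (\<lambda>x. f x * g x)"
  by (simp add: smooth_on_def Ck_on_mult)

lemma smooth_cmult:
  fixes f :: "'a::euclidean_space \<Rightarrow> real"
  shows "smooth f \<Longrightarrow> smooth (\<lambda>x. c * f x)"
  by (intro smooth_mult smooth_const)

lemma smooth_diff:
  fixes f g :: "'a::euclidean_space \<Rightarrow> real"
  shows "smooth f \<Longrightarrow> smooth g \<Longrightarrow> smooth (\<lambda>x. f x - g x)"
  using smooth_add[of f "\<lambda>x. (-1) * g x"] smooth_cmult[of g "-1"] by simp

lemma smooth_inner: "smooth (\<lambda>x. x \<bullet> c)"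
  by (intro smooth_linear bounded_linear_inner_left)

lemma smooth_norm_sq: "smooth (\<lambda>x. (norm x)^2)"
proof -
  have "smooth (\<lambda>x::'a. \<Sum>b\<in>Basis. (x \<bullet> b) * (x \<bullet> b))"
    by (intro smooth_sum smooth_mult smooth_inner)
  moreover have "(\<lambda>x::'a. \<Sum>b\<in>Basis. (x \<bullet> b) * (x \<bullet> b)) = (\<lambda>x. (norm x)^2)"
    unfolding power2_norm_eq_inner by (intro ext euclidean_inner[symmetric])
  ultimately show ?thesis by simp
qed

text \<open>\<open>F\<close> lists all derivatives of the outer function. Leaving the index
  \<open>j\<close> arbitrary lets the induction hypothesis apply to \<open>F (Suc j)\<close>, which
  the chain rule produces. This covers \<open>exp\<close> as well as functions that are flat at a
  point.\<close>

lemma Ck_on_chain_real: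
  fixes g :: "'a::euclidean_space \<Rightarrow> real"
  assumes F: "\<And>j t. (F j has_real_derivative F (Suc j) t) (at t)" and g: "smooth g"
  shows "Ck_on k UNIV (\<lambda>x. F j (g x))"
proof (induction k arbitrary: j)
  case 0
  have "continuous_on UNIV (F j)"
    using F DERIV_isCont continuous_at_imp_continuous_on by blast
  then show ?case
    using continuous_on_compose2[OF _ smooth_continuous[OF g]] by auto
next
  case (Suc k)
  have "dirderiv b (\<lambda>x. F j (g x)) = (\<lambda>x. F (Suc j) (g x) * dirderiv b g x)" for b
    by (intro ext dirderiv_chain_real F smoothD g)
  moreover have "(\<lambda>x. F j (g x)) differentiable (at x)" for x
    using has_derivative_compose[OF has_derivative_dirderiv[OF smoothD[OF g]]
        F[unfolded has_field_derivative_def]]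
    by (auto simp: differentiable_def)
  moreover have "Ck_on k UNIV (\<lambda>x. F (Suc j) (g x) * dirderiv b g x)" for b
    using smooth_dirderiv[OF g] by (intro Ck_on_mult Suc) (simp add: smooth_on_def)
  ultimately show ?case by simp
qed

lemma smooth_chain_real:
  fixes g :: "'a::euclidean_space \<Rightarrow> real"
  assumes "\<And>j t. (F j has_real_derivative F (Suc j) t) (at t)" and "smooth g"
  shows "smooth (\<lambda>x. F j (g x))"
  using Ck_on_chain_real[of F, OF assms] by (simp add: smooth_on_def)

lemma smooth_exp:
  fixes g :: "'a::euclidean_space \<Rightarrow> real"
  shows "smooth g \<Longrightarrow> smooth (\<lambda>x. exp (g x))"
  using smooth_chain_real[of "\<lambda>j. exp"] by (simp add: DERIV_exp)

lemma dirderiv_exp: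
  fixes g :: "'a::euclidean_space \<Rightarrow> real"
  shows "g differentiable (at x) \<Longrightarrow> dirderiv b (\<lambda>x. exp (g x)) x = exp (g x) * dirderiv b g x"
  by (rule dirderiv_chain_real) (auto simp: DERIV_exp)

lemma dirderiv_cmult:
  fixes f :: "'a::euclidean_space \<Rightarrow> real"
  shows "f differentiable (at x) \<Longrightarrow> dirderiv b (\<lambda>x. c * f x) x = c * dirderiv b f x"
  by (simp add: dirderiv_mult dirderiv_const)

lemma dirderiv_diff:
  "f differentiable (at x) \<Longrightarrow> g differentiable (at x) \<Longrightarrow>
    dirderiv b (\<lambda>x. f x - g x) x = dirderiv b f x - dirderiv b g x"
  by (rule dirderiv_eqI) (intro has_derivative_diff has_derivative_dirderiv)

lemma dirderiv_inner: "dirderiv b (\<lambda>x. x \<bullet> c) x = b \<bullet> c"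
  by (simp add: dirderiv_linear bounded_linear_inner_left)

lemma dirderiv_norm_sq: "dirderiv b (\<lambda>x. (norm x)^2) x = 2 * (x \<bullet> b)"
proof -
  have "((\<lambda>x. x \<bullet> x) has_derivative (\<lambda>h. x \<bullet> h + h \<bullet> x)) (at x)"
    by (intro derivative_intros)
  then show ?thesis
    by (simp add: power2_norm_eq_inner dirderiv_eqI inner_commute)
qed

lemma dirderiv_sum:
  assumes "\<And>i. i \<in> I \<Longrightarrow> f i differentiable (at x)"
  shows "dirderiv b (\<lambda>x. \<Sum>i\<in>I. f i x) x = (\<Sum>i\<in>I. dirderiv b (f i) x)"
  by (rule dirderiv_eqI) (intro has_derivative_sum has_derivative_dirderiv assms)

text \<open>Symmetry of second derivatives: both mixed derivatives are limits of the same second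
  difference quotient, by applying the mean value theorem in the two variables in either order.\<close>

lemma second_difference_mvt:
  fixes f :: "'a::euclidean_space \<Rightarrow> real"
  assumes f: "smooth f" and t: "t > 0"
  shows "\<exists>\<theta>\<in>{0..t}. \<exists>\<theta>'\<in>{0..t}.
    f (x + t *R b + t *R c) - f (x + t *R b) - f (x + t *R c) + f x
      = t^2 * dirderiv c (dirderiv b f) (x + \<theta> *R b + \<theta>' *R c)"
proof -
  have line: "((\<lambda>s. g (y + s *R d)) has_real_derivative dirderiv d g (y + s *R d)) (at s)"
    if "smooth g" for g :: "'a \<Rightarrow> real" and y d s
  proof -
    have D: "((\<lambda>s. y + s *R d) has_derivative (\<lambda>h. h *R d)) (at s)"
      by (auto intro!: derivative_eq_intros)
    have "((\<lambda>s. g (y + s *R d)) has_derivative (\<lambda>h. dirderiv (h *R d) g (y + s *R d))) (at s)"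
      using has_derivative_compose[OF D has_derivative_dirderiv[OF smoothD[OF that]]] .
    moreover have "(\<lambda>h. dirderiv (h *R d) g (y + s *R d)) = (*) (dirderiv d g (y + s *R d))"
      using linear_scale[OF has_derivative_linear[OF
            has_derivative_dirderiv[OF smoothD[OF that]]]] by auto
    ultimately show ?thesis by (simp add: has_field_derivative_def)
  qed
  \<comment> \<open>First difference in direction \<open>c\<close> at displacement \<open>s\<close>
    along \<open>b\<close>. The mean value theorem is applied to it, and then once more in direction
    \<open>c\<close> to the derivative that comes out.\<close>
  define G where "G s = f ((x + t *R c) + s *R b) - f (x + s *R b)" for s
  have "DERIV G s :> dirderiv b f ((x + t *R c) + s *R b) - dirderiv b f (x + s *R b)" for s
    unfolding G_def by (intro DERIV_diff line f)
  then obtain \<theta> where \<theta>: "0 < \<theta>" "\<theta> < t"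
    "G t - G 0 = (t - 0) * (dirderiv b f ((x + t *R c) + \<theta> *R b) - dirderiv b f (x + \<theta> *R b))"
    using MVT2[OF t, of G "\<lambda>s. dirderiv b f ((x + t *R c) + s *R b) - dirderiv b f (x + s *R b)"]
    by blast
  have "DERIV (\<lambda>s. dirderiv b f ((x + \<theta> *R b) + s *R c)) s
      :> dirderiv c (dirderiv b f) ((x + \<theta> *R b) + s *R c)" for s
    by (intro line smooth_dirderiv f)
  from MVT2[OF t this] obtain \<theta>' where \<theta>': "0 < \<theta>'" "\<theta>' < t"
    "dirderiv b f ((x + \<theta> *R b) + t *R c) - dirderiv b f ((x + \<theta> *R b) + 0 *R c)
      = (t - 0) * dirderiv c (dirderiv b f) ((x + \<theta> *R b) + \<theta>' *R c)"
    by blast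
  have "G t - G 0 = t^2 * dirderiv c (dirderiv b f) (x + \<theta> *R b + \<theta>' *R c)"
    using \<theta>(3) \<theta>'(3) by (simp add: algebra_simps power2_eq_square)
  moreover have "G t - G 0 = f (x + t *R b + t *R c) - f (x + t *R b) - f (x + t *R c) + f x"
    by (simp add: G_def add_ac)
  ultimately show ?thesis
    using \<theta>(1,2) \<theta>'(1,2) by (intro bexI[of _ \<theta>] bexI[of _ \<theta>']) auto
qed

lemma dirderiv_commute:
  fixes f :: "'a::euclidean_space \<Rightarrow> real"
  assumes f: "smooth f"
  shows "dirderiv b (dirderiv c f) x = dirderiv c (dirderiv b f) x"
proof -
  define t where "t n = inverse (real (Suc n))" for n
  have tpos: "t n > 0" for n by (simp add: t_def)
  have tlim: "t ----> 0" unfolding t_def by (rule LIMSEQ_inverse_real_of_nat)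
  \<comment> \<open>This quotient is symmetric in \<open>b\<close> and \<open>c\<close>; reading it
    in either order identifies the two mixed derivatives. Hence \<open>lim\<close> below is stated
    for an arbitrary pair of directions.\<close>
  define D where "D n = (f (x + t n *R b + t n *R c) - f (x + t n *R b) - f (x + t n *R c) + f x)
    / (t n)^2" for n
  have lim: "D' ----> dirderiv c (dirderiv b f) x"
    if D': "\<And>n. \<exists>\<theta>\<in>{0..t n}. \<exists>\<theta>'\<in>{0..t n}. D' n = dirderiv c (dirderiv b f) (x + \<theta> *R b + \<theta>' *R c)"
    for b c and D' :: "nat \<Rightarrow> real"
  proof -
    obtain \<theta> \<theta>' where \<theta>: "\<And>n. 0 \<le> \<theta> n" "\<And>n. \<theta> n \<le> t n" "\<And>n. 0 \<le> \<theta>' n" "\<And>n. \<theta>' n \<le> t n"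
      and eq: "\<And>n. D' n = dirderiv c (dirderiv b f) (x + \<theta> n *R b + \<theta>' n *R c)"
      using D' by (simp add: Bex_def) metis
    have "\<theta> ----> 0" "\<theta>' ----> 0"
      by (rule tendsto_sandwich[OF _ _ tendsto_const tlim]; simp add: \<theta>)+
    then have lim: "(\<lambda>n. x + \<theta> n *R b + \<theta>' n *R c) ----> x + 0 *R b + 0 *R c"
      by (intro tendsto_intros)
    have cont: "isCont (dirderiv c (dirderiv b f)) (x + 0 *R b + 0 *R c)"
      using smooth_continuous[OF smooth_dirderiv[OF smooth_dirderiv[OF f]], of UNIV]
      by (simp add: continuous_on_eq_continuous_at)
    have "D' = (\<lambda>n. dirderiv c (dirderiv b f) (x + \<theta> n *R b + \<theta>' n *R c))"
      by (intro ext eq)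
    then show ?thesis using isCont_tendsto_compose[OF cont lim] by simp
  qed
  have "D ----> dirderiv c (dirderiv b f) x"
  proof (rule lim)
    fix n show "\<exists>\<theta>\<in>{0..t n}. \<exists>\<theta>'\<in>{0..t n}. D n = dirderiv c (dirderiv b f) (x + \<theta> *R b + \<theta>' *R c)"
      using second_difference_mvt[OF f tpos, of n x b c] tpos[of n] unfolding D_def by fastforce
  qed
  moreover have "D ----> dirderiv b (dirderiv c f) x"
  proof (rule lim)
    fix n show "\<exists>\<theta>\<in>{0..t n}. \<exists>\<theta>'\<in>{0..t n}. D n = dirderiv b (dirderiv c f) (x + \<theta> *R c + \<theta>' *R b)"
    proof -
      have "D n = (f (x + t n *R c + t n *R b) - f (x + t n *R c) - f (x + t n *R b) + f x) / (t n)^2"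
        by (simp add: D_def add_ac)
      then show ?thesis
        using second_difference_mvt[OF f tpos, of n x c b] tpos[of n] by fastforce
    qed
  qed
  ultimately show ?thesis using LIMSEQ_unique by blast
qed

lemmas smooth_intros = smooth_const smooth_add smooth_sum smooth_mult smooth_diff smooth_inner
  smooth_norm_sq smooth_dirderiv smooth_exp

section \<open>Test functions: supports, uniform bounds and Taylor remainders\<close>

lemma test_smooth: "test_function \<Omega> \<phi> \<Longrightarrow> smooth \<phi>"
  by (simp add: test_function_def)

lemma test_functionI:
  assumes "smooth \<phi>" "compact K" "K \<subseteq> \<Omega>" "\<And>x. x \<notin> K \<Longrightarrow> \<phi> x = 0"
  shows "test_function \<Omega> \<phi>"
proof -
  have "closure {x. \<phi> x \<noteq> 0} \<subseteq> K"
    using assms by (intro closure_minimal) (auto simp: compact_imp_closed)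
  then show ?thesis
    using assms compact_Int_closed[of K "closure {x. \<phi> x \<noteq> 0}"]
    by (auto simp: test_function_def Int_absorb1 Int_commute)
qed

lemma dirderiv_zero_outside:
  assumes "closed K" "\<And>x. x \<notin> K \<Longrightarrow> \<phi> x = 0" "x \<notin> K"
  shows "dirderiv b \<phi> x = 0"
proof -
  have "(\<phi> has_derivative (\<lambda>h. 0)) (at x)"
    by (rule has_derivative_transform_within_open[of "\<lambda>x. 0" _ _ _ "- K"]) (use assms in auto)
  then show ?thesis by (rule dirderiv_eqI)
qed

lemma test_functionE:
  assumes "test_function \<Omega> \<phi>"
  obtains K where "compact K" "K \<subseteq> \<Omega>" "\<And>x. x \<notin> K \<Longrightarrow> \<phi> x = 0"
proof -
  have "\<phi> x = 0" if "x \<notin> closure {x. \<phi> x \<noteq> 0}" for x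
    using that closure_subset[of "{x. \<phi> x \<noteq> 0}"] by auto
  moreover have "compact (closure {x. \<phi> x \<noteq> 0})" "closure {x. \<phi> x \<noteq> 0} \<subseteq> \<Omega>"
    using assms by (simp_all add: test_function_def)
  ultimately show thesis using that by blast
qed

lemma test_mono: "test_function \<Omega> \<phi> \<Longrightarrow> \<Omega> \<subseteq> \<Omega>' \<Longrightarrow> test_function \<Omega>' \<phi>"
  by (auto simp: test_function_def)

lemma test_outside: "test_function \<Omega> \<phi> \<Longrightarrow> x \<notin> \<Omega> \<Longrightarrow> \<phi> x = 0"
  by (metis test_functionE subsetD)

lemma test_dirderiv:
  assumes "test_function \<Omega> \<phi>"
  shows "test_function \<Omega> (dirderiv b \<phi>)"
proof -
  obtain K where "compact K" "K \<subseteq> \<Omega>" "\<And>x. x \<notin> K \<Longrightarrow> \<phi> x = 0"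
    using assms test_functionE by blast
  then show ?thesis
    using assms by (intro test_functionI[where K=K] smooth_dirderiv)
      (auto simp: test_smooth intro: dirderiv_zero_outside compact_imp_closed)
qed

lemma test_mult_right:
  fixes \<phi> :: "'a::euclidean_space \<Rightarrow> real"
  assumes "test_function \<Omega> \<phi>" "smooth g"
  shows "test_function \<Omega> (\<lambda>x. \<phi> x * g x)"
proof -
  obtain K where "compact K" "K \<subseteq> \<Omega>" "\<And>x. x \<notin> K \<Longrightarrow> \<phi> x = 0"
    using assms(1) test_functionE by blast
  then show ?thesis
    using assms by (intro test_functionI[where K=K] smooth_intros) (auto simp: test_smooth)
qed

lemma test_mult_left:
  fixes \<phi> :: "'a::euclidean_space \<Rightarrow> real"
  shows "test_function \<Omega> \<phi> \<Longrightarrow> smooth g \<Longrightarrow> test_function \<Omega> (\<lambda>x. g x * \<phi> x)"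
  using test_mult_right[of \<Omega> \<phi> g] by (simp add: mult.commute)

lemma test_add:
  assumes "test_function \<Omega> \<phi>" "test_function \<Omega> \<psi>"
  shows "test_function \<Omega> (\<lambda>x. \<phi> x + \<psi> x)"
proof -
  obtain K L where "compact K" "K \<subseteq> \<Omega>" "\<And>x. x \<notin> K \<Longrightarrow> \<phi> x = 0"
    "compact L" "L \<subseteq> \<Omega>" "\<And>x. x \<notin> L \<Longrightarrow> \<psi> x = 0"
    using assms test_functionE by metis
  then show ?thesis
    using assms
    by (intro test_functionI[where K="K \<union> L"] smooth_intros) (auto simp: test_smooth)
qed

lemma test_zero: "test_function \<Omega> (\<lambda>x. 0)"
  by (rule test_functionI[where K="{}"]) (auto simp: smooth_const)

lemma test_sum:
  "(\<And>i. i \<in> I \<Longrightarrow> test_function \<Omega> (f i)) \<Longrightarrow> test_function \<Omega> (\<lambda>x. \<Sum>i\<in>I. f i x)"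
  by (induction I rule: infinite_finite_induct) (auto simp: test_zero test_add)

lemma test_bounded_support:
  assumes "test_function \<Omega> \<phi>"
  obtains R where "R > 0" "\<And>x. norm x \<ge> R \<Longrightarrow> \<phi> x = 0"
proof -
  obtain K where K: "compact K" "\<And>x. x \<notin> K \<Longrightarrow> \<phi> x = 0"
    using assms test_functionE by metis
  then obtain R where "\<And>x. x \<in> K \<Longrightarrow> norm x \<le> R"
    using compact_imp_bounded bounded_iff by metis
  with K that[of "max R 0 + 1"] show thesis by fastforce
qed

lemma integrable_compact_support:
  fixes g :: "'a::euclidean_space \<Rightarrow> 'b::euclidean_space"
  assumes "continuous_on UNIV g" "compact K" "\<And>x. x \<notin> K \<Longrightarrow> g x = 0"
  shows "L1 g"
proof -
  have "L1 (cut K g)"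
    using continuous_on_subset[OF assms(1) subset_UNIV] assms(2) by (rule borel_integrable_compact[rotated])
  moreover have "indicator K x *R g x = g x" for x
    using assms(3)[of x] by (cases "x \<in> K") simp_all
  ultimately show ?thesis by simp
qed

lemma test_integrable: "test_function \<Omega> \<phi> \<Longrightarrow> L1 \<phi>"
  by (metis test_functionE integrable_compact_support smooth_continuous test_smooth)

lemma test_bounded:
  assumes "test_function \<Omega> \<phi>"
  obtains B where "B > 0" "\<And>x. norm (\<phi> x) \<le> B"
proof -
  obtain K where K: "compact K" "\<And>x. x \<notin> K \<Longrightarrow> \<phi> x = 0"
    using assms test_functionE by metis
  have "compact (\<phi> ` K)"
    using assms K by (intro compact_continuous_image smooth_continuous test_smooth)
  then obtain B where "\<And>x. x \<in> K \<Longrightarrow> norm (\<phi> x) \<le> B"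
    using compact_imp_bounded bounded_iff by (metis imageI)
  then have "norm (\<phi> x) \<le> max B 0 + 1" for x
    using K(2)[of x] by (cases "x \<in> K") force+
  with that[of "max B 0 + 1"] show thesis by auto
qed

text \<open>The derivatives along the basis are test functions again, hence bounded; their sum
  bounds the operator norm of the derivative, and the mean value inequality applies. The constant
  later dominates difference quotients.\<close>

lemma test_lipschitz:
  assumes "test_function \<Omega> \<phi>"
  obtains L where "L > 0" "\<And>x y. norm (\<phi> x - \<phi> y) \<le> L * norm (x - y)"
proof -
  have "\<exists>B>0. \<forall>x. norm (dirderiv b \<phi> x) \<le> B" for b
    using test_dirderiv[OF assms] test_bounded by metis
  then obtain B where B: "\<And>b. B b > 0" "\<And>b x. norm (dirderiv b \<phi> x) \<le> B b" by metis
  let ?L = "\<Sum>b\<in>(Basis :: 'a set). B b"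
  have "norm (dirderiv h \<phi> x) \<le> ?L * norm h" for h x
  proof -
    have "norm (dirderiv h \<phi> x) \<le> (\<Sum>b\<in>Basis. norm ((h \<bullet> b) *R dirderiv b \<phi> x))"
      unfolding dirderiv_sum_Basis[OF smoothD[OF test_smooth[OF assms]], of h x]
      by (rule norm_sum)
    also have "\<dots> \<le> (\<Sum>b\<in>Basis. norm h * B b)"
      using B by (intro sum_mono) (auto intro!: mult_mono simp: Basis_le_norm order_less_imp_le)
    finally show ?thesis by (simp add: sum_distrib_left mult.commute)
  qed
  then have on: "onorm (\<lambda>h. dirderiv h \<phi> x) \<le> ?L" for x
    using B by (intro onorm_bound) (auto intro!: sum_nonneg simp: order_less_imp_le mult.commute)
  have "norm (\<phi> x - \<phi> y) \<le> ?L * norm (x - y)" for x y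
    by (rule differentiable_bound[where S=UNIV and f'="\<lambda>x h. dirderiv h \<phi> x"])
       (auto intro!: has_derivative_dirderiv smoothD test_smooth[OF assms] on)
  moreover have "?L > 0" using B by (intro sum_pos) auto
  ultimately show thesis using that by blast
qed

text \<open>Lipschitz continuity of the first derivatives makes the remainder quadratic uniformly in
  the base point. This uniformity allows differentiation of a convolution without a limit
  theorem.\<close>

lemma test_taylor:
  fixes \<phi> :: "'a::euclidean_space \<Rightarrow> real"
  assumes "test_function \<Omega> \<phi>"
  obtains C where "C > 0" "\<And>x h. \<bar>\<phi> (x + h) - \<phi> x - dirderiv h \<phi> x\<bar> \<le> C * (norm h)^2"
proof -
  have "\<exists>B>0. \<forall>x y. norm (dirderiv b \<phi> x - dirderiv b \<phi> y) \<le> B * norm (x - y)" for b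
    using test_dirderiv[OF assms] test_lipschitz by metis
  then obtain B where B: "\<And>b. B b > 0"
    "\<And>b x y. norm (dirderiv b \<phi> x - dirderiv b \<phi> y) \<le> B b * norm (x - y)" by metis
  let ?L = "\<Sum>b\<in>(Basis :: 'a set). B b"
  have diff: "\<phi> differentiable (at x)" for x
    by (intro smoothD test_smooth[OF assms])
  have lip: "\<bar>dirderiv h \<phi> x - dirderiv h \<phi> y\<bar> \<le> ?L * norm h * norm (x - y)" for h x y
  proof -
    have "\<bar>dirderiv h \<phi> x - dirderiv h \<phi> y\<bar>
        = \<bar>\<Sum>b\<in>Basis. (h \<bullet> b) * (dirderiv b \<phi> x - dirderiv b \<phi> y)\<bar>"
      unfolding dirderiv_sum_Basis[OF diff, of h x] dirderiv_sum_Basis[OF diff, of h y]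
      by (simp add: sum_subtractf right_diff_distrib)
    also have "\<dots> \<le> (\<Sum>b\<in>Basis. \<bar>h \<bullet> b\<bar> * \<bar>dirderiv b \<phi> x - dirderiv b \<phi> y\<bar>)"
      using sum_abs[of "\<lambda>b. (h \<bullet> b) * (dirderiv b \<phi> x - dirderiv b \<phi> y)" Basis] by (simp add: abs_mult)
    also have "\<dots> \<le> (\<Sum>b\<in>Basis. norm h * (B b * norm (x - y)))"
      using B(2) by (intro sum_mono mult_mono) (auto simp: Basis_le_norm)
    finally show ?thesis by (simp add: sum_distrib_right sum_distrib_left mult_ac)
  qed
  have "\<bar>\<phi> (x + h) - \<phi> x - dirderiv h \<phi> x\<bar> \<le> ?L * (norm h)^2" for x h
  proof -
    have D: "((\<lambda>s. x + s *R h) has_derivative (\<lambda>t. t *R h)) (at s)" for s :: real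
      by (auto intro!: derivative_eq_intros)
    have "((\<lambda>s. \<phi> (x + s *R h)) has_derivative (\<lambda>t. dirderiv (t *R h) \<phi> (x + s *R h))) (at s)" for s
      using has_derivative_compose[OF D has_derivative_dirderiv[OF diff]] .
    moreover have "(\<lambda>t. dirderiv (t *R h) \<phi> y) = (*) (dirderiv h \<phi> y)" for y
      using linear_scale[OF has_derivative_linear[OF has_derivative_dirderiv[OF diff]]] by auto
    ultimately have "DERIV (\<lambda>s. \<phi> (x + s *R h)) s :> dirderiv h \<phi> (x + s *R h)" for s
      by (simp add: has_field_derivative_def)
    from MVT2[OF zero_less_one this] obtain \<theta> where \<theta>: "0 < \<theta>" "\<theta> < 1"
      "\<phi> (x + 1 *R h) - \<phi> (x + 0 *R h) = (1 - 0) * dirderiv h \<phi> (x + \<theta> *R h)"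
      by blast
    have "\<bar>\<phi> (x + h) - \<phi> x - dirderiv h \<phi> x\<bar> \<le> ?L * norm h * norm (\<theta> *R h)"
      using \<theta>(3) lip[of h "x + \<theta> *R h" x] by simp
    also have "\<dots> \<le> ?L * norm h * norm h"
      using \<theta>(1,2) B(1) by (intro mult_left_mono)
        (auto intro!: sum_nonneg mult_nonneg_nonneg mult_left_le_one_le simp: order_less_imp_le)
    finally show ?thesis by (simp add: power2_eq_square)
  qed
  moreover have "?L > 0" using B by (intro sum_pos) auto
  ultimately show thesis using that by blast
qed

text \<open>Steps \<open>1 / (n + 1)\<close> in place of a continuous parameter make the quotient a
  sequence, as dominated convergence requires.\<close>

lemma dirderiv_difference_quotient:
  fixes f :: "'a::euclidean_space \<Rightarrow> real"
  assumes "f differentiable (at x)"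
  shows "(\<lambda>n. real (Suc n) * (f (x + (1 / real (Suc n)) *R d) - f x)) ----> dirderiv d f x"
proof -
  have D: "((\<lambda>s. x + s *R d) has_derivative (\<lambda>t. t *R d)) (at (0::real))"
    by (auto intro!: derivative_eq_intros)
  have "((\<lambda>s. f (x + s *R d)) has_derivative (\<lambda>t. dirderiv (t *R d) f x)) (at 0)"
    using has_derivative_compose[OF D, of f "\<lambda>h. dirderiv h f x"] has_derivative_dirderiv[OF assms] by simp
  moreover have "(\<lambda>t. dirderiv (t *R d) f x) = (*) (dirderiv d f x)"
    using linear_scale[OF has_derivative_linear[OF has_derivative_dirderiv[OF assms]]] by auto
  ultimately have "DERIV (\<lambda>s. f (x + s *R d)) 0 :> dirderiv d f x"
    by (simp add: has_field_derivative_def)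
  then have "((\<lambda>h. (f (x + h *R d) - f x) / h) \<longlongrightarrow> dirderiv d f x) (at 0)"
    by (simp add: DERIV_def)
  moreover have "filterlim (\<lambda>n. inverse (real (Suc n))) (at 0) sequentially"
    by (intro filterlim_atI LIMSEQ_inverse_real_of_nat) auto
  ultimately have "(\<lambda>n. (f (x + inverse (real (Suc n)) *R d) - f x) / inverse (real (Suc n)))
      ----> dirderiv d f x"
    by (rule filterlim_compose)
  then show ?thesis by (simp add: divide_simps mult.commute)
qed

section \<open>Affine substitutions and integration by parts\<close>

lemma integral_lborel_affine:
  fixes f :: "'a::euclidean_space \<Rightarrow> 'b::euclidean_space"
  assumes "c \<noteq> 0" "f \<in> Borel"
  shows "(\<integral>x. f x) = \<bar>c\<bar> ^ DIM('a) *R (\<integral>x. f (t + c *R x))"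
  using assms by (subst lborel_affine[OF assms(1), of t]) (simp add: integral_density integral_distr)

lemma nn_integral_lborel_affine:
  fixes f :: "'a::euclidean_space \<Rightarrow> ennreal"
  assumes "c \<noteq> 0" "f \<in> Borel"
  shows "(\<integral>\<^sup>+x. f x) = ennreal (\<bar>c\<bar> ^ DIM('a)) * (\<integral>\<^sup>+x. f (t + c *R x))"
  using assms by (subst lborel_affine[OF assms(1), of t])
    (simp add: nn_integral_density nn_integral_distr nn_integral_cmult)

lemma integrable_lborel_affine:
  fixes f :: "'a::euclidean_space \<Rightarrow> 'b::euclidean_space"
  assumes "c \<noteq> 0" "L1 f"
  shows "L1 (\<lambda>x. f (t + c *R x))"
proof -
  have m: "f \<in> Borel" using assms(2) by (simp add: integrable_iff_bounded)
  have "integrable (density (distr lborel borel (\<lambda>x. t + c *R x)) (\<lambda>_. \<bar>c\<bar> ^ DIM('a))) f"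
    using assms by (subst lborel_affine[symmetric]) auto
  then have "L1 (\<lambda>x. \<bar>c\<bar> ^ DIM('a) *R f (t + c *R x))"
    using assms m by (simp add: integrable_density integrable_distr_eq)
  then have "L1 (\<lambda>x. inverse (\<bar>c\<bar> ^ DIM('a)) *R \<bar>c\<bar> ^ DIM('a) *R f (t + c *R x))"
    by (rule integrable_scaleR_right)
  moreover have "inverse (\<bar>c\<bar> ^ DIM('a)) * \<bar>c\<bar> ^ DIM('a) = 1" using assms(1) by simp
  ultimately show ?thesis by (simp only: scaleR_scaleR scaleR_one)
qed

text \<open>By translation invariance every difference quotient has integral zero. The Lipschitz
  bound, on a ball enlarged by \<open>norm b\<close> because the steps are at most one, dominates
  the quotients, so their limit has integral zero as well.\<close>

lemma integral_dirderiv_zero: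
  fixes \<phi> :: "'a::euclidean_space \<Rightarrow> real"
  assumes \<phi>: "test_function \<Omega> \<phi>"
  shows "(\<integral>x. dirderiv b \<phi> x) = 0"
proof -
  obtain L where L: "L > 0" "\<And>x y. norm (\<phi> x - \<phi> y) \<le> L * norm (x - y)"
    using test_lipschitz[OF \<phi>] by blast
  obtain R where R: "R > 0" "\<And>x. norm x \<ge> R \<Longrightarrow> \<phi> x = 0"
    using test_bounded_support[OF \<phi>] by blast
  have m[measurable]: "\<phi> \<in> Borel"
    using \<phi> smooth_measurable test_smooth by blast
  have m'[measurable]: "dirderiv b \<phi> \<in> Borel"
    using \<phi> smooth_measurable test_smooth smooth_dirderiv by blast
  define s where "s n = 1 / real (Suc n)" for n
  have s: "0 < s n" "s n \<le> 1" for n by (auto simp: s_def)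
  have int: "L1 \<phi>" using \<phi> by (rule test_integrable)
  let ?q = "\<lambda>n x. real (Suc n) * (\<phi> (x + s n *R b) - \<phi> x)"
  have "(\<integral>x. ?q n x) = 0" for n
  proof -
    have "L1 (\<lambda>x. \<phi> (x + s n *R b))"
      using integrable_lborel_affine[of 1 \<phi> "s n *R b"] int by (simp add: add.commute)
    moreover have "(\<integral>x. \<phi> (x + s n *R b)) = (\<integral>x. \<phi> x)"
      using integral_lborel_affine[of 1 \<phi> "s n *R b"] by (simp add: add.commute)
    ultimately show ?thesis using int by simp
  qed
  moreover have "(\<lambda>n. \<integral>x. ?q n x) ----> (\<integral>x. dirderiv b \<phi> x)"
  proof (rule integral_dominated_convergence[where w="\<lambda>x. indicator (cball 0 (R + norm b)) x * (L * norm b)"])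
    show "L1 (\<lambda>x. indicator (cball 0 (R + norm b)) x * (L * norm b))"
      by (intro integrable_mult_left integrable_real_indicator) (use emeasure_lborel_cball_finite in auto)
    show "AE x in lborel. (\<lambda>n. ?q n x) ----> dirderiv b \<phi> x"
      unfolding s_def
      by (intro AE_I2 dirderiv_difference_quotient smoothD test_smooth[OF \<phi>])
    fix n
    show "AE x in lborel. norm (?q n x) \<le> indicator (cball 0 (R + norm b)) x * (L * norm b)"
    proof (rule AE_I2)
      fix x
      have "norm (?q n x) \<le> real (Suc n) * (L * norm (s n *R b))"
        using L(2)[of "x + s n *R b" x] by (simp add: abs_mult mult_left_mono)
      also have "\<dots> = L * norm b" by (simp add: s_def)
      finally have b1: "norm (?q n x) \<le> L * norm b" .
      show "norm (?q n x) \<le> indicator (cball 0 (R + norm b)) x * (L * norm b)"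
      proof (cases "norm x \<le> R + norm b")
        case False
        have "norm x \<le> norm (x + s n *R b) + norm (s n *R b)"
          using norm_triangle_ineq4[of "x + s n *R b" "s n *R b"] by simp
        moreover have "norm (s n *R b) \<le> norm b"
          using s[of n] by (simp add: mult_left_le_one_le)
        ultimately have "\<phi> (x + s n *R b) = 0" "\<phi> x = 0"
          using False norm_ge_zero[of b] by (intro R(2); linarith)+
        then show ?thesis by (simp add: False)
      qed (use b1 in auto)
    qed
  qed auto
  ultimately show ?thesis using LIMSEQ_unique[OF _ tendsto_const] by simp
qed

section \<open>The Carleman estimate\<close>

definition laplacian :: "('a::euclidean_space \<Rightarrow> real) \<Rightarrow> 'a \<Rightarrow> real"
  where "laplacian f x = (\<Sum>b\<in>Basis. dirderiv b (dirderiv b f) x)"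

lemma smooth_laplacian: "smooth f \<Longrightarrow> smooth (laplacian f)"
  unfolding laplacian_def[abs_def] by (intro smooth_intros)

lemma test_laplacian: "test_function \<Omega> f \<Longrightarrow> test_function \<Omega> (laplacian f)"
  unfolding laplacian_def[abs_def] by (intro test_sum test_dirderiv)

lemma integral_divergence_zero:
  fixes F :: "'a \<Rightarrow> 'a::euclidean_space \<Rightarrow> real"
  assumes "\<And>b. b \<in> Basis \<Longrightarrow> test_function UNIV (F b)"
  shows "(\<integral>x. (\<Sum>b\<in>Basis. dirderiv b (F b) x)) = 0"
proof -
  have "(\<integral>x. (\<Sum>b\<in>Basis. dirderiv b (F b) x)) = (\<Sum>b\<in>Basis. \<integral>x. dirderiv b (F b) x)"
    using assms by (intro Bochner_Integration.integral_sum test_integrable test_dirderiv)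
  also have "\<dots> = 0"
    using assms integral_dirderiv_zero by (intro sum.neutral) blast
  finally show ?thesis .
qed

section \<open>Dilations and Pohozaev's identity\<close>

lemma inner_Basis_sum_left:
  assumes "b \<in> Basis" shows "(\<Sum>c\<in>Basis. (b \<bullet> c) * f c) = (f b :: real)"
proof -
  have "(\<Sum>c\<in>Basis. (b \<bullet> c) * f c) = (\<Sum>c\<in>Basis. if c = b then f c else 0)"
    by (rule sum.cong) (use assms in \<open>auto simp: inner_Basis\<close>)
  then show ?thesis using assms by simp
qed

text \<open>The radial derivative, generator of dilations. The coordinate form inherits smoothness
  and support from the partial derivatives; \<open>euler_eq\<close> links it to the derivative in
  direction \<open>x\<close>.\<close>

definition euler :: "('a::euclidean_space \<Rightarrow> real) \<Rightarrow> 'a \<Rightarrow> real"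
  where "euler f x = (\<Sum>c\<in>Basis. (x \<bullet> c) * dirderiv c f x)"

lemma smooth_euler: "smooth f \<Longrightarrow> smooth (euler f)"
  unfolding euler_def[abs_def] by (intro smooth_intros)

lemma euler_eq: "f differentiable (at x) \<Longrightarrow> euler f x = dirderiv x f x"
  by (simp add: euler_def dirderiv_sum_Basis[of f x x])

text \<open>The commutator of a partial derivative with \<open>x \<bullet> \<nabla>\<close> is that
  partial derivative itself; the second-order terms match by symmetry of second derivatives.\<close>

lemma dirderiv_euler:
  assumes f: "smooth f" and b: "b \<in> Basis"
  shows "dirderiv b (euler f) x = dirderiv b f x + euler (dirderiv b f) x"
proof -
  have "dirderiv b (euler f) x = (\<Sum>c\<in>Basis. dirderiv b (\<lambda>x. (x \<bullet> c) * dirderiv c f x) x)"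
    unfolding euler_def[abs_def]
    by (rule dirderiv_sum) (intro smoothD smooth_intros f)
  also have "\<dots> = (\<Sum>c\<in>Basis. (x \<bullet> c) * dirderiv c (dirderiv b f) x + (b \<bullet> c) * dirderiv c f x)"
    by (intro sum.cong refl, subst dirderiv_mult)
       (auto intro!: smoothD smooth_intros f simp: dirderiv_inner dirderiv_commute[OF f, of b])
  finally show ?thesis
    using b by (simp add: sum.distrib euler_def inner_Basis_sum_left)
qed

lemma sum_norm_sq: "(\<Sum>b\<in>Basis. (x \<bullet> b)^2) = (norm x)^2"
  unfolding power2_norm_eq_inner by (subst euclidean_inner) (simp add: power2_eq_square)

lemma divergence_position:
  assumes "g differentiable (at x)"
  shows "(\<Sum>b\<in>Basis. dirderiv b (\<lambda>x::'a::euclidean_space. (x \<bullet> b) * g x) x) = euler g x + real DIM('a) * g x"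
proof -
  have "(\<Sum>b\<in>Basis. dirderiv b (\<lambda>x. (x \<bullet> b) * g x) x) = (\<Sum>b\<in>Basis. (x \<bullet> b) * dirderiv b g x + g x)"
    by (intro sum.cong refl, subst dirderiv_mult)
       (auto intro!: smoothD smooth_inner assms simp: dirderiv_inner)
  then show ?thesis by (simp add: sum.distrib euler_def)
qed

text \<open>The compactly supported field \<open>x g\<close> has divergence
  \<open>euler g + n g\<close>. This is why \<open>euler\<close> becomes skew-adjoint after adding
  \<open>n / 2\<close>.\<close>

lemma integral_euler:
  fixes g :: "'a::euclidean_space \<Rightarrow> real"
  assumes "test_function UNIV g"
  shows "(\<integral>x. euler g x) = - (real DIM('a) * (\<integral>x. g x))"
proof -
  have g: "smooth g" "L1 g"
    using assms test_smooth test_integrable by blast+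
  have "test_function UNIV (euler g)"
    unfolding euler_def[abs_def]
    by (intro test_sum test_mult_left test_dirderiv assms smooth_inner)
  then have e: "L1 (euler g)" by (rule test_integrable)
  have "0 = (\<integral>x. (\<Sum>b\<in>Basis. dirderiv b (\<lambda>x::'a. (x \<bullet> b) * g x) x))"
    by (rule integral_divergence_zero[symmetric]) (intro test_mult_left assms smooth_inner)
  also have "\<dots> = (\<integral>x. euler g x + real DIM('a) * g x)"
    using g by (simp add: divergence_position smoothD)
  also have "\<dots> = (\<integral>x. euler g x) + real DIM('a) * (\<integral>x. g x)"
    using e g by simp
  finally show ?thesis by simp
qed

lemma euler_mult:
  "f differentiable (at x) \<Longrightarrow> g differentiable (at x) \<Longrightarrow>
    euler (\<lambda>x. f x * g x) x = f x * euler g x + euler f x * g x"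
  by (simp add: euler_def dirderiv_mult sum.distrib sum_distrib_left sum_distrib_right algebra_simps)

lemma euler_norm_sq: "euler (\<lambda>x::'a::euclidean_space. (norm x)^2) x = 2 * (norm x)^2"
proof -
  have "euler (\<lambda>x::'a. (norm x)^2) x = (\<Sum>c\<in>Basis. 2 * (x \<bullet> c)^2)"
    unfolding euler_def dirderiv_norm_sq by (simp add: power2_eq_square mult_ac)
  then show ?thesis by (simp add: sum_distrib_left[symmetric] sum_norm_sq)
qed

text \<open>Pohozaev's identity for the skew-adjoint generator \<open>x \<bullet> \<nabla> + n / 2\<close> of dilations.\<close>

lemma integral_laplacian_euler:
  fixes z :: "'a::euclidean_space \<Rightarrow> real"
  assumes z: "test_function UNIV z"
  shows "(\<integral>x. laplacian z x * (euler z x + real DIM('a) / 2 * z x))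
    = - (\<integral>x. (\<Sum>b\<in>Basis. (dirderiv b z x)^2))"
proof -
  have sm: "smooth z" using z by (rule test_smooth)
  define E where "E x = euler z x + real DIM('a) / 2 * z x" for x
  define Q where "Q x = (\<Sum>c\<in>Basis. dirderiv c z x * dirderiv c z x)" for x
  have smE: "smooth E" and smQ: "smooth Q"
    unfolding E_def[abs_def] Q_def[abs_def] by (intro smooth_intros smooth_euler sm)+
  have tQ: "test_function UNIV Q"
    unfolding Q_def[abs_def]
    by (intro test_sum test_mult_left test_dirderiv z smooth_dirderiv sm)
  have tL: "test_function UNIV (\<lambda>x. laplacian z x * E x)"
    by (intro test_mult_right test_laplacian z smE)
  have dE: "dirderiv b E x = dirderiv b z x + euler (dirderiv b z) x + real DIM('a) / 2 * dirderiv b z x"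
    if "b \<in> Basis" for b x
    unfolding E_def[abs_def] using that sm
    by (subst dirderiv_add; (subst dirderiv_cmult)?)
       (auto simp: smoothD smooth_euler smooth_cmult[where c="real DIM('a) / 2"] dirderiv_euler simp del: times_divide_eq_left)
  have eQ: "euler Q x = 2 * (\<Sum>c\<in>Basis. dirderiv c z x * euler (dirderiv c z) x)" for x
  proof -
    have "dirderiv b Q x = (\<Sum>c\<in>Basis. 2 * (dirderiv c z x * dirderiv b (dirderiv c z) x))" for b
      unfolding Q_def[abs_def] using sm
      by (subst dirderiv_sum) (auto simp: smoothD smooth_mult smooth_dirderiv dirderiv_mult)
    then have "euler Q x = (\<Sum>b\<in>Basis. \<Sum>c\<in>Basis. (x \<bullet> b) * (2 * (dirderiv c z x * dirderiv b (dirderiv c z) x)))"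
      by (simp add: euler_def sum_distrib_left)
    also have "\<dots> = (\<Sum>c\<in>Basis. \<Sum>b\<in>Basis. (x \<bullet> b) * (2 * (dirderiv c z x * dirderiv b (dirderiv c z) x)))"
      by (rule sum.swap)
    finally show ?thesis by (simp add: euler_def sum_distrib_left mult_ac)
  qed
  \<comment> \<open>Pohozaev's field: \<open>E \<nabla>z\<close> minus half of
    \<open>x |\<nabla>z|^2\<close>. The factor one half cancels the second derivatives of
    \<open>z\<close> contained in the derivative of \<open>E\<close>; the terms with
    \<open>n\<close> cancel as well, and \<open>Q\<close> is left over.\<close>
  let ?G = "\<lambda>b x. dirderiv b z x * E x - (1/2) * ((x \<bullet> b) * Q x)"
  have dG: "dirderiv b (?G b) x = dirderiv b z x * dirderiv b E x + dirderiv b (dirderiv b z) x * E x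
      - (1/2) * dirderiv b (\<lambda>x. (x \<bullet> b) * Q x) x" for b x
    by (subst dirderiv_diff dirderiv_mult dirderiv_cmult;
        (intro smoothD smooth_intros smE smQ sm)?)+ simp
  have "(\<Sum>b\<in>Basis. dirderiv b (?G b) x) = laplacian z x * E x + Q x" for x
  proof -
    have "(\<Sum>b\<in>Basis. dirderiv b z x * dirderiv b E x)
        = (\<Sum>b\<in>Basis. dirderiv b z x * euler (dirderiv b z) x) + (1 + real DIM('a) / 2) * Q x"
      by (simp add: dE Q_def sum.distrib sum_distrib_left algebra_simps)
    moreover have "(\<Sum>b\<in>Basis. dirderiv b (\<lambda>x. (x \<bullet> b) * Q x) x) = euler Q x + real DIM('a) * Q x"
      by (rule divergence_position) (intro smoothD smQ)
    moreover have "(\<Sum>b\<in>Basis. dirderiv b (?G b) x) = (\<Sum>b\<in>Basis. dirderiv b z x * dirderiv b E x)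
        + laplacian z x * E x - (1/2) * (\<Sum>b\<in>Basis. dirderiv b (\<lambda>x. (x \<bullet> b) * Q x) x)"
      unfolding dG laplacian_def
      by (simp only: sum.distrib sum_subtractf sum_distrib_left[symmetric] sum_distrib_right[symmetric])
    ultimately show ?thesis
      by (simp add: eQ field_simps)
  qed
  then have "(\<integral>x. laplacian z x * E x + Q x) = (\<integral>x. (\<Sum>b\<in>Basis. dirderiv b (?G b) x))"
    by simp
  also have "\<dots> = 0"
  proof (rule integral_divergence_zero)
    fix b :: 'a
    have "test_function UNIV (\<lambda>x. dirderiv b z x * E x + (- (1/2) * (x \<bullet> b)) * Q x)"
      by (intro test_add test_mult_right test_mult_left test_dirderiv z smE tQ
          smooth_cmult smooth_inner)
    then show "test_function UNIV (?G b)" by (simp add: mult.assoc)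
  qed
  finally have "(\<integral>x. laplacian z x * E x) + (\<integral>x. Q x) = 0"
    using test_integrable[OF tL] test_integrable[OF tQ] by simp
  then show ?thesis by (simp add: E_def Q_def power2_eq_square)
qed

text \<open>Monotonicity of \<open>a\<close> along rays is used in integrated form, by comparing \<open>h\<close> with its dilates.\<close>

lemma integral_radially_nondecreasing:
  fixes a h :: "'a::euclidean_space \<Rightarrow> real"
  assumes a[measurable]: "a \<in> Borel" and B: "\<And>x. \<bar>a x\<bar> \<le> B"
    and mono: "\<And>x l. l \<ge> 1 \<Longrightarrow> a x \<le> a (l *R x)"
    and h: "test_function UNIV h" and nn: "\<And>x. h x \<ge> 0"
  shows "(\<integral>x. a x * (euler h x + real DIM('a) * h x)) \<le> 0"
proof -
  have hm[measurable]: "h \<in> Borel"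
    and em[measurable]: "euler h \<in> Borel"
    using smooth_measurable smooth_euler test_smooth[OF h] by blast+
  have hi: "L1 h" using h by (rule test_integrable)
  obtain L where L: "L > 0" "\<And>x y. norm (h x - h y) \<le> L * norm (x - y)"
    using test_lipschitz[OF h] by blast
  obtain R where R: "R > 0" "\<And>x. norm x \<ge> R \<Longrightarrow> h x = 0"
    using test_bounded_support[OF h] by blast
  have bm: "L1 (\<lambda>x. a x * g x)" if "L1 g" for g
    by (rule Bochner_Integration.integrable_bound[OF integrable_mult_right[OF integrable_norm[OF that], of B]])
       (use that B in \<open>auto simp: abs_mult intro!: mult_right_mono AE_I2 order_trans[OF B]\<close>)
  let ?n = "real DIM('a)"
  define l where "l m = 1 + 1 / real (Suc m)" for m
  have l: "l m > 1" for m by (auto simp: l_def)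
  define q where "q m x = real (Suc m) * (h (l m *R x) - h x)" for m x
  have qi: "L1 (q m)" for m
    unfolding q_def using integrable_lborel_affine[of "l m" h 0] hi l[of m] by simp
  \<comment> \<open>As \<open>h\<close> is nonnegative, \<open>a x\<close> may be raised to
    \<open>a (l m *R x)\<close>; rescaling then gives back the integral of \<open>a * h\<close> with
    the Jacobian \<open>1 / l m ^ n\<close>. No derivative of \<open>a\<close> is ever
    taken.\<close>
  have step: "(\<integral>x. a x * q m x)
      \<le> real (Suc m) * (inverse (l m ^ DIM('a)) - 1) * (\<integral>x. a x * h x)" for m
  proof -
    have hl: "L1 (\<lambda>x. h (l m *R x))"
      using integrable_lborel_affine[of "l m" h 0] hi l[of m] by simp
    have al: "L1 (\<lambda>x. a (l m *R x) * h (l m *R x))"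
      using integrable_lborel_affine[of "l m" "\<lambda>x. a x * h x" 0] bm[OF hi] l[of m] by simp
    have "(\<integral>x. a x * h (l m *R x)) \<le> (\<integral>x. a (l m *R x) * h (l m *R x))"
      using l[of m] by (intro integral_mono bm hl al mult_right_mono mono nn) auto
    also have "\<dots> = inverse (l m ^ DIM('a)) * (\<integral>x. a x * h x)"
      using integral_lborel_affine[of "l m" "\<lambda>x. a x * h x" 0] l[of m] by simp
    finally have *: "(\<integral>x. a x * h (l m *R x)) \<le> inverse (l m ^ DIM('a)) * (\<integral>x. a x * h x)" .
    have "(\<integral>x. a x * q m x)
        = (\<integral>x. real (Suc m) * (a x * h (l m *R x) - a x * h x))"
      by (intro Bochner_Integration.integral_cong refl) (simp add: q_def algebra_simps)
    also have "\<dots> = real (Suc m) * ((\<integral>x. a x * h (l m *R x)) - (\<integral>x. a x * h x))"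
      using bm[OF hl] bm[OF hi] by simp
    also have "\<dots> \<le> real (Suc m) * ((inverse (l m ^ DIM('a)) - 1) * (\<integral>x. a x * h x))"
      using * by (intro mult_left_mono) (auto simp: algebra_simps)
    finally show ?thesis by (simp add: mult.assoc)
  qed
  \<comment> \<open>The dilations only enlarge norms, so all quotients vanish outside the fixed ball
    of radius \<open>R\<close>; inside, the Lipschitz bound gives \<open>L * R\<close>.\<close>
  have lim1: "(\<lambda>m. \<integral>x. a x * q m x) ----> (\<integral>x. a x * euler h x)"
  proof (rule integral_dominated_convergence[where w="\<lambda>x. indicator (cball 0 R) x * (B * (L * R))"])
    show "L1 (\<lambda>x. indicator (cball (0::'a) R) x * (B * (L * R)))"
      by (intro integrable_mult_left integrable_real_indicator) (use emeasure_lborel_cball_finite in auto)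
    have "(\<lambda>m. q m x) ----> euler h x" for x
      using dirderiv_difference_quotient[of h x x] smoothD[OF test_smooth[OF h], of x]
      by (simp add: euler_eq q_def l_def algebra_simps)
    then show "AE x in lborel. (\<lambda>m. a x * q m x) ----> a x * euler h x"
      by (intro AE_I2 tendsto_mult_left)
    fix m
    show "AE x in lborel. norm (a x * q m x) \<le> indicator (cball 0 R) x * (B * (L * R))"
    proof (rule AE_I2)
      fix x
      show "norm (a x * q m x) \<le> indicator (cball 0 R) x * (B * (L * R))"
      proof (cases "norm x \<le> R")
        case True
        have "\<bar>q m x\<bar> \<le> real (Suc m) * (L * norm (l m *R x - x))"
          unfolding q_def using L(2)[of "l m *R x" x] by (simp add: abs_mult mult_left_mono)
        also have "l m *R x - x = (1 / real (Suc m)) *R x" by (simp add: l_def algebra_simps)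
        also have "real (Suc m) * (L * norm ((1 / real (Suc m)) *R x)) = L * norm x" by simp
        also have "\<dots> \<le> L * R" using True L(1) by simp
        finally have "\<bar>q m x\<bar> \<le> L * R" .
        then show ?thesis
          using True B[of x] L(1) R(1) by (auto simp: abs_mult intro!: mult_mono)
      next
        case False
        have "norm x \<le> norm (l m *R x)" using l[of m] by (simp add: mult_le_cancel_right1)
        then have "q m x = 0" using False by (simp add: q_def R(2))
        then show ?thesis using False by simp
      qed
    qed
  qed (use qi in \<open>auto simp: q_def\<close>)
  have lim2: "(\<lambda>m. real (Suc m) * (inverse (l m ^ DIM('a)) - 1)) ----> - ?n"
  proof -
    have "DERIV (\<lambda>t::real. inverse ((1 + t) ^ DIM('a))) 0 :> - ?n"
      by (auto intro!: derivative_eq_intros)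
    then have "((\<lambda>t::real. (inverse ((1 + t) ^ DIM('a)) - 1) / t) \<longlongrightarrow> - ?n) (at 0)"
      by (simp add: DERIV_def)
    moreover have "filterlim (\<lambda>m. inverse (real (Suc m))) (at 0) sequentially"
      by (intro filterlim_atI LIMSEQ_inverse_real_of_nat) auto
    ultimately have "(\<lambda>m. (inverse ((1 + inverse (real (Suc m))) ^ DIM('a)) - 1) / inverse (real (Suc m))) ----> - ?n"
      by (rule filterlim_compose)
    then show ?thesis by (simp add: l_def divide_inverse mult.commute)
  qed
  have "(\<integral>x. a x * euler h x) \<le> - ?n * (\<integral>x. a x * h x)"
    by (rule LIMSEQ_le[OF lim1 tendsto_mult_right[OF lim2]]) (use step in auto)
  moreover have "test_function UNIV (euler h)"
    unfolding euler_def[abs_def]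
    by (intro test_sum test_mult_left test_dirderiv h smooth_inner)
  then have "L1 (\<lambda>x. a x * euler h x)" by (intro bm test_integrable)
  then have "(\<integral>x. a x * (euler h x + ?n * h x))
      = (\<integral>x. a x * euler h x) + ?n * (\<integral>x. a x * h x)"
    using bm[OF hi] by (simp add: distrib_left mult.left_commute[of _ ?n])
  ultimately show ?thesis by simp
qed

text \<open>The Gaussian \<open>w\<close> has gradient \<open>-2 t x w\<close>. The constant
  \<open>-2 t n\<close> from its Laplacian is grouped with \<open>euler\<close> to form the
  skew-adjoint \<open>euler + n / 2\<close>; what remains is symmetric.\<close>

lemma laplacian_gaussian_conjugation:
  fixes z :: "'a::euclidean_space \<Rightarrow> real"
  assumes sm: "smooth z"
  shows "laplacian (\<lambda>x. gauss t x * z x) x = gauss t x *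
    (laplacian z x + 4 * t^2 * (norm x)^2 * z x - 4 * t * (euler z x + real DIM('a) / 2 * z x))"
proof -
  define w where "w x = gauss t x" for x :: 'a
  have smw: "smooth w" unfolding w_def[abs_def] by (intro smooth_intros)
  have dw: "dirderiv b w x = w x * (- 2 * t * (x \<bullet> b))" for b x
    unfolding w_def[abs_def]
    by (subst dirderiv_exp, (intro smoothD smooth_intros)[1], subst dirderiv_cmult)
       (auto intro!: smoothD smooth_norm_sq simp: dirderiv_norm_sq)
  have d1: "dirderiv b (\<lambda>x. w x * z x) = (\<lambda>x. w x * (dirderiv b z x - 2 * t * ((x \<bullet> b) * z x)))" for b
    using smw sm by (auto simp: dirderiv_mult smoothD dw algebra_simps fun_eq_iff)
  have d2: "dirderiv b (dirderiv b (\<lambda>x. w x * z x)) x = w x * (dirderiv b (dirderiv b z) x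
      - 4 * t * ((x \<bullet> b) * dirderiv b z x) - 2 * t * z x + 4 * t^2 * (x \<bullet> b)^2 * z x)"
    if b: "b \<in> Basis" for b
  proof -
    have eq: "dirderiv b (\<lambda>x. dirderiv b z x - 2 * t * ((x \<bullet> b) * z x)) x
        = dirderiv b (dirderiv b z) x - 2 * t * ((x \<bullet> b) * dirderiv b z x + z x)"
      using b by (subst dirderiv_diff dirderiv_cmult dirderiv_mult;
          (intro smoothD smooth_intros sm)?)+ (simp add: dirderiv_inner)
    have "smooth (\<lambda>x. dirderiv b z x - 2 * t * ((x \<bullet> b) * z x))"
      by (intro smooth_intros sm)
    then have "dirderiv b (\<lambda>x. w x * (dirderiv b z x - 2 * t * ((x \<bullet> b) * z x))) x
      = w x * dirderiv b (\<lambda>x. dirderiv b z x - 2 * t * ((x \<bullet> b) * z x)) x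
        + dirderiv b w x * (dirderiv b z x - 2 * t * ((x \<bullet> b) * z x))"
      using smw by (intro dirderiv_mult smoothD)
    then show ?thesis
      unfolding d1 eq dw by (simp add: algebra_simps power2_eq_square)
  qed
  have "laplacian (\<lambda>x. w x * z x) x = (\<Sum>b\<in>Basis. w x * (dirderiv b (dirderiv b z) x
      - 4 * t * ((x \<bullet> b) * dirderiv b z x) - 2 * t * z x + 4 * t^2 * (x \<bullet> b)^2 * z x))"
    unfolding laplacian_def by (intro sum.cong refl d2)
  also have "\<dots> = w x * (laplacian z x - 4 * t * euler z x - 2 * t * (real DIM('a) * z x)
      + 4 * t^2 * (\<Sum>b\<in>Basis. (x \<bullet> b)^2) * z x)"
    unfolding laplacian_def euler_def
    by (simp only: sum.distrib sum_subtractf sum_distrib_left[symmetric] sum_distrib_right[symmetric]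
        sum_constant mult.left_commute[of _ "2 * t"])
  finally show ?thesis by (simp add: w_def sum_norm_sq algebra_simps)
qed

text \<open>The field \<open>\<nabla>z + 2 t x z\<close> has a nonnegative square. Its cross term is
  \<open>2 t * euler (z^2)\<close>, which integrates to \<open>-2 t n\<close> times the integral of
  \<open>z^2\<close>. This is the ground state bound of the harmonic oscillator.\<close>

lemma test_uncertainty:
  fixes z :: "'a::euclidean_space \<Rightarrow> real"
  assumes z: "test_function UNIV z"
  shows "2 * t * real DIM('a) * (\<integral>x. (z x)^2)
    \<le> (\<integral>x. (\<Sum>b\<in>Basis. (dirderiv b z x)^2)) + 4 * t^2 * (\<integral>x. (norm x)^2 * (z x)^2)"
proof -
  have sm: "smooth z" using z by (rule test_smooth)
  have tz: "test_function UNIV (\<lambda>x. z x * z x)" by (intro test_mult_left z sm)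
  have t1: "test_function UNIV (\<lambda>x. (norm x)^2 * (z x * z x))"
    by (intro test_mult_left tz smooth_norm_sq)
  have t2: "test_function UNIV (\<lambda>x. \<Sum>b\<in>Basis. dirderiv b z x * dirderiv b z x)"
    by (intro test_sum test_mult_left test_dirderiv z smooth_dirderiv sm)
  have te: "test_function UNIV (euler (\<lambda>x. z x * z x))"
    unfolding euler_def[abs_def]
    by (intro test_sum test_mult_left test_dirderiv tz smooth_inner)
  note int = test_integrable[OF tz] test_integrable[OF t1]
    test_integrable[OF t2] test_integrable[OF te]
  have ez: "euler (\<lambda>x. z x * z x) x = 2 * (z x * euler z x)" for x
    by (simp add: euler_mult smoothD sm)
  have "0 \<le> (\<integral>x. (\<Sum>b\<in>Basis. (dirderiv b z x + 2 * t * (x \<bullet> b) * z x)^2))"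
    by (intro integral_nonneg_AE AE_I2 sum_nonneg) auto
  also have "\<dots> = (\<integral>x. (\<Sum>b\<in>Basis. dirderiv b z x * dirderiv b z x) + 2 * t * euler (\<lambda>x. z x * z x) x
      + 4 * t^2 * ((norm x)^2 * (z x * z x)))"
  proof (intro Bochner_Integration.integral_cong refl)
    fix x
    have "(\<Sum>b\<in>Basis. (dirderiv b z x + 2 * t * (x \<bullet> b) * z x)^2)
       = (\<Sum>b\<in>Basis. dirderiv b z x * dirderiv b z x + 4 * t * z x * ((x \<bullet> b) * dirderiv b z x)
          + (x \<bullet> b)^2 * (4 * t^2 * (z x * z x)))"
      by (intro sum.cong refl) (simp add: power2_eq_square algebra_simps)
    also have "\<dots> = (\<Sum>b\<in>Basis. dirderiv b z x * dirderiv b z x) + 4 * t * z x * euler z x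
        + (\<Sum>b\<in>Basis. (x \<bullet> b)^2) * (4 * t^2 * (z x * z x))"
      unfolding euler_def by (simp only: sum.distrib sum_distrib_left[symmetric] sum_distrib_right[symmetric])
    finally show "(\<Sum>b\<in>Basis. (dirderiv b z x + 2 * t * (x \<bullet> b) * z x)^2)
       = (\<Sum>b\<in>Basis. dirderiv b z x * dirderiv b z x) + 2 * t * euler (\<lambda>x. z x * z x) x
      + 4 * t^2 * ((norm x)^2 * (z x * z x))"
      by (simp add: sum_norm_sq ez)
  qed
  also have "\<dots> = (\<integral>x. (\<Sum>b\<in>Basis. dirderiv b z x * dirderiv b z x))
      - 2 * t * (real DIM('a) * (\<integral>x. z x * z x)) + 4 * t^2 * (\<integral>x. (norm x)^2 * (z x * z x))"
    using int integral_euler[OF tz] by simp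
  finally show ?thesis by (simp add: power2_eq_square)
qed

text \<open>Carleman estimate with the Gaussian weight. The symmetric part \<open>\<Delta> + 4 t^2 |x|^2 + a\<close> and the
  skew part \<open>-4 t (x \<bullet> \<nabla> + n / 2)\<close> of the conjugated operator have a positive commutator
  precisely because \<open>a\<close> is nondecreasing along rays, so the constant does not depend on \<open>a\<close>.\<close>

theorem carleman:
  fixes a \<phi> :: "'a::euclidean_space \<Rightarrow> real"
  assumes a[measurable]: "a \<in> Borel" and B: "\<And>x. \<bar>a x\<bar> \<le> B"
    and mono: "\<And>x l. l \<ge> 1 \<Longrightarrow> a x \<le> a (l *R x)"
    and \<phi>: "test_function UNIV \<phi>" and t: "t > 0"
  shows "16 * real DIM('a) * t^2 * (\<integral>x. (exp (t * (norm x)^2) * \<phi> x)^2)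
    \<le> (\<integral>x. (exp (t * (norm x)^2) * (laplacian \<phi> x + a x * \<phi> x))^2)"
proof -
  let ?n = "real DIM('a)"
  define z where "z x = exp (t * (norm x)^2) * \<phi> x" for x
  have tz: "test_function UNIV z"
    unfolding z_def[abs_def] by (intro test_mult_left \<phi> smooth_intros)
  have sm: "smooth z" using tz by (rule test_smooth)
  have phi_z: "\<phi> = (\<lambda>x. gauss t x * z x)"
    by (simp add: z_def fun_eq_iff exp_minus field_simps)
  define E where "E x = euler z x + ?n / 2 * z x" for x
  have smE: "smooth E" unfolding E_def[abs_def] by (intro smooth_intros smooth_euler sm)
  define S where "S x = laplacian z x + 4 * t^2 * (norm x)^2 * z x + a x * z x" for x
  have conj: "exp (t * (norm x)^2) * (laplacian \<phi> x + a x * \<phi> x) = S x - 4 * t * E x" for x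
  proof -
    have "laplacian \<phi> x = gauss t x *
      (laplacian z x + 4 * t^2 * (norm x)^2 * z x - 4 * t * E x)"
      unfolding phi_z E_def by (rule laplacian_gaussian_conjugation[OF sm])
    moreover have "a x * \<phi> x = gauss t x * (a x * z x)"
      by (subst phi_z) simp
    moreover have "exp (t * (norm x)^2) * gauss t x = 1"
      by (simp add: exp_add[symmetric])
    ultimately have "exp (t * (norm x)^2) * (laplacian \<phi> x + a x * \<phi> x)
      = (exp (t * (norm x)^2) * gauss t x) * (S x - 4 * t * E x)"
      unfolding S_def by (simp only: distrib_left[symmetric] mult.assoc) (simp add: algebra_simps)
    then show ?thesis
      using \<open>exp (t * (norm x)^2) * gauss t x = 1\<close> by simp
  qed
  have tzz: "test_function UNIV (\<lambda>x. z x * z x)" by (intro test_mult_left tz sm)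
  have tnz: "test_function UNIV (\<lambda>x. (norm x)^2 * (z x * z x))"
    by (intro test_mult_left tzz smooth_norm_sq)
  have tE: "test_function UNIV E"
    unfolding E_def[abs_def] euler_def
    by (intro test_add test_sum test_mult_left test_dirderiv tz smooth_inner smooth_const)
  have ezz: "euler (\<lambda>x. z x * z x) x + ?n * (z x * z x) = 2 * (z x * E x)" for x
    by (simp add: E_def euler_mult smoothD sm algebra_simps)
  have I1: "(\<integral>x. laplacian z x * E x) = - (\<integral>x. (\<Sum>b\<in>Basis. (dirderiv b z x)^2))"
    unfolding E_def by (rule integral_laplacian_euler[OF tz])
  have i1: "L1 (\<lambda>x. laplacian z x * E x)"
    by (intro test_integrable[of UNIV] test_mult_left tE smooth_laplacian sm)
  have i2: "L1 (\<lambda>x. (norm x)^2 * (z x * E x))"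
    by (intro test_integrable[of UNIV] test_mult_left tE smooth_norm_sq sm)
  have ab: "L1 (\<lambda>x. a x * g x)" if "L1 g" for g
    by (rule Bochner_Integration.integrable_bound[OF integrable_mult_right[OF integrable_norm[OF that], of B]])
       (use that B in \<open>auto simp: abs_mult intro!: mult_right_mono AE_I2 order_trans[OF B]\<close>)
  have tzE: "test_function UNIV (\<lambda>x. z x * E x)" by (intro test_mult_left tE sm)
  have i3: "L1 (\<lambda>x. a x * (z x * E x))"
    by (intro ab test_integrable[OF tzE])
  have I2: "(\<integral>x. (norm x)^2 * (z x * E x)) = - (\<integral>x. (norm x)^2 * (z x * z x))"
  proof -
    have "euler (\<lambda>x. (norm x)^2 * (z x * z x)) x
        = 2 * ((norm x)^2 * (z x * E x)) + (2 - ?n) * ((norm x)^2 * (z x * z x))" for x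
    proof -
      have "euler (\<lambda>x. (norm x)^2 * (z x * z x)) x
          = (norm x)^2 * euler (\<lambda>x. z x * z x) x + 2 * (norm x)^2 * (z x * z x)"
        by (subst euler_mult) (auto intro!: smoothD smooth_intros sm simp: euler_norm_sq)
      also have "euler (\<lambda>x. z x * z x) x = 2 * (z x * E x) - ?n * (z x * z x)" using ezz[of x] by simp
      finally show ?thesis by (simp add: algebra_simps)
    qed
    then have "(\<integral>x. 2 * ((norm x)^2 * (z x * E x)) + (2 - ?n) * ((norm x)^2 * (z x * z x)))
        = - (?n * (\<integral>x. (norm x)^2 * (z x * z x)))"
      using integral_euler[OF tnz] by simp
    moreover have "(\<integral>x. 2 * ((norm x)^2 * (z x * E x)) + (2 - ?n) * ((norm x)^2 * (z x * z x)))
        = 2 * (\<integral>x. (norm x)^2 * (z x * E x)) + (2 - ?n) * (\<integral>x. (norm x)^2 * (z x * z x))"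
      using i2 test_integrable[OF tnz] by simp
    ultimately show ?thesis by (simp add: left_diff_distrib)
  qed
  \<comment> \<open>With \<open>h = z^2\<close> the product \<open>2 z E\<close> is exactly
    \<open>euler h + n h\<close>; here the monotonicity of \<open>a\<close> enters.\<close>
  have I3: "(\<integral>x. a x * (z x * E x)) \<le> 0"
  proof -
    have "(\<integral>x. a x * (euler (\<lambda>x. z x * z x) x + ?n * (z x * z x))) \<le> 0"
      by (rule integral_radially_nondecreasing[OF a B mono tzz]) auto
    then show ?thesis unfolding ezz by (simp add: mult.left_commute[of _ 2])
  qed
  have SE: "S x * E x = laplacian z x * E x + 4 * t^2 * ((norm x)^2 * (z x * E x)) + a x * (z x * E x)" for x
    by (simp add: S_def algebra_simps)
  have iSE: "L1 (\<lambda>x. S x * E x)" unfolding SE using i1 i2 i3 by simp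
  have "(\<integral>x. S x * E x) \<le> - (\<integral>x. (\<Sum>b\<in>Basis. (dirderiv b z x)^2))
      - 4 * t^2 * (\<integral>x. (norm x)^2 * (z x * z x))"
    unfolding SE using i1 i2 i3 I1 I2 I3 by simp
  also have "\<dots> \<le> - (2 * t * ?n * (\<integral>x. (z x)^2))"
    using test_uncertainty[OF tz, of t] by (simp add: power2_eq_square)
  finally have "2 * t * ?n * (\<integral>x. (z x)^2) \<le> - (\<integral>x. S x * E x)" by simp
  then have "8 * t * (2 * t * ?n * (\<integral>x. (z x)^2)) \<le> 8 * t * (- (\<integral>x. S x * E x))"
    using t by (intro mult_left_mono) auto
  moreover have "8 * t * (2 * t * ?n * (\<integral>x. (z x)^2)) = 16 * ?n * t^2 * (\<integral>x. (z x)^2)"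
    unfolding power2_eq_square[of t] by simp
  moreover have "8 * t * (- (\<integral>x. S x * E x)) = (\<integral>x. - 8 * t * (S x * E x))"
    by simp
  ultimately have "16 * ?n * t^2 * (\<integral>x. (z x)^2) \<le> (\<integral>x. - 8 * t * (S x * E x))"
    by linarith
  \<comment> \<open>Only the cross term of the square is kept, which carries the commutator; the
    squares of \<open>S\<close> and of \<open>4 * t * E\<close> are dropped.\<close>
  also have "\<dots> \<le> (\<integral>x. (S x - 4 * t * E x)^2)"
  proof (rule integral_mono)
    show "L1 (\<lambda>x. - 8 * t * (S x * E x))" using iSE by simp
    \<comment> \<open>\<open>S\<close> contains \<open>a\<close>, which is only bounded and
      measurable, so the square is no test function. Splitting off the part \<open>P\<close> free of
      \<open>a\<close> exhibits it as a polynomial in \<open>a\<close> with integrable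
      coefficients.\<close>
    define P where "P x = laplacian z x + 4 * t^2 * ((norm x)^2 * z x) + (- 4 * t) * E x" for x
    have tP: "test_function UNIV P"
      unfolding P_def[abs_def]
      by (intro test_add test_laplacian test_mult_left tz tE smooth_norm_sq smooth_const)
    have "(\<lambda>x. (S x - 4 * t * E x)^2) = (\<lambda>x. P x * P x + a x * (2 * (P x * z x)) + a x * (a x * (z x * z x)))"
      by (simp add: fun_eq_iff P_def S_def power2_eq_square algebra_simps)
    moreover have "L1 (\<lambda>x. P x * P x)" "L1 (\<lambda>x. 2 * (P x * z x))"
      by (intro integrable_mult_right test_integrable[of UNIV] test_mult_right tP sm
          test_smooth[OF tP])+
    ultimately show "L1 (\<lambda>x. (S x - 4 * t * E x)^2)"
      using ab test_integrable[OF tzz] by (simp del: integrable_mult_right_iff)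
    show "- 8 * t * (S x * E x) \<le> (S x - 4 * t * E x)^2" for x
      using zero_le_power2[of "S x"] zero_le_power2[of "4 * t * E x"]
      by (simp add: power2_diff)
  qed
  finally show ?thesis unfolding conj by (simp add: z_def)
qed

section \<open>Square integrable functions\<close>

lemma L2_measurable: "in_L2 M f \<Longrightarrow> f \<in> borel_measurable M"
  by (simp add: in_L2_def)

lemma L2_integrable: "in_L2 M f \<Longrightarrow> integrable M (\<lambda>x. (norm (f x))^2)"
  by (simp add: in_L2_def)

lemma L2_norm_nonneg: "0 \<le> L2_norm M f"
  by (simp add: L2_norm_def)

lemma L2_norm_sq: "(L2_norm M f)^2 = (\<integral>x. (norm (f x))^2 \<partial>M)"
  by (simp add: L2_norm_def)

lemma L2_zero: "in_L2 M (\<lambda>x. 0)"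
  by (simp add: in_L2_def)

lemma L2_norm_zero: "L2_norm M (\<lambda>x. 0) = 0"
  by (simp add: L2_norm_def)

lemma L2_bound:
  assumes g: "in_L2 M g" and m: "f \<in> borel_measurable M" and b: "AE x in M. norm (f x) \<le> C * norm (g x)"
    and C: "C \<ge> 0"
  shows "in_L2 M f" "L2_norm M f \<le> C * L2_norm M g"
proof -
  have b2: "AE x in M. (norm (f x))^2 \<le> C^2 * (norm (g x))^2"
    using b by eventually_elim (metis norm_ge_zero power_mono power_mult_distrib)
  have gi: "integrable M (\<lambda>x. C^2 * (norm (g x))^2)"
    using L2_integrable[OF g] by simp
  have fi: "integrable M (\<lambda>x. (norm (f x))^2)"
    by (rule Bochner_Integration.integrable_bound[OF gi]) (use m b2 in auto)
  then show "in_L2 M f" using m by (simp add: in_L2_def)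
  have "(\<integral>x. (norm (f x))^2 \<partial>M) \<le> (\<integral>x. C^2 * (norm (g x))^2 \<partial>M)"
    by (rule integral_mono_AE[OF fi gi b2])
  then have "(L2_norm M f)^2 \<le> (C * L2_norm M g)^2"
    by (simp add: L2_norm_sq power_mult_distrib)
  then show "L2_norm M f \<le> C * L2_norm M g"
    by (rule power2_le_imp_le) (simp add: L2_norm_nonneg C)
qed

lemma L2_scaleR: "in_L2 M f \<Longrightarrow> in_L2 M (\<lambda>x. c *R f x)"
  by (rule L2_bound[of M f _ "\<bar>c\<bar>"])
     (auto intro: borel_measurable_scaleR L2_measurable)

lemma L2_cmult: "in_L2 M f \<Longrightarrow> in_L2 M (\<lambda>x. c * f x :: real)"
  using L2_scaleR[of M f c] by simp

lemma L2_norm_scaleR: "L2_norm M (\<lambda>x. c *R f x) = \<bar>c\<bar> * L2_norm M f"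
proof -
  have "(\<integral>x. (norm (c *R f x))^2 \<partial>M) = c^2 * (\<integral>x. (norm (f x))^2 \<partial>M)"
    by (simp add: power_mult_distrib)
  then show ?thesis by (simp add: L2_norm_def real_sqrt_mult)
qed

lemma L2_add:
  assumes f: "in_L2 M f" and g: "in_L2 M g"
  shows "in_L2 M (\<lambda>x. f x + g x)"
proof -
  have "integrable M (\<lambda>x. (norm (f x + g x))^2)"
  proof (rule Bochner_Integration.integrable_bound)
    show "integrable M (\<lambda>x. 2 * (norm (f x))^2 + 2 * (norm (g x))^2)"
      using f g by (intro Bochner_Integration.integrable_add integrable_mult_right L2_integrable)
    show "(\<lambda>x. (norm (f x + g x))^2) \<in> borel_measurable M"
      using L2_measurable[OF f] L2_measurable[OF g] by measurable
    have "(norm (u + v))^2 \<le> 2 * (norm u)^2 + 2 * (norm v)^2" for u v :: 'b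
    proof -
      have "(norm (u + v))^2 \<le> (norm u + norm v)^2" by (intro power_mono norm_triangle_ineq norm_ge_zero)
      also have "\<dots> \<le> 2 * (norm u)^2 + 2 * (norm v)^2"
        using zero_le_power2[of "norm u - norm v"] by (simp add: power2_eq_square algebra_simps)
      finally show ?thesis .
    qed
    then show "AE x in M. norm ((norm (f x + g x))^2) \<le> norm (2 * (norm (f x))^2 + 2 * (norm (g x))^2)"
      by (auto intro!: AE_I2)
  qed
  moreover have "(\<lambda>x. f x + g x) \<in> borel_measurable M"
    using L2_measurable[OF f] L2_measurable[OF g] by measurable
  ultimately show ?thesis by (simp add: in_L2_def)
qed

lemma L2_diff: "in_L2 M f \<Longrightarrow> in_L2 M g \<Longrightarrow> in_L2 M (\<lambda>x. f x - g x)"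
  using L2_add[of M f "\<lambda>x. (-1) *R g x"] L2_scaleR[of M g "-1"] by simp

lemma L2_sum: "(\<And>i. i \<in> I \<Longrightarrow> in_L2 M (f i)) \<Longrightarrow> in_L2 M (\<lambda>x. \<Sum>i\<in>I. f i x)"
  by (induction I rule: infinite_finite_induct) (auto simp: L2_zero L2_add)

lemma L2_norm: "in_L2 M f \<Longrightarrow> in_L2 M (\<lambda>x. norm (f x))"
  by (auto simp: in_L2_def)

lemma L2_norm_norm: "L2_norm M (\<lambda>x. norm (f x)) = L2_norm M f"
  by (simp add: L2_norm_def)

section \<open>Inner products, norms and convergence in L^2\<close>

lemma L2_integrable_inner:
  assumes f: "in_L2 M f" and g: "in_L2 M g"
  shows "integrable M (\<lambda>x. f x \<bullet> g x)"
proof (rule Bochner_Integration.integrable_bound)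
  show "integrable M (\<lambda>x. (norm (f x))^2 + (norm (g x))^2)"
    using f g by (intro Bochner_Integration.integrable_add L2_integrable)
  show "(\<lambda>x. f x \<bullet> g x) \<in> borel_measurable M"
    using f g L2_measurable by (intro borel_measurable_inner)
  have "\<bar>u \<bullet> v\<bar> \<le> (norm u)^2 + (norm v)^2" for u v :: 'b
  proof -
    have "\<bar>u \<bullet> v\<bar> \<le> norm u * norm v" by (rule Cauchy_Schwarz_ineq2)
    also have "\<dots> \<le> (norm u)^2 + (norm v)^2"
      using sum_squares_bound[of "norm u" "norm v"] zero_le_power2[of "norm u"] zero_le_power2[of "norm v"]
        mult_nonneg_nonneg[OF norm_ge_zero[of u] norm_ge_zero[of v]] by linarith
    finally show ?thesis .
  qed
  then show "AE x in M. norm (f x \<bullet> g x) \<le> norm ((norm (f x))^2 + (norm (g x))^2)"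
    by (auto intro!: AE_I2)
qed

lemma L2_integrable_mult:
  fixes f g :: "'a \<Rightarrow> real"
  shows "in_L2 M f \<Longrightarrow> in_L2 M g \<Longrightarrow> integrable M (\<lambda>x. f x * g x)"
  using L2_integrable_inner[of M f g] by simp

lemma L2_norm_add_sq:
  assumes f: "in_L2 M f" and g: "in_L2 M g"
  shows "(L2_norm M (\<lambda>x. f x + g x))^2 = (L2_norm M f)^2 + 2 * (\<integral>x. f x \<bullet> g x \<partial>M) + (L2_norm M g)^2"
proof -
  have "(\<integral>x. (norm (f x + g x))^2 \<partial>M) = (\<integral>x. (norm (f x))^2 + 2 * (f x \<bullet> g x) + (norm (g x))^2 \<partial>M)"
    by (intro Bochner_Integration.integral_cong refl)
       (simp add: power2_norm_eq_inner inner_simps inner_commute)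
  then show ?thesis
    using L2_integrable[OF f] L2_integrable[OF g] L2_integrable_inner[OF f g]
    by (simp add: L2_norm_sq)
qed

text \<open>The quadratic \<open>s \<mapsto> \<parallel>f + s g\<parallel>^2\<close> is nonnegative.\<close>

lemma L2_Cauchy_Schwarz:
  assumes f: "in_L2 M f" and g: "in_L2 M g"
  shows "\<bar>\<integral>x. f x \<bullet> g x \<partial>M\<bar> \<le> L2_norm M f * L2_norm M g"
proof -
  let ?I = "\<integral>x. f x \<bullet> g x \<partial>M" and ?F = "L2_norm M f" and ?G = "L2_norm M g"
  have q: "0 \<le> ?F^2 + 2 * s * ?I + s^2 * ?G^2" for s
  proof -
    have "(L2_norm M (\<lambda>x. f x + s *R g x))^2 = ?F^2 + 2 * (s * ?I) + (\<bar>s\<bar> * ?G)^2"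
      using L2_norm_add_sq[OF f L2_scaleR[OF g, of s]] by (simp add: L2_norm_scaleR)
    then show ?thesis
      using zero_le_power2[of "L2_norm M (\<lambda>x. f x + s *R g x)"] by (simp add: power_mult_distrib)
  qed
  have "?I^2 \<le> ?F^2 * ?G^2"
  proof (cases "?G = 0")
    case True
    have "?I = 0"
    proof (rule ccontr)
      assume "?I \<noteq> 0"
      then show False using q[of "- (?F^2 + 1) / ?I"] True zero_le_power2[of ?F] by simp
    qed
    then show ?thesis by simp
  next
    case False
    then have "?G^2 > 0" by simp
    then have "?F^2 + 2 * (- ?I / ?G^2) * ?I + (- ?I / ?G^2)^2 * ?G^2 = ?F^2 - ?I^2 / ?G^2"
      by (simp add: power2_eq_square)
    then have "?I^2 / ?G^2 \<le> ?F^2" using q[of "- ?I / ?G^2"] by linarith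
    then show ?thesis using \<open>?G^2 > 0\<close> by (simp add: divide_le_eq)
  qed
  then have "\<bar>?I\<bar>^2 \<le> (?F * ?G)^2" by (simp add: power_mult_distrib)
  then show ?thesis by (rule power2_le_imp_le) (simp add: L2_norm_nonneg)
qed

lemma L2_Cauchy_Schwarz_norm:
  assumes f: "in_L2 M f" and g: "in_L2 M g"
  shows "(\<integral>x. norm (f x) * norm (g x) \<partial>M) \<le> L2_norm M f * L2_norm M g"
  using L2_Cauchy_Schwarz[OF L2_norm[OF f] L2_norm[OF g]] by (simp add: L2_norm_norm)

lemma L2_norm_triangle:
  assumes f: "in_L2 M f" and g: "in_L2 M g"
  shows "L2_norm M (\<lambda>x. f x + g x) \<le> L2_norm M f + L2_norm M g"
proof (rule power2_le_imp_le)
  show "(L2_norm M (\<lambda>x. f x + g x))^2 \<le> (L2_norm M f + L2_norm M g)^2"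
    using L2_Cauchy_Schwarz[OF f g] by (simp add: L2_norm_add_sq[OF f g] power2_sum)
qed (simp add: L2_norm_nonneg)

lemma L2_norm_minus_commute: "L2_dist M f g = L2_dist M g f"
  by (simp add: L2_norm_def norm_minus_commute)

lemma L2_norm_triangle_diff:
  assumes "in_L2 M f" "in_L2 M g"
  shows "L2_dist M f g \<le> L2_norm M f + L2_norm M g"
  using L2_norm_triangle[of M f "\<lambda>x. (-1) *R g x"] L2_scaleR[of M g "-1"] L2_norm_scaleR[of M "-1" g] assms
  by simp

lemma L2_norm_triangle3:
  assumes "in_L2 M f" "in_L2 M g" "in_L2 M h"
  shows "L2_dist M f h \<le> L2_dist M f g + L2_dist M g h"
  using L2_norm_triangle[of M "\<lambda>x. f x - g x" "\<lambda>x. g x - h x"] assms by (simp add: L2_diff)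

lemma L2_norm_reverse_triangle:
  assumes "in_L2 M f" "in_L2 M g"
  shows "\<bar>L2_norm M f - L2_norm M g\<bar> \<le> L2_dist M f g"
proof -
  have "L2_norm M f \<le> L2_dist M f g + L2_norm M g"
    using L2_norm_triangle[of M "\<lambda>x. f x - g x" g] assms by (simp add: L2_diff)
  moreover have "L2_norm M g \<le> L2_dist M f g + L2_norm M f"
    using L2_norm_triangle[of M "\<lambda>x. g x - f x" f] assms L2_norm_minus_commute[of M f g]
    by (simp add: L2_diff)
  ultimately show ?thesis by linarith
qed

lemma L2_tendsto_norm:
  assumes "\<And>n. in_L2 M (f n)" "in_L2 M g" "L2_lim M f g"
  shows "(\<lambda>n. L2_norm M (f n)) ----> L2_norm M g"
proof -
  have "(\<lambda>n. L2_norm M (f n) - L2_norm M g) ----> 0"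
    by (rule Lim_null_comparison[OF _ assms(3)]) (use L2_norm_reverse_triangle[OF assms(1,2)] in auto)
  then show ?thesis by (simp add: LIM_zero_iff)
qed

lemma L2_tendsto_inner:
  assumes "\<And>n. in_L2 M (f n)" "in_L2 M f'" "L2_lim M f f'" "in_L2 M g"
  shows "(\<lambda>n. \<integral>x. f n x \<bullet> g x \<partial>M) ----> (\<integral>x. f' x \<bullet> g x \<partial>M)"
proof -
  have "(\<lambda>n. (\<integral>x. f n x \<bullet> g x \<partial>M) - (\<integral>x. f' x \<bullet> g x \<partial>M)) ----> 0"
  proof (rule Lim_null_comparison)
    show "(\<lambda>n. L2_dist M (f n) f' * L2_norm M g) ----> 0"
      using tendsto_mult_right[OF assms(3)] by simp
    have "(\<integral>x. f n x \<bullet> g x \<partial>M) - (\<integral>x. f' x \<bullet> g x \<partial>M) = (\<integral>x. (f n x - f' x) \<bullet> g x \<partial>M)" for n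
      using assms by (simp add: inner_diff_left L2_integrable_inner)
    then show "\<forall>\<^sub>F n in sequentially. norm ((\<integral>x. f n x \<bullet> g x \<partial>M) - (\<integral>x. f' x \<bullet> g x \<partial>M))
        \<le> L2_dist M (f n) f' * L2_norm M g"
      using L2_Cauchy_Schwarz[OF L2_diff[OF assms(1,2)] assms(4)] by simp
  qed
  then show ?thesis by (simp add: LIM_zero_iff)
qed

lemma L2_lim_Cauchy:
  assumes f: "\<And>k. in_L2 M (f k)" "in_L2 M f'" "L2_lim M f f'" and e: "e > 0"
  shows "\<exists>N. \<forall>m\<ge>N. \<forall>n\<ge>N. L2_dist M (f m) (f n) < e"
proof -
  obtain N where N: "\<And>k. k \<ge> N \<Longrightarrow> L2_dist M (f k) f' < e / 2" using LIMSEQ_D[OF f(3), of "e / 2"] e by (auto simp: L2_norm_nonneg)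
  have "L2_dist M (f m) (f n) < e" if "m \<ge> N" "n \<ge> N" for m n
    using L2_norm_triangle3[OF f(1,2) f(1), of m n] N[OF that(1)] N[OF that(2)] L2_norm_minus_commute[of M f' "f n"] by linarith
  then show ?thesis by blast
qed

text \<open>The same pattern serves twice, for gradients of mollifications and for their boundary
  values: an energy inequality controls the differences by those of two convergent
  sequences.\<close>

lemma L2_Cauchy_dominated:
  assumes f: "\<And>k. in_L2 M1 (f k)" "in_L2 M1 f'" "L2_lim M1 f f'" and g: "\<And>k. in_L2 M2 (g k)" "in_L2 M2 g'" "L2_lim M2 g g'"
    and b: "\<And>k l. k \<ge> N \<Longrightarrow> l \<ge> N \<Longrightarrow> (L2_dist M (D k) (D l))^2 \<le> a * (L2_dist M1 (f k) (f l) + L2_dist M2 (g k) (g l))^2"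
    and a: "a \<ge> 0" and e: "e > 0"
  shows "\<exists>N. \<forall>m\<ge>N. \<forall>n\<ge>N. L2_dist M (D m) (D n) < e"
proof -
  \<comment> \<open>The summand \<open>1\<close> keeps the denominator positive for
    \<open>a = 0\<close> and leaves \<open>2 * sqrt a * d\<close> strictly below
    \<open>e\<close>.\<close>
  define d where "d = e / (2 * sqrt a + 1)"
  have p: "2 * sqrt a + 1 > 0" using a by (simp add: add_nonneg_pos)
  then have d: "d > 0" "(2 * sqrt a + 1) * d = e" using e by (simp_all add: d_def)
  obtain N1 where N1: "\<forall>m\<ge>N1. \<forall>n\<ge>N1. L2_dist M1 (f m) (f n) < d" using L2_lim_Cauchy[OF f d(1)] by blast
  obtain N2 where N2: "\<forall>m\<ge>N2. \<forall>n\<ge>N2. L2_dist M2 (g m) (g n) < d" using L2_lim_Cauchy[OF g d(1)] by blast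
  have "L2_dist M (D m) (D n) < e" if mn: "m \<ge> max N (max N1 N2)" "n \<ge> max N (max N1 N2)" for m n
  proof -
    have "(L2_dist M (D m) (D n))^2 \<le> a * (d + d)^2"
      using mn N1 N2 a by (intro order_trans[OF b] mult_left_mono power_mono add_mono) (auto simp: L2_norm_nonneg intro: less_imp_le)
    also have "\<dots> = (2 * sqrt a * d)^2" using a by (simp add: power_mult_distrib mult_2[symmetric])
    finally have "L2_dist M (D m) (D n) \<le> 2 * sqrt a * d" by (rule power2_le_imp_le) (use a d in simp)
    also have "\<dots> < e" using d by (simp add: algebra_simps)
    finally show ?thesis .
  qed
  then show ?thesis by blast
qed

lemma L2_tendsto_mult:
  fixes g :: "'a \<Rightarrow> real"
  assumes "\<And>n. in_L2 M (f n)" "in_L2 M f'" "L2_lim M f f'" "in_L2 M g"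
  shows "(\<lambda>n. \<integral>x. f n x * g x \<partial>M) ----> (\<integral>x. f' x * g x \<partial>M)"
  using L2_tendsto_inner[OF assms] by simp

text \<open>Fatou and Tonelli give bounds for extended nonnegative integrals; membership and norm
  bound are both read off from such a bound.\<close>

lemma L2_norm_leI_nn:
  assumes m: "f \<in> borel_measurable M" and b: "(\<integral>\<^sup>+x. ennreal ((norm (f x))^2) \<partial>M) \<le> ennreal (c^2)" and c: "c \<ge> 0"
  shows "in_L2 M f" "L2_norm M f \<le> c"
proof -
  have i: "integrable M (\<lambda>x. (norm (f x))^2)"
    using m b by (intro integrableI_nonneg) (auto simp: le_less_trans)
  then show "in_L2 M f" using m by (simp add: in_L2_def)
  have "ennreal (\<integral>x. (norm (f x))^2 \<partial>M) \<le> ennreal (c^2)"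
    using b i by (simp add: nn_integral_eq_integral)
  then have "(L2_norm M f)^2 \<le> c^2" by (simp add: L2_norm_sq)
  then show "L2_norm M f \<le> c" using c by (rule power2_le_imp_le)
qed

lemma nn_integral_L2: "in_L2 M f \<Longrightarrow> (\<integral>\<^sup>+x. ennreal ((norm (f x))^2) \<partial>M) = ennreal ((L2_norm M f)^2)"
  by (simp add: L2_norm_sq nn_integral_eq_integral L2_integrable)

text \<open>Multiplication by \<open>w\<close> turns an \<open>L^2\<close> Cauchy sequence into an
  \<open>L^1\<close> Cauchy sequence by Cauchy--Schwarz, and the latter has an almost everywhere
  Cauchy subsequence. Where \<open>w\<close> vanishes the sequence is zero anyway; elsewhere
  \<open>w x\<close> is divided out.\<close>

lemma L2_Cauchy_AE_subseq:
  fixes f :: "nat \<Rightarrow> 'a \<Rightarrow> 'b::euclidean_space" and w :: "'a \<Rightarrow> real"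
  assumes f: "\<And>n. in_L2 M (f n)" and w: "in_L2 M w"
    and w0: "\<And>n x. w x = 0 \<Longrightarrow> f n x = 0"
    and C: "\<And>e. e > 0 \<Longrightarrow> \<exists>N. \<forall>m\<ge>N. \<forall>n\<ge>N. L2_dist M (f m) (f n) < e"
  obtains r where "strict_mono r" "AE x in M. Cauchy (\<lambda>i. f (r i) x)"
proof -
  have wf: "integrable M (\<lambda>x. w x *R g x)" if "in_L2 M g" for g :: "'a \<Rightarrow> 'b"
    using L2_integrable_mult[OF L2_norm[OF w] L2_norm[OF that]] w that
    by (subst integrable_norm_iff[symmetric]) (auto intro: borel_measurable_scaleR L2_measurable)
  have "\<exists>N. \<forall>i\<ge>N. \<forall>j\<ge>N. (\<integral>x. norm (w x *R f i x - w x *R f j x) \<partial>M) < e" if e: "e > 0" for e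
  proof -
    let ?W = "L2_norm M w + 1"
    have W: "?W > 0" using L2_norm_nonneg[of M w] by linarith
    then obtain N where N: "\<And>m n. m \<ge> N \<Longrightarrow> n \<ge> N \<Longrightarrow> L2_dist M (f m) (f n) < e / ?W"
      using C[of "e / ?W"] e by auto
    have "(\<integral>x. norm (w x *R f i x - w x *R f j x) \<partial>M) < e" if "i \<ge> N" "j \<ge> N" for i j
    proof -
      have "(\<integral>x. norm (w x *R f i x - w x *R f j x) \<partial>M) = (\<integral>x. norm (w x) * norm (f i x - f j x) \<partial>M)"
        by (simp add: scaleR_diff_right[symmetric])
      also have "\<dots> \<le> L2_norm M w * L2_dist M (f i) (f j)"
        by (intro L2_Cauchy_Schwarz_norm w L2_diff f)
      also have "\<dots> \<le> ?W * L2_dist M (f i) (f j)"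
        by (intro mult_right_mono) (auto simp: L2_norm_nonneg)
      also have "\<dots> < ?W * (e / ?W)"
        using N[OF that] W by (intro mult_strict_left_mono)
      finally show ?thesis using W by simp
    qed
    then show ?thesis by blast
  qed
  with cauchy_L1_AE_cauchy_subseq[of M "\<lambda>n x. w x *R f n x", OF wf[OF f]]
  obtain r where r: "strict_mono r" "AE x in M. Cauchy (\<lambda>i. w x *R f (r i) x)" by blast
  have "Cauchy (\<lambda>i. f (r i) x)" if c: "Cauchy (\<lambda>i. w x *R f (r i) x)" for x
  proof (cases "w x = 0")
    case True
    then have "f (r i) x = 0" for i by (rule w0)
    then show ?thesis by (simp add: convergent_Cauchy convergent_const)
  next
    case False
    from c obtain l where "(\<lambda>i. w x *R f (r i) x) ----> l"
      using Cauchy_convergent convergent_def by blast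
    from tendsto_scaleR[OF tendsto_const[of "inverse (w x)"] this] False
    show ?thesis by (auto intro!: convergent_Cauchy simp: convergent_def)
  qed
  then have "AE x in M. Cauchy (\<lambda>i. f (r i) x)" using r(2) by (auto elim: AE_mp)
  with r(1) that show thesis by blast
qed

text \<open>Completeness for sequences supported in a common set of finite measure (or, more generally,
  in the set where a fixed \<open>L^2\<close> function \<open>w\<close> does not vanish).\<close>

lemma L2_complete:
  fixes f :: "nat \<Rightarrow> 'a \<Rightarrow> 'b::euclidean_space" and w :: "'a \<Rightarrow> real"
  assumes f: "\<And>n. in_L2 M (f n)" and w: "in_L2 M w"
    and w0: "\<And>n x. w x = 0 \<Longrightarrow> f n x = 0"
    and C: "\<And>e. e > 0 \<Longrightarrow> \<exists>N. \<forall>m\<ge>N. \<forall>n\<ge>N. L2_dist M (f m) (f n) < e"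
  obtains g where "in_L2 M g" "L2_lim M f g" "\<And>x. w x = 0 \<Longrightarrow> g x = 0"
proof -
  obtain r where r: "strict_mono r" "AE x in M. Cauchy (\<lambda>i. f (r i) x)"
    using L2_Cauchy_AE_subseq[OF f w w0 C] by blast
  define g where "g x = lim (\<lambda>i. f (r i) x)" for x
  have fm[measurable]: "f n \<in> borel_measurable M" for n by (rule L2_measurable[OF f])
  have gm[measurable]: "g \<in> borel_measurable M" unfolding g_def[abs_def] by measurable
  have lim: "AE x in M. (\<lambda>i. f (r i) x) ----> g x"
    using r(2) by eventually_elim (metis Cauchy_convergent convergent_LIMSEQ_iff g_def)
  \<comment> \<open>Fatou's lemma along the subsequence: the Cauchy tolerance for
    \<open>f n - f (r i)\<close> is inherited by \<open>f n - g\<close>. Integrability of the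
    difference and the error estimate come out together.\<close>
  have key: "in_L2 M (\<lambda>x. f n x - g x) \<and> L2_dist M (f n) g \<le> e"
    if e: "e > 0" and N: "\<And>m. m \<ge> n \<Longrightarrow> L2_dist M (f n) (f m) < e" for n e
  proof -
    have "(\<integral>\<^sup>+x. ennreal ((norm (f n x - g x))^2) \<partial>M)
        = (\<integral>\<^sup>+x. liminf (\<lambda>i. ennreal ((norm (f n x - f (r i) x))^2)) \<partial>M)"
    proof (rule nn_integral_cong_AE)
      show "AE x in M. ennreal ((norm (f n x - g x))^2) = liminf (\<lambda>i. ennreal ((norm (f n x - f (r i) x))^2))"
        using lim
      proof eventually_elim
        fix x assume "(\<lambda>i. f (r i) x) ----> g x"
        then have "(\<lambda>i. ennreal ((norm (f n x - f (r i) x))^2)) ----> ennreal ((norm (f n x - g x))^2)"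
          by (intro tendsto_intros)
        then show "ennreal ((norm (f n x - g x))^2) = liminf (\<lambda>i. ennreal ((norm (f n x - f (r i) x))^2))"
          by (intro lim_imp_Liminf[symmetric]) auto
      qed
    qed
    also have "\<dots> \<le> liminf (\<lambda>i. \<integral>\<^sup>+x. ennreal ((norm (f n x - f (r i) x))^2) \<partial>M)"
      by (rule nn_integral_liminf) simp
    also have "\<dots> \<le> ennreal (e^2)"
    proof (rule Liminf_le)
      have "\<forall>\<^sub>F i in sequentially. r i \<ge> n"
        using filterlim_subseq[OF r(1)] by (simp add: filterlim_at_top)
      then show "\<forall>\<^sub>F i in sequentially. (\<integral>\<^sup>+x. ennreal ((norm (f n x - f (r i) x))^2) \<partial>M) \<le> ennreal (e^2)"
      proof eventually_elim
        fix i assume "r i \<ge> n"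
        then have "L2_dist M (f n) (f (r i)) < e" by (rule N)
        then show "(\<integral>\<^sup>+x. ennreal ((norm (f n x - f (r i) x))^2) \<partial>M) \<le> ennreal (e^2)"
          by (subst nn_integral_L2[OF L2_diff[OF f f]])
             (auto intro!: ennreal_leI power_mono simp: L2_norm_nonneg)
      qed
    qed auto
    finally show ?thesis using L2_norm_leI_nn[of "\<lambda>x. f n x - g x" M e] e by simp
  qed
  obtain N0 where N0: "\<And>m n. m \<ge> N0 \<Longrightarrow> n \<ge> N0 \<Longrightarrow> L2_dist M (f m) (f n) < 1"
    using C[of 1] by auto
  have "in_L2 M (\<lambda>x. f N0 x - g x)"
    using key[of 1 N0] N0 by simp
  from L2_diff[OF f[of N0] this] have gL: "in_L2 M g" by simp
  moreover have "L2_lim M f g"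
  proof (rule LIMSEQ_I)
    fix e :: real assume e: "e > 0"
    then obtain N where N: "\<And>m n. m \<ge> N \<Longrightarrow> n \<ge> N \<Longrightarrow> L2_dist M (f m) (f n) < e / 2"
      using C[of "e / 2"] by auto
    have "L2_dist M (f n) g \<le> e / 2" if "n \<ge> N" for n
      using key[of "e / 2" n] N that e by auto
    then have "\<forall>n\<ge>N. norm (L2_dist M (f n) g - 0) < e"
      using e by (force simp: L2_norm_nonneg)
    then show "\<exists>N. \<forall>n\<ge>N. norm (L2_dist M (f n) g - 0) < e" ..
  qed
  moreover have "g x = 0" if "w x = 0" for x
    using w0[OF that] by (simp add: g_def limI)
  ultimately show thesis by (rule that)
qed

section \<open>Minimising sequences and Riesz representation\<close>

lemma L2_parallelogram:
  fixes f g :: "'a \<Rightarrow> 'b::euclidean_space"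
  assumes f: "in_L2 M f" and g: "in_L2 M g"
  shows "(L2_dist M f g)^2 = 2 * (L2_norm M f)^2 + 2 * (L2_norm M g)^2
    - 4 * (L2_norm M (\<lambda>x. (1/2) *R (f x + g x)))^2"
proof -
  have "(L2_norm M (\<lambda>x. f x + (-1) *R g x))^2 = (L2_norm M f)^2 + 2 * (\<integral>x. f x \<bullet> ((-1) *R g x) \<partial>M) + (L2_norm M g)^2"
    using L2_norm_add_sq[OF f L2_scaleR[OF g, of "-1"]] L2_norm_scaleR[of M "-1" g] by simp
  moreover have "(L2_norm M (\<lambda>x. (1/2) *R (f x + g x)))^2 = (1/4) * (L2_norm M (\<lambda>x. f x + g x))^2"
    unfolding L2_norm_scaleR by (simp add: power_mult_distrib power_divide)
  ultimately show ?thesis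
    by (simp add: L2_norm_add_sq[OF f g])
qed

text \<open>Weak compactness in disguise: from decreasing convex sets one selects a strongly Cauchy
  sequence of almost minimal elements.\<close>

lemma L2_nested_convex:
  fixes C :: "nat \<Rightarrow> ('a \<Rightarrow> 'b::euclidean_space) set"
  assumes sub: "\<And>n f. f \<in> C n \<Longrightarrow> in_L2 M f"
    and dec: "\<And>n. C (Suc n) \<subseteq> C n"
    and mid: "\<And>n f g. f \<in> C n \<Longrightarrow> g \<in> C n \<Longrightarrow> (\<lambda>x. (1/2) *R (f x + g x)) \<in> C n"
    and bdd: "\<And>n. \<exists>f\<in>C n. L2_norm M f \<le> K"
  obtains f where "\<And>n. f n \<in> C n"
    "\<And>e. e > 0 \<Longrightarrow> \<exists>N. \<forall>m\<ge>N. \<forall>n\<ge>N. L2_dist M (f m) (f n) < e"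
    "\<And>n g. g \<in> C n \<Longrightarrow> (L2_norm M (f n))^2 \<le> (L2_norm M g)^2 + 1 / real (Suc n)"
proof -
  \<comment> \<open>As the sets decrease, the minimal squared norms increase, and the common bound
    \<open>K\<close> makes them converge.\<close>
  define d where "d n = (INF f\<in>C n. (L2_norm M f)^2)" for n
  have bb: "bdd_below ((\<lambda>f. (L2_norm M f)^2) ` C n)" for n by (rule bdd_belowI[of _ 0]) auto
  have ne: "C n \<noteq> {}" for n using bdd[of n] by auto
  have dle: "d n \<le> (L2_norm M f)^2" if "f \<in> C n" for n f
    unfolding d_def by (rule cINF_lower[OF bb that])
  have "\<exists>f\<in>C n. (L2_norm M f)^2 < d n + 1 / real (Suc n)" for n
    unfolding d_def using cINF_less_iff[OF ne bb, of n "d n + 1 / real (Suc n)"] by (simp add: d_def)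
  then obtain f where f: "\<And>n. f n \<in> C n" "\<And>n. (L2_norm M (f n))^2 < d n + 1 / real (Suc n)"
    by metis
  have decm: "C n \<subseteq> C m" if "m \<le> n" for m n
    using that dec by (rule lift_Suc_antimono_le[of C, rotated])
  have inc: "d m \<le> d n" if "m \<le> n" for m n
    unfolding d_def by (rule cINF_superset_mono[OF ne bb decm[OF that]]) simp
  have "d n \<le> K^2" for n
  proof -
    obtain g where "g \<in> C n" "L2_norm M g \<le> K" using bdd by blast
    then show ?thesis
      using dle[of g n] power_mono[of "L2_norm M g" K 2] by (simp add: L2_norm_nonneg)
  qed
  then obtain L where "d ----> L"
    using incseq_convergent[of d "K^2"] inc unfolding incseq_def by metis
  then have dC: "Cauchy d" by (rule LIMSEQ_imp_Cauchy)
  \<comment> \<open>For \<open>m \<le> n\<close> both elements lie in \<open>C m\<close>, hence so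
    does their midpoint, whose squared norm is at least \<open>d m\<close>. The parallelogram law
    turns this into closeness.\<close>
  have close: "(L2_dist M (f m) (f n))^2 \<le> 2 * (d n - d m) + 4 / real (Suc m)" if "m \<le> n" for m n
  proof -
    have "f n \<in> C m" using f(1)[of n] decm[OF that] by blast
    then have "d m \<le> (L2_norm M (\<lambda>x. (1/2) *R (f m x + f n x)))^2"
      using f(1)[of m] by (intro dle mid)
    moreover have "1 / real (Suc n) \<le> 1 / real (Suc m)" using that by (simp add: frac_le)
    ultimately show ?thesis
      using L2_parallelogram[OF sub[OF f(1)[of m]] sub[OF f(1)[of n]]] f(2)[of m] f(2)[of n] by simp
  qed
  have "\<exists>N. \<forall>m\<ge>N. \<forall>n\<ge>N. L2_dist M (f m) (f n) < e" if e: "e > 0" for e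
  proof -
    obtain N1 where N1: "\<And>m n. m \<ge> N1 \<Longrightarrow> n \<ge> N1 \<Longrightarrow> \<bar>d m - d n\<bar> < e^2 / 8"
      using CauchyD[OF dC, of "e^2 / 8"] e by auto
    obtain N2 where N2: "1 / real (Suc N2) < e^2 / 8"
      using nat_approx_posE[of "e^2 / 8"] e by auto
    let ?N = "max N1 N2"
    have le: "L2_dist M (f m) (f n) < e" if "m \<ge> ?N" "m \<le> n" for m n
    proof -
      have "1 / real (Suc m) \<le> 1 / real (Suc N2)" using that by (simp add: frac_le)
      then have "4 / real (Suc m) < e^2 / 2"
        using N2 by simp
      moreover have "d n - d m < e^2 / 8" using N1[of n m] that abs_ge_self[of "d n - d m"] by auto
      ultimately have "2 * (d n - d m) + 4 / real (Suc m) < 2 * (e^2 / 8) + e^2 / 2"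
        by (intro add_strict_mono mult_strict_left_mono) auto
      also have "\<dots> \<le> e^2" by simp
      finally have "(L2_dist M (f m) (f n))^2 < e^2"
        using close[OF that(2)] by (rule le_less_trans[rotated])
      then show ?thesis using e by (intro power2_less_imp_less[of _ e]) auto
    qed
    show ?thesis
    proof (intro exI[of _ ?N] allI impI)
      fix m n assume "m \<ge> ?N" "n \<ge> ?N"
      then show "L2_dist M (f m) (f n) < e"
        using le[of m n] le[of n m] L2_norm_minus_commute[of M "f m" "f n"] by (cases "m \<le> n") auto
    qed
  qed
  moreover have "(L2_norm M (f n))^2 \<le> (L2_norm M g)^2 + 1 / real (Suc n)" if "g \<in> C n" for n g
    using f(2)[of n] dle[OF that] by simp
  ultimately show thesis using f(1) that by blast
qed

text \<open>Riesz representation of \<open>l\<close> through the range of \<open>T\<close>: a multiple of the element of minimal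
  norm of \<open>T (l = 1)\<close>.\<close>

lemma L2_Riesz:
  fixes T :: "('i \<Rightarrow> real) \<Rightarrow> 'a \<Rightarrow> real" and l :: "('i \<Rightarrow> real) \<Rightarrow> real" and w :: "'a \<Rightarrow> real"
  assumes lin: "\<And>\<phi> \<psi> s. \<phi> \<in> X \<Longrightarrow> \<psi> \<in> X \<Longrightarrow> (\<lambda>x. \<phi> x + s * \<psi> x) \<in> X"
    and Tlin: "\<And>\<phi> \<psi> s. \<phi> \<in> X \<Longrightarrow> \<psi> \<in> X \<Longrightarrow> T (\<lambda>x. \<phi> x + s * \<psi> x) = (\<lambda>x. T \<phi> x + s * T \<psi> x)"
    and llin: "\<And>\<phi> \<psi> s. \<phi> \<in> X \<Longrightarrow> \<psi> \<in> X \<Longrightarrow> l (\<lambda>x. \<phi> x + s * \<psi> x) = l \<phi> + s * l \<psi>"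
    and TL: "\<And>\<phi>. \<phi> \<in> X \<Longrightarrow> in_L2 M (T \<phi>)"
    and w: "in_L2 M w" and w0: "\<And>\<phi> x. \<phi> \<in> X \<Longrightarrow> w x = 0 \<Longrightarrow> T \<phi> x = 0"
    and b: "\<And>\<phi>. \<phi> \<in> X \<Longrightarrow> \<bar>l \<phi>\<bar> \<le> K * L2_norm M (T \<phi>)" and K: "K \<ge> 0"
  obtains \<rho> where "in_L2 M \<rho>" "L2_norm M \<rho> \<le> K" "\<And>\<phi>. \<phi> \<in> X \<Longrightarrow> (\<integral>x. \<rho> x * T \<phi> x \<partial>M) = l \<phi>"
    "\<And>x. w x = 0 \<Longrightarrow> \<rho> x = 0"
proof (cases "\<forall>\<phi>\<in>X. l \<phi> = 0")
  case True
  then show thesis using that[of "\<lambda>x. 0"] K by (simp add: L2_zero L2_norm_zero)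
next
  case False
  then obtain \<phi>0 where \<phi>0: "\<phi>0 \<in> X" "l \<phi>0 \<noteq> 0" by blast
  \<comment> \<open>Multiples are obtained from the one closure rule as
    \<open>\<psi> + (s - 1) * \<psi>\<close>.\<close>
  have scale: "(\<lambda>x. s * \<psi> x) \<in> X" "T (\<lambda>x. s * \<psi> x) = (\<lambda>x. s * T \<psi> x)" "l (\<lambda>x. s * \<psi> x) = s * l \<psi>"
    if "\<psi> \<in> X" for s \<psi>
    using lin[OF that that, of "s - 1"] Tlin[OF that that, of "s - 1"] llin[OF that that, of "s - 1"]
    by (simp_all add: algebra_simps)
  define C where "C = {T \<phi> | \<phi>. \<phi> \<in> X \<and> l \<phi> = 1}"
  have inC: "T \<phi> \<in> C" if "\<phi> \<in> X" "l \<phi> = 1" for \<phi> using that by (auto simp: C_def)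
  let ?\<phi>1 = "\<lambda>x. (1 / l \<phi>0) * \<phi>0 x"
  have \<phi>1: "?\<phi>1 \<in> X" "l ?\<phi>1 = 1" using scale[OF \<phi>0(1), of "1 / l \<phi>0"] \<phi>0 by auto
  \<comment> \<open>With a constant sequence of sets the selection lemma yields a minimising
    sequence in the affine set \<open>C\<close>.\<close>
  obtain F where F: "\<And>n. F n \<in> C"
    "\<And>e. e > 0 \<Longrightarrow> \<exists>N. \<forall>m\<ge>N. \<forall>n\<ge>N. L2_dist M (F m) (F n) < e"
    "\<And>n g. g \<in> C \<Longrightarrow> (L2_norm M (F n))^2 \<le> (L2_norm M g)^2 + 1 / real (Suc n)"
  proof (rule L2_nested_convex[of "\<lambda>n. C" M "L2_norm M (T ?\<phi>1)"])
    fix f g assume "f \<in> C" "g \<in> C"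
    then obtain \<phi> \<psi> where p: "\<phi> \<in> X" "l \<phi> = 1" "f = T \<phi>" "\<psi> \<in> X" "l \<psi> = 1" "g = T \<psi>"
      by (auto simp: C_def)
    let ?\<chi> = "\<lambda>x. (1/2) * \<phi> x + (1/2) * \<psi> x"
    have "?\<chi> \<in> X" "T ?\<chi> = (\<lambda>x. (1/2) * T \<phi> x + (1/2) * T \<psi> x)" "l ?\<chi> = 1"
      using lin[OF scale(1)[OF p(1), of "1/2"] p(4), of "1/2"]
        Tlin[OF scale(1)[OF p(1), of "1/2"] p(4), of "1/2"]
        llin[OF scale(1)[OF p(1), of "1/2"] p(4), of "1/2"] scale[OF p(1), of "1/2"] p
      by auto
    then show "(\<lambda>x. (1/2) *R (f x + g x)) \<in> C"
      using inC[of ?\<chi>] p by (simp add: distrib_left add_divide_distrib)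
  qed (use TL \<phi>1 inC in \<open>auto simp: C_def\<close>)
  have FL: "in_L2 M (F n)" "w x = 0 \<Longrightarrow> F n x = 0" for n x
    using F(1)[of n] TL w0 by (auto simp: C_def)
  obtain \<rho> where \<rho>: "in_L2 M \<rho>" "L2_lim M F \<rho>" "\<And>x. w x = 0 \<Longrightarrow> \<rho> x = 0"
    using L2_complete[of M F w, OF FL(1) w FL(2) F(2)] by blast
  have normlim: "(\<lambda>n. L2_norm M (F n)) ----> L2_norm M \<rho>"
    by (rule L2_tendsto_norm[OF FL(1) \<rho>(1,2)])
  have min: "(L2_norm M \<rho>)^2 \<le> (L2_norm M g)^2" if "g \<in> C" for g
  proof (rule LIMSEQ_le[OF tendsto_power[OF normlim]])
    show "(\<lambda>n. (L2_norm M g)^2 + 1 / real (Suc n)) ----> (L2_norm M g)^2"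
      using tendsto_add[OF tendsto_const LIMSEQ_inverse_real_of_nat, of "(L2_norm M g)^2"]
      by (simp add: inverse_eq_divide)
  qed (use F(3)[OF that] in blast)
  \<comment> \<open>\<open>\<rho>\<close> is only a limit of elements of \<open>C\<close>. The
    perturbation \<open>s * T \<psi>\<close> with \<open>l \<psi> = 0\<close> is therefore added to
    each \<open>F n\<close>, which stays in \<open>C\<close>, and minimality is compared in the
    limit; the term linear in \<open>s\<close> must vanish.\<close>
  have orth: "(\<integral>x. \<rho> x * T \<psi> x \<partial>M) = 0" if \<psi>: "\<psi> \<in> X" "l \<psi> = 0" for \<psi>
  proof (rule ccontr)
    let ?I = "\<integral>x. \<rho> x * T \<psi> x \<partial>M" and ?Q = "(L2_norm M (T \<psi>))^2"
    assume I: "?I \<noteq> 0"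
    have q: "0 \<le> 2 * s * ?I + s^2 * ?Q" for s
    proof -
      have sT: "in_L2 M (\<lambda>x. s * T \<psi> x)" using L2_cmult TL \<psi> by blast
      have "(L2_norm M \<rho>)^2 \<le> (L2_norm M (\<lambda>x. F n x + s * T \<psi> x))^2" for n
      proof -
        obtain \<phi> where "\<phi> \<in> X" "l \<phi> = 1" "F n = T \<phi>" using F(1)[of n] by (auto simp: C_def)
        then show ?thesis
          using inC[of "\<lambda>x. \<phi> x + s * \<psi> x"] lin[of \<phi> \<psi> s] Tlin[of \<phi> \<psi> s] llin[of \<phi> \<psi> s] \<psi>
          by (intro min) simp
      qed
      moreover have "(\<lambda>n. (L2_norm M (\<lambda>x. F n x + s * T \<psi> x))^2) ----> (L2_norm M (\<lambda>x. \<rho> x + s * T \<psi> x))^2"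
        by (intro tendsto_power L2_tendsto_norm L2_add FL \<rho> sT) (simp add: \<rho>(2))
      ultimately have "(L2_norm M \<rho>)^2 \<le> (L2_norm M (\<lambda>x. \<rho> x + s * T \<psi> x))^2"
        by (intro LIMSEQ_le_const[where X="\<lambda>n. (L2_norm M (\<lambda>x. F n x + s * T \<psi> x))^2"]) auto
      also have "\<dots> = (L2_norm M \<rho>)^2 + 2 * (s * ?I) + (\<bar>s\<bar> * L2_norm M (T \<psi>))^2"
        using L2_norm_add_sq[OF \<rho>(1) sT] L2_norm_scaleR[of M s "T \<psi>"]
        by (simp add: mult.left_commute[of _ s])
      finally show ?thesis by (simp add: power_mult_distrib)
    qed
    show False
    proof (cases "?Q = 0")
      case True
      then show ?thesis using q[of "- ?I"] I by (simp add: power2_eq_square) (metis zero_less_mult_iff linorder_neq_iff not_less mult_le_0_iff)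
    next
      case False
      then have "?Q > 0" by simp
      then have "2 * (- ?I / ?Q) * ?I + (- ?I / ?Q)^2 * ?Q = - (?I^2 / ?Q)"
        by (simp add: power2_eq_square field_simps)
      moreover have "?I^2 / ?Q > 0" using \<open>?Q > 0\<close> I by simp
      ultimately show ?thesis using q[of "- ?I / ?Q"] by linarith
    qed
  qed
  let ?D = "(L2_norm M \<rho>)^2"
  have rep: "(\<integral>x. \<rho> x * T \<phi> x \<partial>M) = l \<phi> * ?D" if \<phi>: "\<phi> \<in> X" for \<phi>
  proof -
    \<comment> \<open>\<open>\<phi> - l \<phi> * \<phi>'\<close> lies in the kernel of
      \<open>l\<close>, so the pairing of \<open>\<rho>\<close> with \<open>T \<phi>\<close> is
      proportional to \<open>l \<phi>\<close>.\<close>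
    have eq: "(\<integral>x. \<rho> x * F n x \<partial>M) * l \<phi> = (\<integral>x. \<rho> x * T \<phi> x \<partial>M)" for n
    proof -
      obtain \<phi>' where p: "\<phi>' \<in> X" "l \<phi>' = 1" "F n = T \<phi>'" using F(1)[of n] by (auto simp: C_def)
      have "(\<integral>x. \<rho> x * (T \<phi> x + (- l \<phi>) * T \<phi>' x) \<partial>M) = 0"
        using orth[OF lin[OF \<phi> p(1), of "- l \<phi>"]] Tlin[OF \<phi> p(1), of "- l \<phi>"] llin[OF \<phi> p(1), of "- l \<phi>"] p
        by simp
      then show ?thesis
        using L2_integrable_mult[OF \<rho>(1) TL[OF \<phi>]] L2_integrable_mult[OF \<rho>(1) TL[OF p(1)]] p(3)
        by (simp add: right_diff_distrib mult.left_commute[of _ "l \<phi>"])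
    qed
    have "(\<lambda>n. (\<integral>x. F n x * \<rho> x \<partial>M) * l \<phi>) ----> (\<integral>x. \<rho> x * \<rho> x \<partial>M) * l \<phi>"
      by (intro tendsto_mult_right L2_tendsto_mult FL \<rho>)
    moreover have "(\<lambda>n. (\<integral>x. F n x * \<rho> x \<partial>M) * l \<phi>) = (\<lambda>n. (\<integral>x. \<rho> x * T \<phi> x \<partial>M))"
      using eq by (simp add: mult.commute)
    ultimately have "(\<integral>x. \<rho> x * T \<phi> x \<partial>M) = (\<integral>x. \<rho> x * \<rho> x \<partial>M) * l \<phi>"
      using LIMSEQ_unique tendsto_const by metis
    then show ?thesis unfolding L2_norm_sq by (simp add: power2_eq_square mult.commute)
  qed
  \<comment> \<open>On \<open>C\<close> the functional equals one, so its bound keeps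
    \<open>\<rho>\<close> away from zero. The same inequality bounds
    \<open>1 / L2_norm M \<rho>\<close>, the norm of the normalised representative.\<close>
  have lower: "1 \<le> K * L2_norm M \<rho>"
  proof (rule LIMSEQ_le_const[OF tendsto_mult_left[OF normlim]])
    show "\<exists>N. \<forall>n\<ge>N. 1 \<le> K * L2_norm M (F n)"
      using F(1) b by (auto simp: C_def) (metis abs_one)
  qed
  then have D: "L2_norm M \<rho> > 0"
    using L2_norm_nonneg[of M \<rho>] by (cases "L2_norm M \<rho> = 0") auto
  show thesis
  proof (rule that[of "\<lambda>x. (1 / ?D) * \<rho> x"])
    show "in_L2 M (\<lambda>x. (1 / ?D) * \<rho> x)" by (intro L2_cmult \<rho>)
    have "L2_norm M (\<lambda>x. (1 / ?D) * \<rho> x) = 1 / L2_norm M \<rho>"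
      using L2_norm_scaleR[of M "1 / ?D" \<rho>] D by (simp add: power2_eq_square)
    also have "\<dots> \<le> K" using lower D by (simp add: field_simps)
    finally show "L2_norm M (\<lambda>x. (1 / ?D) * \<rho> x) \<le> K" .
    show "(\<integral>x. (1 / ?D) * \<rho> x * T \<phi> x \<partial>M) = l \<phi>" if "\<phi> \<in> X" for \<phi>
      using rep[OF that] D by (simp add: mult.assoc)
  qed (use \<rho>(3) in auto)
qed

section \<open>Mollifiers\<close>

text \<open>The functions \<open>p (1/t) * exp (-1/t)\<close>, continued by zero to
  \<open>t \<le> 0\<close>. Admitting every polynomial \<open>p\<close> makes the family closed
  under differentiation.\<close>

definition exp_inv :: "real poly \<Rightarrow> real \<Rightarrow> real"
  where "exp_inv p t = (if t > 0 then poly p (1 / t) / exp (1 / t) else 0)"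

lemma tendsto_poly_div_exp: "((\<lambda>y. poly p y / exp y) \<longlongrightarrow> (0::real)) at_top"
proof -
  have "((\<lambda>y. \<Sum>i\<le>degree p. coeff p i * (y ^ i / exp y)) \<longlongrightarrow> (\<Sum>i\<le>degree p. coeff p i * 0)) at_top"
    by (intro tendsto_sum tendsto_mult tendsto_const tendsto_power_div_exp_0)
  then show ?thesis by (simp add: poly_altdef sum_divide_distrib)
qed

text \<open>In the variable \<open>y = 1/t\<close> the derivative has the polynomial
  \<open>y^2 (p - p')\<close>. At the origin the difference quotient multiplies \<open>p\<close> by
  \<open>y\<close>, and the exponential still dominates.\<close>

lemma exp_inv_deriv:
  "(exp_inv p has_real_derivative exp_inv ([:0, 0, 1:] * (p - pderiv p)) t) (at t)"
proof (cases t "0 :: real" rule: linorder_cases)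
  case less
  have "((\<lambda>t. 0) has_real_derivative 0) (at t)" by simp
  then have "(exp_inv p has_real_derivative 0) (at t)"
    by (rule has_field_derivative_transform_within_open[of _ _ _ "{..<0}"])
       (use less in \<open>auto simp: exp_inv_def\<close>)
  then show ?thesis using less by (simp add: exp_inv_def)
next
  case greater
  have "((\<lambda>t. poly p (1 / t) / exp (1 / t)) has_real_derivative
      exp_inv ([:0, 0, 1:] * (p - pderiv p)) t) (at t)"
    using greater
    by (auto intro!: derivative_eq_intros poly_DERIV[THEN DERIV_chain2] simp: exp_inv_def field_simps power2_eq_square)
  then show ?thesis
    by (rule has_field_derivative_transform_within_open[of _ _ _ "{0<..}"])
       (use greater in \<open>auto simp: exp_inv_def\<close>)
next
  case equal
  have r: "((\<lambda>h. exp_inv p h / h) \<longlongrightarrow> 0) (at_right 0)"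
  proof -
    have "((\<lambda>h. poly ([:0, 1:] * p) (inverse h) / exp (inverse h)) \<longlongrightarrow> 0) (at_right (0::real))"
      by (rule filterlim_compose[OF tendsto_poly_div_exp filterlim_inverse_at_top_right])
    moreover have "\<forall>\<^sub>F h in at_right 0. poly ([:0, 1:] * p) (inverse h) / exp (inverse h) = exp_inv p h / h"
      unfolding eventually_at_right_field by (intro exI[of _ 1]) (auto simp: exp_inv_def field_simps)
    ultimately show ?thesis by (rule Lim_transform_eventually)
  qed
  have l: "((\<lambda>h. exp_inv p h / h) \<longlongrightarrow> 0) (at_left 0)"
  proof (rule Lim_transform_eventually[OF tendsto_const])
    show "\<forall>\<^sub>F h in at_left 0. 0 = exp_inv p h / h"
      unfolding eventually_at_left_field by (intro exI[of _ "-1"]) (auto simp: exp_inv_def)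
  qed
  have "((\<lambda>h. exp_inv p h / h) \<longlongrightarrow> 0) (at 0)" using l r by (rule filterlim_split_at)
  then show ?thesis using equal by (simp add: DERIV_def exp_inv_def)
qed

text \<open>The squared norm is a polynomial, so the chain rule gives smoothness at the origin
  too.\<close>

definition bump :: "real \<Rightarrow> 'a::euclidean_space \<Rightarrow> real"
  where "bump e x = exp_inv 1 (e^2 - (norm x)^2)"

definition mollifier :: "real \<Rightarrow> 'a::euclidean_space \<Rightarrow> real"
  where "mollifier e x = inverse (\<integral>y. bump e (y::'a)) * bump e x"

lemma smooth_bump: "smooth (bump e)"
proof -
  let ?D = "\<lambda>p :: real poly. [:0, 0, 1:] * (p - pderiv p)"
  have "smooth (\<lambda>x::'a. exp_inv ((?D ^^ 0) 1) (e^2 - (norm x)^2))"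
    by (rule smooth_chain_real[of "\<lambda>j. exp_inv ((?D ^^ j) 1)"])
       (use exp_inv_deriv in \<open>auto intro!: smooth_intros\<close>)
  then show ?thesis by (simp add: bump_def[abs_def])
qed

lemma
  fixes x :: "'a::euclidean_space"
  shows bump_nonneg: "bump e x \<ge> 0"
  and bump_pos: "e > 0 \<Longrightarrow> norm x < e \<Longrightarrow> bump e x > 0"
  and bump_zero: "e > 0 \<Longrightarrow> norm x \<ge> e \<Longrightarrow> bump e x = 0"
  by (auto simp: bump_def exp_inv_def power_strict_mono dest: power2_less_imp_less[of "norm x" e])

lemma test_bump: "e > 0 \<Longrightarrow> test_function UNIV (bump e :: 'a::euclidean_space \<Rightarrow> real)"
  by (rule test_functionI[where K="cball 0 e"]) (auto simp: smooth_bump bump_zero)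

text \<open>A vanishing integral would make a nonempty open ball a null set.\<close>

lemma integral_bump_pos:
  assumes e: "e > 0"
  shows "(\<integral>y. bump e (y::'a::euclidean_space)) > 0"
proof -
  have i: "L1 (bump e :: 'a \<Rightarrow> real)" by (rule test_integrable[OF test_bump[OF e]])
  have "(\<integral>y. bump e (y::'a)) \<noteq> 0"
  proof
    assume "(\<integral>y. bump e (y::'a)) = 0"
    then have "AE y in lborel. bump e (y::'a) = 0"
      using integral_nonneg_eq_0_iff_AE[OF i] by (simp add: bump_nonneg)
    then have "AE y in lborel. y \<notin> ball (0::'a) e"
      by eventually_elim (metis bump_pos e less_irrefl mem_ball_0)
    moreover have "ball (0::'a) e = {y \<in> space lborel. \<not> y \<notin> ball (0::'a) e}" by auto
    ultimately have "ball (0::'a) e \<in> null_sets lborel"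
      using AE_iff_null[of lborel "\<lambda>y. y \<notin> ball (0::'a) e"] by simp
    then have "negligible (ball (0::'a) e)"
      by (simp add: negligible_iff_null_sets null_sets_completionI)
    then show False using open_not_negligible[of "ball (0::'a) e"] e by auto
  qed
  moreover have "(\<integral>y. bump e (y::'a)) \<ge> 0" by (simp add: bump_nonneg)
  ultimately show ?thesis by linarith
qed

lemma test_mollifier: "e > 0 \<Longrightarrow> test_function UNIV (mollifier e :: 'a::euclidean_space \<Rightarrow> real)"
  unfolding mollifier_def[abs_def]
  by (intro test_mult_left test_bump smooth_const)

lemma smooth_mollifier: "smooth (mollifier e)"
  unfolding mollifier_def[abs_def] by (intro smooth_cmult smooth_bump)

lemma mollifier_nonneg: "e > 0 \<Longrightarrow> mollifier e x \<ge> 0"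
  using integral_bump_pos[of e, where 'a='a] by (simp add: mollifier_def bump_nonneg)

lemma mollifier_zero: "e > 0 \<Longrightarrow> norm x \<ge> e \<Longrightarrow> mollifier e x = 0"
  by (simp add: mollifier_def bump_zero)

lemma integral_mollifier: "e > 0 \<Longrightarrow> (\<integral>x. mollifier e (x::'a::euclidean_space)) = 1"
  using integral_bump_pos[of e, where 'a='a] by (simp add: mollifier_def)

lemma measurable_mollifier[measurable]: "mollifier e \<in> Borel"
  by (rule smooth_measurable[OF smooth_mollifier])

section \<open>Convolution with a test function\<close>

lemma integral_reflect:
  fixes f :: "'a::euclidean_space \<Rightarrow> 'b::euclidean_space"
  assumes "f \<in> Borel"
  shows "(\<integral>y. f (x - y)) = (\<integral>y. f y)"
  using integral_lborel_affine[of "-1" f x] assms by simp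

lemma nn_integral_translate:
  fixes f :: "'a::euclidean_space \<Rightarrow> ennreal"
  assumes "f \<in> Borel"
  shows "(\<integral>\<^sup>+y. f (y - x)) = (\<integral>\<^sup>+y. f y)"
  using nn_integral_lborel_affine[of "1" f "-x"] assms by simp

lemma smooth_reflect:
  fixes f :: "'a::euclidean_space \<Rightarrow> real"
  assumes f: "smooth f"
  shows "smooth (\<lambda>y. f (x - y))"
    and dirderiv_reflect: "dirderiv b (\<lambda>y. f (x - y)) y = - dirderiv b f (x - y)"
proof -
  have hd: "((\<lambda>y. g (x - y)) has_derivative (\<lambda>h. - dirderiv h g (x - y))) (at y)"
    if g: "smooth g" for g :: "'a \<Rightarrow> real" and y
  proof -
    have "((\<lambda>y. x - y) has_derivative (\<lambda>h. - h)) (at y)" by (auto intro!: derivative_eq_intros)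
    from has_derivative_compose[OF this has_derivative_dirderiv[OF smoothD[OF g]]]
    have "((\<lambda>y. g (x - y)) has_derivative (\<lambda>h. dirderiv (- h) g (x - y))) (at y)" .
    moreover have "dirderiv (- h) g z = - dirderiv h g z" for h z
      using linear_neg[OF has_derivative_linear[OF has_derivative_dirderiv[OF smoothD[OF g]]]] .
    ultimately show ?thesis by simp
  qed
  show "dirderiv b (\<lambda>y. f (x - y)) y = - dirderiv b f (x - y)"
    by (rule dirderiv_eqI[OF hd[OF f]])
  show "smooth (\<lambda>y. f (x - y))"
  proof (rule smooth_coinduct[where P="\<lambda>h. \<exists>g. smooth g \<and> h = (\<lambda>y. g (x - y))"])
    fix h :: "'a \<Rightarrow> real" and b assume "\<exists>g. smooth g \<and> h = (\<lambda>y. g (x - y))"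
    then obtain g where g: "smooth g" "h = (\<lambda>y. g (x - y))" by blast
    then have "dirderiv b h = (\<lambda>y. (\<lambda>z. (-1) * dirderiv b g z) (x - y))"
      using dirderiv_eqI[OF hd[OF g(1)]] by auto
    moreover have "smooth (\<lambda>z. (-1) * dirderiv b g z)" by (intro smooth_cmult smooth_dirderiv g)
    ultimately show "\<exists>g. smooth g \<and> dirderiv b h = (\<lambda>y. g (x - y))" by blast
  qed (use f hd in \<open>auto simp: differentiable_def\<close>)
qed

lemma laplacian_reflect:
  fixes f :: "'a::euclidean_space \<Rightarrow> real"
  assumes f: "smooth f"
  shows "laplacian (\<lambda>y. f (x - y)) y = laplacian f (x - y)"
proof -
  have "dirderiv b (dirderiv b (\<lambda>y. f (x - y))) y = dirderiv b (dirderiv b f) (x - y)" for b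
  proof -
    have "dirderiv b (\<lambda>y. f (x - y)) = (\<lambda>y. (-1) * dirderiv b f (x - y))"
      by (simp add: dirderiv_reflect[OF f] fun_eq_iff)
    then have "dirderiv b (dirderiv b (\<lambda>y. f (x - y))) y = (-1) * dirderiv b (\<lambda>y. dirderiv b f (x - y)) y"
      by (simp only: dirderiv_cmult smoothD smooth_reflect(1) smooth_dirderiv f)
    then show ?thesis by (simp add: dirderiv_reflect[OF smooth_dirderiv[OF f]])
  qed
  then show ?thesis by (simp add: laplacian_def)
qed

text \<open>The point \<open>x\<close> occurs only in the kernel \<open>\<rho>\<close>, so
  derivatives fall on \<open>\<rho>\<close> and \<open>f\<close> has to provide no more than
  integrability.\<close>

definition conv :: "('a::euclidean_space \<Rightarrow> real) \<Rightarrow> ('a \<Rightarrow> real) \<Rightarrow> 'a \<Rightarrow> real"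
  where "conv \<rho> f x = (\<integral>y. \<rho> (x - y) * f y)"

lemma integrable_bounded_mult:
  fixes f g :: "'a::euclidean_space \<Rightarrow> real"
  assumes "g \<in> borel_measurable M" "\<And>x. \<bar>g x\<bar> \<le> B" "integrable M f"
  shows "integrable M (\<lambda>x. g x * f x)"
  by (rule Bochner_Integration.integrable_bound[OF integrable_mult_right[OF integrable_norm[OF assms(3)], of B]])
     (use assms in \<open>auto simp: abs_mult intro!: mult_right_mono AE_I2 order_trans[OF assms(2)]\<close>)

lemma conv_integrable:
  fixes \<rho> :: "'a::euclidean_space \<Rightarrow> real"
  assumes \<rho>: "test_function UNIV \<rho>" and f: "L1 f"
  shows "L1 (\<lambda>y. \<rho> (x - y) * f y)"
proof -
  obtain B where "\<And>x. norm (\<rho> x) \<le> B" using test_bounded[OF \<rho>] by blast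
  moreover have [measurable]: "\<rho> \<in> Borel"
    using \<rho> by (intro smooth_measurable test_smooth)
  ultimately show ?thesis by (intro integrable_bounded_mult[where B=B] f) auto
qed

text \<open>The Taylor remainder of \<open>\<rho>\<close> is at most \<open>C * (norm h)^2\<close>
  uniformly in the base point, so the remainder of the convolution is at most that times the
  \<open>L^1\<close> norm of \<open>f\<close>.\<close>

lemma conv_has_derivative:
  fixes \<rho> :: "'a::euclidean_space \<Rightarrow> real"
  assumes \<rho>: "test_function UNIV \<rho>" and f: "L1 f"
  shows "(conv \<rho> f has_derivative (\<lambda>h. conv (dirderiv h \<rho>) f x)) (at x)"
proof -
  obtain C where C: "C > 0" "\<And>x h. \<bar>\<rho> (x + h) - \<rho> x - dirderiv h \<rho> x\<bar> \<le> C * (norm h)^2"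
    using test_taylor[OF \<rho>] by blast
  have lin: "linear (\<lambda>h. dirderiv h \<rho> z)" for z
    by (intro has_derivative_linear[OF has_derivative_dirderiv] smoothD test_smooth[OF \<rho>])
  have ci: "L1 (\<lambda>y. \<rho> (x - y) * f y)" "L1 (\<lambda>y. dirderiv h \<rho> (x - y) * f y)" for x h
    by (intro conv_integrable test_dirderiv \<rho> f)+
  have "linear (\<lambda>h. conv (dirderiv h \<rho>) f x)"
    by (rule linearI)
       (use ci in \<open>simp_all add: conv_def linear_add[OF lin] linear_scale[OF lin] distrib_right mult.assoc\<close>)
  then have bl: "bounded_linear (\<lambda>h. conv (dirderiv h \<rho>) f x)"
    by (simp add: linear_conv_bounded_linear)
  let ?F = "\<integral>y. \<bar>f y\<bar>"
  have est: "norm (conv \<rho> f y - conv \<rho> f x - conv (dirderiv (y - x) \<rho>) f x) \<le> C * (norm (y - x))^2 * ?F" for y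
  proof -
    have "conv \<rho> f y - conv \<rho> f x - conv (dirderiv (y - x) \<rho>) f x
        = (\<integral>z. (\<rho> (y - z) - \<rho> (x - z) - dirderiv (y - x) \<rho> (x - z)) * f z)"
      using ci by (simp add: conv_def left_diff_distrib)
    also have "norm \<dots> \<le> (\<integral>z. C * (norm (y - x))^2 * \<bar>f z\<bar>)"
    proof (rule order_trans[OF integral_norm_bound integral_mono])
      show "L1 (\<lambda>z. norm ((\<rho> (y - z) - \<rho> (x - z) - dirderiv (y - x) \<rho> (x - z)) * f z))"
        using ci by (intro integrable_norm) (simp add: left_diff_distrib)
      fix z
      have "\<bar>\<rho> (y - z) - \<rho> (x - z) - dirderiv (y - x) \<rho> (x - z)\<bar> \<le> C * (norm (y - x))^2"
        using C(2)[of "x - z" "y - x"] by simp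
      then show "norm ((\<rho> (y - z) - \<rho> (x - z) - dirderiv (y - x) \<rho> (x - z)) * f z) \<le> C * (norm (y - x))^2 * \<bar>f z\<bar>"
        by (simp add: abs_mult mult_right_mono)
    qed (use f in auto)
    finally show ?thesis by simp
  qed
  show ?thesis
  proof (rule has_derivativeI_sandwich[where e=1 and H="\<lambda>y. C * ?F * norm (y - x)"])
    fix y assume "y \<noteq> x"
    then show "norm (conv \<rho> f y - conv \<rho> f x - conv (dirderiv (y - x) \<rho>) f x) / norm (y - x) \<le> C * ?F * norm (y - x)"
      using est[of y] by (simp add: divide_le_eq power2_eq_square mult_ac)
  next
    have "((\<lambda>y. C * ?F * norm (y - x)) \<longlongrightarrow> C * ?F * norm (x - x)) (at x)" by (intro tendsto_intros)
    then show "((\<lambda>y. C * ?F * norm (y - x)) \<longlongrightarrow> 0) (at x)" by simp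
  qed (use bl in auto)
qed

lemma dirderiv_conv:
  fixes \<rho> :: "'a::euclidean_space \<Rightarrow> real"
  assumes "test_function UNIV \<rho>" "L1 f"
  shows "dirderiv b (conv \<rho> f) = conv (dirderiv b \<rho>) f"
  using dirderiv_eqI[OF conv_has_derivative[OF assms]] by auto

lemma smooth_conv:
  fixes \<rho> :: "'a::euclidean_space \<Rightarrow> real"
  assumes "test_function UNIV \<rho>" and f: "L1 f"
  shows "smooth (conv \<rho> f)"
proof (rule smooth_coinduct[where P="\<lambda>h. \<exists>\<rho>. test_function UNIV \<rho> \<and> h = conv \<rho> f"])
  fix h :: "'a \<Rightarrow> real" and b assume "\<exists>\<rho>. test_function UNIV \<rho> \<and> h = conv \<rho> f"
  then show "\<exists>\<rho>. test_function UNIV \<rho> \<and> dirderiv b h = conv \<rho> f"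
    using dirderiv_conv[OF _ f] test_dirderiv by blast
next
  fix h :: "'a \<Rightarrow> real" and x assume "\<exists>\<rho>. test_function UNIV \<rho> \<and> h = conv \<rho> f"
  then show "h differentiable (at x)"
    using conv_has_derivative[OF _ f] differentiableI by blast
qed (use assms in blast)

lemma laplacian_conv:
  fixes \<rho> :: "'a::euclidean_space \<Rightarrow> real"
  assumes \<rho>: "test_function UNIV \<rho>" and f: "L1 f"
  shows "laplacian (conv \<rho> f) x = conv (laplacian \<rho>) f x"
proof -
  have "laplacian (conv \<rho> f) x = (\<Sum>b\<in>Basis. conv (dirderiv b (dirderiv b \<rho>)) f x)"
    using \<rho> f by (simp add: laplacian_def dirderiv_conv test_dirderiv)
  also have "\<dots> = conv (laplacian \<rho>) f x"
    unfolding conv_def laplacian_def sum_distrib_right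
    by (intro Bochner_Integration.integral_sum[symmetric] conv_integrable test_dirderiv \<rho> f)
  finally show ?thesis .
qed

lemma measurable_conv:
  assumes [measurable]: "\<rho> \<in> Borel" "f \<in> Borel"
  shows "conv \<rho> f \<in> Borel"
  unfolding conv_def[abs_def] by measurable

section \<open>Mollification as approximation in L^2\<close>

lemma emeasure_lborel_ball_less_top [simp]:
  "emeasure lborel (ball (x :: 'a::euclidean_space) r) < top" "emeasure lborel (ball x r) \<noteq> top"
  using emeasure_lborel_ball_finite[of x r] by simp_all

lemma L2_indicator:
  assumes "A \<in> sets M" "emeasure M A < \<infinity>"
  shows "in_L2 M (indicator A :: 'a \<Rightarrow> real)"
proof -
  have "(\<lambda>x. (norm (indicator A x :: real))^2) = (indicator A :: 'a \<Rightarrow> real)"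
    by (auto simp: indicator_def fun_eq_iff)
  then show ?thesis
    using assms by (simp add: in_L2_def)
qed

lemma L2_integrable_bounded_support:
  fixes f :: "'a::euclidean_space \<Rightarrow> 'b::euclidean_space"
  assumes f: "L2 f" and R: "\<And>x. norm x \<ge> R \<Longrightarrow> f x = 0"
  shows "L1 f"
proof -
  have i: "L2 (indicator (cball 0 R) :: 'a \<Rightarrow> real)"
    by (rule L2_indicator) (auto simp: emeasure_lborel_cball_finite[unfolded infinity_ennreal_def])
  have "L1 (\<lambda>x. indicator (cball 0 R) x * norm (f x))"
    by (intro L2_integrable_mult i L2_norm f)
  moreover have "(\<lambda>x. indicator (cball 0 R) x * norm (f x)) = (\<lambda>x. norm (f x))"
    using R by (auto simp: indicator_def fun_eq_iff)
  ultimately have "L1 (\<lambda>x. norm (f x))" by simp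
  then show ?thesis using L2_measurable[OF f] by (simp add: integrable_norm_iff)
qed

lemma integrable_square:
  fixes f :: "'a \<Rightarrow> real"
  shows "in_L2 M f \<Longrightarrow> integrable M (\<lambda>x. (f x)^2)"
  using L2_integrable[of M f] by simp

lemma L2_norm_sq_real:
  fixes f :: "'a \<Rightarrow> real"
  shows "(L2_norm M f)^2 = (\<integral>x. (f x)^2 \<partial>M)"
  by (simp add: L2_norm_sq)

lemma tendsto_L2_dominated:
  fixes f :: "nat \<Rightarrow> 'a \<Rightarrow> 'b::euclidean_space" and w :: "'a \<Rightarrow> real"
  assumes f: "\<And>n. f n \<in> borel_measurable M" and g: "g \<in> borel_measurable M" and w: "in_L2 M w"
    and lim: "AE x in M. (\<lambda>n. f n x) ----> g x"
    and b: "\<And>n. AE x in M. norm (f n x - g x) \<le> w x"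
  shows "L2_lim M f g"
proof -
  have "(\<lambda>n. \<integral>x. (norm (f n x - g x))^2 \<partial>M) ----> (\<integral>x. 0 \<partial>M)"
  proof (rule integral_dominated_convergence[where w="\<lambda>x. (w x)^2"])
    show "integrable M (\<lambda>x. (w x)^2)" using w by (rule integrable_square)
    show "AE x in M. (\<lambda>n. (norm (f n x - g x))^2) ----> 0"
      using lim
    proof eventually_elim
      fix x assume "(\<lambda>n. f n x) ----> g x"
      then have "(\<lambda>n. (norm (f n x - g x))^2) ----> (norm (g x - g x))^2" by (intro tendsto_intros)
      then show "(\<lambda>n. (norm (f n x - g x))^2) ----> 0" by simp
    qed
    show "AE x in M. norm ((norm (f n x - g x))^2) \<le> (w x)^2" for n
      using b[of n] by eventually_elim (simp add: power_mono)
  qed (use f g in measurable)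
  then have "(\<lambda>n. sqrt (\<integral>x. (norm (f n x - g x))^2 \<partial>M)) ----> sqrt 0"
    by (intro tendsto_real_sqrt) simp
  then show ?thesis by (simp add: L2_norm_def)
qed

text \<open>Young's inequality for a probability density: Cauchy--Schwarz with the splitting
  \<open>\<rho> h = \<surd>\<rho> \<cdot> \<surd>\<rho> h\<close>, then Tonelli.\<close>

lemma conv_L2:
  fixes \<rho> h :: "'a::euclidean_space \<Rightarrow> real"
  assumes \<rho>: "test_function UNIV \<rho>" and nn: "\<And>x. \<rho> x \<ge> 0" and one: "(\<integral>x. \<rho> x) = 1"
    and h: "L2 h"
  shows "L2 (conv \<rho> h)" "norm2 (conv \<rho> h) \<le> norm2 h"
    "L1 (\<lambda>y. \<rho> (x - y) * h y)"
proof -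
  have rm[measurable]: "\<rho> \<in> Borel"
    using \<rho> by (intro smooth_measurable test_smooth)
  have hm[measurable]: "h \<in> Borel" using L2_measurable[OF h] by simp
  have ri: "L1 \<rho>" using \<rho> by (rule test_integrable)
  obtain B where B: "B > 0" "\<And>x. norm (\<rho> x) \<le> B" using test_bounded[OF \<rho>] by blast
  have ri': "L1 (\<lambda>y. \<rho> (x - y))" for x
    using integrable_lborel_affine[of "-1" \<rho> x] ri by simp
  have L1: "L2 (\<lambda>y. sqrt (\<rho> (x - y)))" for x
    using ri'[of x] nn by (simp add: in_L2_def)
  have n1: "norm2 (\<lambda>y. sqrt (\<rho> (x - y))) = 1" for x
    using integral_reflect[of \<rho> x] nn one by (simp add: L2_norm_def)
  have L2: "L2 (\<lambda>y. sqrt (\<rho> (x - y)) * h y)" for x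
  proof (rule L2_bound(1)[OF h, where C="sqrt B"])
    have "sqrt (\<rho> z) \<le> sqrt B" for z using B(2)[of z] by simp
    then show "AE y in lborel. norm (sqrt (\<rho> (x - y)) * h y) \<le> sqrt B * norm (h y)"
      using nn by (auto simp: abs_mult intro!: mult_right_mono)
  qed (use B in auto)
  have eq: "sqrt (\<rho> (x - y)) * (sqrt (\<rho> (x - y)) * h y) = \<rho> (x - y) * h y" for x y
    using nn[of "x - y"] by (simp add: mult.assoc[symmetric])
  show "L1 (\<lambda>y. \<rho> (x - y) * h y)"
    using L2_integrable_mult[OF L1[of x] L2[of x]] by (simp add: eq)
  have b: "ennreal ((norm (conv \<rho> h x))^2) \<le> (\<integral>\<^sup>+y. ennreal (\<rho> (x - y)) * ennreal ((h y)^2))" for x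
  proof -
    have "\<bar>conv \<rho> h x\<bar> \<le> 1 * norm2 (\<lambda>y. sqrt (\<rho> (x - y)) * h y)"
      using L2_Cauchy_Schwarz[OF L1[of x] L2[of x]] by (simp add: eq conv_def n1)
    then have "(norm (conv \<rho> h x))^2 \<le> (norm2 (\<lambda>y. sqrt (\<rho> (x - y)) * h y))^2"
      by (intro power_mono) auto
    then have "ennreal ((norm (conv \<rho> h x))^2) \<le> ennreal ((norm2 (\<lambda>y. sqrt (\<rho> (x - y)) * h y))^2)"
      by (rule ennreal_leI)
    also have "\<dots> = (\<integral>\<^sup>+y. ennreal ((norm (sqrt (\<rho> (x - y)) * h y))^2))"
      by (rule nn_integral_L2[OF L2, symmetric])
    also have "\<dots> = (\<integral>\<^sup>+y. ennreal (\<rho> (x - y)) * ennreal ((h y)^2))"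
      by (intro nn_integral_cong) (simp add: nn power_mult_distrib ennreal_mult[symmetric])
    finally show ?thesis .
  qed
  have cm[measurable]: "conv \<rho> h \<in> borel_measurable lborel" using measurable_conv[OF rm hm] by simp
  have "(\<integral>\<^sup>+x. ennreal ((norm (conv \<rho> h x))^2))
      \<le> (\<integral>\<^sup>+x. \<integral>\<^sup>+y. ennreal (\<rho> (x - y)) * ennreal ((h y)^2) \<partial>lborel \<partial>lborel)"
    by (intro nn_integral_mono b)
  also have "\<dots> = (\<integral>\<^sup>+y. \<integral>\<^sup>+x. ennreal (\<rho> (x - y)) * ennreal ((h y)^2) \<partial>lborel \<partial>lborel)"
    by (rule lborel_pair.Fubini') measurable
  also have "\<dots> = (\<integral>\<^sup>+y. ennreal ((h y)^2))"
  proof (rule nn_integral_cong)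
    fix y
    have "(\<integral>\<^sup>+x. ennreal (\<rho> (x - y)) * ennreal ((h y)^2)) = (\<integral>\<^sup>+x. ennreal (\<rho> (x - y))) * ennreal ((h y)^2)"
      by (rule nn_integral_multc) simp
    also have "(\<integral>\<^sup>+x. ennreal (\<rho> (x - y))) = (\<integral>\<^sup>+x. ennreal (\<rho> x))"
      by (rule nn_integral_translate) simp
    also have "\<dots> = 1" using ri nn one by (simp add: nn_integral_eq_integral)
    finally show "(\<integral>\<^sup>+x. ennreal (\<rho> (x - y)) * ennreal ((h y)^2)) = ennreal ((h y)^2)" by simp
  qed
  also have "\<dots> = ennreal ((norm2 h)^2)"
    using nn_integral_L2[OF h] by simp
  finally show "L2 (conv \<rho> h)" "norm2 (conv \<rho> h) \<le> norm2 h"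
    using L2_norm_leI_nn[OF cm _ L2_norm_nonneg] by auto
qed

text \<open>Truncation in space (\<open>cut\<close>) and in value (\<open>T\<close>) comes before
  the approximation: afterwards an almost everywhere limit of continuous functions is dominated by a
  multiple of an indicator and hence converges in \<open>L^2\<close>.\<close>

lemma L2_dense_continuous:
  fixes f :: "'a::euclidean_space \<Rightarrow> real"
  assumes f: "L2 f" and e: "e > 0"
  obtains g R where "continuous_on UNIV g" "R > 0" "\<And>x. norm x \<ge> R \<Longrightarrow> g x = 0"
    "L2 g" "dist2 f g < e"
proof -
  have fm[measurable]: "f \<in> Borel" using L2_measurable[OF f] by simp
  define cut where "cut k x = max 0 (min 1 (real (Suc k) - norm x))" for k :: nat and x :: 'a
  define T where "T k s = max (- real k) (min (real k) s)" for k :: nat and s :: real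
  have cut01: "0 \<le> cut k x" "cut k x \<le> 1" for k x by (auto simp: cut_def)
  have Tb: "\<bar>T k s\<bar> \<le> \<bar>s\<bar>" "\<bar>T k s\<bar> \<le> real k" for k s by (auto simp: T_def)
  have cutc: "continuous_on UNIV (cut k)" for k unfolding cut_def by (intro continuous_intros)
  have Tc: "continuous_on UNIV (T k)" for k unfolding T_def by (intro continuous_intros)
  have [measurable]: "cut k \<in> Borel" "T k \<in> Borel" for k
    using cutc Tc by (auto intro: borel_measurable_continuous_onI)
  have "(\<lambda>k. norm2 (\<lambda>x. cut k x * T k (f x) - f x)) ----> 0"
  proof (rule tendsto_L2_dominated[where w="\<lambda>x. 2 * norm (f x)"])
    show "L2 (\<lambda>x. 2 * norm (f x))" by (intro L2_cmult L2_norm f)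
    have "(\<lambda>k. cut k x * T k (f x)) ----> f x" for x
    proof (rule tendsto_eventually)
      obtain N where N: "norm x + \<bar>f x\<bar> \<le> real N" using real_arch_simple by blast
      have "cut k x * T k (f x) = f x" if "k \<ge> N" for k
      proof -
        have "real N \<le> real k" using that by simp
        then have "\<bar>f x\<bar> \<le> real k" "norm x \<le> real k"
          using N norm_ge_zero[of x] abs_ge_zero[of "f x"] by linarith+
        then have "T k (f x) = f x" "cut k x = 1" by (auto simp: T_def cut_def)
        then show ?thesis by simp
      qed
      then show "\<forall>\<^sub>F k in sequentially. cut k x * T k (f x) = f x"
        by (auto simp: eventually_sequentially)
    qed
    then show "AE x in lborel. (\<lambda>k. cut k x * T k (f x)) ----> f x" by simp
    have "\<bar>cut k x * T k (f x) - f x\<bar> \<le> 2 * \<bar>f x\<bar>" for k x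
    proof -
      have "\<bar>cut k x * T k (f x)\<bar> \<le> 1 * \<bar>f x\<bar>"
        unfolding abs_mult using cut01 Tb by (intro mult_mono) auto
      then show ?thesis by linarith
    qed
    then show "AE x in lborel. norm (cut k x * T k (f x) - f x) \<le> 2 * norm (f x)" for k by simp
  qed auto
  then obtain k where k: "norm2 (\<lambda>x. cut k x * T k (f x) - f x) < e / 2"
    using e by (auto dest!: LIMSEQ_D[where r="e / 2"] simp: L2_norm_nonneg)
  have bd: "L2 (\<lambda>x. cut k x * T k (u x))" if [measurable]: "u \<in> Borel" for u
  proof (rule L2_bound(1)[of lborel "indicator (cball (0::'a) (real (Suc k))) :: 'a \<Rightarrow> real" _ "real k"])
    show "L2 (indicator (cball 0 (real (Suc k))) :: 'a \<Rightarrow> real)"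
      by (rule L2_indicator) (auto simp: emeasure_lborel_cball_finite[unfolded infinity_ennreal_def])
    show "AE x in lborel. norm (cut k x * T k (u x)) \<le> real k * norm (indicator (cball 0 (real (Suc k))) x :: real)"
    proof (rule AE_I2)
      fix x
      have "norm x > real (Suc k) \<Longrightarrow> cut k x = 0" by (simp add: cut_def)
      moreover have "\<bar>cut k x * T k (u x)\<bar> \<le> 1 * real k"
        unfolding abs_mult using cut01 Tb by (intro mult_mono) auto
      ultimately show "norm (cut k x * T k (u x)) \<le> real k * norm (indicator (cball 0 (real (Suc k))) x :: real)"
        by (cases "norm x > real (Suc k)") auto
    qed
  qed auto
  have "f \<in> borel_measurable lebesgue" using measurable_completion[of f lborel borel] fm by simp
  then have "f measurable_on UNIV"
    using lebesgue_measurable_imp_measurable_on[of f UNIV] by simp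
  \<comment> \<open>Measurability provides continuous functions converging off a negligible set.
    They carry no bounds of their own; applying \<open>cut\<close> and \<open>T\<close> to them
    supplies the bounds.\<close>
  then obtain N g where N: "negligible N" and gc: "\<And>n. continuous_on UNIV (g n)"
    and gl: "\<And>x. x \<notin> N \<Longrightarrow> (\<lambda>n. g n x) ----> f x"
    unfolding measurable_on_def by auto
  have [measurable]: "g n \<in> Borel" for n
    using gc by (intro borel_measurable_continuous_onI)
  have "(\<lambda>n. norm2 (\<lambda>x. cut k x * T k (g n x) - cut k x * T k (f x))) ----> 0"
  proof (rule tendsto_L2_dominated[where w="\<lambda>x. indicator (cball 0 (real (Suc k))) x * (2 * real k)"])
    show "L2 (\<lambda>x::'a. indicator (cball 0 (real (Suc k))) x * (2 * real k))"
      using L2_cmult[OF L2_indicator, of "cball (0::'a) (real (Suc k))" lborel "2 * real k"]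
        emeasure_lborel_cball_finite[of "0::'a" "real (Suc k)"] by (simp add: mult.commute)
    have "AE x in lebesgue. x \<notin> N"
      using N by (simp add: negligible_iff_null_sets AE_not_in)
    then have "AE x in lborel. x \<notin> N"
      by (simp add: AE_completion_iff)
    then show "AE x in lborel. (\<lambda>n. cut k x * T k (g n x)) ----> cut k x * T k (f x)"
    proof eventually_elim
      fix x assume "x \<notin> N"
      from gl[OF this] Tc[of k] have "(\<lambda>n. T k (g n x)) ----> T k (f x)"
        by (intro isCont_tendsto_compose[of "f x" "T k"]) (auto simp: continuous_on_eq_continuous_at)
      then show "(\<lambda>n. cut k x * T k (g n x)) ----> cut k x * T k (f x)" by (rule tendsto_mult_left)
    qed
    fix n
    show "AE x in lborel. norm (cut k x * T k (g n x) - cut k x * T k (f x)) \<le> indicator (cball 0 (real (Suc k))) x * (2 * real k)"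
    proof (rule AE_I2)
      fix x
      have c0: "norm x > real (Suc k) \<Longrightarrow> cut k x = 0" by (simp add: cut_def)
      have "\<bar>cut k x * T k s\<bar> \<le> 1 * real k" for s
        unfolding abs_mult using cut01 Tb by (intro mult_mono) auto
      from this[of "g n x"] this[of "f x"] c0
      show "norm (cut k x * T k (g n x) - cut k x * T k (f x)) \<le> indicator (cball 0 (real (Suc k))) x * (2 * real k)"
        by (cases "norm x > real (Suc k)") auto
    qed
  qed auto
  then obtain n where n: "norm2 (\<lambda>x. cut k x * T k (g n x) - cut k x * T k (f x)) < e / 2"
    using e by (auto dest!: LIMSEQ_D[where r="e / 2"] simp: L2_norm_nonneg)
  show thesis
  proof (rule that[of "\<lambda>x. cut k x * T k (g n x)" "real (Suc k)"])
    show "continuous_on UNIV (\<lambda>x. cut k x * T k (g n x))"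
      by (intro continuous_on_mult cutc continuous_on_compose2[OF Tc gc]) auto
    show "L2 (\<lambda>x. cut k x * T k (g n x))" by (rule bd) simp
    have "norm2 (\<lambda>x. f x - cut k x * T k (g n x))
        \<le> norm2 (\<lambda>x. f x - cut k x * T k (f x)) + norm2 (\<lambda>x. cut k x * T k (f x) - cut k x * T k (g n x))"
      by (intro L2_norm_triangle3 f bd) auto
    then show "norm2 (\<lambda>x. f x - cut k x * T k (g n x)) < e"
      using k n L2_norm_minus_commute[of lborel f "\<lambda>x. cut k x * T k (f x)"]
        L2_norm_minus_commute[of lborel "\<lambda>x. cut k x * T k (f x)" "\<lambda>x. cut k x * T k (g n x)"] by linarith
  qed (auto simp: cut_def)
qed

abbreviation mollify :: "nat \<Rightarrow> ('a::euclidean_space \<Rightarrow> real) \<Rightarrow> 'a \<Rightarrow> real"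
  where "mollify k \<equiv> conv (mollifier (inverse (real (Suc k))))"

lemma mollify_L2:
  assumes "L2 f"
  shows "L2 (mollify k f)" "norm2 (mollify k f) \<le> norm2 f"
    "L1 (\<lambda>y. mollifier (inverse (real (Suc k))) (x - y) * f y)"
  using conv_L2[OF test_mollifier mollifier_nonneg integral_mollifier assms, of "inverse (real (Suc k))"]
  by auto

lemma mollify_diff:
  assumes "L2 f" "L2 g"
  shows "mollify k (\<lambda>x. f x - g x) = (\<lambda>x. mollify k f x - mollify k g x)"
  using mollify_L2(3)[OF assms(1), of k] mollify_L2(3)[OF assms(2), of k]
  by (simp add: conv_def right_diff_distrib fun_eq_iff)

lemma mollify_tendsto_continuous:
  fixes g :: "'a::euclidean_space \<Rightarrow> real"
  assumes gc: "continuous_on UNIV g" and R: "R > 0" "\<And>x. norm x \<ge> R \<Longrightarrow> g x = 0"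
    and gL: "L2 g"
  shows "lim2 (\<lambda>k. mollify k g) g"
proof (rule tendsto_L2_dominated[where w="\<lambda>x. indicator (cball 0 (R + 1)) x * (2 * (SUP x. \<bar>g x\<bar>))"])
  have gm: "g \<in> Borel" using gc by (rule borel_measurable_continuous_onI)
  then show "g \<in> borel_measurable lborel" by simp
  show "mollify k g \<in> borel_measurable lborel" for k
    using measurable_conv[OF measurable_mollifier gm] by simp
  have "compact (g ` cball 0 R)" by (intro compact_continuous_image continuous_on_subset[OF gc]) auto
  then obtain B where B: "\<And>x. norm x \<le> R \<Longrightarrow> \<bar>g x\<bar> \<le> B"
    using compact_imp_bounded bounded_iff by (metis imageI mem_cball_0 real_norm_def)
  have bd: "\<bar>g x\<bar> \<le> max B 0" for x using B[of x] R(2)[of x] by (cases "norm x \<le> R") force+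
  let ?S = "SUP x. \<bar>g x\<bar>"
  have S: "\<bar>g x\<bar> \<le> ?S" for x
    using bd by (intro cSUP_upper bdd_aboveI[of _ "max B 0"]) auto
  then have S0: "?S \<ge> 0" using abs_ge_zero order_trans by blast
  show "L2 (\<lambda>x::'a. indicator (cball 0 (R + 1)) x * (2 * ?S))"
    using L2_cmult[OF L2_indicator, of "cball (0::'a) (R + 1)" lborel "2 * ?S"]
      emeasure_lborel_cball_finite[of "0::'a" "R + 1"] by (simp add: mult.commute)
  define e where "e k = inverse (real (Suc k))" for k
  have e: "0 < e k" "e k \<le> 1" for k by (auto simp: e_def inverse_le_1_iff)
  let ?m = "\<lambda>k. mollifier (e k) :: 'a \<Rightarrow> real"
  have mi: "L1 (\<lambda>y. ?m k (x - y))" "(\<integral>y. ?m k (x - y)) = 1" for k x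
    using integrable_lborel_affine[of "-1" "?m k" x] test_integrable[OF test_mollifier[OF e(1)]]
      integral_reflect[of "?m k" x] integral_mollifier[OF e(1)] by auto
  have mg: "L1 (\<lambda>y. ?m k (x - y) * g y)" for k x
    unfolding e_def by (rule mollify_L2(3)[OF gL])
  \<comment> \<open>The oscillation of \<open>g\<close> within the mollification radius bounds the
    error. It is used with \<open>2 * ?S\<close> for the dominating function, with \<open>0\<close>
    far from the support, and with \<open>r / 2\<close> for pointwise convergence.\<close>
  have est: "\<bar>mollify k g x - g x\<bar> \<le> d" if d: "\<And>y. norm (x - y) < e k \<Longrightarrow> \<bar>g y - g x\<bar> \<le> d" for k x d
  proof -
    have "mollify k g x - g x = (\<integral>y. ?m k (x - y) * g y) - (\<integral>y. ?m k (x - y)) * g x"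
      using mi by (simp add: conv_def e_def)
    also have "\<dots> = (\<integral>y. ?m k (x - y) * (g y - g x))"
      using mg mi by (simp add: right_diff_distrib)
    also have "\<bar>\<dots>\<bar> \<le> (\<integral>y. ?m k (x - y) * d)"
    proof (rule order_trans[OF integral_abs_bound integral_mono])
      show "L1 (\<lambda>y. \<bar>?m k (x - y) * (g y - g x)\<bar>)"
        using mg mi by (intro integrable_abs) (simp add: right_diff_distrib)
      show "\<bar>?m k (x - y) * (g y - g x)\<bar> \<le> ?m k (x - y) * d" for y
        using d[of y] mollifier_zero[OF e(1)[of k], of "x - y"] mollifier_nonneg[OF e(1)[of k], of "x - y"]
        by (cases "norm (x - y) < e k") (auto simp: abs_mult intro!: mult_left_mono)
    qed (use mi in auto)
    also have "\<dots> = d" using mi by simp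
    finally show ?thesis .
  qed
  show "AE x in lborel. norm (mollify k g x - g x) \<le> indicator (cball 0 (R + 1)) x * (2 * ?S)" for k
  proof (rule AE_I2)
    fix x
    show "norm (mollify k g x - g x) \<le> indicator (cball 0 (R + 1)) x * (2 * ?S)"
    proof (cases "norm x \<le> R + 1")
      case True
      have "\<bar>g y - g x\<bar> \<le> 2 * ?S" for y using S[of x] S[of y] by linarith
      then show ?thesis using True est[of x k "2 * ?S"] by simp
    next
      case False
      have "\<bar>g y - g x\<bar> \<le> 0" if "norm (x - y) < e k" for y
      proof -
        have "norm x \<le> norm (x - y) + norm y" by (metis add.commute diff_add_cancel norm_triangle_ineq)
        then have "norm y \<ge> R" using that e(2)[of k] False by linarith
        then show ?thesis using R False by simp
      qed
      then show ?thesis using False est[of x k 0] by simp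
    qed
  qed
  have "(\<lambda>k. mollify k g x) ----> g x" for x
  proof (rule LIMSEQ_I)
    fix r :: real assume r: "r > 0"
    have "isCont g x" using gc by (simp add: continuous_on_eq_continuous_at)
    then obtain d where d: "d > 0" "\<And>y. dist y x < d \<Longrightarrow> dist (g y) (g x) < r / 2"
      unfolding continuous_at_eps_delta using r by (meson half_gt_zero)
    obtain N where N: "e N < d"
      using reals_Archimedean[OF d(1)] by (auto simp: e_def)
    have "\<bar>mollify k g x - g x\<bar> \<le> r / 2" if "k \<ge> N" for k
    proof (rule est)
      fix y assume "norm (x - y) < e k"
      moreover have "e k \<le> e N" using that by (simp add: e_def le_imp_inverse_le)
      ultimately have "dist y x < d" using N by (simp add: dist_norm norm_minus_commute)
      then show "\<bar>g y - g x\<bar> \<le> r / 2" using d(2)[of y] by (simp add: dist_norm)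
    qed
    then show "\<exists>N. \<forall>k\<ge>N. norm (mollify k g x - g x) < r" using r by (intro exI[of _ N]) fastforce
  qed
  then show "AE x in lborel. (\<lambda>k. mollify k g x) ----> g x" by simp
qed

text \<open>Mollification does not increase the norm, so convergence on the dense class of
  continuous functions of bounded support carries over.\<close>

lemma mollify_tendsto:
  assumes f: "L2 f"
  shows "lim2 (\<lambda>k. mollify k f) f"
proof (rule LIMSEQ_I)
  fix r :: real assume r: "r > 0"
  obtain g R where g: "continuous_on UNIV g" "R > 0" "\<And>x. norm x \<ge> R \<Longrightarrow> g x = 0"
    "L2 g" "dist2 f g < r / 3"
    using L2_dense_continuous[OF f, of "r / 3"] r by auto
  obtain N where N: "\<And>k. k \<ge> N \<Longrightarrow> dist2 (mollify k g) g < r / 3"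
    using LIMSEQ_D[OF mollify_tendsto_continuous[OF g(1-4)], of "r / 3"] r by (auto simp: L2_norm_nonneg)
  have "dist2 (mollify k f) f < r" if "k \<ge> N" for k
  proof -
    have "dist2 (mollify k f) f
        \<le> dist2 (mollify k f) (mollify k g) + dist2 (mollify k g) f"
      by (intro L2_norm_triangle3 mollify_L2 f g)
    moreover have "dist2 (mollify k g) f
        \<le> dist2 (mollify k g) g + dist2 g f"
      by (intro L2_norm_triangle3 mollify_L2 f g)
    moreover have "dist2 (mollify k f) (mollify k g) \<le> dist2 f g"
      using mollify_L2(2)[OF L2_diff[OF f g(4)], of k] mollify_diff[OF f g(4), of k] by simp
    ultimately show ?thesis
      using N[OF that] g(5) L2_norm_minus_commute[of lborel f g] by linarith
  qed
  then show "\<exists>N. \<forall>k\<ge>N. norm (dist2 (mollify k f) f - 0) < r"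
    by (intro exI[of _ N]) (auto simp: L2_norm_nonneg)
qed

lemma test_mollifier_reflect:
  assumes "e > 0" "cball x e \<subseteq> \<Omega>"
  shows "test_function \<Omega> (\<lambda>y. mollifier e (x - y))"
  using assms by (intro test_functionI[where K="cball x e"] smooth_reflect smooth_mollifier)
    (auto simp: dist_norm intro!: mollifier_zero)

lemma AE_zero_if_L2_norm_zero:
  assumes "in_L2 M f" "L2_norm M f = 0"
  shows "AE x in M. f x = 0"
proof -
  have "(\<integral>x. (norm (f x))^2 \<partial>M) = 0" using L2_norm_sq[of M f] assms(2) by simp
  then have "AE x in M. (norm (f x))^2 = 0"
    using integral_nonneg_eq_0_iff_AE[OF L2_integrable[OF assms(1)]] by simp
  then show ?thesis by simp
qed

text \<open>At points well inside \<open>\<Omega>\<close> the reflected mollifier is an admissible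
  test function, so the mollifications of \<open>f\<close> vanish there; they converge to
  \<open>f\<close> in \<open>L^2\<close>.\<close>

lemma AE_zero_if_orthogonal_test_functions:
  fixes f :: "'a::euclidean_space \<Rightarrow> real"
  assumes \<Omega>: "open \<Omega>" and f: "L2 f"
    and z: "\<And>\<phi>. test_function \<Omega> \<phi> \<Longrightarrow> (\<integral>x. \<phi> x * f x) = 0"
  shows "AE x in lborel. x \<in> \<Omega> \<longrightarrow> f x = 0"
proof -
  \<comment> \<open>Points at distance at least twice \<open>1 / (j + 1)\<close> from the
    complement; the factor two leaves room for the closed balls of radius \<open>1 / (k + 1)\<close>
    with \<open>k \<ge> j\<close>.\<close>
  define K where "K j = {x. \<forall>z. z \<notin> \<Omega> \<longrightarrow> 2 * inverse (real (Suc j)) \<le> dist x z}" for j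
  have Kc: "closed (K j)" for j
  proof -
    have "K j = (\<Inter>z\<in>- \<Omega>. {x. 2 * inverse (real (Suc j)) \<le> dist x z})" by (auto simp: K_def)
    then show ?thesis by (auto intro!: closed_INT closed_Collect_le continuous_intros)
  qed
  have [measurable]: "K j \<in> sets borel" for j using Kc by (rule borel_closed)
  have zero: "mollify k f x = 0" if "x \<in> K j" "k \<ge> j" for x j k
  proof -
    have "inverse (real (Suc k)) \<le> inverse (real (Suc j))" using that by (simp add: le_imp_inverse_le)
    moreover have "inverse (real (Suc j)) < 2 * inverse (real (Suc j))" by simp
    ultimately have lt: "inverse (real (Suc k)) < 2 * inverse (real (Suc j))" by linarith
    have "cball x (inverse (real (Suc k))) \<subseteq> \<Omega>"
    proof (rule ccontr)
      assume "\<not> ?thesis"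
      then obtain y where "dist x y \<le> inverse (real (Suc k))" "y \<notin> \<Omega>"
        unfolding subset_iff mem_cball by blast
      then show False using that(1) lt by (auto simp: K_def)
    qed
    from z[OF test_mollifier_reflect[OF _ this]] show ?thesis by (simp add: conv_def)
  qed
  have "AE x in lborel. x \<in> K j \<longrightarrow> f x = 0" for j
  proof -
    let ?g = "\<lambda>x. indicator (K j) x * f x"
    have gL: "L2 ?g"
      using L2_measurable[OF f] by (intro L2_bound(1)[OF f, where C=1]) (auto simp: indicator_def)
    have "norm2 ?g \<le> 0"
    proof (rule LIMSEQ_le_const[OF mollify_tendsto[OF f]])
      have "norm2 ?g \<le> 1 * dist2 (mollify k f) f" if "k \<ge> j" for k
        using L2_measurable[OF f] zero[OF _ that]
        by (intro L2_bound(2) L2_diff mollify_L2 f AE_I2) (auto simp: indicator_def)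
      then show "\<exists>N. \<forall>k\<ge>N. norm2 ?g \<le> dist2 (mollify k f) f" by auto
    qed
    then have "norm2 ?g = 0" using L2_norm_nonneg[of lborel ?g] by linarith
    from AE_zero_if_L2_norm_zero[OF gL this] show ?thesis by eventually_elim (auto simp: indicator_def)
  qed
  then have "AE x in lborel. \<forall>j. x \<in> K j \<longrightarrow> f x = 0" unfolding AE_all_countable by blast
  then show ?thesis
  proof eventually_elim
    case K: (elim x)
    show ?case
    proof
      assume "x \<in> \<Omega>"
      then obtain d where d: "d > 0" "ball x d \<subseteq> \<Omega>" using \<Omega> open_contains_ball by blast
      then obtain j where "inverse (real (Suc j)) < d / 2" using reals_Archimedean[of "d / 2"] by auto
      then have "x \<in> K j" using d(2) by (force simp: K_def)
      with K show "f x = 0" by blast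
    qed
  qed
qed

lemma L2_bounded_mult:
  fixes g f :: "'a \<Rightarrow> real"
  assumes "in_L2 M f" "g \<in> borel_measurable M" "\<And>x. \<bar>g x\<bar> \<le> B"
  shows "in_L2 M (\<lambda>x. g x * f x)" "L2_norm M (\<lambda>x. g x * f x) \<le> B * L2_norm M f"
proof -
  have B: "B \<ge> 0" using abs_ge_zero order_trans assms(3) by blast
  have "AE x in M. norm (g x * f x) \<le> B * norm (f x)"
    using assms(3) by (auto simp: abs_mult intro!: mult_right_mono)
  moreover have "(\<lambda>x. g x * f x) \<in> borel_measurable M"
    by (intro borel_measurable_times L2_measurable[OF assms(1)] assms(2))
  ultimately show "in_L2 M (\<lambda>x. g x * f x)" "L2_norm M (\<lambda>x. g x * f x) \<le> B * L2_norm M f"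
    using L2_bound[OF assms(1) _ _ B] by blast+
qed

lemma L2_test_function:
  fixes \<phi> :: "'a::euclidean_space \<Rightarrow> 'b::euclidean_space"
  assumes "test_function \<Omega> \<phi>"
  shows "L2 \<phi>"
proof -
  obtain K where K: "compact K" "\<And>x. x \<notin> K \<Longrightarrow> \<phi> x = 0"
    using assms test_functionE by metis
  have "continuous_on UNIV (\<lambda>x. (norm (\<phi> x))^2)"
    by (intro continuous_intros smooth_continuous test_smooth[OF assms])
  then have "L1 (\<lambda>x. (norm (\<phi> x))^2)"
    by (rule integrable_compact_support[OF _ K(1)]) (simp add: K(2))
  then show ?thesis
    using smooth_measurable[OF test_smooth[OF assms]] by (simp add: in_L2_def)
qed

lemma measurable_test_function: "test_function \<Omega> \<phi> \<Longrightarrow> \<phi> \<in> Borel"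
  by (intro smooth_measurable test_smooth)

lemma test_bounded_real:
  fixes \<phi> :: "'a::euclidean_space \<Rightarrow> real"
  assumes "test_function \<Omega> \<phi>"
  obtains B where "B > 0" "\<And>x. \<bar>\<phi> x\<bar> \<le> B"
  using test_bounded[OF assms] by auto

section \<open>Solvability and interior regularity\<close>

text \<open>The Carleman estimate gives at least the factor \<open>4 t\<close>, since the dimension
  is at least one. The bounded \<open>V\<close> is moved to the right at cost \<open>N\<close>, and
  \<open>N + 1 \<le> 4 t\<close> leaves the factor one.\<close>

lemma carleman_L2:
  fixes a V \<phi> :: "'a::euclidean_space \<Rightarrow> real"
  assumes a: "a \<in> Borel" "\<And>x. \<bar>a x\<bar> \<le> B"
    and mono: "\<And>x l. l \<ge> 1 \<Longrightarrow> a x \<le> a (l *R x)"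
    and V: "V \<in> Borel" "\<And>x. \<bar>V x\<bar> \<le> N"
    and \<phi>: "test_function UNIV \<phi>" and t: "t > 0" "N + 1 \<le> 4 * t"
  defines "w \<equiv> \<lambda>x. exp (t * (norm x)^2)"
  shows "L2 (\<lambda>x. w x * (laplacian \<phi> x + (a x + V x) * \<phi> x))"
    "norm2 (\<lambda>x. w x * \<phi> x) \<le> norm2 (\<lambda>x. w x * (laplacian \<phi> x + (a x + V x) * \<phi> x))"
proof -
  have sw: "smooth w" unfolding w_def by (intro smooth_intros)
  have z: "L2 (\<lambda>x. w x * \<phi> x)"
    by (intro L2_test_function[of UNIV] test_mult_left \<phi> sw)
  have Dz: "L2 (\<lambda>x. w x * laplacian \<phi> x)"
    by (intro L2_test_function[of UNIV] test_mult_left test_laplacian \<phi> sw)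
  have az: "L2 (\<lambda>x. a x * (w x * \<phi> x))" and Vz: "L2 (\<lambda>x. V x * (w x * \<phi> x))"
    and Vn: "norm2 (\<lambda>x. V x * (w x * \<phi> x)) \<le> N * norm2 (\<lambda>x. w x * \<phi> x)"
    using L2_bounded_mult[OF z, of a B] L2_bounded_mult[OF z, of V N] a V by auto
  let ?P = "\<lambda>x. w x * (laplacian \<phi> x + a x * \<phi> x)"
  let ?Q = "\<lambda>x. w x * (laplacian \<phi> x + (a x + V x) * \<phi> x)"
  have P: "L2 ?P" using L2_add[OF Dz az] by (simp add: algebra_simps)
  show Q: "L2 ?Q" using L2_add[OF P Vz] by (simp add: algebra_simps)
  have "(4 * t * norm2 (\<lambda>x. w x * \<phi> x))^2 = 16 * 1 * t^2 * (\<integral>x. (w x * \<phi> x)^2)"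
    by (simp add: power_mult_distrib L2_norm_sq)
  also have "\<dots> \<le> 16 * real DIM('a) * t^2 * (\<integral>x. (w x * \<phi> x)^2)"
    by (intro mult_right_mono) (auto simp: Suc_leI)
  also have "\<dots> \<le> (\<integral>x. (?P x)^2)"
    unfolding w_def by (rule carleman[OF a mono \<phi> t(1)])
  also have "\<dots> = (norm2 ?P)^2" by (simp add: L2_norm_sq)
  finally have "4 * t * norm2 (\<lambda>x. w x * \<phi> x) \<le> norm2 ?P"
    by (rule power2_le_imp_le) (simp add: L2_norm_nonneg)
  also have "?P = (\<lambda>x. ?Q x - V x * (w x * \<phi> x))" by (simp add: algebra_simps fun_eq_iff)
  also have "norm2 \<dots> \<le> norm2 ?Q + norm2 (\<lambda>x. V x * (w x * \<phi> x))"
    by (rule L2_norm_triangle_diff[OF Q Vz])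
  finally have "4 * t * norm2 (\<lambda>x. w x * \<phi> x) \<le> norm2 ?Q + N * norm2 (\<lambda>x. w x * \<phi> x)"
    using Vn by linarith
  moreover have "(N + 1) * norm2 (\<lambda>x. w x * \<phi> x) \<le> 4 * t * norm2 (\<lambda>x. w x * \<phi> x)"
    by (intro mult_right_mono t L2_norm_nonneg)
  ultimately show "norm2 (\<lambda>x. w x * \<phi> x) \<le> norm2 ?Q"
    by (simp add: algebra_simps)
qed

text \<open>The Carleman estimate is dualised into solvability with weighted bounds; no boundary
  condition is imposed, so there is no spectral obstruction.\<close>

lemma carleman_solve:
  fixes a V f :: "'a::euclidean_space \<Rightarrow> real"
  assumes a: "a \<in> Borel" "\<And>x. \<bar>a x\<bar> \<le> B"
    and mono: "\<And>x l. l \<ge> 1 \<Longrightarrow> a x \<le> a (l *R x)"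
    and V: "V \<in> Borel" "\<And>x. \<bar>V x\<bar> \<le> N"
    and f: "L2 f" and t: "t > 0" "N + 1 \<le> 4 * t"
  obtains r where "L2 r" "\<And>x. norm x \<ge> 4 \<Longrightarrow> r x = 0"
    "norm2 (\<lambda>x. gauss t x * r x) \<le> norm2 (\<lambda>x. gauss t x * f x)"
    "\<And>\<phi>. test_function (ball 0 4) \<phi> \<Longrightarrow>
      (\<integral>x. r x * (laplacian \<phi> x + (a x + V x) * \<phi> x)) = (\<integral>x. f x * \<phi> x)"
proof -
  define w where "w x = exp (t * (norm x)^2)" for x :: 'a
  define w' where "w' x = gauss t x" for x :: 'a
  have ww: "w x * w' x = 1" for x by (simp add: w_def w'_def exp_add[symmetric])
  have wm[measurable]: "w \<in> Borel" "w' \<in> Borel"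
    unfolding w_def[abs_def] w'_def[abs_def] by (intro smooth_measurable smooth_intros)+
  have w'1: "\<bar>w' x\<bar> \<le> 1" for x using t by (simp add: w'_def)
  have F: "L2 (\<lambda>x. w' x * f x)"
    using L2_bounded_mult(1)[OF f, of w' 1] w'1 by simp
  \<comment> \<open>The weight is built into the adjoint operator, so that the unweighted Riesz
    representation yields the weighted bound: the representative \<open>\<rho>\<close> is the
    weighted solution, and \<open>r = w * \<rho>\<close>.\<close>
  define T where "T \<phi> = (\<lambda>x. w x * (laplacian \<phi> x + (a x + V x) * \<phi> x))" for \<phi> :: "'a \<Rightarrow> real"
  define X where "X = {\<phi> :: 'a \<Rightarrow> real. test_function (ball 0 4) \<phi>}"
  have XU: "test_function UNIV \<phi>" if "\<phi> \<in> X" for \<phi>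
    using that test_mono[of _ \<phi> UNIV] by (auto simp: X_def)
  have lap: "laplacian (\<lambda>x. \<phi> x + s * \<psi> x) x = laplacian \<phi> x + s * laplacian \<psi> x"
    if "\<phi> \<in> X" "\<psi> \<in> X" for \<phi> \<psi> s x
  proof -
    have sm: "smooth \<phi>" "smooth \<psi>" using XU that test_smooth by blast+
    have "dirderiv b (\<lambda>x. \<phi> x + s * \<psi> x) = (\<lambda>x. dirderiv b \<phi> x + s * dirderiv b \<psi> x)"
      if "smooth \<phi>" "smooth \<psi>" for b and \<phi> \<psi> :: "'a \<Rightarrow> real"
      using that by (simp add: fun_eq_iff dirderiv_add dirderiv_cmult smoothD smooth_cmult)
    then show ?thesis
      using sm by (simp add: laplacian_def smooth_dirderiv sum.distrib sum_distrib_left)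
  qed
  have TL: "L2 (T \<phi>)" and Tb: "norm2 (\<lambda>x. w x * \<phi> x) \<le> norm2 (T \<phi>)"
    if "\<phi> \<in> X" for \<phi>
    using carleman_L2[OF a mono V XU[OF that] t] by (simp_all add: T_def w_def)
  have zL: "L2 (\<lambda>x. w x * \<phi> x)" if "\<phi> \<in> X" for \<phi>
    unfolding w_def by (intro L2_test_function[of UNIV] test_mult_left XU that smooth_intros)
  have iL: "L1 (\<lambda>x. f x * \<phi> x)" if "\<phi> \<in> X" for \<phi>
    using that by (intro L2_integrable_mult f L2_test_function[of UNIV] XU)
  obtain \<rho> where \<rho>: "L2 \<rho>" "norm2 \<rho> \<le> norm2 (\<lambda>x. w' x * f x)"
    "\<And>\<phi>. \<phi> \<in> X \<Longrightarrow> (\<integral>x. \<rho> x * T \<phi> x) = (\<integral>x. f x * \<phi> x)"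
    "\<And>x. indicator (ball (0::'a) 4) x = (0::real) \<Longrightarrow> \<rho> x = 0"
  proof (rule L2_Riesz[of X T "\<lambda>\<phi>. \<integral>x. f x * \<phi> x" lborel "indicator (ball 0 4)" "norm2 (\<lambda>x. w' x * f x)"])
    fix \<phi> \<psi> s assume p: "\<phi> \<in> X" "\<psi> \<in> X"
    show "(\<lambda>x. \<phi> x + s * \<psi> x) \<in> X"
      using p unfolding X_def by (auto intro!: test_add test_mult_left smooth_const)
    show "T (\<lambda>x. \<phi> x + s * \<psi> x) = (\<lambda>x. T \<phi> x + s * T \<psi> x)"
      using lap[OF p] by (simp add: T_def fun_eq_iff algebra_simps)
    show "(\<integral>x. f x * (\<phi> x + s * \<psi> x)) = (\<integral>x. f x * \<phi> x) + s * (\<integral>x. f x * \<psi> x)"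
      using iL p by (simp add: distrib_left mult.left_commute[of _ s])
  next
    fix \<phi> assume p: "\<phi> \<in> X"
    show "L2 (T \<phi>)" by (rule TL[OF p])
    have "\<bar>\<integral>x. f x * \<phi> x \<partial>lborel\<bar> = \<bar>\<integral>x. (w' x * f x) \<bullet> (w x * \<phi> x) \<partial>lborel\<bar>"
    proof -
      have "f x * \<phi> x = (w' x * f x) \<bullet> (w x * \<phi> x)" for x
      proof -
        have "(w' x * f x) \<bullet> (w x * \<phi> x) = (w x * w' x) * (f x * \<phi> x)" by simp
        then show ?thesis by (simp add: ww)
      qed
      then show ?thesis by (simp only:)
    qed
    also have "\<dots> \<le> norm2 (\<lambda>x. w' x * f x) * norm2 (\<lambda>x. w x * \<phi> x)"
      by (intro L2_Cauchy_Schwarz F zL p)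
    also have "\<dots> \<le> norm2 (\<lambda>x. w' x * f x) * norm2 (T \<phi>)"
      by (intro mult_left_mono Tb p L2_norm_nonneg)
    finally show "\<bar>\<integral>x. f x * \<phi> x \<partial>lborel\<bar> \<le> norm2 (\<lambda>x. w' x * f x) * norm2 (T \<phi>)" .
    fix x assume "indicator (ball (0::'a) 4) x = (0::real)"
    then have "x \<notin> ball 0 4" by (auto simp: indicator_def split: if_splits)
    then show "T \<phi> x = 0"
      using p test_outside[of "ball 0 4" \<phi> x] test_outside[OF test_laplacian, of "ball 0 4" \<phi> x]
      by (simp add: T_def X_def)
  next
    show "L2 (indicator (ball 0 4) :: 'a \<Rightarrow> real)"
      by (rule L2_indicator) auto
  qed (auto simp: L2_norm_nonneg)
  have \<rho>0: "\<rho> x = 0" if "norm x \<ge> 4" for x using \<rho>(4)[of x] that by simp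
  define r where "r x = w x * \<rho> x" for x
  have rm: "r \<in> borel_measurable lborel"
    unfolding r_def[abs_def] using L2_measurable[OF \<rho>(1)] by simp
  show thesis
  proof (rule that[of r])
    show "L2 r"
    proof (rule L2_bound(1)[OF \<rho>(1) rm, where C="exp (t * 16)"])
      have "norm (r x) \<le> exp (t * 16) * norm (\<rho> x)" for x
      proof (cases "norm x \<ge> 4")
        case False
        then have "(norm x)^2 \<le> 4^2" by (intro power_mono) auto
        then show ?thesis using t by (auto simp: r_def abs_mult w_def intro!: mult_right_mono)
      qed (simp add: r_def \<rho>0)
      then show "AE x in lborel. norm (r x) \<le> exp (t * 16) * norm (\<rho> x)" by simp
    qed auto
    have "(\<lambda>x. w' x * r x) = \<rho>"
    proof
      fix x
      have "w' x * r x = (w x * w' x) * \<rho> x" by (simp add: r_def)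
      then show "w' x * r x = \<rho> x" by (simp add: ww)
    qed
    then show "norm2 (\<lambda>x. gauss t x * r x) \<le> norm2 (\<lambda>x. gauss t x * f x)"
      using \<rho>(2) by (simp add: w'_def)
    fix \<phi> :: "'a \<Rightarrow> real" assume "test_function (ball 0 4) \<phi>"
    then have "(\<integral>x. \<rho> x * T \<phi> x) = (\<integral>x. f x * \<phi> x)" by (intro \<rho>(3)) (simp add: X_def)
    then show "(\<integral>x. r x * (laplacian \<phi> x + (a x + V x) * \<phi> x)) = (\<integral>x. f x * \<phi> x)"
      by (simp add: T_def r_def mult_ac)
  qed (simp add: r_def \<rho>0)
qed

text \<open>The field integrated is \<open>\<zeta> W \<nabla>W\<close> minus half of
  \<open>W^2 \<nabla>\<zeta>\<close>. The second term removes the product of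
  \<open>\<nabla>\<zeta>\<close> and \<open>\<nabla>W\<close>, so \<open>\<nabla>W\<close> occurs
  only in the energy.\<close>

lemma energy_identity:
  fixes \<zeta> W :: "'a::euclidean_space \<Rightarrow> real"
  assumes \<zeta>: "test_function UNIV \<zeta>" and W: "smooth W"
  shows "(\<integral>x. \<zeta> x * (norm (grad W x))^2)
    = - (\<integral>x. \<zeta> x * W x * laplacian W x) + (1/2) * (\<integral>x. laplacian \<zeta> x * (W x)^2)"
proof -
  have sz: "smooth \<zeta>" using \<zeta> by (rule test_smooth)
  let ?F = "\<lambda>b x. \<zeta> x * (W x * dirderiv b W x) - (1/2) * (dirderiv b \<zeta> x * (W x * W x))"
  have tF: "test_function UNIV (?F b)" for b
  proof -
    have "test_function UNIV (\<lambda>x. \<zeta> x * (W x * dirderiv b W x) + (- (1/2)) * (dirderiv b \<zeta> x * (W x * W x)))"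
      by (intro test_add test_mult_left[OF _ smooth_const] test_mult_right
          test_dirderiv \<zeta> smooth_intros W)
    then show ?thesis by simp
  qed
  have dF: "dirderiv b (?F b) x = \<zeta> x * (dirderiv b W x)^2 + \<zeta> x * W x * dirderiv b (dirderiv b W) x
      - (1/2) * (dirderiv b (dirderiv b \<zeta>) x * (W x)^2)" for b x
  proof -
    have 1: "dirderiv b (\<lambda>x. W x * dirderiv b W x) x = W x * dirderiv b (dirderiv b W) x + dirderiv b W x * dirderiv b W x"
      by (intro dirderiv_mult smoothD smooth_intros W)
    have 2: "dirderiv b (\<lambda>x. W x * W x) x = W x * dirderiv b W x + dirderiv b W x * W x"
      by (intro dirderiv_mult smoothD smooth_intros W)
    have 3: "dirderiv b (\<lambda>x. \<zeta> x * (W x * dirderiv b W x)) x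
        = \<zeta> x * dirderiv b (\<lambda>x. W x * dirderiv b W x) x + dirderiv b \<zeta> x * (W x * dirderiv b W x)"
      by (intro dirderiv_mult smoothD smooth_intros W sz)
    have 4: "dirderiv b (\<lambda>x. dirderiv b \<zeta> x * (W x * W x)) x
        = dirderiv b \<zeta> x * dirderiv b (\<lambda>x. W x * W x) x + dirderiv b (dirderiv b \<zeta>) x * (W x * W x)"
      by (intro dirderiv_mult smoothD smooth_intros W sz)
    have 5: "dirderiv b (\<lambda>x. (1/2) * (dirderiv b \<zeta> x * (W x * W x))) x
        = (1/2) * dirderiv b (\<lambda>x. dirderiv b \<zeta> x * (W x * W x)) x"
      by (intro dirderiv_cmult smoothD smooth_intros W sz)
    have "dirderiv b (?F b) x = dirderiv b (\<lambda>x. \<zeta> x * (W x * dirderiv b W x)) x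
        - dirderiv b (\<lambda>x. (1/2) * (dirderiv b \<zeta> x * (W x * W x))) x"
      by (intro dirderiv_diff smoothD smooth_intros W sz)
    then show ?thesis unfolding 5 4 3 2 1 by (simp add: power2_eq_square algebra_simps)
  qed
  have eq: "(\<Sum>b\<in>Basis. dirderiv b (?F b) x) = \<zeta> x * (norm (grad W x))^2 + \<zeta> x * W x * laplacian W x
      - (1/2) * (laplacian \<zeta> x * (W x)^2)" for x
    unfolding dF norm_grad_sq laplacian_def
    by (simp only: sum.distrib sum_subtractf sum_distrib_left[symmetric] sum_distrib_right[symmetric])
  have i1: "L1 (\<lambda>x. \<zeta> x * W x * laplacian W x)"
    unfolding mult.assoc by (intro test_integrable[of UNIV] test_mult_right \<zeta> smooth_mult W smooth_laplacian)
  have i2: "L1 (\<lambda>x. laplacian \<zeta> x * (W x)^2)"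
    unfolding power2_eq_square
    by (intro test_integrable[of UNIV] test_mult_right test_laplacian \<zeta> smooth_mult W)
  have i3: "L1 (\<lambda>x. \<zeta> x * (norm (grad W x))^2)"
    unfolding norm_grad_sq unfolding power2_eq_square
    by (intro test_integrable[of UNIV] test_mult_right \<zeta> smooth_intros W)
  have "0 = (\<integral>x. (\<Sum>b\<in>Basis. dirderiv b (?F b) x))"
    using integral_divergence_zero[OF tF] by simp
  also have "\<dots> = (\<integral>x. \<zeta> x * (norm (grad W x))^2) + (\<integral>x. \<zeta> x * W x * laplacian W x)
      - (1/2) * (\<integral>x. laplacian \<zeta> x * (W x)^2)"
    unfolding eq using i1 i2 i3 by simp
  finally show ?thesis by linarith
qed

section \<open>Interior regularity from mollified equations\<close>

lemma L2_tendsto_bounded_mult: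
  fixes f :: "nat \<Rightarrow> 'a \<Rightarrow> real"
  assumes "\<And>n. in_L2 M (f n)" "in_L2 M g" "L2_lim M f g"
    "h \<in> borel_measurable M" "\<And>x. \<bar>h x\<bar> \<le> B"
  shows "(\<lambda>n. L2_norm M (\<lambda>x. h x * f n x - h x * g x)) ----> 0"
proof (rule tendsto_sandwich[OF _ _ tendsto_const])
  show "(\<lambda>n. B * L2_dist M (f n) g) ----> 0"
    using tendsto_mult_left[OF assms(3), of B] by simp
  show "\<forall>\<^sub>F n in sequentially. L2_norm M (\<lambda>x. h x * f n x - h x * g x) \<le> B * L2_dist M (f n) g"
    using L2_bounded_mult(2)[OF L2_diff[OF assms(1,2)] assms(4,5)] by (simp add: right_diff_distrib)
qed (simp add: L2_norm_nonneg)

lemma L2_tendsto_mult2: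
  fixes f g :: "nat \<Rightarrow> 'a \<Rightarrow> real"
  assumes f: "\<And>n. in_L2 M (f n)" "in_L2 M f'" "L2_lim M f f'"
    and g: "\<And>n. in_L2 M (g n)" "in_L2 M g'" "L2_lim M g g'"
  shows "(\<lambda>n. \<integral>x. f n x * g n x \<partial>M) ----> (\<integral>x. f' x * g' x \<partial>M)"
proof -
  have "(\<lambda>n. \<integral>x. (f n x - f' x) \<bullet> g n x \<partial>M) ----> 0"
  proof (rule Lim_null_comparison)
    show "(\<lambda>n. L2_dist M (f n) f' * L2_norm M (g n)) ----> 0"
      using tendsto_mult[OF f(3) L2_tendsto_norm[OF g]] by simp
    show "\<forall>\<^sub>F n in sequentially. norm (\<integral>x. (f n x - f' x) \<bullet> g n x \<partial>M) \<le> L2_dist M (f n) f' * L2_norm M (g n)"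
      using L2_Cauchy_Schwarz[OF L2_diff[OF f(1,2)] g(1)] by simp
  qed
  moreover have "(\<lambda>n. \<integral>x. g n x * f' x \<partial>M) ----> (\<integral>x. g' x * f' x \<partial>M)"
    by (rule L2_tendsto_mult[OF g f(2)])
  ultimately have "(\<lambda>n. (\<integral>x. (f n x - f' x) \<bullet> g n x \<partial>M) + (\<integral>x. g n x * f' x \<partial>M)) ----> 0 + (\<integral>x. g' x * f' x \<partial>M)"
    by (rule tendsto_add)
  moreover have "(\<integral>x. (f n x - f' x) \<bullet> g n x \<partial>M) + (\<integral>x. g n x * f' x \<partial>M) = (\<integral>x. f n x * g n x \<partial>M)" for n
  proof -
    have "(\<integral>x. (f n x - f' x) \<bullet> g n x \<partial>M) = (\<integral>x. f n x * g n x \<partial>M) - (\<integral>x. f' x * g n x \<partial>M)"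
      using L2_integrable_mult[OF f(1) g(1)] L2_integrable_mult[OF f(2) g(1)]
      by (simp add: left_diff_distrib)
    then show ?thesis by (simp add: mult.commute[of "f' _"])
  qed
  ultimately show ?thesis by (simp add: mult.commute)
qed

text \<open>For \<open>x\<close> far enough from the boundary the reflected mollifier is an
  admissible test function in the distributional equation, which thereby holds pointwise for the
  mollifications.\<close>

lemma laplacian_mollify:
  fixes r g :: "'a::euclidean_space \<Rightarrow> real"
  assumes r: "L1 r"
    and eq: "\<And>\<phi>. test_function \<Omega> \<phi> \<Longrightarrow> (\<integral>x. r x * laplacian \<phi> x) = (\<integral>x. g x * \<phi> x)"
    and x: "cball x (inverse (real (Suc k))) \<subseteq> \<Omega>"
  shows "laplacian (mollify k r) x = mollify k g x"
proof -
  let ?m = "mollifier (inverse (real (Suc k))) :: 'a \<Rightarrow> real"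
  have "laplacian (mollify k r) x = (\<integral>y. r y * laplacian (\<lambda>y. ?m (x - y)) y)"
    using laplacian_conv[OF test_mollifier r, of "inverse (real (Suc k))"]
    by (simp add: conv_def laplacian_reflect[OF smooth_mollifier] mult.commute)
  also have "\<dots> = (\<integral>y. g y * ?m (x - y))"
    by (intro eq test_mollifier_reflect x) simp
  finally show ?thesis by (simp add: conv_def mult.commute)
qed

lemma integral_dirderiv_mult:
  fixes \<phi> W :: "'a::euclidean_space \<Rightarrow> real"
  assumes \<phi>: "test_function UNIV \<phi>" and W: "smooth W"
  shows "(\<integral>x. dirderiv b \<phi> x * W x) = - (\<integral>x. \<phi> x * dirderiv b W x)"
proof -
  have "0 = (\<integral>x. dirderiv b (\<lambda>x. \<phi> x * W x) x)"
    by (rule integral_dirderiv_zero[symmetric]) (rule test_mult_right[OF \<phi> W])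
  also have "\<dots> = (\<integral>x. \<phi> x * dirderiv b W x + dirderiv b \<phi> x * W x)"
    by (simp add: dirderiv_mult smoothD W test_smooth[OF \<phi>])
  also have "\<dots> = (\<integral>x. \<phi> x * dirderiv b W x) + (\<integral>x. dirderiv b \<phi> x * W x)"
    by (intro Bochner_Integration.integral_add test_integrable[of UNIV] test_mult_right
        test_dirderiv \<phi> W smooth_dirderiv)
  finally show ?thesis by linarith
qed

lemma smooth_grad: "smooth f \<Longrightarrow> smooth (grad f)"
  unfolding grad_def[abs_def]
  by (intro smooth_sum smooth_compose_linear[OF bounded_linear_scaleR_left] smooth_dirderiv)

lemma grad_diff:
  "f differentiable (at x) \<Longrightarrow> g differentiable (at x) \<Longrightarrow> grad (\<lambda>x. f x - g x) x = grad f x - grad g x"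
  by (simp add: grad_def dirderiv_diff scaleR_diff_left sum_subtractf)

lemma L2_continuous_ball:
  fixes h :: "'a::euclidean_space \<Rightarrow> 'b::euclidean_space"
  assumes h: "continuous_on UNIV h"
  shows "L2 (cut (ball 0 R) h)"
proof -
  have "compact (h ` cball 0 R)" by (intro compact_continuous_image continuous_on_subset[OF h]) auto
  then obtain B where B: "\<And>x. norm x \<le> R \<Longrightarrow> norm (h x) \<le> B"
    using compact_imp_bounded bounded_iff by (metis imageI mem_cball_0)
  have [measurable]: "h \<in> Borel" using h by (rule borel_measurable_continuous_onI)
  have [measurable]: "ball (0::'a) R \<in> sets borel" by simp
  have m: "(cut (ball 0 R) h) \<in> Borel" by measurable
  show ?thesis
  proof (rule L2_bound(1)[of lborel "indicator (ball (0::'a) R) :: 'a \<Rightarrow> real" _ "\<bar>B\<bar>"])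
    show "L2 (indicator (ball 0 R) :: 'a \<Rightarrow> real)"
      by (rule L2_indicator) auto
    have "norm (indicator (ball 0 R) x *R h x) \<le> \<bar>B\<bar> * norm (indicator (ball 0 R) x :: real)" for x
      using B[of x] by (auto simp: indicator_def)
    then show "AE x in lborel. norm (indicator (ball 0 R) x *R h x) \<le> \<bar>B\<bar> * norm (indicator (ball 0 R) x :: real)"
      by simp
  qed (use m in auto)
qed

text \<open>Interior regularity for \<open>\<Delta>r = g\<close>: Caccioppoli's inequality makes the gradients of the
  mollifications Cauchy, and passes to the limit.\<close>

lemma interior_H1:
  fixes r g \<zeta> :: "'a::euclidean_space \<Rightarrow> real"
  assumes r: "L2 r" "\<And>x. norm x \<ge> 4 \<Longrightarrow> r x = 0" and g: "L2 g"
    and eq: "\<And>\<phi>. test_function (ball 0 4) \<phi> \<Longrightarrow> (\<integral>x. r x * laplacian \<phi> x) = (\<integral>x. g x * \<phi> x)"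
    and \<zeta>: "test_function UNIV \<zeta>" "\<And>x. \<zeta> x \<ge> 0" "\<And>x. norm x < 3 \<Longrightarrow> \<zeta> x = 1" "\<And>x. norm x \<ge> 7/2 \<Longrightarrow> \<zeta> x = 0"
  obtains G :: "'a \<Rightarrow> 'a" where "L2 G" "\<And>x. norm x \<ge> 3 \<Longrightarrow> G x = 0"
    "\<And>b \<phi>. test_function (ball 0 3) \<phi> \<Longrightarrow> (\<integral>x. dirderiv b \<phi> x * r x) = - (\<integral>x. \<phi> x * (G x \<bullet> b))"
    "(norm2 G)^2 \<le> - (\<integral>x. \<zeta> x * r x * g x) + (1/2) * (\<integral>x. laplacian \<zeta> x * (r x)^2)"
proof -
  have ri: "L1 r" by (rule L2_integrable_bounded_support[OF r])
  define W where "W k = mollify k r" for k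
  define h where "h k = mollify k g" for k
  have sW: "smooth (W k)" for k
    unfolding W_def by (intro smooth_conv test_mollifier ri) simp
  have WL: "L2 (W k)" and hL: "L2 (h k)" for k
    unfolding W_def h_def by (intro mollify_L2 r g)+
  have Wlim: "lim2 W r"
    and hlim: "lim2 h g"
    unfolding W_def h_def by (intro mollify_tendsto r g)+
  obtain B1 where B1: "B1 > 0" "\<And>x. \<bar>\<zeta> x\<bar> \<le> B1" using test_bounded_real[OF \<zeta>(1)] by blast
  obtain B2 where B2: "B2 > 0" "\<And>x. \<bar>laplacian \<zeta> x\<bar> \<le> B2"
    using test_bounded_real[OF test_laplacian[OF \<zeta>(1)]] by blast
  have zm[measurable]: "\<zeta> \<in> Borel" "laplacian \<zeta> \<in> Borel"
    using measurable_test_function[OF \<zeta>(1)] measurable_test_function[OF test_laplacian[OF \<zeta>(1)]] .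
  \<comment> \<open>Where \<open>\<zeta>\<close> is not zero, the distance to the sphere of radius 4
    exceeds \<open>1/2\<close>, and \<open>k \<ge> 2\<close> makes the mollification radius at most
    \<open>1/3\<close>.\<close>
  have lapW: "\<zeta> x * laplacian (W k) x = \<zeta> x * h k x" if "k \<ge> 2" for k x
  proof (cases "norm x \<ge> 7/2")
    case False
    have k: "inverse (real (Suc k)) \<le> inverse 3" using that by (intro le_imp_inverse_le) auto
    have "cball x (inverse (real (Suc k))) \<subseteq> ball 0 4"
    proof
      fix y assume "y \<in> cball x (inverse (real (Suc k)))"
      then have "norm (y - x) \<le> 1/3" using k by (simp add: dist_norm norm_minus_commute)
      then show "y \<in> ball 0 4" using False norm_triangle_sub[of y x] by simp
    qed
    then have "laplacian (W k) x = h k x"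
      unfolding W_def h_def by (intro laplacian_mollify[OF ri eq])
    then show ?thesis by simp
  qed (simp add: \<zeta>(4))
  define D where "D k x = indicator (ball 0 3) x *R grad (W k) x" for k x
  have DL: "L2 (D k)" for k
    unfolding D_def by (intro L2_continuous_ball smooth_continuous smooth_grad sW)
  \<comment> \<open>Stated for general \<open>U\<close> and \<open>H\<close> because it is applied
    to differences of mollifications for the Cauchy property, and to single ones for the final
    bound.\<close>
  have energy: "(norm2 (cut (ball 0 3) (grad U)))^2
      \<le> - (\<integral>x. \<zeta> x * U x * H x) + (1/2) * (\<integral>x. laplacian \<zeta> x * (U x)^2)"
    if U: "smooth U" and H: "\<And>x. \<zeta> x * laplacian U x = \<zeta> x * H x" for U H
  proof -
    have "(norm2 (cut (ball 0 3) (grad U)))^2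
        = (\<integral>x. (norm (indicator (ball 0 3) x *R grad U x))^2)"
      by (rule L2_norm_sq)
    also have "\<dots> \<le> (\<integral>x. \<zeta> x * (norm (grad U x))^2)"
    proof (rule integral_mono)
      show "L1 (\<lambda>x. (norm (indicator (ball 0 3) x *R grad U x))^2)"
        by (intro L2_integrable L2_continuous_ball smooth_continuous smooth_grad U)
      show "L1 (\<lambda>x. \<zeta> x * (norm (grad U x))^2)"
        unfolding norm_grad_sq unfolding power2_eq_square
        by (intro test_integrable[of UNIV] test_mult_right \<zeta> smooth_intros U)
      show "(norm (indicator (ball 0 3) x *R grad U x))^2 \<le> \<zeta> x * (norm (grad U x))^2" for x
        using \<zeta>(2)[of x] \<zeta>(3)[of x] by (cases "norm x < 3") auto
    qed
    also have "\<dots> = - (\<integral>x. \<zeta> x * U x * laplacian U x) + (1/2) * (\<integral>x. laplacian \<zeta> x * (U x)^2)"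
      by (rule energy_identity[OF \<zeta>(1) U])
    also have "(\<integral>x. \<zeta> x * U x * laplacian U x) = (\<integral>x. \<zeta> x * U x * H x)"
    proof -
      have "\<zeta> x * U x * laplacian U x = \<zeta> x * U x * H x" for x
        using H[of x] by (metis mult.assoc mult.commute)
      then show ?thesis by (simp only:)
    qed
    finally show ?thesis .
  qed
  have diffE: "(dist2 (D k) (D l))^2 \<le> B1 * dist2 (W k) (W l) * dist2 (h k) (h l)
      + B2 * (dist2 (W k) (W l))^2" if kl: "k \<ge> 2" "l \<ge> 2" for k l
  proof -
    let ?U = "\<lambda>x. W k x - W l x" and ?H = "\<lambda>x. h k x - h l x"
    have UL: "L2 ?U" and HL: "L2 ?H" by (intro L2_diff WL hL)+
    have sU: "smooth ?U" by (intro smooth_diff sW)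
    have "laplacian ?U x = laplacian (W k) x - laplacian (W l) x" for x
    proof -
      have "dirderiv b (\<lambda>x. W k x - W l x) = (\<lambda>x. dirderiv b (W k) x - dirderiv b (W l) x)" for b
        by (simp add: fun_eq_iff dirderiv_diff smoothD sW)
      then show ?thesis
        by (simp add: laplacian_def dirderiv_diff smoothD smooth_dirderiv sW sum_subtractf)
    qed
    then have "\<zeta> x * laplacian ?U x = \<zeta> x * ?H x" for x
      using lapW[OF kl(1), of x] lapW[OF kl(2), of x] by auto
    from energy[OF sU this]
    have "(norm2 (cut (ball 0 3) (grad ?U)))^2
      \<le> - (\<integral>x. \<zeta> x * ?U x * ?H x) + (1/2) * (\<integral>x. laplacian \<zeta> x * (?U x)^2)" .
    moreover have "- (\<integral>x. \<zeta> x * ?U x * ?H x) \<le> B1 * norm2 ?U * norm2 ?H"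
    proof -
      have zU: "L2 (\<lambda>x. \<zeta> x * ?U x)" "norm2 (\<lambda>x. \<zeta> x * ?U x) \<le> B1 * norm2 ?U"
        using L2_bounded_mult[OF UL, of \<zeta> B1] B1 by auto
      have "\<bar>\<integral>x. (\<zeta> x * ?U x) \<bullet> ?H x \<partial>lborel\<bar> \<le> norm2 (\<lambda>x. \<zeta> x * ?U x) * norm2 ?H"
        by (rule L2_Cauchy_Schwarz[OF zU(1) HL])
      also have "\<dots> \<le> B1 * norm2 ?U * norm2 ?H"
        by (intro mult_right_mono zU L2_norm_nonneg)
      finally show ?thesis by simp
    qed
    moreover have "(1/2) * (\<integral>x. laplacian \<zeta> x * (?U x)^2) \<le> B2 * (norm2 ?U)^2"
    proof -
      have iU: "L1 (\<lambda>x. (?U x)^2)" by (rule integrable_square[OF UL])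
      have "(\<integral>x. laplacian \<zeta> x * (?U x)^2) \<le> (\<integral>x. B2 * (?U x)^2)"
        using B2 iU by (intro integral_mono integrable_bounded_mult[where B=B2] mult_right_mono)
          (auto intro: order_trans[OF abs_ge_self])
      then have "(\<integral>x. laplacian \<zeta> x * (?U x)^2) \<le> B2 * (norm2 ?U)^2"
        by (simp add: L2_norm_sq)
      moreover have "0 \<le> B2 * (norm2 ?U)^2" using B2 by simp
      ultimately show ?thesis by linarith
    qed
    moreover have "(cut (ball 0 3) (grad ?U)) = (\<lambda>x. D k x - D l x)"
      by (simp add: D_def fun_eq_iff grad_diff smoothD sW scaleR_diff_right)
    ultimately show ?thesis by simp
  qed
  have Cauchy: "\<exists>N. \<forall>m\<ge>N. \<forall>n\<ge>N. dist2 (D m) (D n) < e" if "e > 0" for e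
  proof (rule L2_Cauchy_dominated[OF WL r(1) Wlim hL g hlim, of 2 _ _ "B1 + B2"])
    show "(dist2 (D k) (D l))^2 \<le> (B1 + B2) * (dist2 (W k) (W l) + dist2 (h k) (h l))^2" if "k \<ge> 2" "l \<ge> 2" for k l
    proof -
      have "B1 * x * y + B2 * x^2 \<le> (B1 + B2) * (x + y)^2" if "x \<ge> 0" "y \<ge> 0" for x y
        using that B1 B2 by (simp add: power2_eq_square algebra_simps)
      from order_trans[OF diffE[OF that] this] show ?thesis by (simp add: L2_norm_nonneg)
    qed
  qed (use B1 B2 that in auto)
  obtain G where G: "L2 G" "lim2 D G"
    "\<And>x. indicator (ball (0::'a) 3) x = (0::real) \<Longrightarrow> G x = 0"
  proof (rule L2_complete[OF DL _ _ Cauchy])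
    show "L2 (indicator (ball 0 3) :: 'a \<Rightarrow> real)"
      by (rule L2_indicator) auto
  qed (auto simp: D_def)
  show thesis
  proof (rule that[OF G(1)])
    show "G x = 0" if "norm x \<ge> 3" for x using G(3)[of x] that by simp
    fix b :: 'a and \<phi> :: "'a \<Rightarrow> real" assume \<phi>: "test_function (ball 0 3) \<phi>"
    have \<phi>U: "test_function UNIV \<phi>" using \<phi> by (rule test_mono) simp
    have l1: "(\<lambda>k. \<integral>x. W k x * dirderiv b \<phi> x) ----> (\<integral>x. r x * dirderiv b \<phi> x)"
      by (intro L2_tendsto_mult WL r Wlim L2_test_function[OF test_dirderiv[OF \<phi>]])
    have l2: "(\<lambda>k. \<integral>x. D k x \<bullet> (\<phi> x *R b)) ----> (\<integral>x. G x \<bullet> (\<phi> x *R b))"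
    proof (intro L2_tendsto_inner DL G)
      have [measurable]: "\<phi> \<in> Borel" by (rule measurable_test_function[OF \<phi>])
      have "(\<lambda>x. \<phi> x *R b) \<in> Borel" by measurable
      then show "L2 (\<lambda>x. \<phi> x *R b)"
        by (intro L2_bound(1)[OF L2_test_function[OF \<phi>], where C="norm b"]) auto
    qed
    have "(\<integral>x. W k x * dirderiv b \<phi> x) = - (\<integral>x. D k x \<bullet> (\<phi> x *R b))" for k
    proof -
      have "\<phi> x * dirderiv b (W k) x = D k x \<bullet> (\<phi> x *R b)" for x
        using test_outside[OF \<phi>, of x] by (cases "norm x < 3") (auto simp: D_def grad_inner smoothD sW)
      then have "(\<integral>x. \<phi> x * dirderiv b (W k) x) = (\<integral>x. D k x \<bullet> (\<phi> x *R b))"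
        by (simp only:)
      moreover have "(\<integral>x. W k x * dirderiv b \<phi> x) = (\<integral>x. dirderiv b \<phi> x * W k x)"
        by (simp add: mult.commute)
      ultimately show ?thesis
        using integral_dirderiv_mult[OF \<phi>U sW, of b k] by (simp only:)
    qed
    then have "(\<lambda>k. - (\<integral>x. D k x \<bullet> (\<phi> x *R b))) ----> (\<integral>x. r x * dirderiv b \<phi> x)"
      using l1 by simp
    with tendsto_minus[OF l2] have "(\<integral>x. r x * dirderiv b \<phi> x) = - (\<integral>x. G x \<bullet> (\<phi> x *R b))"
      using LIMSEQ_unique by blast
    then show "(\<integral>x. dirderiv b \<phi> x * r x) = - (\<integral>x. \<phi> x * (G x \<bullet> b))"
      by (simp add: mult.commute)
  next
    have n: "(\<lambda>k. (norm2 (D k))^2) ----> (norm2 G)^2"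
      by (intro tendsto_power L2_tendsto_norm DL G)
    have zW: "L2 (\<lambda>x. \<zeta> x * W k x)" "L2 (\<lambda>x. laplacian \<zeta> x * W k x)" for k
      using L2_bounded_mult(1)[OF WL, of \<zeta> B1 k] L2_bounded_mult(1)[OF WL, of "laplacian \<zeta>" B2 k] B1 B2 by auto
    have zr: "L2 (\<lambda>x. \<zeta> x * r x)" "L2 (\<lambda>x. laplacian \<zeta> x * r x)"
      using L2_bounded_mult(1)[OF r(1), of \<zeta> B1] L2_bounded_mult(1)[OF r(1), of "laplacian \<zeta>" B2] B1 B2 by auto
    have z1: "(\<lambda>k. norm2 (\<lambda>x. \<zeta> x * W k x - \<zeta> x * r x)) ----> 0"
      using L2_tendsto_bounded_mult[OF WL r(1) Wlim, of \<zeta> B1] B1 by simp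
    have z2: "(\<lambda>k. norm2 (\<lambda>x. laplacian \<zeta> x * W k x - laplacian \<zeta> x * r x)) ----> 0"
      using L2_tendsto_bounded_mult[OF WL r(1) Wlim, of "laplacian \<zeta>" B2] B2 by simp
    \<comment> \<open>The limit is taken in the signed form and not in absolute values: the well
      added later enters through \<open>g\<close> with a favourable sign.\<close>
    have "(\<lambda>k. - (\<integral>x. \<zeta> x * W k x * h k x) + (1/2) * (\<integral>x. laplacian \<zeta> x * W k x * W k x))
      ----> - (\<integral>x. \<zeta> x * r x * g x) + (1/2) * (\<integral>x. laplacian \<zeta> x * r x * r x)"
      by (intro tendsto_intros L2_tendsto_mult2 zW zr z1 z2 WL r hL g Wlim hlim)
    moreover have "\<forall>k\<ge>2. (norm2 (D k))^2
        \<le> - (\<integral>x. \<zeta> x * W k x * h k x) + (1/2) * (\<integral>x. laplacian \<zeta> x * W k x * W k x)"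
      using energy[OF sW lapW] by (simp add: D_def[abs_def] power2_eq_square mult.assoc)
    ultimately have "(norm2 G)^2 \<le> - (\<integral>x. \<zeta> x * r x * g x) + (1/2) * (\<integral>x. laplacian \<zeta> x * r x * r x)"
      by (intro LIMSEQ_le[OF n]) auto
    then show "(norm2 G)^2 \<le> - (\<integral>x. \<zeta> x * r x * g x) + (1/2) * (\<integral>x. laplacian \<zeta> x * (r x)^2)"
      by (simp add: power2_eq_square mult.assoc)
  qed
qed

text \<open>The indicator of the ball with the middle radius, mollified at half the gap: at points
  with \<open>norm x \<le> r1\<close> the mollifier sees only ones, and beyond \<open>r2\<close>
  only zeros.\<close>

lemma smooth_cutoff:
  assumes r: "0 < r1" "r1 < r2"
  obtains \<eta> :: "'a::euclidean_space \<Rightarrow> real" where "test_function UNIV \<eta>" "\<And>x. 0 \<le> \<eta> x" "\<And>x. \<eta> x \<le> 1"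
    "\<And>x. norm x \<le> r1 \<Longrightarrow> \<eta> x = 1" "\<And>x. norm x \<ge> r2 \<Longrightarrow> \<eta> x = 0"
proof -
  define e where "e = (r2 - r1) / 2"
  define m where "m = (r1 + r2) / 2"
  have e: "e > 0" using r by (simp add: e_def)
  let ?m = "mollifier e :: 'a \<Rightarrow> real" and ?I = "indicator (ball 0 m) :: 'a \<Rightarrow> real"
  define \<eta> where "\<eta> = conv ?m ?I"
  have tm: "test_function UNIV ?m" using e by (rule test_mollifier)
  have Ii: "L1 ?I"
    by (intro integrable_real_indicator) auto
  have sm: "smooth \<eta>" unfolding \<eta>_def by (rule smooth_conv[OF tm Ii])
  have mi: "L1 (\<lambda>y. ?m (x - y))" "(\<integral>y. ?m (x - y)) = 1" for x
    using integrable_lborel_affine[of "-1" ?m x] test_integrable[OF tm]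
      integral_reflect[of ?m x] integral_mollifier[OF e] by auto
  have nn: "0 \<le> ?m z" for z by (rule mollifier_nonneg[OF e])
  have z: "?m (x - y) = 0" if "norm (x - y) \<ge> e" for x y by (rule mollifier_zero[OF e that])
  have 0: "0 \<le> \<eta> x" for x unfolding \<eta>_def conv_def using nn by (intro integral_nonneg_AE) auto
  have 1: "\<eta> x \<le> 1" for x
  proof -
    have "\<eta> x \<le> (\<integral>y. ?m (x - y))"
      unfolding \<eta>_def conv_def using nn
      by (intro integral_mono conv_integrable tm Ii mi) (auto simp: indicator_def)
    then show ?thesis using mi by simp
  qed
  have in1: "\<eta> x = 1" if "norm x \<le> r1" for x
  proof -
    have "?m (x - y) * ?I y = ?m (x - y)" for y
    proof (cases "norm (x - y) \<ge> e")
      case False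
      have "norm y \<le> norm x + norm (y - x)" by (rule norm_triangle_sub)
      then have "norm y < m" using False that by (simp add: m_def e_def norm_minus_commute field_simps)
      then show ?thesis by simp
    qed (simp add: z)
    then have "\<eta> x = (\<integral>y. ?m (x - y))" unfolding \<eta>_def conv_def by (simp only:)
    then show ?thesis using mi by simp
  qed
  have out: "\<eta> x = 0" if "norm x \<ge> r2" for x
  proof -
    have "?m (x - y) * ?I y = 0" for y
    proof (cases "norm (x - y) \<ge> e")
      case False
      have "norm x \<le> norm y + norm (x - y)" by (rule norm_triangle_sub)
      then have "norm y > m" using False that by (simp add: m_def e_def field_simps)
      then show ?thesis by simp
    qed (simp add: z)
    then have "\<eta> x = (\<integral>y. 0 \<partial>(lborel :: 'a measure))" unfolding \<eta>_def conv_def by (simp only:)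
    then show ?thesis by simp
  qed
  have "test_function UNIV \<eta>"
    by (rule test_functionI[where K="cball 0 r2"]) (auto simp: sm out)
  then show thesis using that 0 1 in1 out by blast
qed

text \<open>A function and its weak gradient are treated as one product valued function, so that
  completeness and the convex selection apply to both at once.\<close>

lemma L2_Pair:
  assumes "in_L2 M f" "in_L2 M g"
  shows "in_L2 M (\<lambda>x. (f x, g x))"
proof -
  have [measurable]: "f \<in> borel_measurable M" "g \<in> borel_measurable M" using assms L2_measurable by blast+
  have "(\<lambda>x. (f x, g x)) \<in> borel_measurable M" by measurable
  moreover have "(norm (f x, g x))^2 = (norm (f x))^2 + (norm (g x))^2" for x
    by (simp add: norm_Pair)
  ultimately show ?thesis using assms by (simp add: in_L2_def)
qed

lemma L2_norm_Pair:
  assumes "in_L2 M f" "in_L2 M g"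
  shows "(L2_norm M (\<lambda>x. (f x, g x)))^2 = (L2_norm M f)^2 + (L2_norm M g)^2"
  using assms by (simp add: L2_norm_sq norm_Pair L2_integrable)

lemma L2_fst: "in_L2 M F \<Longrightarrow> in_L2 M (\<lambda>x. fst (F x))"
  and L2_norm_fst: "in_L2 M F \<Longrightarrow> L2_norm M (\<lambda>x. fst (F x)) \<le> L2_norm M F"
  and L2_snd: "in_L2 M F \<Longrightarrow> in_L2 M (\<lambda>x. snd (F x))"
  and L2_norm_snd: "in_L2 M F \<Longrightarrow> L2_norm M (\<lambda>x. snd (F x)) \<le> L2_norm M F"
proof -
  assume F: "in_L2 M F"
  then have [measurable]: "F \<in> borel_measurable M" by (rule L2_measurable)
  have m: "(\<lambda>x. fst (F x)) \<in> borel_measurable M" "(\<lambda>x. snd (F x)) \<in> borel_measurable M"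
    by (intro borel_measurable_continuous_on[where f=fst and g=F] borel_measurable_continuous_on[where f=snd and g=F]; auto intro: continuous_intros)+
  have norm_le: "norm (fst (F x)) \<le> norm (F x)" "norm (snd (F x)) \<le> norm (F x)" for x
    using norm_fst_le[of "fst (F x)" "snd (F x)"] norm_snd_le[of "snd (F x)" "fst (F x)"] by simp_all
  show "in_L2 M (\<lambda>x. fst (F x))" "L2_norm M (\<lambda>x. fst (F x)) \<le> L2_norm M F"
    using L2_bound[OF F m(1), of 1] norm_le by auto
  show "in_L2 M (\<lambda>x. snd (F x))" "L2_norm M (\<lambda>x. snd (F x)) \<le> L2_norm M F"
    using L2_bound[OF F m(2), of 1] norm_le by auto
qed

lemma L2_norm_midpoint_le:
  assumes "in_L2 M f" "in_L2 M g" "L2_norm M f \<le> c" "L2_norm M g \<le> c"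
  shows "L2_norm M (\<lambda>x. (1/2) *R (f x + g x)) \<le> c"
  using L2_norm_triangle[OF assms(1,2)] assms(3,4) by (simp add: L2_norm_scaleR)

text \<open>The zero Dirichlet condition on \<open>|x| = 1/2\<close> is produced by a potential well of depth
  \<open>- n\<close> in the inner ball: this keeps the coefficient nondecreasing along rays, so the Carleman
  bounds are uniform in \<open>n\<close>, while the energy forces the solutions to vanish there.\<close>

lemma corrector:
  fixes A V f \<zeta> :: "'a::euclidean_space \<Rightarrow> real"
  assumes A: "A \<in> Borel" "\<And>x. 0 \<le> A x" "\<And>x. A x \<le> B"
    and mono: "\<And>x l. l \<ge> 1 \<Longrightarrow> norm x > 1/2 \<Longrightarrow> A x \<le> A (l *R x)"
    and V: "V \<in> Borel" "\<And>x. \<bar>V x\<bar> \<le> N"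
    and f: "L2 f" and t: "t > 0" "N + 1 \<le> 4 * t"
    and \<zeta>: "test_function UNIV \<zeta>" "\<And>x. \<zeta> x \<ge> 0" "\<And>x. \<zeta> x \<le> 1" "\<And>x. norm x < 3 \<Longrightarrow> \<zeta> x = 1"
      "\<And>x. norm x \<ge> 7/2 \<Longrightarrow> \<zeta> x = 0" "\<And>x. \<bar>laplacian \<zeta> x\<bar> \<le> C"
  defines "Q \<equiv> norm2 (\<lambda>x. gauss t x * f x)"
  obtains r G where "L2 r" "L2 G" "\<And>x. norm x \<ge> 4 \<Longrightarrow> r x = 0"
    "AE x in lborel. norm x \<le> 1/2 \<longrightarrow> r x = 0"
    "norm2 (\<lambda>x. gauss t x * r x) \<le> Q"
    "norm2 r \<le> exp (16 * t) * Q"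
    "(norm2 G)^2 \<le> (1 + B + N + C) * ((exp (16 * t) * Q)^2 + (norm2 f)^2)"
    "\<And>\<phi>. test_function (ball 0 4 - cball 0 (1/2)) \<phi> \<Longrightarrow>
      (\<integral>x. r x * (laplacian \<phi> x + (A x + V x) * \<phi> x)) = (\<integral>x. f x * \<phi> x)"
    "\<And>b \<phi>. test_function (ball 0 3) \<phi> \<Longrightarrow> (\<integral>x. dirderiv b \<phi> x * r x) = - (\<integral>x. \<phi> x * (G x \<bullet> b))"
proof -
  let ?E = "exp (16 * t) * Q"
  define P where "P = (1 + B + N + C) * (?E^2 + (norm2 f)^2)"
  have pos: "0 \<le> B" "0 \<le> N" "0 \<le> C" "0 \<le> Q"
    using A(2,3)[of 0] V(2)[of 0] \<zeta>(6)[of 0] by (auto simp: Q_def L2_norm_nonneg)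
  have P0: "P \<ge> 0" unfolding P_def using pos by simp
  define w' where "w' x = gauss t x" for x :: 'a
  have w'm[measurable]: "w' \<in> Borel"
    unfolding w'_def[abs_def] by (intro smooth_measurable smooth_intros)
  have w'1: "\<bar>w' x\<bar> \<le> 1" for x using t by (simp add: w'_def)
  note [measurable] = A(1) V(1)
  let ?J = "indicator (cball 0 (1/2)) :: 'a \<Rightarrow> real"
  have Jm[measurable]: "?J \<in> Borel" by (intro borel_measurable_indicator) auto
  have fm[measurable]: "f \<in> Borel" using L2_measurable[OF f] by simp
  define L where "L \<phi> x = laplacian \<phi> x + (A x + V x) * \<phi> x" for \<phi> and x :: 'a
  have AV: "\<bar>A x + V x\<bar> \<le> B + N" for x using A(2,3)[of x] V(2)[of x] by linarith
  have LL: "L2 (L \<phi>)" if "test_function \<Omega> \<phi>" for \<phi> and \<Omega> :: "'a set"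
    unfolding L_def[abs_def]
    by (intro L2_add L2_bounded_mult(1)[where B="B + N"] L2_test_function[OF test_laplacian[OF that]]
        L2_test_function[OF that] AV) simp
  \<comment> \<open>The linear constraints, each a pair of a square integrable test vector and the
    prescribed value of the inner product. The first kind expresses the equation outside the inner
    ball, the second says that the second component is the weak gradient of the first.\<close>
  define S where "S = {(\<lambda>x. (L \<phi> x, 0 :: 'a), \<integral>x. f x * \<phi> x) | \<phi>. test_function (ball 0 4 - cball 0 (1/2)) \<phi>} \<union>
    {(\<lambda>x. (dirderiv b \<phi> x, \<phi> x *R b), 0) | b \<phi>. test_function (ball 0 3) \<phi>}"
  \<comment> \<open>Every condition is convex. Only the last one depends on \<open>n\<close>, and it
    becomes stricter, so the sets decrease; in the limit it forces the function to vanish in the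
    inner ball.\<close>
  define Cs where "Cs n = {F. L2 F \<and> (\<forall>x. norm x \<ge> 4 \<longrightarrow> F x = 0) \<and> (\<forall>p\<in>S. (\<integral>x. F x \<bullet> fst p x) = snd p) \<and>
      norm2 (\<lambda>x. w' x * fst (F x)) \<le> Q \<and> norm2 (\<lambda>x. fst (F x)) \<le> ?E \<and> norm2 (\<lambda>x. snd (F x)) \<le> sqrt P \<and>
      norm2 (\<lambda>x. ?J x * fst (F x)) \<le> sqrt (P / real (Suc n))}" for n
  have \<phi>bL: "L2 (\<lambda>x. \<phi> x *R b)" if \<phi>: "test_function (ball 0 3) \<phi>" for \<phi> and b :: 'a
    by (rule L2_bound(1)[OF L2_test_function[OF \<phi>], where C="norm b"])
      (use measurable_test_function[OF \<phi>] in auto)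
  have SL: "L2 (fst p)" if "p \<in> S" for p
    using that L2_Pair[OF LL L2_zero] L2_Pair[OF L2_test_function[OF test_dirderiv] \<phi>bL]
    unfolding S_def by auto
  have split: "(\<integral>x. (u x, U x) \<bullet> (dirderiv b \<phi> x, \<phi> x *R b)) = (\<integral>x. dirderiv b \<phi> x * u x) + (\<integral>x. \<phi> x * (U x \<bullet> b))"
    if "L2 u" "L2 U" and \<phi>: "test_function (ball 0 3) \<phi>" for u b \<phi> and U :: "'a \<Rightarrow> 'a"
    using L2_integrable_mult[OF L2_test_function[OF test_dirderiv[OF \<phi>]] that(1), of b] L2_integrable_inner[OF that(2) \<phi>bL[OF \<phi>, of b]]
    by (simp add: mult.commute)
  have ex: "\<exists>F\<in>Cs n. norm2 F \<le> sqrt (?E^2 + P)" for n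
  proof -
    \<comment> \<open>The well of depth \<open>n + 1\<close>. For \<open>l \<ge> 1\<close> dilation
      may leave the inner ball but never enters it, and outside \<open>A\<close> is nonnegative, so
      \<open>a\<close> is nondecreasing along all rays.\<close>
    define a where "a x = (if norm x \<le> 1/2 then - real (Suc n) else A x)" for x
    have am: "a \<in> Borel" unfolding a_def[abs_def] by measurable
    have ab: "\<bar>a x\<bar> \<le> max (real (Suc n)) B" for x using A(2,3)[of x] by (auto simp: a_def)
    have amono: "a x \<le> a (l *R x)" if "l \<ge> 1" for x l
    proof (cases "norm x \<le> 1/2")
      case True
      have "- real (Suc n) \<le> A (l *R x)" using A(2)[of "l *R x"] by linarith
      then show ?thesis using True by (simp add: a_def)
    next
      case False
      have "norm x \<le> norm (l *R x)" using that by (simp add: mult_le_cancel_right1)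
      then show ?thesis using False mono[OF that, of x] by (simp add: a_def)
    qed
    obtain r where r: "L2 r" "\<And>x. norm x \<ge> 4 \<Longrightarrow> r x = 0"
      "norm2 (\<lambda>x. w' x * r x) \<le> Q"
      "\<And>\<phi>. test_function (ball 0 4) \<phi> \<Longrightarrow>
        (\<integral>x. r x * (laplacian \<phi> x + (a x + V x) * \<phi> x)) = (\<integral>x. f x * \<phi> x)"
      using carleman_solve[OF am ab amono V f t] by (auto simp: w'_def Q_def)
    have rm[measurable]: "r \<in> Borel" using L2_measurable[OF r(1)] by simp
    have rE: "norm2 r \<le> ?E"
    proof -
      have "norm2 r \<le> exp (16 * t) * norm2 (\<lambda>x. w' x * r x)"
      proof (rule L2_bound(2)[OF L2_bounded_mult(1)[OF r(1) _ w'1]])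
        have "norm (r x) \<le> exp (16 * t) * norm (w' x * r x)" for x
        proof (cases "norm x \<ge> 4")
          case False
          then have "(norm x)^2 \<le> 4^2" by (intro power_mono) auto
          then have "1 \<le> exp (16 * t + - t * (norm x)^2)" using t by simp
          then have "1 * \<bar>r x\<bar> \<le> exp (16 * t + - t * (norm x)^2) * \<bar>r x\<bar>" by (rule mult_right_mono) simp
          then show ?thesis unfolding exp_add by (simp add: w'_def abs_mult mult.assoc)
        qed (simp add: r(2))
        then show "AE x in lborel. norm (r x) \<le> exp (16 * t) * norm (w' x * r x)" by simp
      qed auto
      also have "\<dots> \<le> ?E" using r(3) by simp
      finally show ?thesis .
    qed
    \<comment> \<open>The whole zeroth-order term is moved to the right, so that the regularity for
      the pure Laplacian applies. The bound on \<open>g\<close> depends on \<open>n\<close>; only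
      its sign structure will be used.\<close>
    define g where "g x = f x - (a x + V x) * r x" for x
    have avb: "\<bar>a x + V x\<bar> \<le> max (real (Suc n)) B + N" for x using ab[of x] V(2)[of x] by linarith
    have avm: "(\<lambda>x. a x + V x) \<in> borel_measurable lborel" using am by simp
    have avr: "L2 (\<lambda>x. (a x + V x) * r x)"
      by (rule L2_bounded_mult(1)[OF r(1) avm avb])
    have gL: "L2 g" unfolding g_def[abs_def] by (intro L2_diff f avr)
    have geq: "(\<integral>x. r x * laplacian \<phi> x) = (\<integral>x. g x * \<phi> x)" if \<phi>: "test_function (ball 0 4) \<phi>" for \<phi>
    proof -
      note pL = L2_test_function[OF \<phi>] and lL = L2_test_function[OF test_laplacian[OF \<phi>]]
      have i: "L1 (\<lambda>x. r x * laplacian \<phi> x)" "L1 (\<lambda>x. (a x + V x) * r x * \<phi> x)"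
        "L1 (\<lambda>x. f x * \<phi> x)"
        by (intro L2_integrable_mult r lL avr f pL)+
      have "(\<integral>x. r x * (laplacian \<phi> x + (a x + V x) * \<phi> x))
          = (\<integral>x. r x * laplacian \<phi> x + (a x + V x) * r x * \<phi> x)"
        by (intro Bochner_Integration.integral_cong refl) (simp add: algebra_simps)
      also have "\<dots> = (\<integral>x. r x * laplacian \<phi> x) + (\<integral>x. (a x + V x) * r x * \<phi> x)"
        using i by simp
      finally have "(\<integral>x. r x * laplacian \<phi> x) = (\<integral>x. f x * \<phi> x) - (\<integral>x. (a x + V x) * r x * \<phi> x)"
        using r(4)[OF \<phi>] by simp
      also have "\<dots> = (\<integral>x. g x * \<phi> x)" using i by (simp add: g_def left_diff_distrib)
      finally show ?thesis .
    qed
    obtain G :: "'a \<Rightarrow> 'a" where G: "L2 G" "\<And>x. norm x \<ge> 3 \<Longrightarrow> G x = 0"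
      "\<And>b \<phi>. test_function (ball 0 3) \<phi> \<Longrightarrow> (\<integral>x. dirderiv b \<phi> x * r x) = - (\<integral>x. \<phi> x * (G x \<bullet> b))"
      "(norm2 G)^2 \<le> - (\<integral>x. \<zeta> x * r x * g x) + (1/2) * (\<integral>x. laplacian \<zeta> x * (r x)^2)"
      using interior_H1[OF r(1,2) gL geq \<zeta>(1,2,4,5)] by blast
    have zr: "L2 (\<lambda>x. \<zeta> x * r x)"
      using \<zeta>(2,3) by (intro L2_bounded_mult(1)[OF r(1), where B=1]) (auto simp: measurable_test_function[OF \<zeta>(1)])
    have i1: "L1 (\<lambda>x. \<zeta> x * r x * g x)" by (intro L2_integrable_mult zr gL)
    have ir: "L1 (\<lambda>x. (r x)^2)" and iff: "L1 (\<lambda>x. (f x)^2)"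
      using integrable_square r(1) f by blast+
    have i2: "L1 (\<lambda>x. laplacian \<zeta> x * (r x)^2)"
      by (rule integrable_bounded_mult[OF _ \<zeta>(6) ir]) (simp add: measurable_test_function[OF test_laplacian[OF \<zeta>(1)]])
    have Jr: "L2 (\<lambda>x. ?J x * r x)"
      by (rule L2_bounded_mult(1)[OF r(1), where B=1]) (auto simp: indicator_def)
    have iJ: "L1 (\<lambda>x. (?J x * r x)^2)" by (rule integrable_square[OF Jr])
    \<comment> \<open>In the inner ball \<open>\<zeta>\<close> is one and the well contributes
      \<open>- (n + 1) r^2\<close>. All other terms are bounded by \<open>r^2\<close> and
      \<open>f^2\<close> with a factor independent of \<open>n\<close>.\<close>
    have pt: "- (\<zeta> x * r x * g x) + (1/2) * (laplacian \<zeta> x * (r x)^2)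
        \<le> (1 + B + N + C) * ((r x)^2 + (f x)^2) - real (Suc n) * (?J x * r x)^2" for x
    proof -
      have "- (\<zeta> x * r x * g x) = - (\<zeta> x * (r x * f x)) + \<zeta> x * a x * (r x)^2 + \<zeta> x * V x * (r x)^2"
        by (simp add: g_def power2_eq_square algebra_simps)
      moreover have "- (\<zeta> x * (r x * f x)) \<le> (r x)^2 + (f x)^2"
      proof -
        have "\<bar>\<zeta> x * (r x * f x)\<bar> \<le> 1 * \<bar>r x * f x\<bar>"
          unfolding abs_mult[of "\<zeta> x"] using \<zeta>(2,3)[of x] by (intro mult_right_mono) auto
        moreover have "\<bar>r x * f x\<bar> \<le> (r x)^2 + (f x)^2"
          using sum_squares_bound[of "\<bar>r x\<bar>" "\<bar>f x\<bar>"] abs_ge_zero[of "r x * f x"]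
          unfolding abs_mult power2_abs by linarith
        ultimately show ?thesis by linarith
      qed
      moreover have "\<zeta> x * a x * (r x)^2 \<le> B * (r x)^2 - real (Suc n) * (?J x * r x)^2"
      proof (cases "norm x \<le> 1/2")
        case True
        then have "\<zeta> x = 1" using \<zeta>(4) by simp
        moreover have "0 \<le> B * (r x)^2" using pos by simp
        ultimately show ?thesis using True by (simp add: a_def algebra_simps)
      next
        case False
        have "\<zeta> x * A x \<le> 1 * B" using \<zeta>(2,3)[of x] A(2,3)[of x] by (intro mult_mono) auto
        then show ?thesis using False by (simp add: a_def mult_right_mono)
      qed
      moreover have "\<zeta> x * V x * (r x)^2 \<le> N * (r x)^2"
      proof -
        have "\<bar>\<zeta> x * V x\<bar> \<le> 1 * N"
          unfolding abs_mult using \<zeta>(2,3)[of x] V(2)[of x] by (intro mult_mono) auto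
        then show ?thesis by (intro mult_right_mono) auto
      qed
      moreover have "(1/2) * (laplacian \<zeta> x * (r x)^2) \<le> C * (r x)^2"
      proof -
        have "laplacian \<zeta> x * (r x)^2 \<le> C * (r x)^2"
          using \<zeta>(6)[of x] by (intro mult_right_mono) auto
        moreover have "0 \<le> C * (r x)^2" using pos by simp
        ultimately show ?thesis by linarith
      qed
      moreover have "0 \<le> (B + N + C) * (f x)^2" using pos by simp
      ultimately show ?thesis by (simp add: distrib_right distrib_left)
    qed
    have "(norm2 G)^2 \<le> (\<integral>x. - (\<zeta> x * r x * g x) + (1/2) * (laplacian \<zeta> x * (r x)^2))"
      using G(4) i1 i2 by simp
    also have "\<dots> \<le> (\<integral>x. (1 + B + N + C) * ((r x)^2 + (f x)^2) - real (Suc n) * (?J x * r x)^2)"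
    proof (rule integral_mono[OF _ _ pt])
      show "L1 (\<lambda>x. - (\<zeta> x * r x * g x) + (1/2) * (laplacian \<zeta> x * (r x)^2))"
        using i1 i2 by simp
      show "L1 (\<lambda>x. (1 + B + N + C) * ((r x)^2 + (f x)^2) - real (Suc n) * (?J x * r x)^2)"
        using ir iff iJ by (intro Bochner_Integration.integrable_diff integrable_mult_right Bochner_Integration.integrable_add)
    qed
    also have "\<dots> = (1 + B + N + C) * ((norm2 r)^2 + (norm2 f)^2)
        - real (Suc n) * (norm2 (\<lambda>x. ?J x * r x))^2"
    proof -
      have "(\<integral>x. (1 + B + N + C) * ((r x)^2 + (f x)^2) - real (Suc n) * (?J x * r x)^2)
        = (\<integral>x. (1 + B + N + C) * ((r x)^2 + (f x)^2)) - (\<integral>x. real (Suc n) * (?J x * r x)^2)"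
        using ir iff iJ by (intro Bochner_Integration.integral_diff integrable_mult_right Bochner_Integration.integrable_add)
      then show ?thesis using ir iff by (simp only: L2_norm_sq_real integral_mult_right_zero Bochner_Integration.integral_add)
    qed
    also have "\<dots> \<le> P - real (Suc n) * (norm2 (\<lambda>x. ?J x * r x))^2"
      unfolding P_def using pos rE by (intro diff_right_mono mult_left_mono add_right_mono power_mono) (auto simp: L2_norm_nonneg)
    \<comment> \<open>Gradient energy and penalty share the budget \<open>P\<close>, which does not
      involve \<open>n\<close>; hence the mass in the inner ball is of order
      \<open>1 / (n + 1)\<close>.\<close>
    finally have fin: "(norm2 G)^2 + real (Suc n) * (norm2 (\<lambda>x. ?J x * r x))^2 \<le> P" by simp
    have GP: "(norm2 G)^2 \<le> P"
      using fin mult_nonneg_nonneg[OF of_nat_0_le_iff[of "Suc n"] zero_le_power2[of "norm2 (\<lambda>x. ?J x * r x)"]]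
      by linarith
    have "real (Suc n) * (norm2 (\<lambda>x. ?J x * r x))^2 \<le> P"
      using fin zero_le_power2[of "norm2 G"] by linarith
    then have JP: "(norm2 (\<lambda>x. ?J x * r x))^2 \<le> P / real (Suc n)"
      by (simp add: pos_le_divide_eq mult.commute)
    let ?F = "\<lambda>x. (r x, G x)"
    have "?F \<in> Cs n"
    proof -
      \<comment> \<open>Test functions supported away from the inner ball do not see the well, so
        \<open>a\<close> may be replaced by \<open>A\<close>.\<close>
      have "(\<integral>x. r x * L \<phi> x) = (\<integral>x. f x * \<phi> x)" if \<phi>: "test_function (ball 0 4 - cball 0 (1/2)) \<phi>" for \<phi>
      proof -
        have "L \<phi> x = laplacian \<phi> x + (a x + V x) * \<phi> x" for x
          using test_outside[OF \<phi>, of x] by (cases "norm x \<le> 1/2") (auto simp: L_def a_def)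
        then show ?thesis using r(4)[OF test_mono[OF \<phi>]] by auto
      qed
      then have "\<forall>p\<in>S. (\<integral>x. ?F x \<bullet> fst p x) = snd p"
        unfolding S_def using split[OF r(1) G(1)] G(3) by auto
      moreover have "G x = 0" if "norm x \<ge> 4" for x using G(2) that by simp
      ultimately show ?thesis
        unfolding Cs_def using L2_Pair[OF r(1) G(1)] r(2,3) rE GP JP by (auto simp: zero_prod_def real_le_rsqrt)
    qed
    moreover have "norm2 ?F \<le> sqrt (?E^2 + P)"
    proof (rule real_le_rsqrt)
      show "(norm2 ?F)^2 \<le> ?E^2 + P"
        unfolding L2_norm_Pair[OF r(1) G(1)] using rE GP by (intro add_mono power_mono) (auto simp: L2_norm_nonneg)
    qed
    ultimately show ?thesis by blast
  qed
  have w'L: "L2 (\<lambda>x. w' x * u x)" and JL: "L2 (\<lambda>x. ?J x * u x)" if "L2 u" for u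
    using w'1 by (intro L2_bounded_mult(1)[OF that, where B=1]; auto simp: indicator_def)+
  obtain F where F: "\<And>n. F n \<in> Cs n"
    "\<And>e. e > 0 \<Longrightarrow> \<exists>N. \<forall>m\<ge>N. \<forall>n\<ge>N. dist2 (F m) (F n) < e"
  proof (rule L2_nested_convex[of Cs lborel "sqrt (?E^2 + P)"])
    show "L2 F" if "F \<in> Cs n" for n F using that by (simp add: Cs_def)
    show "Cs (Suc n) \<subseteq> Cs n" for n
    proof -
      have "P / real (Suc (Suc n)) \<le> P / real (Suc n)" using P0 by (intro divide_left_mono) auto
      then have "sqrt (P / real (Suc (Suc n))) \<le> sqrt (P / real (Suc n))" by simp
      then show ?thesis unfolding Cs_def by (auto intro: order_trans)
    qed
    fix n F H assume FH: "F \<in> Cs n" "H \<in> Cs n"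
    have L: "L2 F" "L2 H" using FH by (auto simp: Cs_def)
    note LF = L2_fst[OF L(1)] L2_fst[OF L(2)] L2_snd[OF L(1)] L2_snd[OF L(2)]
    let ?K = "\<lambda>x. (1/2) *R (F x + H x)"
    have "(\<integral>x. ?K x \<bullet> fst p x) = snd p" if p: "p \<in> S" for p
      using L2_integrable_inner[OF L(1) SL[OF p]] L2_integrable_inner[OF L(2) SL[OF p]] FH p
      by (simp add: Cs_def inner_add_left)
    moreover have "norm2 (\<lambda>x. w' x * fst (?K x)) \<le> Q"
      using L2_norm_midpoint_le[OF w'L[OF LF(1)] w'L[OF LF(2)], of Q] FH by (simp add: Cs_def distrib_left mult.left_commute)
    moreover have "norm2 (\<lambda>x. fst (?K x)) \<le> ?E"
      using L2_norm_midpoint_le[OF LF(1,2), of ?E] FH by (simp add: Cs_def)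
    moreover have "norm2 (\<lambda>x. snd (?K x)) \<le> sqrt P"
      using L2_norm_midpoint_le[OF LF(3,4), of "sqrt P"] FH by (simp add: Cs_def)
    moreover have "norm2 (\<lambda>x. ?J x * fst (?K x)) \<le> sqrt (P / real (Suc n))"
      using L2_norm_midpoint_le[OF JL[OF LF(1)] JL[OF LF(2)], of "sqrt (P / real (Suc n))"] FH
      by (simp add: Cs_def distrib_left mult.left_commute)
    moreover have "L2 ?K" by (intro L2_scaleR L2_add L)
    moreover have "?K x = 0" if "norm x \<ge> 4" for x using FH that by (simp add: Cs_def)
    ultimately show "?K \<in> Cs n" unfolding Cs_def by auto
  qed (use ex in auto)
  have FL: "L2 (F n)" "norm x \<ge> 4 \<Longrightarrow> F n x = 0" for n x using F(1)[of n] by (auto simp: Cs_def)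
  obtain H where H: "L2 H" "lim2 F H"
    "\<And>x. indicator (ball (0::'a) 4) x = (0::real) \<Longrightarrow> H x = 0"
  proof (rule L2_complete[of lborel F "indicator (ball (0::'a) 4)"])
    show "L2 (indicator (ball 0 4) :: 'a \<Rightarrow> real)"
      by (rule L2_indicator) auto
    show "F n x = 0" if "indicator (ball 0 4) x = (0::real)" for n x
      using that by (intro FL(2)) (auto simp: indicator_def split: if_splits)
  qed (use FL F in auto)
  define r where "r x = fst (H x)" for x
  define G where "G x = snd (H x)" for x
  define rn where "rn n x = fst (F n x)" for n x
  define Gn where "Gn n x = snd (F n x)" for n x
  have rL: "L2 r" "L2 G" "L2 (rn n)" "L2 (Gn n)" for n
    unfolding r_def[abs_def] G_def[abs_def] rn_def[abs_def] Gn_def[abs_def]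
    by (intro L2_fst L2_snd H FL)+
  have rlim: "lim2 rn r"
  proof (rule tendsto_sandwich[OF _ _ tendsto_const H(2)])
    show "\<forall>\<^sub>F n in sequentially. dist2 (rn n) r \<le> dist2 (F n) H"
      using L2_norm_fst[OF L2_diff[OF FL(1) H(1)]] by (simp add: r_def rn_def)
  qed (simp add: L2_norm_nonneg)
  have Glim: "lim2 Gn G"
  proof (rule tendsto_sandwich[OF _ _ tendsto_const H(2)])
    show "\<forall>\<^sub>F n in sequentially. dist2 (Gn n) G \<le> dist2 (F n) H"
      using L2_norm_snd[OF L2_diff[OF FL(1) H(1)]] by (simp add: G_def Gn_def)
  qed (simp add: L2_norm_nonneg)
  have pr: "norm2 (\<lambda>x. w' x * rn n x) \<le> Q" "norm2 (rn n) \<le> ?E" "norm2 (Gn n) \<le> sqrt P"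
      "norm2 (\<lambda>x. ?J x * rn n x) \<le> sqrt (P / real (Suc n))" for n
    using F(1)[of n] unfolding Cs_def rn_def[abs_def] Gn_def[abs_def] by auto
  \<comment> \<open>The constraints in \<open>S\<close> are the same for all \<open>n\<close>, hence
    they hold along the whole sequence and pass to the strong limit.\<close>
  have eqH: "(\<integral>x. (r x, G x) \<bullet> K x) = c" if KS: "(K, c) \<in> S" for K c
  proof -
    have "(\<lambda>n. \<integral>x. F n x \<bullet> K x) ----> (\<integral>x. H x \<bullet> K x)" using SL[OF KS] by (intro L2_tendsto_inner FL H) simp
    moreover have "(\<lambda>n. \<integral>x. F n x \<bullet> K x) = (\<lambda>n. c)" using F(1) KS by (force simp: Cs_def)
    ultimately show ?thesis using LIMSEQ_unique[OF _ tendsto_const] by (simp add: r_def G_def)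
  qed
  show thesis
  proof (rule that[OF rL(1,2)])
    show "r x = 0" if "norm x \<ge> 4" for x
      using H(3)[of x] that by (simp add: r_def)
  next
    have lim: "(\<lambda>n. norm2 (\<lambda>x. ?J x * rn n x)) ----> norm2 (\<lambda>x. ?J x * r x)"
      by (intro L2_tendsto_norm JL rL L2_tendsto_bounded_mult[OF rL(3) rL(1) rlim, where B=1]) (auto simp: indicator_def)
    have "(\<lambda>n. P * inverse (real (Suc n))) ----> P * 0" by (intro tendsto_mult tendsto_const LIMSEQ_inverse_real_of_nat)
    then have "(\<lambda>n. sqrt (P / real (Suc n))) ----> sqrt 0"
      by (intro tendsto_real_sqrt) (simp add: divide_inverse)
    with lim have "norm2 (\<lambda>x. ?J x * r x) \<le> sqrt 0"
      by (rule LIMSEQ_le) (use pr(4) in auto)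
    then have "norm2 (\<lambda>x. ?J x * r x) = 0" using L2_norm_nonneg[of lborel "\<lambda>x. ?J x * r x"] by simp
    from AE_zero_if_L2_norm_zero[OF JL[OF rL(1)] this]
    show "AE x in lborel. norm x \<le> 1/2 \<longrightarrow> r x = 0" by eventually_elim (auto simp: indicator_def)
    have "(\<lambda>n. norm2 (\<lambda>x. w' x * rn n x)) ----> norm2 (\<lambda>x. w' x * r x)"
      by (intro L2_tendsto_norm w'L rL L2_tendsto_bounded_mult[OF rL(3) rL(1) rlim _ w'1]) simp
    then have "norm2 (\<lambda>x. w' x * r x) \<le> Q"
      by (rule LIMSEQ_le_const2) (use pr(1) in auto)
    then show "norm2 (\<lambda>x. gauss t x * r x) \<le> Q" by (simp add: w'_def)
    show "norm2 r \<le> ?E"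
      by (rule LIMSEQ_le_const2[OF L2_tendsto_norm[OF rL(3) rL(1) rlim]]) (use pr(2) in auto)
    have "norm2 G \<le> sqrt P"
      by (rule LIMSEQ_le_const2[OF L2_tendsto_norm[OF rL(4) rL(2) Glim]]) (use pr(3) in auto)
    then have "(norm2 G)^2 \<le> (sqrt P)^2" by (intro power_mono L2_norm_nonneg)
    then show "(norm2 G)^2 \<le> (1 + B + N + C) * (?E^2 + (norm2 f)^2)"
      using P0 by (simp add: P_def)
  next
    fix \<phi> :: "'a \<Rightarrow> real" assume \<phi>: "test_function (ball 0 4 - cball (0::'a) (1/2)) \<phi>"
    then have "((\<lambda>x. (L \<phi> x, 0)), \<integral>x. f x * \<phi> x) \<in> S" by (auto simp: S_def)
    then show "(\<integral>x. r x * (laplacian \<phi> x + (A x + V x) * \<phi> x)) = (\<integral>x. f x * \<phi> x)"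
      using eqH[of "\<lambda>x. (L \<phi> x, 0)"] by (simp add: L_def)
  next
    fix b :: 'a and \<phi> :: "'a \<Rightarrow> real" assume \<phi>: "test_function (ball 0 3) \<phi>"
    then have "((\<lambda>x. (dirderiv b \<phi> x, \<phi> x *R b)), 0) \<in> S" by (auto simp: S_def)
    from eqH[OF this] show "(\<integral>x. dirderiv b \<phi> x * r x) = - (\<integral>x. \<phi> x * (G x \<bullet> b))"
      unfolding split[OF rL(1,2) \<phi>] by simp
  qed
qed

section \<open>Surface measure and boundary values\<close>

lemma radial_projection_measurable[measurable]: "(\<lambda>x::'a::euclidean_space. (R / norm x) *R x) \<in> Borel"
  by measurable

lemma radial_projection_measurable_lebesgue_on:
  "(\<lambda>x::'a::euclidean_space. (R / norm x) *R x) \<in> measurable (lebesgue_on S) borel"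
  by (intro measurable_restrict_space1 measurable_completion) simp

lemma sets_sphere_measure[measurable_cong, simp]: "sets (sphere_measure R) = sets borel"
  by (simp add: sphere_measure_def)

lemma space_sphere_measure[simp]: "space (sphere_measure R) = UNIV"
  using sets_eq_imp_space_eq[OF sets_sphere_measure] by simp

lemma nn_integral_lebesgue_on:
  fixes F :: "'a::euclidean_space \<Rightarrow> ennreal"
  assumes "S \<in> sets borel"
  shows "(\<integral>\<^sup>+x. F x \<partial>lebesgue_on S) = (\<integral>\<^sup>+x. F x * indicator S x)"
  using assms by (subst nn_integral_restrict_space) (auto simp: nn_integral_completion)

lemma nn_integral_sphere_measure:
  fixes F :: "'a::euclidean_space \<Rightarrow> ennreal"
  assumes "F \<in> Borel"
  shows "(\<integral>\<^sup>+x. F x \<partial>sphere_measure R)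
    = ennreal (real DIM('a) / R) * (\<integral>\<^sup>+x. F ((R / norm x) *R x) * indicator (ball 0 R) x)"
proof -
  have "(\<integral>\<^sup>+x. F x \<partial>sphere_measure R)
      = ennreal (real DIM('a) / R) * (\<integral>\<^sup>+x. F x \<partial>distr (lebesgue_on (ball 0 R)) borel (\<lambda>x. (R / norm x) *R x))"
    unfolding sphere_measure_def using assms by (subst nn_integral_scale_measure) auto
  also have "(\<integral>\<^sup>+x. F x \<partial>distr (lebesgue_on (ball 0 R)) borel (\<lambda>x. (R / norm x) *R x))
      = (\<integral>\<^sup>+x. F ((R / norm x) *R x) \<partial>lebesgue_on (ball 0 R))"
    by (rule nn_integral_distr[OF radial_projection_measurable_lebesgue_on]) (use assms in simp)
  also have "\<dots> = (\<integral>\<^sup>+x. F ((R / norm x) *R x) * indicator (ball 0 R) x)"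
    by (rule nn_integral_lebesgue_on) simp
  finally show ?thesis .
qed

lemma emeasure_sphere_measure:
  assumes [measurable]: "U \<in> sets borel"
  shows "emeasure (sphere_measure R) (U :: 'a::euclidean_space set)
    = ennreal (real DIM('a) / R) * emeasure lborel {x \<in> ball 0 R. (R / norm x) *R x \<in> U}"
proof -
  have [measurable]: "{x \<in> ball 0 R. (R / norm x) *R x \<in> U} \<in> sets borel"
    using measurable_sets[OF radial_projection_measurable assms, of R]
    by (simp add: Collect_conj_eq Int_def[symmetric] vimage_def)
  have "emeasure (sphere_measure R) U = (\<integral>\<^sup>+x. indicator U x \<partial>sphere_measure R)"
    by simp
  also have "\<dots> = ennreal (real DIM('a) / R) * (\<integral>\<^sup>+x. indicator U ((R / norm x) *R x) * indicator (ball 0 R) x)"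
    by (rule nn_integral_sphere_measure) simp
  also have "(\<integral>\<^sup>+x. indicator U ((R / norm x) *R x) * indicator (ball 0 R) x)
      = (\<integral>\<^sup>+x. indicator {x \<in> ball 0 R. (R / norm x) *R x \<in> U} x \<partial>(lborel :: 'a measure))"
    by (intro nn_integral_cong) (auto simp: indicator_def)
  finally show ?thesis by simp
qed

lemma finite_measure_sphere_measure: "finite_measure (sphere_measure R :: 'a::euclidean_space measure)"
proof
  have "emeasure (sphere_measure R) (UNIV :: 'a set) = ennreal (real DIM('a) / R) * emeasure lborel (ball (0::'a) R)"
    by (subst emeasure_sphere_measure) (auto simp: Collect_conj_eq ball_def)
  also have "\<dots> < \<infinity>" using emeasure_lborel_ball_finite[of "0::'a" R]
    by (simp add: ennreal_mult_less_top)
  finally show "emeasure (sphere_measure R) (space (sphere_measure R :: 'a measure)) \<noteq> \<infinity>" by simp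
qed

text \<open>\<open>K\<close> is the cone over the cap. If \<open>s < R\<close>, the part of
  \<open>K\<close> with \<open>norm x \<ge> R - s\<close> lies in a ball of radius
  \<open>2 s\<close>, while scaling by \<open>l = (R - s) / R\<close> shows that it makes up at
  least the fraction \<open>s / R\<close> of the volume of \<open>K\<close>. This gains one power of
  \<open>s\<close>. If \<open>s \<ge> R\<close>, the volume of the whole ball suffices.\<close>

lemma sphere_measure_cap:
  assumes R: "R > 0" and s: "s > 0"
  shows "emeasure (sphere_measure R) (ball (y::'a::euclidean_space) s)
    \<le> ennreal (real DIM('a) * measure lborel (ball (0::'a) 1) * 2 ^ DIM('a) * s ^ (DIM('a) - 1))"
proof -
  obtain m where m: "DIM('a) = Suc m" using DIM_positive[where 'a='a] gr0_conv_Suc by blast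
  let ?\<omega> = "measure lborel (ball (0::'a) 1)"
  have \<omega>: "?\<omega> \<ge> 0" by simp
  let ?T = "\<lambda>x::'a. (R / norm x) *R x"
  define K where "K = {x \<in> ball 0 R. ?T x \<in> ball y s}"
  have Km[measurable]: "K \<in> sets borel"
    unfolding K_def using measurable_sets[OF radial_projection_measurable, of "ball y s" R]
    by (simp add: Collect_conj_eq Int_def[symmetric] vimage_def)
  have ballv: "measure lborel (ball c r) = r ^ DIM('a) * ?\<omega>" if "r \<ge> 0" for c :: 'a and r
    using content_ball_conv_unit_ball[OF that, of c] by simp
  have Kf: "K \<in> fmeasurable lborel"
    by (rule fmeasurableI2[of "ball 0 R"]) (auto simp: K_def fmeasurable_def)
  have "measure lborel K \<le> R * ?\<omega> * 2 ^ DIM('a) * s ^ m"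
  proof (cases "s < R")
    case False
    have "measure lborel K \<le> measure lborel (ball (0::'a) R)"
      by (rule measure_mono_fmeasurable) (auto simp: K_def fmeasurable_def)
    also have "\<dots> = R * ?\<omega> * 1 * R ^ m" using ballv[of R 0] R by (simp add: m)
    also have "\<dots> \<le> R * ?\<omega> * 2 ^ DIM('a) * s ^ m"
      using False R by (intro mult_mono power_mono) auto
    finally show ?thesis .
  next
    case True
    define l where "l = (R - s) / R"
    have l: "0 < l" "l < 1" using True s R by (auto simp: l_def)
    let ?K1 = "K \<inter> ball 0 (R - s)"
    have sc: "measure lborel ?K1 = l ^ DIM('a) * measure lborel K"
    proof -
      have iff: "l *R x \<in> ?K1 \<longleftrightarrow> x \<in> K" for x
      proof -
        have T: "?T (l *R x) = ?T x" using l by simp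
        have "norm (l *R x) < R - s \<longleftrightarrow> norm x < R"
        proof -
          have "R - s = l * R" using R by (simp add: l_def)
          then show ?thesis using l by simp
        qed
        moreover have "norm (l *R x) < R - s \<Longrightarrow> norm (l *R x) < R" using s by linarith
        ultimately show ?thesis unfolding K_def mem_Collect_eq Int_iff T by auto
      qed
      have "indicator ?K1 (0 + l *R x) = (indicator K x :: real)" for x
        unfolding indicator_def add_0_left iff ..
      then have "(\<integral>x. indicator ?K1 x) = l ^ DIM('a) *R (\<integral>x. indicator K x \<partial>(lborel :: 'a measure) :: real)"
        using integral_lborel_affine[of l "indicator ?K1 :: 'a \<Rightarrow> real" 0] l
          borel_measurable_indicator[of ?K1 borel] by simp
      then show ?thesis by simp
    qed
    have "K - ?K1 \<subseteq> ball y (2 * s)"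
    proof
      fix x assume x: "x \<in> K - ?K1"
      then have nx: "norm x < R" "norm x \<ge> R - s" and T: "dist y (?T x) < s" by (auto simp: K_def)
      have x0: "norm x > 0" using nx True by linarith
      have "?T x - x = ((R - norm x) / norm x) *R x" using x0 by (simp add: diff_divide_distrib scaleR_diff_left)
      then have "dist (?T x) x = R - norm x" using x0 nx by (simp add: dist_norm)
      then show "x \<in> ball y (2 * s)" using T nx dist_triangle[of y x "?T x"] by simp
    qed
    then have "measure lborel (K - ?K1) \<le> measure lborel (ball y (2 * s))"
      by (intro measure_mono_fmeasurable) (auto simp: fmeasurable_def)
    also have "\<dots> = (2 * s) ^ DIM('a) * ?\<omega>" using s by (intro ballv) simp
    finally have A: "measure lborel (K - ?K1) \<le> (2 * s) ^ DIM('a) * ?\<omega>" .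
    have "measure lborel (K - ?K1) = measure lborel K - measure lborel ?K1"
      using Kf by (intro measurable_measure_Diff) auto
    then have "(1 - l ^ DIM('a)) * measure lborel K \<le> (2 * s) ^ DIM('a) * ?\<omega>"
      using A sc by (simp add: left_diff_distrib)
    moreover have "s / R \<le> 1 - l ^ DIM('a)"
    proof -
      have "l ^ DIM('a) \<le> l" using l m power_decreasing[of 1 "DIM('a)" l] by simp
      moreover have "1 - l = s / R" using R by (simp add: l_def field_simps)
      ultimately show ?thesis by linarith
    qed
    ultimately have "(s / R) * measure lborel K \<le> (2 * s) ^ DIM('a) * ?\<omega>"
      using mult_right_mono[of "s / R" "1 - l ^ DIM('a)" "measure lborel K"] by simp
    then have "s * measure lborel K \<le> s * (R * ?\<omega> * 2 ^ DIM('a) * s ^ m)"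
      using R by (simp add: divide_le_eq m power_mult_distrib mult_ac)
    then show ?thesis using s by simp
  qed
  then have "emeasure lborel K \<le> ennreal (R * ?\<omega> * 2 ^ DIM('a) * s ^ m)"
    using Kf by (subst emeasure_eq_ennreal_measure) (auto simp: fmeasurable_def intro: ennreal_leI)
  then have "ennreal (real DIM('a) / R) * emeasure lborel K \<le> ennreal (real DIM('a) / R) * ennreal (R * ?\<omega> * 2 ^ DIM('a) * s ^ m)"
    by (rule mult_left_mono) simp
  also have "\<dots> = ennreal (real DIM('a) * ?\<omega> * 2 ^ DIM('a) * s ^ m)"
    using R s by (subst ennreal_mult[symmetric]) (auto simp: field_simps)
  finally show ?thesis
    by (subst emeasure_sphere_measure) (auto simp: K_def m)
qed

text \<open>The radial projection misses the sphere only at the origin, where division by zero makes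
  its value zero.\<close>

lemma AE_sphere_measure_norm:
  assumes R: "R > 0"
  shows "AE x in sphere_measure R. norm (x :: 'a::euclidean_space) = R"
proof -
  have "{x \<in> ball 0 R. (R / norm x) *R x \<in> {x. norm x \<noteq> R}} \<subseteq> {0 :: 'a}" using R by auto
  then have "emeasure lborel {x \<in> ball 0 R. (R / norm x) *R x \<in> {x :: 'a. norm x \<noteq> R}} \<le> emeasure lborel {0 :: 'a}"
    by (intro emeasure_mono) auto
  then have "emeasure (sphere_measure R) {x :: 'a. norm x \<noteq> R} = 0"
    by (subst emeasure_sphere_measure) auto
  then show ?thesis by (intro AE_I[where N="{x. norm x \<noteq> R}"]) auto
qed

section \<open>Integration along rays and segments: trace and Gagliardo inequalities\<close>

lemma line_has_derivative:
  fixes w :: "'a::euclidean_space \<Rightarrow> real"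
  assumes w: "smooth w" and g: "(\<gamma> has_vector_derivative \<gamma>') (at s)"
  shows "((\<lambda>s. w (\<gamma> s)) has_real_derivative grad w (\<gamma> s) \<bullet> \<gamma>') (at s)"
proof -
  have lin: "linear (\<lambda>h. dirderiv h w (\<gamma> s))"
    by (intro has_derivative_linear[OF has_derivative_dirderiv] smoothD w)
  have "((\<lambda>s. w (\<gamma> s)) has_derivative (\<lambda>h. dirderiv (h *R \<gamma>') w (\<gamma> s))) (at s)"
    using has_derivative_compose[OF g[unfolded has_vector_derivative_def]
        has_derivative_dirderiv[OF smoothD[OF w]]] .
  moreover have "(\<lambda>h. dirderiv (h *R \<gamma>') w (\<gamma> s)) = (*) (grad w (\<gamma> s) \<bullet> \<gamma>')"
    using linear_scale[OF lin] by (auto simp: grad_inner smoothD w)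
  ultimately show ?thesis by (simp add: has_field_derivative_def)
qed

text \<open>In this form the estimate can be integrated in further variables by Tonelli. As
  \<open>ennreal\<close> cuts off negative values, the endpoint terms need case distinctions on
  signs.\<close>

lemma FTC_le_nn_integral:
  fixes f f' g :: "real \<Rightarrow> real"
  assumes ab: "a \<le> b" and d: "\<And>s. DERIV f s :> f' s" and c: "continuous_on UNIV f'"
    and g: "g \<in> Borel" "\<And>s. a \<le> s \<Longrightarrow> s \<le> b \<Longrightarrow> f' s \<le> g s"
  shows "ennreal (f b) \<le> ennreal (f a) + (\<integral>\<^sup>+s. ennreal (g s) * indicator {a..b} s)"
proof -
  have h: "has_bochner_integral lborel (\<lambda>s. indicator {a..b} s *R f' s) (f b - f a)"
    using d c by (intro has_bochner_integral_FTC_Icc ab)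
      (auto intro: has_real_derivative_iff_has_vector_derivative[THEN iffD1] has_field_derivative_at_within
        continuous_on_subset)
  have "ennreal (f b - f a) \<le> (\<integral>\<^sup>+s. ennreal (indicator {a..b} s *R f' s))"
  proof -
    have "f b - f a = (\<integral>s. indicator {a..b} s *R f' s)"
      using has_bochner_integral_integral_eq[OF h] by simp
    also have "\<dots> \<le> (\<integral>s. max 0 (indicator {a..b} s *R f' s))"
      using has_bochner_integral_iff[THEN iffD1, OF h] by (intro integral_mono Bochner_Integration.integrable_max) auto
    finally have "ennreal (f b - f a) \<le> ennreal (\<integral>s. max 0 (indicator {a..b} s *R f' s))"
      by (rule ennreal_leI)
    also have "\<dots> = (\<integral>\<^sup>+s. ennreal (max 0 (indicator {a..b} s *R f' s)))"
      using has_bochner_integral_iff[THEN iffD1, OF h]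
      by (intro nn_integral_eq_integral[symmetric] Bochner_Integration.integrable_max) auto
    also have "\<dots> = (\<integral>\<^sup>+s. ennreal (indicator {a..b} s *R f' s))"
      by (intro nn_integral_cong) (auto simp: max_def ennreal_neg)
    finally show ?thesis .
  qed
  also have "\<dots> \<le> (\<integral>\<^sup>+s. ennreal (g s) * indicator {a..b} s)"
    using g(2) by (intro nn_integral_mono) (auto simp: indicator_def intro: ennreal_leI)
  finally have le: "ennreal (f b - f a) \<le> (\<integral>\<^sup>+s. ennreal (g s) * indicator {a..b} s)" .
  have "ennreal (f b) \<le> ennreal (f a) + ennreal (f b - f a)"
  proof (cases "f b \<ge> f a")
    case True
    show ?thesis
    proof (cases "f a \<ge> 0")
      case True
      then show ?thesis using \<open>f b \<ge> f a\<close> by (subst ennreal_plus[symmetric]) auto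
    next
      case False
      then have "ennreal (f b) \<le> ennreal (f b - f a)" by (intro ennreal_leI) simp
      then show ?thesis by (simp add: add_increasing)
    qed
  qed (auto intro!: add_increasing2 ennreal_leI)
  also have "\<dots> \<le> ennreal (f a) + (\<integral>\<^sup>+s. ennreal (g s) * indicator {a..b} s)"
    using le by (rule add_left_mono)
  finally show ?thesis .
qed

lemma nn_integral_inverse_square: "(\<integral>\<^sup>+s. ennreal (1 / s^2) * indicator {1..} s) = 1"
proof -
  have "(\<integral>\<^sup>+s. ennreal (1 / s^2) * indicator {1..} s) = ennreal (0 - (- 1 / 1))"
  proof (rule nn_integral_FTC_atLeast[where F="\<lambda>s. - 1 / s" and T=0 and a=1])
    show "((\<lambda>s. - 1 / s) \<longlongrightarrow> 0) (at_top :: real filter)"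
      using tendsto_minus[OF tendsto_inverse_0_at_top[OF filterlim_ident]] by (simp add: inverse_eq_divide)
    show "DERIV (\<lambda>s. - 1 / s) s :> 1 / s^2" if "1 \<le> s" for s :: real
      using that by (auto intro!: derivative_eq_intros simp: power2_eq_square)
  qed auto
  then show ?thesis by simp
qed

text \<open>Trace inequality: fundamental theorem along rays from \<open>x\<close> to \<open>R x / |x|\<close>, with the cone
  formula for the surface measure.\<close>

lemma trace_inequality:
  fixes w :: "'a::euclidean_space \<Rightarrow> real"
  assumes w: "smooth w" and R: "R > 0"
  shows "(\<integral>\<^sup>+x. ennreal ((w x)^2) \<partial>sphere_measure R)
    \<le> ennreal (real DIM('a) / R * (1 + R)) * (\<integral>\<^sup>+x. ennreal ((w x)^2 + (norm (grad w x))^2) * indicator (cball 0 R) x)"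
proof -
  define H where "H x = (w x)^2 + (norm (grad w x))^2" for x
  have wm[measurable]: "w \<in> Borel" and gm[measurable]: "grad w \<in> Borel"
    using w smooth_measurable smooth_grad by blast+
  have [measurable]: "cball (0::'a) R \<in> sets borel" "ball (0::'a) R \<in> sets borel" by simp_all
  have Hm[measurable]: "H \<in> Borel" unfolding H_def[abs_def] by measurable
  have H0: "H x \<ge> 0" for x by (simp add: H_def)
  let ?T = "\<lambda>x::'a. (R / norm x) *R x"
  let ?I = "\<integral>\<^sup>+x. ennreal (H x) * indicator (cball 0 R) x"
  \<comment> \<open>The condition that \<open>s *R x\<close> lies in the closed ball replaces the
    upper limit \<open>R / norm x\<close>, so that the order of integration can be
    exchanged.\<close>
  let ?k = "\<lambda>s x. ennreal (norm x * H (s *R x)) * indicator (cball 0 R) (s *R x)"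
  let ?W = "\<integral>\<^sup>+x. ennreal ((w (?T x))^2) * indicator (ball 0 R) x"
  have pt: "ennreal ((w (?T x))^2) \<le> ennreal ((w x)^2)
      + (\<integral>\<^sup>+s. ennreal (norm x * H (s *R x)) * indicator {1..R / norm x} s)" if x: "norm x < R" "x \<noteq> 0" for x
  proof -
    let ?f' = "\<lambda>s. 2 * w (s *R x) * (grad w (s *R x) \<bullet> x)"
    have "ennreal ((w ((R / norm x) *R x))^2) \<le> ennreal ((w (1 *R x))^2)
      + (\<integral>\<^sup>+s. ennreal (norm x * H (s *R x)) * indicator {1..R / norm x} s)"
    proof (rule FTC_le_nn_integral[where f="\<lambda>s. (w (s *R x))^2" and f'="?f'"])
      show "1 \<le> R / norm x" using x by simp
      have "((\<lambda>s. s *R x) has_vector_derivative x) (at s)" for s :: real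
        by (auto intro!: derivative_eq_intros simp: has_vector_derivative_def)
      from line_has_derivative[OF w this]
      have "DERIV (\<lambda>s. w (s *R x)) s :> grad w (s *R x) \<bullet> x" for s .
      then show "DERIV (\<lambda>s. (w (s *R x))^2) s :> ?f' s" for s
        by (auto intro!: derivative_eq_intros)
      show "continuous_on UNIV ?f'"
        by (intro continuous_intros continuous_on_compose2[OF smooth_continuous[OF w, of UNIV]]
            continuous_on_compose2[OF smooth_continuous[OF smooth_grad[OF w], of UNIV]]) auto
      show "?f' s \<le> norm x * H (s *R x)" for s
      proof -
        let ?p = "grad w (s *R x) \<bullet> x"
        have "w (s *R x) * ?p \<le> \<bar>w (s *R x)\<bar> * \<bar>?p\<bar>"
          using abs_ge_self[of "w (s *R x) * ?p"] by (simp add: abs_mult)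
        also have "\<dots> \<le> \<bar>w (s *R x)\<bar> * (norm (grad w (s *R x)) * norm x)"
          by (intro mult_left_mono Cauchy_Schwarz_ineq2) simp
        finally have "?f' s \<le> norm x * (2 * \<bar>w (s *R x)\<bar> * norm (grad w (s *R x)))"
          by (simp add: mult_ac)
        also have "\<dots> \<le> norm x * H (s *R x)"
          unfolding H_def using sum_squares_bound[of "\<bar>w (s *R x)\<bar>" "norm (grad w (s *R x))"]
          by (intro mult_left_mono) auto
        finally show ?thesis .
      qed
    qed measurable
    then show ?thesis by simp
  qed
  \<comment> \<open>Substituting \<open>y = s *R x\<close> produces \<open>s ^ (-n - 1)\<close>, at
    most \<open>1 / s^2\<close> because \<open>n \<ge> 1\<close>, which is integrable over
    \<open>s \<ge> 1\<close>.\<close>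
  have inner: "(\<integral>\<^sup>+x. ?k s x)
      \<le> ennreal R * ?I * ennreal (1 / s^2)" if s: "s \<ge> 1" for s
  proof -
    let ?F = "\<lambda>y::'a. ennreal (norm y * H y) * indicator (cball 0 R) y"
    let ?A = "\<integral>\<^sup>+x. ?F (0 + s *R x)"
    have "(\<integral>\<^sup>+x. ?k s x)
        = (\<integral>\<^sup>+x. ennreal (1 / s) * ?F (0 + s *R x))"
    proof (rule nn_integral_cong)
      fix x
      have "norm x * H (s *R x) = (1 / s) * (norm (s *R x) * H (s *R x))" using s by simp
      then show "?k s x = ennreal (1 / s) * ?F (0 + s *R x)"
        using s H0 by (simp add: ennreal_mult'[symmetric] mult.assoc[symmetric])
    qed
    also have "\<dots> = ennreal (1 / s) * ?A" by (rule nn_integral_cmult) measurable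
    also have "\<dots> \<le> ennreal (1 / s) * (ennreal (1 / s) * (ennreal (s ^ DIM('a)) * ?A))"
    proof -
      have "1 \<le> (1 / s) * s ^ DIM('a)"
        using s DIM_positive[where 'a='a] self_le_power[of s "DIM('a)"] by (simp add: le_divide_eq)
      then have "1 \<le> ennreal ((1 / s) * s ^ DIM('a))" by simp
      also have "\<dots> = ennreal (1 / s) * ennreal (s ^ DIM('a))" using s by (intro ennreal_mult) auto
      finally have "1 * X \<le> (ennreal (1 / s) * ennreal (s ^ DIM('a))) * X" for X by (rule mult_right_mono) simp
      then have "X \<le> ennreal (1 / s) * (ennreal (s ^ DIM('a)) * X)" for X by (simp only: mult.assoc mult_1)
      then show ?thesis by (rule mult_left_mono) simp
    qed
    finally have le: "(\<integral>\<^sup>+x. ?k s x)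
      \<le> ennreal (1 / s) * (ennreal (1 / s) * (ennreal (s ^ DIM('a)) * ?A))" .
    have "ennreal (s ^ DIM('a)) * ?A = (\<integral>\<^sup>+y. ?F y)"
      using nn_integral_lborel_affine[of s ?F 0] s by simp
    also have "\<dots> \<le> (\<integral>\<^sup>+y. ennreal R * (ennreal (H y) * indicator (cball 0 R) y))"
    proof (rule nn_integral_mono, goal_cases)
      case (1 y)
      show ?case
        using R H0[of y] by (cases "norm y \<le> R") (auto simp: ennreal_mult[symmetric] intro!: ennreal_leI mult_right_mono)
    qed
    also have "\<dots> = ennreal R * ?I" by (rule nn_integral_cmult) measurable
    finally have "ennreal (1 / s) * (ennreal (1 / s) * (ennreal (s ^ DIM('a)) * ?A))
        \<le> ennreal (1 / s) * (ennreal (1 / s) * (ennreal R * ?I))" by (intro mult_left_mono) auto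
    also have "\<dots> = (ennreal (1 / s) * ennreal (1 / s)) * (ennreal R * ?I)" by (simp only: mult.assoc)
    also have "ennreal (1 / s) * ennreal (1 / s) = ennreal (1 / s^2)"
      using s by (simp add: ennreal_mult[symmetric] power2_eq_square)
    finally show ?thesis using le by (simp only: mult.commute[of _ "ennreal (1 / s^2)"])
  qed
  have "?W
      \<le> (\<integral>\<^sup>+x. ennreal (H x) * indicator (cball 0 R) x
        + (\<integral>\<^sup>+s. ?k s x * indicator {1..} s) \<partial>lborel)"
  proof (rule nn_integral_mono_AE, goal_cases)
    case 1
    have "AE x in lborel. x \<noteq> (0::'a)" by (rule AE_lborel_singleton)
    then show ?case
    proof eventually_elim
      case x0: (elim x)
      show ?case
      proof (cases "norm x < R")
        case True
        have "ennreal ((w x)^2) \<le> ennreal (H x)" by (intro ennreal_leI) (simp add: H_def)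
        moreover have "(\<integral>\<^sup>+s. ennreal (norm x * H (s *R x)) * indicator {1..R / norm x} s)
          \<le> (\<integral>\<^sup>+s. ?k s x * indicator {1..} s)"
          using x0 by (intro nn_integral_mono) (auto simp: indicator_def field_simps)
        ultimately show ?thesis using pt[OF True x0] True by (auto intro: order_trans add_mono)
      qed simp
    qed
  qed
  also have "\<dots> = ?I + (\<integral>\<^sup>+x. \<integral>\<^sup>+s. ?k s x * indicator {1..} s \<partial>lborel \<partial>lborel)"
    by (rule nn_integral_add) measurable
  also have "(\<integral>\<^sup>+x. \<integral>\<^sup>+s. ?k s x * indicator {1..} s \<partial>lborel \<partial>(lborel::'a measure))
      = (\<integral>\<^sup>+s. \<integral>\<^sup>+x. ?k s x * indicator {1..} s \<partial>(lborel::'a measure) \<partial>lborel)"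
    by (rule lborel_pair.Fubini') measurable
  also have "\<dots> \<le> (\<integral>\<^sup>+s. ennreal R * ?I * (ennreal (1 / s^2) * indicator {1..} s))"
  proof (rule nn_integral_mono, goal_cases)
    case (1 s)
    show ?case
      using inner[of s] by (cases "s \<ge> 1") (auto simp: indicator_def)
  qed
  also have "\<dots> = ennreal R * ?I * 1"
    by (subst nn_integral_cmult) (auto simp: nn_integral_inverse_square)
  finally have "?W \<le> ?I + ennreal R * ?I"
    by (simp add: add_left_mono)
  also have "\<dots> = ennreal (1 + R) * ?I" using R by (simp add: ennreal_plus distrib_right)
  finally have "?W \<le> ennreal (1 + R) * ?I" .
  then have "ennreal (real DIM('a) / R) * ?W
      \<le> ennreal (real DIM('a) / R) * (ennreal (1 + R) * ?I)" by (rule mult_left_mono) simp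
  also have "\<dots> = ennreal (real DIM('a) / R * (1 + R)) * ?I"
    using R by (subst ennreal_mult) (auto simp: mult.assoc)
  finally show ?thesis
    unfolding H_def by (subst nn_integral_sphere_measure) simp_all
qed

text \<open>Jensen's inequality along the segment from \<open>x\<close> to \<open>z\<close>. The quadratic parametrisation
  \<open>s \<mapsto> x + s^2 (z - x)\<close> makes the later change of variables in \<open>z\<close> exactly scale invariant.\<close>

lemma segment_difference_sq:
  fixes w :: "'a::euclidean_space \<Rightarrow> real"
  assumes w: "smooth w"
  shows "ennreal ((w x - w z)^2) \<le> (\<integral>\<^sup>+s. ennreal (4 * s^2 * (norm (z - x))^2 * (norm (grad w (x + s^2 *R (z - x))))^2)
    * indicator {0..1} s)"
proof -
  let ?\<gamma> = "\<lambda>s::real. x + s^2 *R (z - x)"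
  let ?f' = "\<lambda>s. grad w (?\<gamma> s) \<bullet> ((2 * s) *R (z - x))"
  have "(?\<gamma> has_vector_derivative (2 * s) *R (z - x)) (at s)" for s
    by (auto intro!: derivative_eq_intros simp: has_vector_derivative_def)
  from line_has_derivative[OF w this]
  have d: "DERIV (\<lambda>s. w (?\<gamma> s)) s :> ?f' s" for s .
  have c: "continuous_on UNIV ?f'"
    by (intro continuous_intros continuous_on_compose2[OF smooth_continuous[OF smooth_grad[OF w], of UNIV]]) auto
  have h: "has_bochner_integral lborel (\<lambda>s. indicator {0..1} s *R ?f' s) (w (?\<gamma> 1) - w (?\<gamma> 0))"
    using d c by (intro has_bochner_integral_FTC_Icc)
      (auto intro: has_real_derivative_iff_has_vector_derivative[THEN iffD1] has_field_derivative_at_within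
        continuous_on_subset)
  have fm[measurable]: "?f' \<in> Borel" using c by (rule borel_measurable_continuous_onI)
  let ?g = "\<lambda>s. indicator {0..1} s * ?f' s"
  have gL: "L2 ?g"
  proof -
    have "L1 (\<lambda>s. indicator {0..1::real} s *R (?f' s)^2)"
      by (intro borel_integrable_compact continuous_on_power continuous_on_subset[OF c]) auto
    moreover have "(\<lambda>s. (norm (?g s))^2) = (\<lambda>s. indicator {0..1} s *R (?f' s)^2)"
      by (auto simp: fun_eq_iff indicator_def)
    ultimately have i: "L1 (\<lambda>s. (norm (?g s))^2)" by (simp only:)
    have "?g \<in> Borel" by (intro borel_measurable_times borel_measurable_indicator fm) auto
    then have "?g \<in> borel_measurable lborel" by (subst measurable_lborel2)
    with i show ?thesis unfolding in_L2_def by blast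
  qed
  have oL: "L2 (indicator {0..1} :: real \<Rightarrow> real)" by (rule L2_indicator) auto
  have o1: "norm2 (indicator {0..1} :: real \<Rightarrow> real) = 1"
  proof -
    have "(\<lambda>s. (norm (indicator {0..1} s :: real))^2) = (indicator {0..1} :: real \<Rightarrow> real)"
      by (auto simp: fun_eq_iff indicator_def)
    then show ?thesis by (simp add: L2_norm_def)
  qed
  have "w z - w x = (\<integral>s. indicator {0..1} s \<bullet> ?g s)"
  proof -
    have "w z - w x = (\<integral>s. indicator {0..1} s *R ?f' s)"
      using has_bochner_integral_integral_eq[OF h] by simp
    also have "(\<lambda>s. indicator {0..1} s *R ?f' s) = (\<lambda>s. indicator {0..1} s \<bullet> ?g s)"
      by (auto simp: fun_eq_iff indicator_def)
    finally show ?thesis .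
  qed
  then have "\<bar>w x - w z\<bar> \<le> 1 * norm2 ?g"
    using L2_Cauchy_Schwarz[OF oL gL] by (simp add: o1 abs_minus_commute)
  then have "\<bar>w x - w z\<bar>^2 \<le> (norm2 ?g)^2" by (intro power_mono) auto
  then have "ennreal ((w x - w z)^2) \<le> ennreal ((norm2 ?g)^2)" by (intro ennreal_leI) simp
  also have "\<dots> = (\<integral>\<^sup>+s. ennreal ((norm (?g s))^2))" by (rule nn_integral_L2[OF gL, symmetric])
  also have "\<dots> \<le> (\<integral>\<^sup>+s. ennreal (4 * s^2 * (norm (z - x))^2 * (norm (grad w (?\<gamma> s)))^2) * indicator {0..1} s)"
  proof (rule nn_integral_mono)
    fix s :: real
    have "(?f' s)^2 \<le> 4 * s^2 * (norm (z - x))^2 * (norm (grad w (?\<gamma> s)))^2"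
    proof -
      have "\<bar>?f' s\<bar> \<le> norm (grad w (?\<gamma> s)) * norm ((2 * s) *R (z - x))" by (rule Cauchy_Schwarz_ineq2)
      then have "\<bar>?f' s\<bar>^2 \<le> (norm (grad w (?\<gamma> s)) * norm ((2 * s) *R (z - x)))^2" by (intro power_mono) auto
      then show ?thesis by (simp add: power_mult_distrib mult_ac)
    qed
    then show "ennreal ((norm (?g s))^2) \<le> ennreal (4 * s^2 * (norm (z - x))^2 * (norm (grad w (?\<gamma> s)))^2) * indicator {0..1} s"
      by (auto simp: indicator_def intro: ennreal_leI)
  qed
  finally show ?thesis .
qed

text \<open>Gagliardo's argument: \<open>x\<close> and \<open>y\<close> at distance \<open>d\<close> are compared through all \<open>z\<close> in a ball of
  radius \<open>d / 8\<close> at depth about \<open>d / 4\<close> inside the sphere.\<close>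

lemma Hhalf_kernel_le:
  fixes w :: "'a::euclidean_space \<Rightarrow> real"
  assumes wm[measurable]: "w \<in> Borel" and R: "R > 0" and x: "norm x = R" and y: "norm y = R"
  defines "\<omega> \<equiv> measure lborel (ball (0::'a) 1)"
  defines "G \<equiv> \<lambda>x y z. ennreal ((w x - w z)^2 / dist x y ^ (2 * DIM('a))) * indicator {z. dist x y / 8 < R - norm z \<and> dist z x < 2 * dist x y} z"
  shows "ennreal (Hhalf_kernel w (x, y)) \<le> ennreal (2 * 8 ^ DIM('a) / \<omega>) * ((\<integral>\<^sup>+z. G x y z) + (\<integral>\<^sup>+z. G y x z))"
proof (cases "x = y")
  case True
  then show ?thesis by (simp add: Hhalf_kernel_def)
next
  case False
  let ?n = "DIM('a)"
  define d where "d = dist x y"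
  have d: "d > 0" using False by (simp add: d_def)
  have \<omega>: "\<omega> > 0" unfolding \<omega>_def by (rule content_ball_pos) simp
  have "d \<le> norm x + norm y" unfolding d_def dist_norm by (rule norm_triangle_ineq4)
  then have d2: "d \<le> 2 * R" using x y by simp
  \<comment> \<open>The centre lies at depth \<open>d / 4\<close> below \<open>x\<close>;
    \<open>d \<le> 2 R\<close> keeps the factor positive. Radius \<open>d / 8\<close> leaves depth
    more than \<open>d / 8\<close> and keeps both distances below \<open>2 d\<close>.\<close>
  define p where "p = (1 - d / (4 * R)) *R x"
  have px: "dist p x = d / 4"
  proof -
    have "p - x = (- (d / (4 * R))) *R x" by (simp add: p_def algebra_simps)
    then show ?thesis using x R d by (simp add: dist_norm)
  qed
  have np: "norm p = R - d / 4"
    using x R d d2 by (simp add: p_def field_simps)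
  have conds: "d / 8 < R - norm z" "dist z x < 2 * d" "dist z y < 2 * d" if z: "z \<in> ball p (d / 8)" for z
  proof -
    have zp: "dist z p < d / 8" using z by (simp add: dist_commute)
    then show "d / 8 < R - norm z" using norm_triangle_sub[of z p] np by (simp add: dist_norm)
    have zx: "dist z x < d / 8 + d / 4" using zp px dist_triangle[of z x p] by simp
    then show "dist z x < 2 * d" using d by simp
    show "dist z y < 2 * d" using zx d dist_triangle[of z y x] unfolding d_def by linarith
  qed
  let ?B = "ball p (d / 8)"
  have vol: "emeasure lborel ?B = ennreal ((d / 8) ^ ?n * \<omega>)"
    using content_ball_conv_unit_ball[of "d / 8" p] d emeasure_lborel_ball_finite[of p "d / 8"]
    by (simp add: \<omega>_def emeasure_eq_ennreal_measure)
  let ?K = "(w x - w y)^2 / d ^ ?n"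
  \<comment> \<open>The kernel value spread evenly over the ball: the constant \<open>c\<close>
    integrates over \<open>?B\<close> to \<open>?K\<close>.\<close>
  define c where "c = ?K / ((d / 8) ^ ?n * \<omega>)"
  have c0: "c \<ge> 0" using d \<omega> by (simp add: c_def)
  have "ennreal (Hhalf_kernel w (x, y)) = ennreal ?K" by (simp add: Hhalf_kernel_def d_def)
  also have "ennreal ?K = ennreal (c * ((d / 8) ^ ?n * \<omega>))" using d \<omega> by (simp add: c_def)
  also have "\<dots> = ennreal c * emeasure lborel ?B" unfolding vol using c0 by (simp add: ennreal_mult')
  also have "\<dots> = (\<integral>\<^sup>+z. ennreal c * indicator ?B z)"
    by (rule nn_integral_cmult_indicator[symmetric]) simp
  also have "\<dots> \<le> (\<integral>\<^sup>+z. ennreal (2 * 8 ^ ?n / \<omega>) * (G x y z + G y x z))"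
  proof (rule nn_integral_mono, goal_cases)
    case (1 z)
    show ?case
    proof (cases "z \<in> ?B")
      case True
      have G1: "G x y z = ennreal ((w x - w z)^2 / d ^ (2 * ?n))" and G2: "G y x z = ennreal ((w y - w z)^2 / d ^ (2 * ?n))"
        using conds[OF True] by (simp_all add: G_def d_def dist_commute)
      have "(w x - w y)^2 \<le> 2 * ((w x - w z)^2 + (w y - w z)^2)"
        using zero_le_power2[of "(w x - w z) + (w y - w z)"] by (simp add: power2_eq_square algebra_simps)
      then have "(8 ^ ?n / \<omega> / d ^ (2 * ?n)) * (w x - w y)^2 \<le> (8 ^ ?n / \<omega> / d ^ (2 * ?n)) * (2 * ((w x - w z)^2 + (w y - w z)^2))"
        using \<omega> d by (intro mult_left_mono) auto
      moreover have "c = (8 ^ ?n / \<omega> / d ^ (2 * ?n)) * (w x - w y)^2"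
      proof -
        have "d ^ (2 * ?n) = d ^ ?n * d ^ ?n" by (simp add: mult_2 power_add)
        then show ?thesis unfolding c_def by (simp only: power_divide) (simp add: mult_ac)
      qed
      moreover have "(8 ^ ?n / \<omega> / d ^ (2 * ?n)) * (2 * ((w x - w z)^2 + (w y - w z)^2))
          = (2 * 8 ^ ?n / \<omega>) * ((w x - w z)^2 / d ^ (2 * ?n) + (w y - w z)^2 / d ^ (2 * ?n))"
        by (simp add: add_divide_distrib algebra_simps)
      ultimately have "ennreal c \<le> ennreal ((2 * 8 ^ ?n / \<omega>) * ((w x - w z)^2 / d ^ (2 * ?n) + (w y - w z)^2 / d ^ (2 * ?n)))"
        by (intro ennreal_leI) simp
      also have "\<dots> = ennreal (2 * 8 ^ ?n / \<omega>) * (G x y z + G y x z)"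
        unfolding G1 G2 using \<omega> d by (subst ennreal_mult) (auto simp: ennreal_plus)
      finally show ?thesis using True by simp
    qed simp
  qed
  also have "\<dots> = ennreal (2 * 8 ^ ?n / \<omega>) * (\<integral>\<^sup>+z. G x y z + G y x z)"
    by (rule nn_integral_cmult) (simp add: G_def)
  also have "(\<integral>\<^sup>+z. G x y z + G y x z) = (\<integral>\<^sup>+z. G x y z) + (\<integral>\<^sup>+z. G y x z)"
    by (rule nn_integral_add) (simp_all add: G_def)
  finally show ?thesis .
qed

text \<open>The triple integral over \<open>x\<close>, \<open>y\<close> and \<open>z\<close> is
  reduced one variable at a time. Each integration over the sphere gains the cap bound, a power
  \<open>n - 1\<close> of the radius; the powers of the distances balance, and only the Dirichlet
  integral is left.\<close>

lemma Hhalf_inequality: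
  assumes R: "R > 0"
  obtains C where "C > 0" "\<And>w :: 'a::euclidean_space \<Rightarrow> real. smooth w \<Longrightarrow>
    (\<integral>\<^sup>+p. ennreal (Hhalf_kernel w p) \<partial>(sphere_measure R \<Otimes>\<^sub>M sphere_measure R))
      \<le> ennreal C * (\<integral>\<^sup>+y. ennreal ((norm (grad w y))^2) * indicator (cball 0 R) y)"
proof -
  let ?I = "\<lambda>w::'a \<Rightarrow> real. \<integral>\<^sup>+y. ennreal ((norm (grad w y))^2) * indicator (cball 0 R) y"
  let ?n = "DIM('a)"
  obtain m where m: "?n = Suc m" using DIM_positive[where 'a='a] gr0_conv_Suc by blast
  let ?S = "sphere_measure R :: 'a measure"
  interpret S: finite_measure ?S by (rule finite_measure_sphere_measure)
  interpret SL: pair_sigma_finite ?S "lborel :: 'a measure" ..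
  interpret SS: pair_sigma_finite ?S ?S ..
  define \<omega> where "\<omega> = measure lborel (ball (0::'a) 1)"
  have \<omega>: "\<omega> > 0" unfolding \<omega>_def by (rule content_ball_pos) simp
  define K where "K = real ?n * \<omega> * 2 ^ ?n"
  have K: "K > 0" using \<omega> by (simp add: K_def)
  have cap: "emeasure ?S (ball y s) \<le> ennreal (K * s ^ m)" if "s > 0" for y s
    using sphere_measure_cap[OF R that, of y] by (simp add: K_def \<omega>_def m)
  have AS: "AE x in ?S. norm x = R" by (rule AE_sphere_measure_norm[OF R])
  define C1 where "C1 = 2 ^ (2 * ?n) * K * 8 ^ m"
  define C where "C = (2 * 8 ^ ?n / \<omega>) * 2 * C1 * 4 * (K * 16 ^ m)"
  have C1: "C1 > 0" using K by (simp add: C1_def)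
  have Cpos: "C > 0" using K \<omega> C1 by (simp add: C_def)
  have "(\<integral>\<^sup>+p. ennreal (Hhalf_kernel w p) \<partial>(?S \<Otimes>\<^sub>M ?S))
      \<le> ennreal C * ?I w"
    if w: "smooth w" for w :: "'a \<Rightarrow> real"
  proof -
    have wm[measurable]: "w \<in> Borel" and gm[measurable]: "grad w \<in> Borel"
      using w smooth_measurable smooth_grad by blast+
    have [measurable]: "cball (0::'a) R \<in> sets borel" by simp
    define G where "G x y z = ennreal ((w x - w z)^2 / dist x y ^ (2 * ?n))
      * indicator {z. dist x y / 8 < R - norm z \<and> dist z x < 2 * dist x y} z" for x y z
    define g where "g x y = (\<integral>\<^sup>+z. G x y z)" for x y
    let ?gg = "\<integral>\<^sup>+x. \<integral>\<^sup>+y. g x y \<partial>?S \<partial>?S"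
    have Gm[measurable]: "(\<lambda>(x, y, z). G x y z) \<in> borel_measurable (borel \<Otimes>\<^sub>M borel \<Otimes>\<^sub>M borel)"
      unfolding G_def indicator_def by measurable
    have Gm'[measurable]: "(\<lambda>p. G (f1 p) (f2 p) (f3 p)) \<in> borel_measurable M"
      if [measurable]: "f1 \<in> borel_measurable M" "f2 \<in> borel_measurable M" "f3 \<in> borel_measurable M" for f1 f2 f3 and M :: "'z measure"
      unfolding G_def indicator_def by measurable
    let ?c = "ennreal (2 * 8 ^ ?n / \<omega>)"
    have gm2: "(\<lambda>(x, y). g x y) \<in> borel_measurable (?S \<Otimes>\<^sub>M ?S)"
      unfolding g_def[abs_def] by measurable
    have hm: "Hhalf_kernel w \<in> borel_measurable (?S \<Otimes>\<^sub>M ?S)"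
      unfolding Hhalf_kernel_def by measurable
    have "(\<integral>\<^sup>+p. ennreal (Hhalf_kernel w p) \<partial>(?S \<Otimes>\<^sub>M ?S)) = (\<integral>\<^sup>+x. \<integral>\<^sup>+y. ennreal (Hhalf_kernel w (x, y)) \<partial>?S \<partial>?S)"
      by (rule S.nn_integral_fst[symmetric]) (use hm in simp)
    also have "\<dots> \<le> (\<integral>\<^sup>+x. \<integral>\<^sup>+y. ?c * (g x y + g y x) \<partial>?S \<partial>?S)"
    proof (rule nn_integral_mono_AE, goal_cases)
      case 1
      show ?case
        using AS
      proof eventually_elim
        case x: (elim x)
        show ?case
        proof (rule nn_integral_mono_AE, goal_cases)
          case 1
          show ?case
            using AS
          proof eventually_elim
            case y: (elim y)
            show ?case
              unfolding g_def G_def \<omega>_def by (rule Hhalf_kernel_le[OF wm R x y])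
          qed
        qed
      qed
    qed
    also have "\<dots> = ?c * (?gg + (\<integral>\<^sup>+x. \<integral>\<^sup>+y. g y x \<partial>?S \<partial>?S))"
    proof -
      have [measurable]: "(\<lambda>y. g x y) \<in> borel_measurable ?S" "(\<lambda>y. g y x) \<in> borel_measurable ?S"
        "(\<lambda>x. \<integral>\<^sup>+y. g x y \<partial>?S) \<in> borel_measurable ?S" "(\<lambda>x. \<integral>\<^sup>+y. g y x \<partial>?S) \<in> borel_measurable ?S" for x
        unfolding g_def[abs_def] by measurable
      have "(\<integral>\<^sup>+x. \<integral>\<^sup>+y. ?c * (g x y + g y x) \<partial>?S \<partial>?S) = (\<integral>\<^sup>+x. ?c * ((\<integral>\<^sup>+y. g x y \<partial>?S) + (\<integral>\<^sup>+y. g y x \<partial>?S)) \<partial>?S)"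
        by (intro nn_integral_cong) (simp add: nn_integral_cmult nn_integral_add)
      also have "\<dots> = ?c * (?gg + (\<integral>\<^sup>+x. \<integral>\<^sup>+y. g y x \<partial>?S \<partial>?S))"
        by (subst nn_integral_cmult, measurable) (simp add: nn_integral_add)
      finally show ?thesis .
    qed
    also have "(\<integral>\<^sup>+x. \<integral>\<^sup>+y. g y x \<partial>?S \<partial>?S) = ?gg"
      by (rule SS.Fubini'[of "\<lambda>y x. g y x"]) (use gm2 in simp)
    finally have step1: "(\<integral>\<^sup>+p. ennreal (Hhalf_kernel w p) \<partial>(?S \<Otimes>\<^sub>M ?S)) \<le> ?c * (2 * ?gg)"
      by (simp only: mult_2)
    define k where "k x z = ennreal ((w x - w z)^2 / dist z x ^ (?n + 1)) * indicator {z. dist z x / 16 < R - norm z} z" for x z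
    have km[measurable]: "(\<lambda>p. k (f1 p) (f2 p)) \<in> borel_measurable M"
      if [measurable]: "f1 \<in> borel_measurable M" "f2 \<in> borel_measurable M" for f1 f2 and M :: "'z measure"
      unfolding k_def indicator_def by measurable
    \<comment> \<open>The constraints put \<open>dist x y\<close> between one half and eight times
      \<open>dist z x\<close>, so \<open>y\<close> ranges over a cap. The exponent becomes
      \<open>2 n - (n - 1) = n + 1\<close>.\<close>
    have step2: "(\<integral>\<^sup>+y. g x y \<partial>?S) \<le> ennreal C1 * (\<integral>\<^sup>+z. k x z)" if x: "norm x = R" for x
    proof -
      have "(\<integral>\<^sup>+y. g x y \<partial>?S) = (\<integral>\<^sup>+z. \<integral>\<^sup>+y. G x y z \<partial>?S \<partial>lborel)"
        unfolding g_def by (rule SL.Fubini'[symmetric]) measurable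
      also have "\<dots> \<le> (\<integral>\<^sup>+z. ennreal C1 * k x z)"
      proof (rule nn_integral_mono)
        fix z
        let ?\<rho> = "dist z x"
        have le: "R - norm z \<le> ?\<rho>" using x norm_triangle_sub[of x z] by (simp add: dist_norm norm_minus_commute)
        show "(\<integral>\<^sup>+y. G x y z \<partial>?S) \<le> ennreal C1 * k x z"
        proof (cases "?\<rho> / 16 < R - norm z")
          case False
          have "G x y z = 0" for y using False by (auto simp: G_def indicator_def)
          then show ?thesis by simp
        next
          case True
          then have \<rho>: "?\<rho> > 0" using le by (cases "?\<rho> = 0") auto
          let ?a = "(w x - w z)^2 * (2 / ?\<rho>) ^ (2 * ?n)"
          have "(\<integral>\<^sup>+y. G x y z \<partial>?S) \<le> (\<integral>\<^sup>+y. ennreal ?a * indicator (ball x (8 * ?\<rho>)) y \<partial>?S)"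
          proof (rule nn_integral_mono, goal_cases)
            case (1 y)
            show ?case
            proof (cases "dist x y / 8 < R - norm z \<and> ?\<rho> < 2 * dist x y")
              case True
              then have "dist x y < 8 * ?\<rho>" using le by linarith
              moreover have "(w x - w z)^2 / dist x y ^ (2 * ?n) \<le> ?a"
              proof -
                have "?\<rho> < 2 * dist x y" "0 < dist x y" using True \<rho> by linarith+
                then have "1 / dist x y \<le> 2 / ?\<rho>" using \<rho> by (simp add: divide_simps)
                then have "(1 / dist x y) ^ (2 * ?n) \<le> (2 / ?\<rho>) ^ (2 * ?n)" by (intro power_mono) auto
                from mult_left_mono[OF this, of "(w x - w z)^2"] show ?thesis by (simp add: power_divide)
              qed
              ultimately show ?thesis using True by (simp add: G_def ennreal_leI)
            qed (auto simp: G_def indicator_def)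
          qed
          also have "\<dots> = ennreal ?a * emeasure ?S (ball x (8 * ?\<rho>))"
            by (rule nn_integral_cmult_indicator) simp
          also have "\<dots> \<le> ennreal ?a * ennreal (K * (8 * ?\<rho>) ^ m)" using \<rho> by (intro mult_left_mono cap) auto
          also have "\<dots> = ennreal (?a * (K * (8 * ?\<rho>) ^ m))" using K \<rho> by (intro ennreal_mult[symmetric]) auto
          also have "?a * (K * (8 * ?\<rho>) ^ m) = C1 * ((w x - w z)^2 / ?\<rho> ^ (?n + 1))"
          proof -
            have "?\<rho> ^ (2 * ?n) = ?\<rho> ^ (?n + 1) * ?\<rho> ^ m" by (simp add: m power_add[symmetric] mult_2 del: power_Suc)
            then have "(2 / ?\<rho>) ^ (2 * ?n) * ?\<rho> ^ m = 2 ^ (2 * ?n) / ?\<rho> ^ (?n + 1)"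
              using \<rho> by (simp add: power_divide del: power_Suc power_mult)
            moreover have "?a * (K * (8 * ?\<rho>) ^ m) = (w x - w z)^2 * K * 8 ^ m * ((2 / ?\<rho>) ^ (2 * ?n) * ?\<rho> ^ m)"
              by (simp only: power_mult_distrib mult_ac)
            ultimately show ?thesis by (simp add: C1_def mult_ac del: power_Suc)
          qed
          also have "ennreal (C1 * ((w x - w z)^2 / ?\<rho> ^ (?n + 1))) = ennreal C1 * ennreal ((w x - w z)^2 / ?\<rho> ^ (?n + 1))"
            using C1 by (intro ennreal_mult) auto
          also have "ennreal ((w x - w z)^2 / ?\<rho> ^ (?n + 1)) = k x z" using True by (simp add: k_def)
          finally show ?thesis .
        qed
      qed
      also have "\<dots> = ennreal C1 * (\<integral>\<^sup>+z. k x z)" by (rule nn_integral_cmult) measurable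
      finally show ?thesis .
    qed
    define h where "h x y = ennreal ((norm (grad w y))^2 / dist y x ^ m) * indicator {y. dist y x / 16 < R - norm y} y" for x y
    let ?hh = "\<integral>\<^sup>+x. \<integral>\<^sup>+y. h x y \<partial>lborel \<partial>?S"
    have hm'[measurable]: "(\<lambda>p. h (f1 p) (f2 p)) \<in> borel_measurable M"
      if [measurable]: "f1 \<in> borel_measurable M" "f2 \<in> borel_measurable M" for f1 f2 and M :: "'z measure"
      unfolding h_def indicator_def by measurable
    \<comment> \<open>The cone condition passes to the points of the segment because it scales with
      \<open>s^2\<close>. The factor \<open>(s^2) ^ n\<close> is exactly the Jacobian of the map
      sending \<open>z\<close> to \<open>x + s^2 (z - x)\<close>, so every \<open>s\<close>
      contributes the same amount.\<close>
    have step3: "(\<integral>\<^sup>+z. k x z) \<le> 4 * (\<integral>\<^sup>+y. h x y)" if x: "norm x = R" for x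
    proof -
      let ?p = "\<lambda>s z. x + s^2 *R (z - x)"
      let ?h = "\<lambda>s z. ennreal (4 * s\<^sup>2 ^ ?n) * h x (?p s z) * indicator {0<..1} s"
      let ?e = "\<lambda>s z. ennreal (4 * s^2 * (norm (z - x))^2 * (norm (grad w (?p s z)))^2) * indicator {0..1} s"
      have "(\<integral>\<^sup>+z. k x z) \<le> (\<integral>\<^sup>+z. \<integral>\<^sup>+s. ?h s z \<partial>lborel \<partial>lborel)"
      proof (rule nn_integral_mono, goal_cases)
        case (1 z)
        show ?case
        proof (cases "dist z x / 16 < R - norm z")
          case True
          have \<rho>: "dist z x > 0"
            using True x by (cases "z = x") auto
          let ?i = "1 / dist z x ^ (?n + 1)"
          have "k x z = ennreal ?i * ennreal ((w x - w z)^2)"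
            using True \<rho> by (simp add: k_def ennreal_mult'[symmetric])
          also have "\<dots> \<le> ennreal ?i * (\<integral>\<^sup>+s. ?e s z)"
            by (intro mult_left_mono segment_difference_sq w) auto
          also have "\<dots> = (\<integral>\<^sup>+s. ennreal ?i * (?e s z))"
            by (rule nn_integral_cmult[symmetric]) measurable
          also have "\<dots> \<le> (\<integral>\<^sup>+s. ?h s z)"
          proof (rule nn_integral_mono_AE, goal_cases)
            case 1
            have "AE s in lborel. s \<noteq> (0::real)" by (rule AE_lborel_singleton)
            then show ?case
            proof eventually_elim
              case s0: (elim s)
              show ?case
              proof (cases "0 \<le> s \<and> s \<le> 1")
                case s: True
                have s2: "0 < s^2" "s^2 \<le> 1" using s s0 by (auto simp: power_le_one)
                have dp: "dist (?p s z) x = s^2 * dist z x" by (simp add: dist_norm)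
                have np: "norm (?p s z) \<le> (1 - s^2) * R + s^2 * norm z"
                proof -
                  have "?p s z = (1 - s^2) *R x + s^2 *R z" by (simp add: algebra_simps)
                  then have "norm (?p s z) \<le> norm ((1 - s^2) *R x) + norm (s^2 *R z)" by (simp only: norm_triangle_ineq)
                  then show ?thesis using s2 x by simp
                qed
                have "dist (?p s z) x / 16 = s^2 * (dist z x / 16)" by (simp add: dp)
                also have "\<dots> < s^2 * (R - norm z)" using True s2 by (intro mult_strict_left_mono)
                also have "\<dots> \<le> R - norm (?p s z)" using np by (simp add: algebra_simps)
                finally have cone: "dist (?p s z) x / 16 < R - norm (?p s z)" .
                have "?i * (4 * s^2 * (norm (z - x))^2 * (norm (grad w (?p s z)))^2)
                    = (4 * s\<^sup>2 ^ ?n) * ((norm (grad w (?p s z)))^2 / dist (?p s z) x ^ m)"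
                  unfolding dp using \<rho> s2 by (simp add: m dist_norm power_mult_distrib power2_eq_square[of "norm (z - x)"] field_simps)
                then have "ennreal ?i * ennreal (4 * s^2 * (norm (z - x))^2 * (norm (grad w (?p s z)))^2)
                    = ennreal (4 * s\<^sup>2 ^ ?n) * ennreal ((norm (grad w (?p s z)))^2 / dist (?p s z) x ^ m)"
                  by (subst (1 2) ennreal_mult'[symmetric]) auto
                then show ?thesis using s s0 cone by (simp add: h_def)
              qed (auto simp: indicator_def)
            qed
          qed
          finally show ?thesis .
        qed (simp add: k_def)
      qed
      also have "\<dots> = (\<integral>\<^sup>+s. \<integral>\<^sup>+z. ?h s z \<partial>lborel \<partial>lborel)"
        by (rule lborel_pair.Fubini') measurable
      also have "\<dots> \<le> (\<integral>\<^sup>+s. (4 * (\<integral>\<^sup>+y. h x y)) * indicator {0<..1::real} s \<partial>lborel)"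
      proof (rule nn_integral_mono, goal_cases)
        case (1 s)
        show ?case
        proof (cases "0 < s \<and> s \<le> 1")
          case True
          have "(\<integral>\<^sup>+z. ?h s z)
            = ennreal (4 * s\<^sup>2 ^ ?n) * (\<integral>\<^sup>+z. h x (?p s z))"
            using True by (simp add: nn_integral_cmult)
          also have "\<dots> = 4 * (ennreal (\<bar>s^2\<bar> ^ ?n) * (\<integral>\<^sup>+z. h x ((x - s^2 *R x) + s^2 *R z)))"
            by (simp add: ennreal_mult mult.assoc algebra_simps)
          also have "\<dots> = 4 * (\<integral>\<^sup>+y. h x y)"
            using True by (subst nn_integral_lborel_affine[of "s^2" "h x" "x - s^2 *R x"]) auto
          finally show ?thesis using True by simp
        qed (auto simp: indicator_def)
      qed
      also have "\<dots> = 4 * (\<integral>\<^sup>+y. h x y)"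
        by (subst nn_integral_cmult_indicator) simp_all
      finally show ?thesis .
    qed
    \<comment> \<open>For fixed \<open>y\<close> at depth \<open>\<delta>\<close>, the point
      \<open>x\<close> lies in a cap of radius \<open>16 \<delta>\<close> and at distance at least
      \<open>\<delta>\<close>; the powers \<open>\<delta> ^ (n - 1)\<close> cancel.\<close>
    have step4: "?hh \<le> ennreal (K * 16 ^ m) * ?I w"
    proof -
      have "?hh = (\<integral>\<^sup>+y. \<integral>\<^sup>+x. h x y \<partial>?S \<partial>lborel)"
        by (rule SL.Fubini'[symmetric]) measurable
      also have "\<dots> \<le> (\<integral>\<^sup>+y. ennreal (K * 16 ^ m) * (ennreal ((norm (grad w y))^2) * indicator (cball 0 R) y))"
      proof (rule nn_integral_mono)
        fix y :: 'a
        define \<delta> where "\<delta> = R - norm y"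
        show "(\<integral>\<^sup>+x. h x y \<partial>?S) \<le> ennreal (K * 16 ^ m) * (ennreal ((norm (grad w y))^2) * indicator (cball 0 R) y)"
        proof (cases "\<delta> > 0")
          case False
          have "h x y = 0" for x
            using False zero_le_dist[of y x] by (auto simp: h_def indicator_def \<delta>_def simp del: zero_le_dist)
          then show ?thesis by simp
        next
          case True
          let ?g = "(norm (grad w y))^2"
          have "(\<integral>\<^sup>+x. h x y \<partial>?S) \<le> (\<integral>\<^sup>+x. ennreal (?g / \<delta> ^ m) * indicator (ball y (16 * \<delta>)) x \<partial>?S)"
          proof (rule nn_integral_mono_AE, goal_cases)
            case 1
            show ?case
              using AS
            proof eventually_elim
              case x: (elim x)
              show ?case
              proof (cases "dist y x / 16 < \<delta>")
                case c: True
                have "\<delta> \<le> dist y x" unfolding \<delta>_def using x norm_triangle_sub[of x y] by (simp add: dist_norm norm_minus_commute)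
                then have "?g / dist y x ^ m \<le> ?g / \<delta> ^ m" using True by (intro divide_left_mono power_mono mult_pos_pos zero_less_power) auto
                then show ?thesis using c by (simp add: h_def \<delta>_def ennreal_leI)
              qed (simp add: h_def \<delta>_def)
            qed
          qed
          also have "\<dots> = ennreal (?g / \<delta> ^ m) * emeasure ?S (ball y (16 * \<delta>))"
            by (rule nn_integral_cmult_indicator) simp
          also have "\<dots> \<le> ennreal (?g / \<delta> ^ m) * ennreal (K * (16 * \<delta>) ^ m)" using True by (intro mult_left_mono cap) auto
          also have "\<dots> = ennreal (?g / \<delta> ^ m * (K * (16 * \<delta>) ^ m))" using True K by (intro ennreal_mult[symmetric]) auto
          also have "?g / \<delta> ^ m * (K * (16 * \<delta>) ^ m) = K * 16 ^ m * ?g" using True by (simp add: power_mult_distrib)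
          also have "ennreal (K * 16 ^ m * ?g) = ennreal (K * 16 ^ m) * ennreal ?g" using K by (intro ennreal_mult) auto
          finally show ?thesis using True by (simp add: \<delta>_def)
        qed
      qed
      also have "\<dots> = ennreal (K * 16 ^ m) * ?I w"
        by (rule nn_integral_cmult) measurable
      finally show ?thesis .
    qed
    have "?gg \<le> (\<integral>\<^sup>+x. ennreal C1 * (4 * (\<integral>\<^sup>+y. h x y)) \<partial>?S)"
    proof (rule nn_integral_mono_AE, goal_cases)
      case 1
      show ?case
        using AS
      proof eventually_elim
        fix x :: 'a assume x: "norm x = R"
        have "ennreal C1 * (\<integral>\<^sup>+z. k x z) \<le> ennreal C1 * (4 * (\<integral>\<^sup>+y. h x y))"
          by (rule mult_left_mono[OF step3[OF x]]) simp
        with step2[OF x] show "(\<integral>\<^sup>+y. g x y \<partial>?S) \<le> ennreal C1 * (4 * (\<integral>\<^sup>+y. h x y))" by (rule order_trans)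
      qed
    qed
    also have "\<dots> = ennreal C1 * (4 * ?hh)"
      by (simp add: nn_integral_cmult)
    also have "\<dots> \<le> ennreal C1 * (4 * (ennreal (K * 16 ^ m) * ?I w))"
      by (intro mult_left_mono step4) auto
    finally have "?c * (2 * ?gg) \<le> ?c * (2 * (ennreal C1 * (4 * (ennreal (K * 16 ^ m) * ?I w))))"
      by (intro mult_left_mono) auto
    also have "\<dots> = ennreal (2 * 8 ^ ?n / \<omega>) * (ennreal 2 * (ennreal C1 * (ennreal 4 * (ennreal (K * 16 ^ m) * ?I w))))"
      by simp
    also have "\<dots> = ennreal ((2 * 8 ^ ?n / \<omega>) * 2 * C1 * 4 * (K * 16 ^ m)) * ?I w"
    proof -
      have "ennreal a * (ennreal 2 * (ennreal b * (ennreal 4 * (ennreal c * X)))) = ennreal (a * 2 * b * 4 * c) * X"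
        if "a \<ge> 0" "b \<ge> 0" "c \<ge> 0" for a b c X
        using that by (simp only: ennreal_mult mult.assoc mult_nonneg_nonneg zero_le_numeral)
      then show ?thesis using K C1 \<omega> by simp
    qed
    also have "\<dots> = ennreal C * ?I w" by (simp only: C_def)
    finally show ?thesis using step1 by (rule order_trans[rotated])
  qed
  then show thesis using that Cpos by blast
qed

section \<open>Weak derivatives and weak solutions\<close>

lemma AE_lebesgue_on_iff:
  "\<Omega> \<in> sets borel \<Longrightarrow> (AE x in lebesgue_on \<Omega>. P x) \<longleftrightarrow> (AE x in lborel. x \<in> \<Omega> \<longrightarrow> P x)"
  by (simp add: AE_restrict_space_iff AE_completion_iff)

lemma measurable_lebesgue_onI:
  "f \<in> Borel \<Longrightarrow> f \<in> borel_measurable (lebesgue_on \<Omega>)"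
  by (intro measurable_restrict_space1 measurable_completion) simp

lemma indicator_scaleR_measurable:
  fixes f :: "'a::euclidean_space \<Rightarrow> 'b::euclidean_space"
  assumes "\<Omega> \<in> sets borel" "f \<in> Borel"
  shows "cut \<Omega> f \<in> Borel"
  using assms by measurable

lemma integral_lebesgue_on_borel:
  fixes f :: "'a::euclidean_space \<Rightarrow> 'b::euclidean_space"
  assumes "\<Omega> \<in> sets borel" "f \<in> Borel"
  shows "(\<integral>x. f x \<partial>lebesgue_on \<Omega>) = (\<integral>x. indicator \<Omega> x *R f x)"
  using assms indicator_scaleR_measurable[OF assms]
  by (subst integral_restrict_space) (auto simp: integral_completion)

lemma integrable_lebesgue_on_borel:
  fixes f :: "'a::euclidean_space \<Rightarrow> 'b::euclidean_space"
  assumes "\<Omega> \<in> sets borel" "f \<in> Borel"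
  shows "integrable (lebesgue_on \<Omega>) f \<longleftrightarrow> L1 (cut \<Omega> f)"
  using assms indicator_scaleR_measurable[OF assms]
  by (subst integrable_restrict_space) (auto simp: integrable_completion)

text \<open>Completeness of Lebesgue measure: a change on a null set preserves
  measurability.\<close>

lemma measurable_lebesgue_on_AE:
  fixes f :: "'a::euclidean_space \<Rightarrow> 'b::euclidean_space"
  assumes "\<Omega> \<in> sets borel" "h \<in> Borel" "ae_eq \<Omega> f h"
  shows "f \<in> borel_measurable (lebesgue_on \<Omega>)"
proof -
  have "(\<lambda>x. if x \<in> \<Omega> then h x else 0) \<in> borel_measurable lebesgue"
    using assms(1) measurable_lebesgue_onI[OF assms(2), of \<Omega>] by (subst borel_measurable_if) auto
  moreover have "AE x in lebesgue. (if x \<in> \<Omega> then h x else 0) = (if x \<in> \<Omega> then f x else 0)"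
    using assms(3) unfolding AE_lebesgue_on_iff[OF assms(1)] AE_completion_iff by eventually_elim auto
  ultimately have "(\<lambda>x. if x \<in> \<Omega> then f x else 0) \<in> borel_measurable lebesgue"
    by (rule borel_measurable_AE)
  then show ?thesis using assms(1) by (subst (asm) borel_measurable_if) auto
qed

text \<open>Substitutions and Tonelli are carried out on \<open>lborel\<close>, so functions on
  \<open>\<Omega>\<close> are replaced by Borel functions on the whole space that vanish outside
  \<open>\<Omega>\<close>.\<close>

lemma borel_representative:
  fixes f :: "'a::euclidean_space \<Rightarrow> real"
  assumes \<Omega>: "\<Omega> \<in> sets borel" and f: "f \<in> borel_measurable (lebesgue_on \<Omega>)"
  obtains h where "h \<in> Borel" "ae_eq \<Omega> f h" "\<And>x. x \<notin> \<Omega> \<Longrightarrow> h x = 0"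
proof -
  have "(\<lambda>x. if x \<in> \<Omega> then f x else 0) \<in> borel_measurable lebesgue"
    using \<Omega> f by (subst borel_measurable_if) auto
  then obtain g where g: "g \<in> borel_measurable lborel" "AE x in lborel. (if x \<in> \<Omega> then f x else 0) = g x"
    using completion_ex_borel_measurable_real by blast
  let ?h = "\<lambda>x. indicator \<Omega> x *R g x"
  have "?h \<in> Borel" using g(1) by (intro indicator_scaleR_measurable \<Omega>) simp
  moreover have "ae_eq \<Omega> f ?h"
    unfolding AE_lebesgue_on_iff[OF \<Omega>] using g(2) by eventually_elim auto
  ultimately show thesis using that[of ?h] by auto
qed

lemma L2_indicator_mult:
  fixes f :: "'a::euclidean_space \<Rightarrow> 'b::euclidean_space"
  assumes "\<Omega> \<in> sets borel" "L2 f"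
  shows "L2 (cut \<Omega> f)" "norm2 (cut \<Omega> f) \<le> norm2 f"
proof -
  have m: "cut \<Omega> f \<in> borel_measurable lborel"
    using indicator_scaleR_measurable[OF assms(1)] L2_measurable[OF assms(2)] by simp
  show "L2 (cut \<Omega> f)" "norm2 (cut \<Omega> f) \<le> norm2 f"
    using L2_bound[OF assms(2) m, of 1] by (auto simp: indicator_def)
qed

lemma L2_lebesgue_on:
  fixes f h :: "'a::euclidean_space \<Rightarrow> 'b::euclidean_space"
  assumes \<Omega>: "\<Omega> \<in> sets borel" and h: "h \<in> Borel" and eq: "ae_eq \<Omega> f h"
  shows "in_L2 (lebesgue_on \<Omega>) f \<longleftrightarrow> L2 (cut \<Omega> h)"
    and "L2_norm (lebesgue_on \<Omega>) f = norm2 (cut \<Omega> h)"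
proof -
  have fm: "f \<in> borel_measurable (lebesgue_on \<Omega>)" by (rule measurable_lebesgue_on_AE[OF \<Omega> h eq])
  have hm: "h \<in> borel_measurable (lebesgue_on \<Omega>)" by (rule measurable_lebesgue_onI[OF h])
  have hn: "(\<lambda>x. (norm (h x))^2) \<in> Borel" using h by measurable
  have im: "cut \<Omega> h \<in> borel_measurable lborel" using indicator_scaleR_measurable[OF \<Omega> h] by simp
  have eq2: "AE x in lebesgue_on \<Omega>. (norm (f x))^2 = (norm (h x))^2" using eq by eventually_elim simp
  have ind: "(norm (indicator \<Omega> x *R h x))^2 = indicator \<Omega> x *R (norm (h x))^2" for x
    by (simp add: indicator_def)
  have nm: "(\<lambda>x. (norm (f x))^2) \<in> borel_measurable (lebesgue_on \<Omega>)" "(\<lambda>x. (norm (h x))^2) \<in> borel_measurable (lebesgue_on \<Omega>)"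
    using fm hm by measurable
  have "integrable (lebesgue_on \<Omega>) (\<lambda>x. (norm (f x))^2) \<longleftrightarrow> integrable (lebesgue_on \<Omega>) (\<lambda>x. (norm (h x))^2)"
    by (rule integrable_cong_AE[OF nm eq2])
  then show "in_L2 (lebesgue_on \<Omega>) f \<longleftrightarrow> L2 (cut \<Omega> h)"
    using fm im unfolding in_L2_def ind integrable_lebesgue_on_borel[OF \<Omega> hn] by simp
  have "(\<integral>x. (norm (f x))^2 \<partial>lebesgue_on \<Omega>) = (\<integral>x. (norm (h x))^2 \<partial>lebesgue_on \<Omega>)"
    by (rule integral_cong_AE[OF nm eq2])
  then show "L2_norm (lebesgue_on \<Omega>) f = norm2 (cut \<Omega> h)"
    unfolding L2_norm_def ind integral_lebesgue_on_borel[OF \<Omega> hn] by simp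
qed

section \<open>Weak gradients of Borel representatives\<close>

lemma borel_representative_L2:
  fixes f :: "'a::euclidean_space \<Rightarrow> real"
  assumes \<Omega>: "\<Omega> \<in> sets borel" and f: "in_L2 (lebesgue_on \<Omega>) f"
  obtains h where "L2 h" "ae_eq \<Omega> f h" "\<And>x. x \<notin> \<Omega> \<Longrightarrow> h x = 0"
    "L2_norm (lebesgue_on \<Omega>) f = norm2 h"
proof -
  obtain h where h: "h \<in> Borel" "ae_eq \<Omega> f h" "\<And>x. x \<notin> \<Omega> \<Longrightarrow> h x = 0"
    using borel_representative[OF \<Omega> L2_measurable[OF f]] by blast
  have "(cut \<Omega> h) = h" using h(3) by (auto simp: fun_eq_iff indicator_def)
  then show thesis using that[OF _ h(2,3)] L2_lebesgue_on[OF \<Omega> h(1,2)] f by simp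
qed

text \<open>The gradient as one vector function, tested over \<open>lborel\<close>. The support of
  the test function confines the integrals to \<open>\<Omega>\<close>, so global representatives can
  be added, cut off and mollified without restricted measures.\<close>

definition weak_grad :: "'a::euclidean_space set \<Rightarrow> ('a \<Rightarrow> real) \<Rightarrow> ('a \<Rightarrow> 'a) \<Rightarrow> bool"
  where "weak_grad \<Omega> u G \<longleftrightarrow> (\<forall>b\<in>Basis. \<forall>\<phi>. test_function \<Omega> \<phi> \<longrightarrow>
    (\<integral>x. dirderiv b \<phi> x * u x) = - (\<integral>x. \<phi> x * (G x \<bullet> b)))"

lemma integral_test_function_lebesgue_on:
  fixes \<phi> u h :: "'a::euclidean_space \<Rightarrow> real"
  assumes \<Omega>: "\<Omega> \<in> sets borel" and \<phi>: "test_function \<Omega> \<phi>" and h: "h \<in> Borel"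
    and eq: "ae_eq \<Omega> u h"
  shows "(\<integral>x. \<phi> x *R u x \<partial>lebesgue_on \<Omega>) = (\<integral>x. \<phi> x * h x)"
proof -
  have \<phi>m: "\<phi> \<in> Borel" by (rule measurable_test_function[OF \<phi>])
  have um: "u \<in> borel_measurable (lebesgue_on \<Omega>)" by (rule measurable_lebesgue_on_AE[OF \<Omega> h eq])
  have "(\<integral>x. \<phi> x *R u x \<partial>lebesgue_on \<Omega>) = (\<integral>x. \<phi> x * h x \<partial>lebesgue_on \<Omega>)"
  proof (rule integral_cong_AE)
    show "(\<lambda>x. \<phi> x *R u x) \<in> borel_measurable (lebesgue_on \<Omega>)"
      by (intro borel_measurable_scaleR um measurable_lebesgue_onI \<phi>m)
    show "(\<lambda>x. \<phi> x * h x) \<in> borel_measurable (lebesgue_on \<Omega>)"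
      by (intro borel_measurable_times measurable_lebesgue_onI \<phi>m h)
    show "AE x in lebesgue_on \<Omega>. \<phi> x *R u x = \<phi> x * h x" using eq by eventually_elim simp
  qed
  also have "\<dots> = (\<integral>x. indicator \<Omega> x *R (\<phi> x * h x))"
    using \<phi>m h by (intro integral_lebesgue_on_borel \<Omega>) simp
  also have "(\<lambda>x. indicator \<Omega> x *R (\<phi> x * h x)) = (\<lambda>x. \<phi> x * h x)"
    using test_outside[OF \<phi>] by (auto simp: fun_eq_iff indicator_def)
  finally show ?thesis .
qed

lemma is_weak_deriv_iff:
  fixes u g u' g' :: "'a::euclidean_space \<Rightarrow> real"
  assumes \<Omega>: "\<Omega> \<in> sets borel" and u: "u' \<in> Borel" "ae_eq \<Omega> u u'"
    and g: "g' \<in> Borel" "ae_eq \<Omega> g g'"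
  shows "is_weak_deriv \<Omega> b u g \<longleftrightarrow>
    (\<forall>\<phi>. test_function \<Omega> \<phi> \<longrightarrow> (\<integral>x. dirderiv b \<phi> x * u' x) = - (\<integral>x. \<phi> x * g' x))"
  unfolding is_weak_deriv_def
  using integral_test_function_lebesgue_on[OF \<Omega> _ g] integral_test_function_lebesgue_on[OF \<Omega> test_dirderiv u]
  by auto

text \<open>\<open>weak_deriv\<close> is a choice; orthogonality of the difference to all test
  functions shows that the choice does not matter up to null sets.\<close>

lemma weak_deriv_unique:
  fixes u g1 g2 :: "'a::euclidean_space \<Rightarrow> real"
  assumes \<Omega>: "open \<Omega>" and g: "in_L2 (lebesgue_on \<Omega>) g1" "in_L2 (lebesgue_on \<Omega>) g2"
    and w: "is_weak_deriv \<Omega> b u g1" "is_weak_deriv \<Omega> b u g2"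
  shows "ae_eq \<Omega> g1 g2"
proof -
  have \<Omega>b: "\<Omega> \<in> sets borel" using \<Omega> by simp
  obtain h1 where h1: "L2 h1" "ae_eq \<Omega> g1 h1"
    using borel_representative_L2[OF \<Omega>b g(1)] by blast
  obtain h2 where h2: "L2 h2" "ae_eq \<Omega> g2 h2"
    using borel_representative_L2[OF \<Omega>b g(2)] by blast
  have hm: "h1 \<in> Borel" "h2 \<in> Borel"
    using L2_measurable h1(1) h2(1) by force+
  have "(\<integral>x. \<phi> x * (h1 x - h2 x)) = 0" if \<phi>: "test_function \<Omega> \<phi>" for \<phi>
  proof -
    have "(\<integral>x. \<phi> x *R g1 x \<partial>lebesgue_on \<Omega>) = (\<integral>x. \<phi> x *R g2 x \<partial>lebesgue_on \<Omega>)"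
      using w \<phi> by (simp add: is_weak_deriv_def)
    then have "(\<integral>x. \<phi> x * h1 x) = (\<integral>x. \<phi> x * h2 x)"
      using integral_test_function_lebesgue_on[OF \<Omega>b \<phi> hm(1) h1(2)] integral_test_function_lebesgue_on[OF \<Omega>b \<phi> hm(2) h2(2)]
      by simp
    then show ?thesis
      using L2_integrable_mult[OF L2_test_function[OF \<phi>] h1(1)] L2_integrable_mult[OF L2_test_function[OF \<phi>] h2(1)]
      by (simp add: right_diff_distrib)
  qed
  from AE_zero_if_orthogonal_test_functions[OF \<Omega> L2_diff[OF h1(1) h2(1)] this]
  have "AE x in lebesgue_on \<Omega>. h1 x - h2 x = 0" unfolding AE_lebesgue_on_iff[OF \<Omega>b] .
  then show ?thesis using h1(2) h2(2) by eventually_elim simp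
qed

lemma in_H1_weak_deriv:
  assumes "in_H1 \<Omega> u" "b \<in> Basis"
  shows "in_L2 (lebesgue_on \<Omega>) (weak_deriv \<Omega> b u)" "is_weak_deriv \<Omega> b u (weak_deriv \<Omega> b u)"
proof -
  have "\<exists>g. in_L2 (lebesgue_on \<Omega>) g \<and> is_weak_deriv \<Omega> b u g" using assms by (auto simp: in_H1_def)
  then have "in_L2 (lebesgue_on \<Omega>) (weak_deriv \<Omega> b u) \<and> is_weak_deriv \<Omega> b u (weak_deriv \<Omega> b u)"
    unfolding weak_deriv_def by (rule someI_ex)
  then show "in_L2 (lebesgue_on \<Omega>) (weak_deriv \<Omega> b u)" "is_weak_deriv \<Omega> b u (weak_deriv \<Omega> b u)" by auto
qed

lemma L2_norm_AE_cong:
  assumes "f \<in> borel_measurable M" "g \<in> borel_measurable M" "AE x in M. f x = g x"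
  shows "L2_norm M f = L2_norm M g"
proof -
  have "AE x in M. (norm (f x))^2 = (norm (g x))^2" using assms(3) by eventually_elim simp
  moreover have "(\<lambda>x. (norm (f x))^2) \<in> borel_measurable M" "(\<lambda>x. (norm (g x))^2) \<in> borel_measurable M"
    using assms(1,2) by measurable
  ultimately have "(\<integral>x. (norm (f x))^2 \<partial>M) = (\<integral>x. (norm (g x))^2 \<partial>M)"
    by (intro integral_cong_AE)
  then show ?thesis by (simp add: L2_norm_def)
qed

lemma L2_norm_sq_Basis:
  fixes G :: "'a \<Rightarrow> 'b::euclidean_space"
  assumes "in_L2 M G"
  shows "(L2_norm M G)^2 = (\<Sum>b\<in>Basis. (L2_norm M (\<lambda>x. G x \<bullet> b))^2)"
    and L2_inner_Basis: "b \<in> Basis \<Longrightarrow> in_L2 M (\<lambda>x. G x \<bullet> b)"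
proof -
  have [measurable]: "G \<in> borel_measurable M" using assms by (rule L2_measurable)
  have c: "in_L2 M (\<lambda>x. G x \<bullet> b)" if "b \<in> Basis" for b
    by (rule L2_bound(1)[OF assms, where C=1]) (use that in \<open>auto simp: Basis_le_norm\<close>)
  then show "b \<in> Basis \<Longrightarrow> in_L2 M (\<lambda>x. G x \<bullet> b)" for b .
  have "(norm (G x))^2 = (\<Sum>b\<in>Basis. (norm (G x \<bullet> b))^2)" for x
    unfolding power2_norm_eq_inner[of "G x"] by (subst euclidean_inner) (simp add: power2_eq_square)
  then show "(L2_norm M G)^2 = (\<Sum>b\<in>Basis. (L2_norm M (\<lambda>x. G x \<bullet> b))^2)"
    unfolding L2_norm_sq using c by (simp add: L2_integrable del: real_norm_def)
qed

text \<open>The bridge from Borel representatives to the definitions: an explicit weak gradient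
  agrees almost everywhere with the chosen \<open>weak_deriv\<close> and therefore computes
  \<open>H1_norm\<close>.\<close>

lemma weak_grad_H1:
  fixes u u' :: "'a::euclidean_space \<Rightarrow> real" and G :: "'a \<Rightarrow> 'a"
  assumes \<Omega>: "open \<Omega>" and L: "L2 u'" "L2 G" and w: "weak_grad \<Omega> u' G"
    and eq: "ae_eq \<Omega> u u'"
  shows "in_H1 \<Omega> u" and "b \<in> Basis \<Longrightarrow> AE x in lebesgue_on \<Omega>. weak_deriv \<Omega> b u x = G x \<bullet> b"
    and "(H1_norm \<Omega> u)^2 = (norm2 (cut \<Omega> u'))^2 + (norm2 (cut \<Omega> G))^2"
proof -
  have \<Omega>b: "\<Omega> \<in> sets borel" using \<Omega> by simp
  have um: "u' \<in> Borel" and Gm[measurable]: "G \<in> Borel"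
    using L2_measurable L by force+
  have Gbm: "(\<lambda>x. G x \<bullet> b) \<in> Borel" for b by measurable
  have GbL: "in_L2 (lebesgue_on \<Omega>) (\<lambda>x. G x \<bullet> b)" if "b \<in> Basis" for b
    using L2_lebesgue_on(1)[OF \<Omega>b Gbm, of "\<lambda>x. G x \<bullet> b" b]
      L2_indicator_mult(1)[OF \<Omega>b L2_inner_Basis[OF L(2) that]] by simp
  have wd: "is_weak_deriv \<Omega> b u (\<lambda>x. G x \<bullet> b)" if "b \<in> Basis" for b
    using w that by (subst is_weak_deriv_iff[OF \<Omega>b um eq Gbm]) (auto simp: weak_grad_def)
  have "in_L2 (lebesgue_on \<Omega>) u"
    using L2_lebesgue_on(1)[OF \<Omega>b um eq] L2_indicator_mult(1)[OF \<Omega>b L(1)] by simp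
  then show H1: "in_H1 \<Omega> u" unfolding in_H1_def using GbL wd by blast
  have ae: "AE x in lebesgue_on \<Omega>. weak_deriv \<Omega> b u x = G x \<bullet> b" if "b \<in> Basis" for b
    by (rule weak_deriv_unique[OF \<Omega> in_H1_weak_deriv(1)[OF H1 that] GbL[OF that] in_H1_weak_deriv(2)[OF H1 that] wd[OF that]])
  then show "b \<in> Basis \<Longrightarrow> AE x in lebesgue_on \<Omega>. weak_deriv \<Omega> b u x = G x \<bullet> b" for b .
  have "L2_norm (lebesgue_on \<Omega>) (weak_deriv \<Omega> b u) = norm2 (\<lambda>x. (indicator \<Omega> x *R G x) \<bullet> b)" if "b \<in> Basis" for b
    using L2_lebesgue_on(2)[OF \<Omega>b Gbm ae[OF that]] by simp
  then show "(H1_norm \<Omega> u)^2 = (norm2 (cut \<Omega> u'))^2 + (norm2 (cut \<Omega> G))^2"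
    unfolding H1_norm_def L2_norm_sq_Basis(1)[OF L2_indicator_mult(1)[OF \<Omega>b L(2)]] L2_lebesgue_on(2)[OF \<Omega>b um eq]
    by (simp add: sum_nonneg)
qed

lemma in_H1_representatives:
  fixes u :: "'a::euclidean_space \<Rightarrow> real"
  assumes \<Omega>: "open \<Omega>" and u: "in_H1 \<Omega> u"
  obtains u' G where "L2 u'" "L2 G" "weak_grad \<Omega> u' G" "ae_eq \<Omega> u u'"
    "\<And>x. x \<notin> \<Omega> \<Longrightarrow> u' x = 0" "\<And>x. x \<notin> \<Omega> \<Longrightarrow> G x = 0"
proof -
  have \<Omega>b: "\<Omega> \<in> sets borel" using \<Omega> by simp
  obtain u' where u': "L2 u'" "ae_eq \<Omega> u u'" "\<And>x. x \<notin> \<Omega> \<Longrightarrow> u' x = 0"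
    using borel_representative_L2[OF \<Omega>b, of u] u unfolding in_H1_def by blast
  have "\<exists>g. L2 g \<and> (AE x in lebesgue_on \<Omega>. weak_deriv \<Omega> b u x = g x) \<and> (\<forall>x. x \<notin> \<Omega> \<longrightarrow> g x = 0)"
    if "b \<in> Basis" for b
    using borel_representative_L2[OF \<Omega>b in_H1_weak_deriv(1)[OF u that]] by metis
  then obtain g where g: "\<And>b. b \<in> Basis \<Longrightarrow> L2 (g b)"
    "\<And>b. b \<in> Basis \<Longrightarrow> AE x in lebesgue_on \<Omega>. weak_deriv \<Omega> b u x = g b x"
    "\<And>b x. b \<in> Basis \<Longrightarrow> x \<notin> \<Omega> \<Longrightarrow> g b x = 0" by metis
  define G where "G x = (\<Sum>b\<in>Basis. g b x *R b)" for x
  have Gb: "G x \<bullet> b = g b x" if "b \<in> Basis" for x b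
    using that by (simp add: G_def inner_sum_left inner_Basis if_distrib cong: if_cong)
  have "L2 (\<lambda>x. g b x *R b)" if b: "b \<in> Basis" for b
  proof -
    have [measurable]: "g b \<in> Borel" using L2_measurable[OF g(1)[OF b]] by simp
    have "(\<lambda>x. g b x *R b) \<in> Borel" by measurable
    then show ?thesis using b by (intro L2_bound(1)[OF g(1)[OF b], where C=1]) auto
  qed
  then have GL: "L2 G" unfolding G_def[abs_def] by (intro L2_sum)
  have "weak_grad \<Omega> u' G"
    unfolding weak_grad_def
  proof (intro ballI)
    fix b :: 'a assume b: "b \<in> Basis"
    have "u' \<in> Borel" "g b \<in> Borel"
      using L2_measurable u'(1) g(1)[OF b] by force+
    from is_weak_deriv_iff[OF \<Omega>b this(1) u'(2) this(2) g(2)[OF b], of b] in_H1_weak_deriv(2)[OF u b]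
    show "\<forall>\<phi>. test_function \<Omega> \<phi> \<longrightarrow> (\<integral>x. dirderiv b \<phi> x * u' x) = - (\<integral>x. \<phi> x * (G x \<bullet> b))"
      using b by (simp add: Gb)
  qed
  moreover have "G x = 0" if "x \<notin> \<Omega>" for x using g(3) that by (simp add: G_def)
  ultimately show thesis using that u' GL by blast
qed

text \<open>One more integration by parts moves both derivatives to the test function. This is the
  form in which the Riesz representation delivers solutions and in which the limit of deep wells is
  taken.\<close>

lemma weak_solution_iff:
  fixes u u' a a' :: "'a::euclidean_space \<Rightarrow> real" and G :: "'a \<Rightarrow> 'a"
  assumes \<Omega>: "open \<Omega>" and L: "L2 u'" "L2 G" and w: "weak_grad \<Omega> u' G"
    and eq: "ae_eq \<Omega> u u'"
    and a: "a' \<in> Borel" "\<And>x. \<bar>a' x\<bar> \<le> B" "ae_eq \<Omega> a a'"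
  shows "weak_solution \<Omega> a (\<lambda>x. 0) u \<longleftrightarrow>
    (\<forall>\<phi>. test_function \<Omega> \<phi> \<longrightarrow> (\<integral>x. u' x * (laplacian \<phi> x + a' x * \<phi> x)) = 0)"
proof -
  let ?W = "\<lambda>\<phi> x. (a x * \<phi> x) *R u x - (\<Sum>b\<in>Basis. dirderiv b \<phi> x *R weak_deriv \<Omega> b u x)"
  have \<Omega>b: "\<Omega> \<in> sets borel" using \<Omega> by simp
  have um[measurable]: "u' \<in> Borel" and Gm[measurable]: "G \<in> Borel"
    using L2_measurable L by force+
  have am: "a \<in> borel_measurable (lebesgue_on \<Omega>)" by (rule measurable_lebesgue_on_AE[OF \<Omega>b a(1,3)])
  have um': "u \<in> borel_measurable (lebesgue_on \<Omega>)" by (rule measurable_lebesgue_on_AE[OF \<Omega>b um eq])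
  have H1: "in_H1 \<Omega> u" by (rule weak_grad_H1(1)[OF \<Omega> L w eq])
  have "(\<integral>x. ?W \<phi> x \<partial>lebesgue_on \<Omega>)
      = (\<integral>x. u' x * (laplacian \<phi> x + a' x * \<phi> x))" if \<phi>: "test_function \<Omega> \<phi>" for \<phi>
  proof -
    have \<phi>m[measurable]: "\<phi> \<in> Borel" and d\<phi>m[measurable]: "dirderiv b \<phi> \<in> Borel" for b
      using measurable_test_function \<phi> test_dirderiv[OF \<phi>] by blast+
    have [measurable]: "a' \<in> Borel" by (rule a(1))
    let ?F = "\<lambda>x. (a' x * \<phi> x) * u' x - (\<Sum>b\<in>Basis. dirderiv b \<phi> x * (G x \<bullet> b))"
    have Fm: "?F \<in> Borel" by measurable
    have "(\<integral>x. ?W \<phi> x \<partial>lebesgue_on \<Omega>)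
        = (\<integral>x. ?F x \<partial>lebesgue_on \<Omega>)"
    proof (rule integral_cong_AE)
      show "(\<lambda>x. ?W \<phi> x) \<in> borel_measurable (lebesgue_on \<Omega>)"
        by (intro borel_measurable_diff borel_measurable_sum borel_measurable_scaleR borel_measurable_times am um'
            measurable_lebesgue_onI \<phi>m d\<phi>m L2_measurable[OF in_H1_weak_deriv(1)[OF H1]])
      show "?F \<in> borel_measurable (lebesgue_on \<Omega>)" by (rule measurable_lebesgue_onI[OF Fm])
      have "AE x in lebesgue_on \<Omega>. \<forall>b\<in>Basis. weak_deriv \<Omega> b u x = G x \<bullet> b"
        using weak_grad_H1(2)[OF \<Omega> L w eq] by (intro AE_finite_allI) auto
      then show "AE x in lebesgue_on \<Omega>. ?W \<phi> x = ?F x"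
        using eq a(3) by eventually_elim simp
    qed
    also have "\<dots> = (\<integral>x. indicator \<Omega> x *R ?F x)" by (rule integral_lebesgue_on_borel[OF \<Omega>b Fm])
    also have "(cut \<Omega> ?F) = ?F"
    proof
      fix x
      show "indicator \<Omega> x *R ?F x = ?F x"
        using test_outside[OF \<phi>, of x] test_outside[OF test_dirderiv[OF \<phi>], of x]
        by (cases "x \<in> \<Omega>") auto
    qed
    also have "(\<integral>x. ?F x) = (\<integral>x. (a' x * \<phi> x) * u' x) - (\<Sum>b\<in>Basis. \<integral>x. dirderiv b \<phi> x * (G x \<bullet> b))"
    proof -
      have i: "L1 (\<lambda>x. dirderiv b \<phi> x * (G x \<bullet> b))" if "b \<in> Basis" for b
        by (intro L2_integrable_mult L2_test_function[OF test_dirderiv[OF \<phi>]] L2_inner_Basis[OF L(2) that])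
      have aphi: "L2 (\<lambda>x. a' x * \<phi> x)"
        by (rule L2_bounded_mult(1)[OF L2_test_function[OF \<phi>] _ a(2)]) simp
      show ?thesis using i L2_integrable_mult[OF aphi L(1)] by simp
    qed
    also have "(\<Sum>b\<in>Basis. \<integral>x. dirderiv b \<phi> x * (G x \<bullet> b)) = (\<Sum>b\<in>Basis. - (\<integral>x. dirderiv b (dirderiv b \<phi>) x * u' x))"
      using w test_dirderiv[OF \<phi>] by (intro sum.cong refl) (simp add: weak_grad_def)
    also have "\<dots> = - (\<integral>x. laplacian \<phi> x * u' x)"
    proof -
      have "(\<integral>x. laplacian \<phi> x * u' x) = (\<Sum>b\<in>Basis. \<integral>x. dirderiv b (dirderiv b \<phi>) x * u' x)"
        unfolding laplacian_def sum_distrib_right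
        by (intro Bochner_Integration.integral_sum L2_integrable_mult L
            L2_test_function[OF test_dirderiv[OF test_dirderiv[OF \<phi>]]])
      then show ?thesis by (simp add: sum_negf)
    qed
    also have "(\<integral>x. (a' x * \<phi> x) * u' x) - - (\<integral>x. laplacian \<phi> x * u' x)
        = (\<integral>x. (a' x * \<phi> x) * u' x + laplacian \<phi> x * u' x)"
    proof -
      have aphi: "L2 (\<lambda>x. a' x * \<phi> x)"
        by (rule L2_bounded_mult(1)[OF L2_test_function[OF \<phi>] _ a(2)]) simp
      show ?thesis
        using L2_integrable_mult[OF aphi L(1)]
          L2_integrable_mult[OF L2_test_function[OF test_laplacian[OF \<phi>]] L(1)] by simp
    qed
    finally show ?thesis by (simp add: algebra_simps)
  qed
  then show ?thesis unfolding weak_solution_def using H1 by simp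
qed

lemma trace_L2:
  fixes w :: "'a::euclidean_space \<Rightarrow> real"
  assumes w: "smooth w" and R: "R > 0"
  defines "S \<equiv> cball (0::'a) R"
  shows L2_sphere: "in_L2 (sphere_measure R) w"
    and "L2 (cut S w)" "L2 (cut S (grad w))"
    and "(L2_norm (sphere_measure R) w)^2 \<le> real DIM('a) / R * (1 + R) *
      ((norm2 (cut S w))^2 + (norm2 (cut S (grad w)))^2)"
proof -
  have S[measurable]: "S \<in> sets borel" by (simp add: S_def)
  have ball: "(\<lambda>x. indicator S x *R (indicator (ball 0 (R + 1)) x *R h x)) = (cut S h)"
    for h :: "'a \<Rightarrow> 'c::euclidean_space"
    by (auto simp: S_def fun_eq_iff indicator_def)
  show 1: "L2 (cut S w)"
    using L2_indicator_mult(1)[OF S L2_continuous_ball[OF smooth_continuous[OF w], of "R + 1"]] unfolding ball .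
  show 2: "L2 (cut S (grad w))"
    using L2_indicator_mult(1)[OF S L2_continuous_ball[OF smooth_continuous[OF smooth_grad[OF w]], of "R + 1"]] unfolding ball .
  define K where "K = real DIM('a) / R * (1 + R)"
  define L where "L = (norm2 (cut S w))^2 + (norm2 (cut S (grad w)))^2"
  have K: "K \<ge> 0" and L: "L \<ge> 0" using R by (simp_all add: K_def L_def)
  have [measurable]: "w \<in> Borel" "grad w \<in> Borel"
    using smooth_measurable w smooth_grad[OF w] by blast+
  have "(\<integral>\<^sup>+x. ennreal ((w x)^2 + (norm (grad w x))^2) * indicator S x)
    = (\<integral>\<^sup>+x. ennreal ((norm (indicator S x *R w x))^2) + ennreal ((norm (indicator S x *R grad w x))^2))"
    by (intro nn_integral_cong) (auto simp: indicator_def ennreal_plus)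
  also have "\<dots> = ennreal L" unfolding L_def
    by (subst nn_integral_add, measurable, measurable) (simp only: nn_integral_L2[OF 1] nn_integral_L2[OF 2] ennreal_plus[OF zero_le_power2 zero_le_power2])
  finally have "(\<integral>\<^sup>+x. ennreal ((norm (w x))^2) \<partial>sphere_measure R) \<le> ennreal (K * L)"
    using trace_inequality[OF w R] unfolding S_def K_def[symmetric] ennreal_mult[OF K L] by simp
  also have "\<dots> = ennreal ((sqrt (K * L))^2)" using K L by simp
  finally have b: "(\<integral>\<^sup>+x. ennreal ((norm (w x))^2) \<partial>sphere_measure R) \<le> ennreal ((sqrt (K * L))^2)" .
  have wm: "w \<in> borel_measurable (sphere_measure R)" by simp
  have s: "sqrt (K * L) \<ge> 0" using K L by simp
  show "in_L2 (sphere_measure R) w" by (rule L2_norm_leI_nn(1)[OF wm b s])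
  have "(L2_norm (sphere_measure R) w)^2 \<le> (sqrt (K * L))^2"
    by (rule power_mono[OF L2_norm_leI_nn(2)[OF wm b s] L2_norm_nonneg])
  then show "(L2_norm (sphere_measure R) w)^2 \<le> real DIM('a) / R * (1 + R) *
      ((norm2 (cut S w))^2 + (norm2 (cut S (grad w)))^2)"
    unfolding K_def[symmetric] L_def[symmetric] real_sqrt_pow2[OF mult_nonneg_nonneg[OF K L]] .
qed

section \<open>Traces as limits of mollifications\<close>

lemma smooth_mollify: "L1 r \<Longrightarrow> smooth (mollify k r)"
  by (intro smooth_conv test_mollifier) simp_all

lemma grad_mollify:
  fixes r :: "'a::euclidean_space \<Rightarrow> real"
  assumes r: "L1 r" and w: "weak_grad \<Omega> r G" and b: "b \<in> Basis"
    and x: "cball x (inverse (real (Suc k))) \<subseteq> \<Omega>"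
  shows "grad (mollify k r) x \<bullet> b = mollify k (\<lambda>y. G y \<bullet> b) x"
proof -
  let ?e = "inverse (real (Suc k))"
  let ?m = "mollifier ?e :: 'a \<Rightarrow> real"
  have e: "?e > 0" by simp
  have "grad (mollify k r) x \<bullet> b = conv (dirderiv b ?m) r x"
    by (simp only: grad_inner_Basis[OF b] dirderiv_conv[OF test_mollifier[OF e] r])
  also have "\<dots> = - (\<integral>y. dirderiv b (\<lambda>y. ?m (x - y)) y * r y)"
    unfolding conv_def dirderiv_reflect[OF smooth_mollifier] by simp
  also have "\<dots> = mollify k (\<lambda>y. G y \<bullet> b) x"
    using w b test_mollifier_reflect[OF e x] by (simp add: weak_grad_def conv_def)
  finally show ?thesis .
qed

text \<open>On \<open>S\<close> the gradient of the mollification is the mollification of the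
  gradient once the scale is below \<open>e\<close>; hence \<open>S\<close> must keep a positive
  distance from the complement of \<open>\<Omega>\<close>.\<close>

lemma mollify_grad_tendsto:
  fixes r :: "'a::euclidean_space \<Rightarrow> real"
  assumes r: "L1 r" and G: "L2 G" and w: "weak_grad \<Omega> r G"
    and S: "S \<in> sets borel" "bounded S" and e: "e > 0" "\<And>x. x \<in> S \<Longrightarrow> cball x e \<subseteq> \<Omega>"
  shows "L2 (cut S (grad (mollify k r)))"
    and "lim2 (\<lambda>k. cut S (grad (mollify k r))) (cut S G)"
proof -
  obtain R where R: "\<And>x. x \<in> S \<Longrightarrow> norm x < R" using S(2) unfolding bounded_pos_less by blast
  have eq: "(\<lambda>x. indicator S x *R (indicator (ball 0 R) x *R h x)) = (cut S h)" for h :: "'a \<Rightarrow> 'a"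
    using R by (auto simp: fun_eq_iff indicator_def)
  show L: "L2 (cut S (grad (mollify k r)))" for k
    using L2_indicator_mult(1)[OF S(1) L2_continuous_ball[OF smooth_continuous[OF smooth_grad[OF smooth_mollify[OF r, of k]]], of R]]
    unfolding eq .
  have LG: "L2 (cut S G)" by (rule L2_indicator_mult(1)[OF S(1) G])
  let ?d = "\<lambda>k x. indicator S x *R grad (mollify k r) x - indicator S x *R G x"
  obtain k0 where k0: "inverse (real (Suc k0)) < e" using reals_Archimedean[OF e(1)] by blast
  have "(norm2 (?d k))^2 \<le> (\<Sum>b\<in>Basis. (norm2 (\<lambda>x. mollify k (\<lambda>y. G y \<bullet> b) x - G x \<bullet> b))^2)" if k: "k \<ge> k0" for k
    unfolding L2_norm_sq_Basis(1)[OF L2_diff[OF L LG]]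
  proof (intro sum_mono power_mono L2_norm_nonneg)
    fix b :: 'a assume b: "b \<in> Basis"
    have "inverse (real (Suc k)) \<le> inverse (real (Suc k0))" using k by (simp add: le_imp_inverse_le)
    then have "cball x (inverse (real (Suc k))) \<subseteq> \<Omega>" if "x \<in> S" for x
      using e(2)[OF that] k0 by (meson cball_subset_cball_iff dual_order.trans less_imp_le subset_cball)
    then have "?d k x \<bullet> b = indicator S x *R (mollify k (\<lambda>y. G y \<bullet> b) x - G x \<bullet> b)" for x
      using grad_mollify[OF r w b] by (cases "x \<in> S") (simp_all add: inner_diff_left)
    then show "norm2 (\<lambda>x. ?d k x \<bullet> b) \<le> norm2 (\<lambda>x. mollify k (\<lambda>y. G y \<bullet> b) x - G x \<bullet> b)"
      using L2_indicator_mult(2)[OF S(1) L2_diff[OF mollify_L2(1) L2_inner_Basis[OF G b]]]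
        L2_inner_Basis[OF G b] by (simp only:)
  qed
  then have le: "\<forall>\<^sub>F k in sequentially. norm ((norm2 (?d k))^2) \<le> (\<Sum>b\<in>Basis. (norm2 (\<lambda>x. mollify k (\<lambda>y. G y \<bullet> b) x - G x \<bullet> b))^2)"
    unfolding eventually_sequentially by (intro exI[of _ k0]) simp
  have "(\<lambda>k. \<Sum>b\<in>Basis. (norm2 (\<lambda>x. mollify k (\<lambda>y. G y \<bullet> b) x - G x \<bullet> b))^2) ----> (\<Sum>b\<in>(Basis::'a set). 0^2)"
    by (intro tendsto_sum tendsto_power mollify_tendsto L2_inner_Basis G)
  then have "(\<lambda>k. (norm2 (?d k))^2) ----> 0"
    using Lim_null_comparison[OF le] by simp
  from tendsto_real_sqrt[OF this] show "(\<lambda>k. norm2 (?d k)) ----> 0"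
    by (simp add: L2_norm_nonneg)
qed

lemma mollify_cball_tendsto:
  fixes r :: "'a::euclidean_space \<Rightarrow> real"
  assumes r: "L2 r" "L1 r" and G: "L2 G" and w: "weak_grad (ball 0 R') r G"
    and R: "0 < R" "R < R'"
  defines "S \<equiv> cball (0::'a) R"
  shows "lim2 (\<lambda>k. cut S (mollify k r)) (cut S r)" (is ?c1)
    and "lim2 (\<lambda>k. cut S (grad (mollify k r))) (cut S G)" (is ?c2)
    and "(\<lambda>k. norm2 (\<lambda>x. indicator S x *R mollify k r x)) ----> norm2 (cut S r)"
    and "(\<lambda>k. norm2 (cut S (grad (mollify k r)))) ----> norm2 (cut S G)"
proof -
  have S: "S \<in> sets borel" "bounded S" by (simp_all add: S_def)
  have cb: "cball x ((R' - R) / 2) \<subseteq> ball 0 R'" if "x \<in> S" for x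
    using that R unfolding S_def by (auto simp: field_simps) (smt (verit) dist_norm norm_triangle_sub norm_minus_commute)
  note tr = trace_L2[OF smooth_mollify[OF r(2)] R(1), folded S_def]
  have rS: "L2 (cut S r)" and GS: "L2 (cut S G)"
    by (intro L2_indicator_mult S r G)+
  show c1: ?c1
  proof (rule Lim_null_comparison[OF always_eventually mollify_tendsto[OF r(1)]], intro allI)
    fix k
    show "norm (dist2 (cut S (mollify k r)) (cut S r)) \<le> dist2 (mollify k r) r"
      using L2_indicator_mult(2)[OF S(1) L2_diff[OF mollify_L2(1)[OF r(1)] r(1)]]
      by (simp add: L2_norm_nonneg right_diff_distrib)
  qed
  show c2: ?c2 by (rule mollify_grad_tendsto(2)[OF r(2) G w S _ cb]) (use R in auto)
  show "(\<lambda>k. norm2 (\<lambda>x. indicator S x *R mollify k r x)) ----> norm2 (cut S r)"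
    by (rule L2_tendsto_norm[OF tr(2) rS c1])
  show "(\<lambda>k. norm2 (cut S (grad (mollify k r)))) ----> norm2 (cut S G)"
    by (rule L2_tendsto_norm[OF tr(3) GS c2])
qed

text \<open>The exceptional pairs lie in two strips over a null set. This gives pointwise
  convergence of the kernel on the product of the sphere with itself.\<close>

lemma AE_pair_same:
  assumes "finite_measure M" "AE x in M. P x"
  shows "AE z in M \<Otimes>\<^sub>M M. P (fst z) \<and> P (snd z)"
proof -
  interpret finite_measure M by fact
  obtain N where N: "N \<in> null_sets M" "{x \<in> space M. \<not> P x} \<subseteq> N"
    using assms(2) by (auto simp: eventually_ae_filter)
  have Z: "N \<times> space M \<in> null_sets (M \<Otimes>\<^sub>M M)" "space M \<times> N \<in> null_sets (M \<Otimes>\<^sub>M M)"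
    using N(1) by (auto simp: null_sets_def emeasure_pair_measure_Times)
  have "{z \<in> space (M \<Otimes>\<^sub>M M). \<not> (P (fst z) \<and> P (snd z))} \<subseteq> N \<times> space M \<union> space M \<times> N"
    using N(2) by (auto simp: space_pair_measure)
  then show ?thesis using null_sets.Un[OF Z] by (intro AE_I') auto
qed

lemma L2_tendsto_AE_subseq:
  fixes f :: "nat \<Rightarrow> 'a \<Rightarrow> real"
  assumes "\<And>n. in_L2 M (f n)" "in_L2 M g" "L2_lim M f g"
  obtains s where "strict_mono s" "AE x in M. (\<lambda>n. f (s n) x) ----> g x"
proof -
  have "(\<lambda>n. (L2_dist M (f n) g)^2) ----> 0" using tendsto_power[OF assms(3), of 2] by simp
  then have "(\<lambda>n. \<integral>x. norm ((f n x - g x)^2) \<partial>M) ----> 0" by (simp add: L2_norm_sq)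
  then obtain s where s: "strict_mono s" "AE x in M. (\<lambda>n. (f (s n) x - g x)^2) ----> 0"
    using tendsto_L1_AE_subseq[of M "\<lambda>n x. (f n x - g x)^2"] integrable_square[OF L2_diff[OF assms(1,2)]] by auto
  have "AE x in M. (\<lambda>n. f (s n) x) ----> g x"
    using s(2)
  proof eventually_elim
    case (elim x)
    from tendsto_real_sqrt[OF this] have "(\<lambda>n. f (s n) x - g x) ----> 0" by (simp add: tendsto_rabs_zero_iff)
    then show ?case by (rule LIM_zero_cancel)
  qed
  with s(1) show thesis by (rule that)
qed

text \<open>The trace is recorded as the limit of one particular sequence, the mollifications, so
  that the same approximants can be used later at both boundary spheres.\<close>

definition trace_le :: "real \<Rightarrow> ('a::euclidean_space \<Rightarrow> real) \<Rightarrow> real \<Rightarrow> bool"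
  where "trace_le R r c \<longleftrightarrow> (\<exists>g. in_L2 (sphere_measure R) g \<and>
    L2_lim (sphere_measure R) (\<lambda>k. mollify k r) g \<and> in_Hhalf R g \<and> Hhalf_norm R g \<le> c)"

text \<open>The trace inequality, applied to differences, makes the restrictions of the
  mollifications Cauchy on the sphere. The seminorm of the limit is bounded by Fatou's lemma along
  an almost everywhere convergent subsequence; convergence in \<open>H^(1/2)\<close> itself is never
  claimed.\<close>

lemma trace_exists:
  assumes R: "0 < R" "R < R'"
  obtains C where "C > 0" "\<And>(r :: 'a::euclidean_space \<Rightarrow> real) G. L2 r \<Longrightarrow> L1 r \<Longrightarrow>
    L2 G \<Longrightarrow> weak_grad (ball 0 R') r G \<Longrightarrow>
    trace_le R r (C * sqrt ((norm2 r)^2 + (norm2 G)^2))"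
proof -
  define K where "K = real DIM('a) / R * (1 + R)"
  have K: "K > 0" using R by (simp add: K_def)
  obtain H where H: "H > 0" "\<And>w :: 'a \<Rightarrow> real. smooth w \<Longrightarrow>
    (\<integral>\<^sup>+p. ennreal (Hhalf_kernel w p) \<partial>(sphere_measure R \<Otimes>\<^sub>M sphere_measure R))
      \<le> ennreal H * (\<integral>\<^sup>+y. ennreal ((norm (grad w y))^2) * indicator (cball 0 R) y)"
    using Hhalf_inequality[OF R(1)] by blast
  define S where "S = cball (0::'a) R"
  have S: "S \<in> sets borel" "bounded S" by (simp_all add: S_def)
  let ?\<sigma> = "sphere_measure R :: 'a measure"
  interpret fin: finite_measure ?\<sigma> by (rule finite_measure_sphere_measure)
  show thesis
  proof (rule that)
    show "sqrt (K + H) > 0" using K H(1) by simp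
    fix r :: "'a \<Rightarrow> real" and G
    assume r: "L2 r" "L1 r" and G: "L2 G" and w: "weak_grad (ball 0 R') r G"
    let ?w = "\<lambda>k. mollify k r"
    have sm: "smooth (?w k)" for k by (rule smooth_mollify[OF r(2)])
    note tr = trace_L2[OF sm R(1), folded S_def K_def]
    have rS: "L2 (cut S r)" and GS: "L2 (cut S G)"
      by (intro L2_indicator_mult S r G)+
    note c = mollify_cball_tendsto[OF r G w R, folded S_def]
    have C: "\<exists>N. \<forall>m\<ge>N. \<forall>n\<ge>N. L2_dist ?\<sigma> (?w m) (?w n) < e" if "e > 0" for e
    proof (rule L2_Cauchy_dominated[OF tr(2) rS c(1) tr(3) GS c(2), of 0 _ _ K])
      fix m n
      have sd: "smooth (\<lambda>x. ?w m x - ?w n x)" by (intro smooth_diff sm)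
      have i: "cut S (\<lambda>x. ?w m x - ?w n x) = (\<lambda>x. cut S (?w m) x - cut S (?w n) x)"
        "cut S (grad (\<lambda>x. ?w m x - ?w n x)) = (\<lambda>x. cut S (grad (?w m)) x - cut S (grad (?w n)) x)"
        by (simp_all only: grad_diff[OF smoothD[OF sm] smoothD[OF sm]] scaleR_diff_right)
      have "x^2 + y^2 \<le> (x + y)^2" if "x \<ge> 0" "y \<ge> 0" for x y :: real using that by (simp add: power2_sum)
      from order_trans[OF trace_L2(4)[OF sd R(1), folded S_def K_def, unfolded i] mult_left_mono[OF this]] K
      show "(L2_dist ?\<sigma> (?w m) (?w n))^2 \<le> K * (dist2 (cut S (?w m)) (cut S (?w n)) + dist2 (cut S (grad (?w m))) (cut S (grad (?w n))))^2"
        by (simp add: L2_norm_nonneg)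
    qed (use K that in auto)
    \<comment> \<open>The constant one serves as the nonvanishing square integrable weight in the
      completeness lemma, since the surface measure is finite.\<close>
    have one: "in_L2 ?\<sigma> (\<lambda>x. 1 :: real)" by (simp add: in_L2_def)
    have w0: "(1 :: real) = 0 \<Longrightarrow> ?w n x = 0" for n x by simp
    obtain g where g: "in_L2 ?\<sigma> g" "L2_lim ?\<sigma> ?w g"
      using L2_complete[OF tr(1) one w0 C] by blast
    have gm[measurable]: "g \<in> Borel" using L2_measurable[OF g(1)] by simp
    let ?r = "norm2 (cut S r)" and ?G = "norm2 (cut S G)"
    have g2: "(L2_norm ?\<sigma> g)^2 \<le> K * (?r^2 + ?G^2)"
    proof (rule LIMSEQ_le)
      show "(\<lambda>k. (L2_norm ?\<sigma> (?w k))^2) ----> (L2_norm ?\<sigma> g)^2"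
        by (intro tendsto_power L2_tendsto_norm tr(1) g)
      show "(\<lambda>k. K * ((norm2 (cut S (?w k)))^2 + (norm2 (cut S (grad (?w k))))^2))
        ----> K * (?r^2 + ?G^2)" by (intro tendsto_intros c(3,4))
    qed (use tr(4) in blast)
    obtain s where s: "strict_mono s" "AE x in ?\<sigma>. (\<lambda>n. ?w (s n) x) ----> g x"
      using L2_tendsto_AE_subseq[OF tr(1) g] by blast
    let ?P = "?\<sigma> \<Otimes>\<^sub>M ?\<sigma>"
    have [measurable]: "?w k \<in> Borel" for k by (rule smooth_measurable[OF sm])
    have km[measurable]: "Hhalf_kernel h \<in> borel_measurable ?P" if [measurable]: "h \<in> Borel" for h :: "'a \<Rightarrow> real"
      unfolding Hhalf_kernel_def by measurable
    have k0: "Hhalf_kernel h p \<ge> 0" for h :: "'a \<Rightarrow> real" and p by (simp add: Hhalf_kernel_def split: prod.split)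
    have lim: "AE p in ?P. (\<lambda>n. ennreal (Hhalf_kernel (?w (s n)) p)) ----> ennreal (Hhalf_kernel g p)"
      using AE_pair_same[OF finite_measure_sphere_measure s(2)]
    proof eventually_elim
      case (elim p)
      obtain x y where p: "p = (x, y)" by (cases p)
      have "(\<lambda>n. Hhalf_kernel (?w (s n)) p) ----> Hhalf_kernel g p"
        using elim unfolding p Hhalf_kernel_def prod.case fst_conv snd_conv divide_inverse
        by (intro tendsto_mult tendsto_const tendsto_power tendsto_norm tendsto_diff) auto
      then show ?case by simp
    qed
    have kn: "(\<integral>\<^sup>+p. ennreal (Hhalf_kernel (?w k) p) \<partial>?P) \<le> ennreal (H * (norm2 (cut S (grad (?w k))))^2)" for k
    proof -
      have "(\<integral>\<^sup>+y. ennreal ((norm (grad (?w k) y))^2) * indicator S y)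
        = (\<integral>\<^sup>+y. ennreal ((norm (indicator S y *R grad (?w k) y))^2))"
        by (intro nn_integral_cong) (auto simp: indicator_def)
      then show ?thesis using H(2)[OF sm[of k], folded S_def]
        unfolding nn_integral_L2[OF tr(3)] ennreal_mult[OF less_imp_le[OF H(1)] zero_le_power2] by (simp only:)
    qed
    have "(\<integral>\<^sup>+p. ennreal (Hhalf_kernel g p) \<partial>?P) = (\<integral>\<^sup>+p. liminf (\<lambda>n. ennreal (Hhalf_kernel (?w (s n)) p)) \<partial>?P)"
    proof (rule nn_integral_cong_AE)
      show "AE p in ?P. ennreal (Hhalf_kernel g p) = liminf (\<lambda>n. ennreal (Hhalf_kernel (?w (s n)) p))"
        using lim by eventually_elim (metis lim_imp_Liminf trivial_limit_sequentially)
    qed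
    also have "\<dots> \<le> liminf (\<lambda>n. \<integral>\<^sup>+p. ennreal (Hhalf_kernel (?w (s n)) p) \<partial>?P)"
      by (intro nn_integral_liminf) measurable
    also have "\<dots> \<le> liminf (\<lambda>n. ennreal (H * (norm2 (\<lambda>x. indicator S x *R grad (?w (s n)) x))^2))"
      by (intro Liminf_mono always_eventually allI kn)
    also have "\<dots> = ennreal (H * ?G^2)"
    proof (rule lim_imp_Liminf)
      show "(\<lambda>n. ennreal (H * (norm2 (\<lambda>x. indicator S x *R grad (?w (s n)) x))^2)) ----> ennreal (H * ?G^2)"
        using LIMSEQ_subseq_LIMSEQ[OF c(4) s(1)] by (intro tendsto_intros) (simp add: o_def)
    qed simp
    finally have kg: "(\<integral>\<^sup>+p. ennreal (Hhalf_kernel g p) \<partial>?P) \<le> ennreal (H * ?G^2)" .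
    have ki: "integrable ?P (Hhalf_kernel g)"
      using kg k0 by (intro integrableI_nonneg km gm) (auto simp: less_top[symmetric] top_unique)
    then have "in_Hhalf R g" using g(1) by (simp add: in_Hhalf_def)
    moreover have "Hhalf_norm R g \<le> sqrt (K + H) * sqrt ((norm2 r)^2 + (norm2 G)^2)"
    proof -
      have "ennreal (\<integral>p. Hhalf_kernel g p \<partial>?P) \<le> ennreal (H * ?G^2)"
        using kg nn_integral_eq_integral[OF ki] k0 by simp
      then have "(\<integral>p. Hhalf_kernel g p \<partial>?P) \<le> H * ?G^2" using H(1) by (subst (asm) ennreal_le_iff) auto
      moreover have "?r \<le> norm2 r" "?G \<le> norm2 G" by (intro L2_indicator_mult S r G)+
      then have "?r^2 \<le> (norm2 r)^2" "?G^2 \<le> (norm2 G)^2" by (auto intro!: power_mono L2_norm_nonneg)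
      ultimately have "(L2_norm ?\<sigma> g)^2 + (\<integral>p. Hhalf_kernel g p \<partial>?P) \<le> (K + H) * ((norm2 r)^2 + (norm2 G)^2)"
        using g2 K H(1) by (simp add: algebra_simps) (smt (verit) mult_left_mono mult_nonneg_nonneg zero_le_power2)
      then show ?thesis unfolding Hhalf_norm_def real_sqrt_mult[symmetric] by simp
    qed
    ultimately show "trace_le R r (sqrt (K + H) * sqrt ((norm2 r)^2 + (norm2 G)^2))"
      using g unfolding trace_le_def by blast
  qed
qed

text \<open>The sphere is approached from inside, where \<open>r\<close> vanishes and hence
  \<open>G\<close> does too: the mollifications tend to zero in \<open>H^1\<close> of the closed
  ball, and the trace inequality gives zero on its boundary. The same mollifications also
  approximate \<open>r\<close> outside, so this is the trace seen from the annulus.\<close>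

lemma trace_vanish:
  fixes r :: "'a::euclidean_space \<Rightarrow> real"
  assumes r: "L2 r" "L1 r" and G: "L2 G" and w: "weak_grad (ball 0 R') r G"
    and R: "0 < R" "R < R'" and z: "AE x in lborel. norm x \<le> R \<longrightarrow> r x = 0"
  shows "(\<lambda>k. L2_norm (sphere_measure R) (mollify k r)) ----> 0"
proof -
  define S where "S = cball (0::'a) R"
  have S: "S \<in> sets borel" by (simp add: S_def)
  have G0: "AE x in lborel. x \<in> ball 0 R \<longrightarrow> G x \<bullet> b = 0" if b: "b \<in> Basis" for b
  proof (rule AE_zero_if_orthogonal_test_functions[OF open_ball L2_inner_Basis[OF G b]])
    fix \<phi> :: "'a \<Rightarrow> real" assume \<phi>: "test_function (ball 0 R) \<phi>"
    have "ball 0 R \<subseteq> ball (0::'a) R'" using R by auto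
    then have "(\<integral>x. \<phi> x * (G x \<bullet> b)) = - (\<integral>x. dirderiv b \<phi> x * r x)"
      using w b test_mono[OF \<phi>] by (simp add: weak_grad_def)
    also have "AE x in lborel. dirderiv b \<phi> x * r x = 0"
      using z
    proof eventually_elim
      case (elim x)
      then show ?case using test_outside[OF test_dirderiv[OF \<phi>], of x b] by (cases "norm x < R") auto
    qed
    then have "(\<integral>x. dirderiv b \<phi> x * r x) = 0" by (rule integral_eq_zero_AE)
    finally show "(\<integral>x. \<phi> x * (G x \<bullet> b)) = 0" by simp
  qed
  then have "AE x in lborel. \<forall>b\<in>Basis. x \<in> ball 0 R \<longrightarrow> G x \<bullet> b = 0" by (intro AE_finite_allI) auto
  moreover have "AE x in lborel. x \<notin> sphere (0::'a) R"
    using negligible_sphere[of 0 R] by (intro AE_not_in) (simp add: negligible_iff_null_sets null_sets_completion_iff)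
  ultimately have Gz: "AE x in lborel. indicator S x *R G x = 0"
    by eventually_elim (auto simp: S_def indicator_def intro!: euclidean_eqI[where 'a='a])
  have rz: "AE x in lborel. indicator S x *R r x = 0"
    using z by eventually_elim (auto simp: S_def indicator_def)
  have L0: "norm2 h = 0" if "AE x in lborel. h x = 0" for h :: "'a \<Rightarrow> 'c::euclidean_space"
  proof -
    have "AE x in lborel. (norm (h x))^2 = 0" using that by eventually_elim simp
    then show ?thesis by (simp add: L2_norm_def integral_eq_zero_AE)
  qed
  define K where "K = real DIM('a) / R * (1 + R)"
  note tr = trace_L2[OF smooth_mollify[OF r(2)] R(1), folded S_def K_def]
  note c = mollify_cball_tendsto(3,4)[OF r G w R, folded S_def, unfolded L0[OF Gz] L0[OF rz]]
  have lim: "(\<lambda>k. K * ((norm2 (\<lambda>x. indicator S x *R mollify k r x))^2 + (norm2 (cut S (grad (mollify k r))))^2))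
    ----> 0"
    by (rule tendsto_eq_rhs[OF tendsto_mult[OF tendsto_const tendsto_add[OF tendsto_power[OF c(1), of 2] tendsto_power[OF c(2), of 2]]]]) simp
  have "(\<lambda>k. (L2_norm (sphere_measure R) (mollify k r))^2) ----> 0"
    by (rule tendsto_sandwich[OF always_eventually always_eventually tendsto_const lim]) (simp_all only: tr(4) zero_le_power2 simp_thms)
  from tendsto_real_sqrt[OF this] show ?thesis by (simp only: real_sqrt_abs real_sqrt_zero abs_of_nonneg[OF L2_norm_nonneg])
qed

section \<open>Cut-off and correction\<close>

lemma laplacian_mult:
  fixes f g :: "'a::euclidean_space \<Rightarrow> real"
  assumes f: "smooth f" and g: "smooth g"
  shows "laplacian (\<lambda>x. f x * g x) x = f x * laplacian g x + 2 * (grad f x \<bullet> grad g x) + laplacian f x * g x"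
proof -
  have d: "dirderiv b (\<lambda>x. f x * g x) = (\<lambda>x. f x * dirderiv b g x + dirderiv b f x * g x)" for b
    by (rule ext) (rule dirderiv_mult[OF smoothD[OF f] smoothD[OF g]])
  have dd: "dirderiv b (dirderiv b (\<lambda>x. f x * g x)) x
      = f x * dirderiv b (dirderiv b g) x + 2 * (dirderiv b f x * dirderiv b g x) + dirderiv b (dirderiv b f) x * g x" for b
    unfolding d
    by (simp add: dirderiv_add dirderiv_mult smoothD smooth_mult smooth_dirderiv f g)
  have "grad f x \<bullet> grad g x = (\<Sum>b\<in>Basis. dirderiv b f x * dirderiv b g x)"
    by (subst euclidean_inner) (simp add: grad_inner_Basis)
  then show ?thesis
    unfolding laplacian_def dd by (simp add: sum.distrib sum_distrib_left sum_distrib_right)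
qed

lemma test_Int: "test_function \<Omega> f \<Longrightarrow> test_function U f \<Longrightarrow> test_function (\<Omega> \<inter> U) f"
  by (auto simp: test_function_def)

lemma test_mult_Int:
  fixes f g :: "'a::euclidean_space \<Rightarrow> real"
  assumes "test_function \<Omega> f" "test_function U g"
  shows "test_function (\<Omega> \<inter> U) (\<lambda>x. f x * g x)"
  using test_mult_right[OF assms(1) test_smooth[OF assms(2)]]
    test_mult_left[OF assms(2) test_smooth[OF assms(1)]] by (rule test_Int)

section \<open>Weak gradients and equations under cut-off\<close>

lemma weak_grad_mono: "weak_grad \<Omega> u G \<Longrightarrow> \<Omega>' \<subseteq> \<Omega> \<Longrightarrow> weak_grad \<Omega>' u G"
  unfolding weak_grad_def using test_mono by blast

lemma weak_grad_add:
  fixes u v :: "'a::euclidean_space \<Rightarrow> real"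
  assumes "weak_grad \<Omega> u G" "weak_grad \<Omega> v H"
    and L: "L2 u" "L2 G" "L2 v" "L2 H"
  shows "weak_grad \<Omega> (\<lambda>x. u x + s * v x) (\<lambda>x. G x + s *R H x)"
  unfolding weak_grad_def
proof (intro ballI allI impI)
  fix b :: 'a and \<phi> :: "'a \<Rightarrow> real" assume b: "b \<in> Basis" and \<phi>: "test_function \<Omega> \<phi>"
  note d = L2_test_function[OF test_dirderiv[OF \<phi>, of b]]
  note p = L2_test_function[OF \<phi>]
  have "(\<integral>x. dirderiv b \<phi> x * (u x + s * v x))
      = (\<integral>x. dirderiv b \<phi> x * u x) + s * (\<integral>x. dirderiv b \<phi> x * v x)"
    using L2_integrable_mult[OF d L(1)] L2_integrable_mult[OF d L(3)]
    by (simp add: distrib_left mult.left_commute[of _ s])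
  moreover have "(\<integral>x. \<phi> x * ((G x + s *R H x) \<bullet> b))
      = (\<integral>x. \<phi> x * (G x \<bullet> b)) + s * (\<integral>x. \<phi> x * (H x \<bullet> b))"
    using L2_integrable_mult[OF p L2_inner_Basis[OF L(2) b]] L2_integrable_mult[OF p L2_inner_Basis[OF L(4) b]]
    by (simp add: inner_add_left distrib_left mult.left_commute[of _ s])
  ultimately show "(\<integral>x. dirderiv b \<phi> x * (u x + s * v x)) = - (\<integral>x. \<phi> x * ((G x + s *R H x) \<bullet> b))"
    using assms(1,2) b \<phi> unfolding weak_grad_def by (simp add: algebra_simps)
qed

lemma weak_grad_smooth:
  fixes w :: "'a::euclidean_space \<Rightarrow> real"
  assumes w: "smooth w" and S: "\<Omega> \<subseteq> S"
  shows "weak_grad \<Omega> (cut S w) (cut S (grad w))"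
  unfolding weak_grad_def
proof (intro ballI allI impI)
  fix b :: 'a and \<phi> :: "'a \<Rightarrow> real" assume b: "b \<in> Basis" and \<phi>: "test_function \<Omega> \<phi>"
  have "(\<lambda>x. dirderiv b \<phi> x * (indicator S x *R w x)) = (\<lambda>x. dirderiv b \<phi> x * w x)"
    using test_outside[OF test_dirderiv[OF \<phi>], of _ b] S by (fastforce simp: indicator_def)
  moreover have "(\<lambda>x. \<phi> x * ((indicator S x *R grad w x) \<bullet> b)) = (\<lambda>x. \<phi> x * dirderiv b w x)"
    using test_outside[OF \<phi>] S grad_inner_Basis[OF b, of w] by (fastforce simp: indicator_def)
  moreover have "test_function UNIV \<phi>" using test_mono[OF \<phi>] by blast
  ultimately show "(\<integral>x. dirderiv b \<phi> x * (indicator S x *R w x)) = - (\<integral>x. \<phi> x * ((indicator S x *R grad w x) \<bullet> b))"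
    using integral_dirderiv_mult[OF _ w] by simp
qed

lemma L2_scaleR_test_function:
  fixes \<eta> :: "'a::euclidean_space \<Rightarrow> real" and G :: "'a \<Rightarrow> 'b::euclidean_space"
  assumes \<eta>: "test_function U \<eta>" and G: "L2 G" and B: "\<And>x. \<bar>\<eta> x\<bar> \<le> B"
  shows "L2 (\<lambda>x. \<eta> x *R G x)" "norm2 (\<lambda>x. \<eta> x *R G x) \<le> B * norm2 G"
proof -
  have [measurable]: "\<eta> \<in> Borel" "G \<in> Borel"
    using measurable_test_function[OF \<eta>] L2_measurable[OF G] by simp_all
  have m: "(\<lambda>x. \<eta> x *R G x) \<in> borel_measurable lborel" by measurable
  have B0: "B \<ge> 0" using B[of 0] by linarith
  have "AE x in lborel. norm (\<eta> x *R G x) \<le> B * norm (G x)" using B by (simp add: mult_right_mono)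
  from L2_bound[OF G m this B0] show "L2 (\<lambda>x. \<eta> x *R G x)" "norm2 (\<lambda>x. \<eta> x *R G x) \<le> B * norm2 G" .
qed

lemma L2_mult_grad_test_function:
  fixes \<eta> v :: "'a::euclidean_space \<Rightarrow> real"
  assumes \<eta>: "test_function U \<eta>" and v: "L2 v" and B: "\<And>x. norm (grad \<eta> x) \<le> B"
  shows "L2 (\<lambda>x. v x *R grad \<eta> x)" "norm2 (\<lambda>x. v x *R grad \<eta> x) \<le> B * norm2 v"
proof -
  have [measurable]: "grad \<eta> \<in> Borel" "v \<in> Borel"
    using smooth_measurable[OF smooth_grad[OF test_smooth[OF \<eta>]]] L2_measurable[OF v] by simp_all
  have m: "(\<lambda>x. v x *R grad \<eta> x) \<in> borel_measurable lborel" by measurable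
  have B0: "B \<ge> 0" using B[of 0] norm_ge_zero order_trans by blast
  have "AE x in lborel. norm (v x *R grad \<eta> x) \<le> B * norm (v x)"
    using mult_right_mono[OF B, of "\<bar>v _\<bar>"] by (simp add: mult.commute)
  from L2_bound[OF v m this B0] show "L2 (\<lambda>x. v x *R grad \<eta> x)"
    "norm2 (\<lambda>x. v x *R grad \<eta> x) \<le> B * norm2 v" .
qed

text \<open>The product \<open>\<phi> \<eta>\<close> is a test function on
  \<open>\<Omega> \<inter> U\<close>, so the gradient of \<open>v\<close> is needed only there,
  although the result holds on all of \<open>\<Omega>\<close>.\<close>

lemma weak_grad_cutoff:
  fixes \<eta> v :: "'a::euclidean_space \<Rightarrow> real"
  assumes \<eta>: "test_function U \<eta>" and w: "weak_grad (\<Omega> \<inter> U) v G" and L: "L2 v" "L2 G"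
  shows "weak_grad \<Omega> (\<lambda>x. \<eta> x * v x) (\<lambda>x. \<eta> x *R G x + v x *R grad \<eta> x)"
  unfolding weak_grad_def
proof (intro ballI allI impI)
  fix b :: 'a and \<phi> :: "'a \<Rightarrow> real" assume b: "b \<in> Basis" and \<phi>: "test_function \<Omega> \<phi>"
  have \<phi>\<eta>: "test_function (\<Omega> \<inter> U) (\<lambda>x. \<phi> x * \<eta> x)" by (rule test_mult_Int[OF \<phi> \<eta>])
  have s: "smooth \<phi>" "smooth \<eta>" using \<phi> \<eta> by (simp_all add: test_smooth)
  have d: "dirderiv b (\<lambda>x. \<phi> x * \<eta> x) x = \<phi> x * dirderiv b \<eta> x + dirderiv b \<phi> x * \<eta> x" for x
    by (rule dirderiv_mult[OF smoothD[OF s(1)] smoothD[OF s(2)]])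
  have i1: "L1 (\<lambda>x. \<phi> x * dirderiv b \<eta> x * v x)"
    by (rule L2_integrable_mult[OF L2_test_function[OF test_mult_right[OF \<phi> smooth_dirderiv[OF s(2)]]] L(1)])
  have i2: "L1 (\<lambda>x. dirderiv b \<phi> x * \<eta> x * v x)"
    by (rule L2_integrable_mult[OF L2_test_function[OF test_mult_right[OF test_dirderiv[OF \<phi>] s(2)]] L(1)])
  have i3: "L1 (\<lambda>x. \<phi> x * \<eta> x * (G x \<bullet> b))"
    by (rule L2_integrable_mult[OF L2_test_function[OF \<phi>\<eta>] L2_inner_Basis[OF L(2) b]])
  have "(\<integral>x. dirderiv b \<phi> x * (\<eta> x * v x))
      = (\<integral>x. dirderiv b (\<lambda>x. \<phi> x * \<eta> x) x * v x) - (\<integral>x. \<phi> x * dirderiv b \<eta> x * v x)"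
    unfolding d distrib_right using i1 i2 by (simp add: mult.assoc)
  also have "(\<integral>x. dirderiv b (\<lambda>x. \<phi> x * \<eta> x) x * v x) = - (\<integral>x. \<phi> x * \<eta> x * (G x \<bullet> b))"
    using w b \<phi>\<eta> by (simp add: weak_grad_def)
  also have "- (\<integral>x. \<phi> x * \<eta> x * (G x \<bullet> b)) - (\<integral>x. \<phi> x * dirderiv b \<eta> x * v x)
      = - (\<integral>x. \<phi> x * \<eta> x * (G x \<bullet> b) + \<phi> x * dirderiv b \<eta> x * v x)"
    using i1 i3 by simp
  also have "(\<lambda>x. \<phi> x * \<eta> x * (G x \<bullet> b) + \<phi> x * dirderiv b \<eta> x * v x) = (\<lambda>x. \<phi> x * ((\<eta> x *R G x + v x *R grad \<eta> x) \<bullet> b))"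
    by (simp add: fun_eq_iff inner_add_left grad_inner_Basis[OF b] algebra_simps)
  finally show "(\<integral>x. dirderiv b \<phi> x * (\<eta> x * v x)) = - (\<integral>x. \<phi> x * ((\<eta> x *R G x + v x *R grad \<eta> x) \<bullet> b))" .
qed

text \<open>Testing the equation with \<open>\<eta> \<phi>\<close> leaves the commutator of the
  Laplacian with \<open>\<eta>\<close>. Its term with \<open>\<nabla>\<phi>\<close> is removed by
  integrating by parts against the field \<open>\<phi> \<nabla>\<eta>\<close>.\<close>

lemma cutoff_equation:
  fixes \<eta> v a :: "'a::euclidean_space \<Rightarrow> real"
  assumes \<eta>: "test_function U \<eta>" and w: "weak_grad (\<Omega> \<inter> U) v G" and L: "L2 v" "L2 G"
    and a: "a \<in> Borel" "\<And>x. \<bar>a x\<bar> \<le> B"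
    and eq: "\<And>\<phi>. test_function (\<Omega> \<inter> U) \<phi> \<Longrightarrow> (\<integral>x. v x * (laplacian \<phi> x + a x * \<phi> x)) = 0"
    and \<phi>: "test_function \<Omega> \<phi>"
  shows "(\<integral>x. (\<eta> x * v x) * (laplacian \<phi> x + a x * \<phi> x))
    = (\<integral>x. (2 * (grad \<eta> x \<bullet> G x) + laplacian \<eta> x * v x) * \<phi> x)"
proof -
  have s: "smooth \<phi>" "smooth \<eta>" using \<phi> \<eta> by (simp_all add: test_smooth)
  let ?\<psi> = "\<lambda>b x. \<phi> x * dirderiv b \<eta> x"
  have \<psi>: "test_function (\<Omega> \<inter> U) (?\<psi> b)" for b
    by (rule test_mult_Int[OF \<phi> test_dirderiv[OF \<eta>]])
  have \<phi>\<eta>: "test_function (\<Omega> \<inter> U) (\<lambda>x. \<eta> x * \<phi> x)"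
    using test_mult_Int[OF \<phi> \<eta>] by (simp add: mult.commute)
  have \<phi>L: "test_function \<Omega> (\<lambda>x. \<phi> x * laplacian \<eta> x)" by (rule test_mult_right[OF \<phi> smooth_laplacian[OF s(2)]])
  have i1: "L1 (\<lambda>x. (\<phi> x * laplacian \<eta> x) * v x)"
    by (rule L2_integrable_mult[OF L2_test_function[OF \<phi>L] L(1)])
  have i2: "L1 (\<lambda>x. dirderiv b (?\<psi> b) x * v x)" for b
    by (rule L2_integrable_mult[OF L2_test_function[OF test_dirderiv[OF \<psi>]] L(1)])
  have i3: "L1 (\<lambda>x. ?\<psi> b x * (G x \<bullet> b))" if "b \<in> Basis" for b
    by (rule L2_integrable_mult[OF L2_test_function[OF \<psi>] L2_inner_Basis[OF L(2) that]])
  have i4: "L1 (\<lambda>x. v x * (laplacian (\<lambda>x. \<eta> x * \<phi> x) x + a x * (\<eta> x * \<phi> x)))"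
    by (intro L2_integrable_mult L L2_add L2_test_function[OF test_laplacian[OF \<phi>\<eta>]]
        L2_bounded_mult(1)[OF L2_test_function[OF \<phi>\<eta>] _ a(2)]) (use a in simp)
  have d\<psi>: "dirderiv b (?\<psi> b) x = \<phi> x * dirderiv b (dirderiv b \<eta>) x + dirderiv b \<phi> x * dirderiv b \<eta> x" for b x
    by (rule dirderiv_mult[OF smoothD[OF s(1)] smoothD[OF smooth_dirderiv[OF s(2)]]])
  have sum_d\<psi>: "(\<Sum>b\<in>Basis. dirderiv b (?\<psi> b) x) = \<phi> x * laplacian \<eta> x + grad \<eta> x \<bullet> grad \<phi> x" for x
  proof -
    have "grad \<eta> x \<bullet> grad \<phi> x = (\<Sum>b\<in>Basis. dirderiv b \<phi> x * dirderiv b \<eta> x)"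
      by (subst euclidean_inner) (simp add: grad_inner_Basis mult.commute)
    then show ?thesis unfolding d\<psi> by (simp add: laplacian_def sum.distrib sum_distrib_left)
  qed
  \<comment> \<open>The divergence of \<open>\<phi> \<nabla>\<eta>\<close> is \<open>\<phi>
    \<Delta>\<eta> + \<nabla>\<eta> \<bullet> \<nabla>\<phi>\<close>. Subtracting it twice turns the
    \<open>- \<phi> \<Delta>\<eta>\<close> of the product rule into
    \<open>+ \<phi> \<Delta>\<eta>\<close>.\<close>
  have pt: "(\<eta> x * v x) * (laplacian \<phi> x + a x * \<phi> x) = v x * (laplacian (\<lambda>x. \<eta> x * \<phi> x) x + a x * (\<eta> x * \<phi> x))
      + ((\<phi> x * laplacian \<eta> x) * v x - 2 * (\<Sum>b\<in>Basis. dirderiv b (?\<psi> b) x * v x))" for x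
    unfolding sum_distrib_right[symmetric] sum_d\<psi> laplacian_mult[OF s(2,1)] by (simp add: algebra_simps)
  have "(\<integral>x. (\<eta> x * v x) * (laplacian \<phi> x + a x * \<phi> x))
      = (\<integral>x. (\<phi> x * laplacian \<eta> x) * v x) - 2 * (\<Sum>b\<in>Basis. \<integral>x. dirderiv b (?\<psi> b) x * v x)"
    unfolding pt using i1 i2 i4 eq[OF \<phi>\<eta>] by simp
  also have "(\<Sum>b\<in>Basis. \<integral>x. dirderiv b (?\<psi> b) x * v x) = - (\<Sum>b\<in>Basis. \<integral>x. ?\<psi> b x * (G x \<bullet> b))"
    using w \<psi> by (simp add: weak_grad_def sum_negf)
  also have "(\<integral>x. (\<phi> x * laplacian \<eta> x) * v x) - 2 * - (\<Sum>b\<in>Basis. \<integral>x. ?\<psi> b x * (G x \<bullet> b))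
      = (\<integral>x. (\<phi> x * laplacian \<eta> x) * v x + 2 * (\<Sum>b\<in>Basis. ?\<psi> b x * (G x \<bullet> b)))"
    using i1 i3 by simp
  also have "(\<lambda>x. (\<phi> x * laplacian \<eta> x) * v x + 2 * (\<Sum>b\<in>Basis. ?\<psi> b x * (G x \<bullet> b)))
      = (\<lambda>x. (2 * (grad \<eta> x \<bullet> G x) + laplacian \<eta> x * v x) * \<phi> x)"
  proof
    fix x
    have "grad \<eta> x \<bullet> G x = (\<Sum>b\<in>Basis. dirderiv b \<eta> x * (G x \<bullet> b))"
      by (subst euclidean_inner) (simp add: grad_inner_Basis)
    then show "(\<phi> x * laplacian \<eta> x) * v x + 2 * (\<Sum>b\<in>Basis. ?\<psi> b x * (G x \<bullet> b)) = (2 * (grad \<eta> x \<bullet> G x) + laplacian \<eta> x * v x) * \<phi> x"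
      by (simp add: sum_distrib_left sum_distrib_right algebra_simps)
  qed
  finally show ?thesis .
qed

lemma H1_norm_tendsto_iff:
  fixes u d :: "nat \<Rightarrow> 'a::euclidean_space \<Rightarrow> real" and D :: "nat \<Rightarrow> 'a \<Rightarrow> 'a"
  assumes \<Omega>: "open \<Omega>" and L: "\<And>m. L2 (d m)" "\<And>m. L2 (D m)" and w: "\<And>m. weak_grad \<Omega> (d m) (D m)"
    and eq: "\<And>m. AE x in lebesgue_on \<Omega>. u m x = d m x"
  shows "(\<lambda>m. H1_norm \<Omega> (u m)) ----> 0 \<longleftrightarrow>
    (\<lambda>m. norm2 (cut \<Omega> (d m))) ----> 0 \<and> (\<lambda>m. norm2 (cut \<Omega> (D m))) ----> 0"
    (is "?l \<longleftrightarrow> ?a ----> 0 \<and> ?b ----> 0")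
proof -
  have H: "H1_norm \<Omega> (u m) = sqrt ((?a m)^2 + (?b m)^2)" for m
    unfolding weak_grad_H1(3)[OF \<Omega> L w eq, symmetric] by (simp add: H1_norm_def sum_nonneg)
  have ab: "?a m \<le> sqrt ((?a m)^2 + (?b m)^2)" "?b m \<le> sqrt ((?a m)^2 + (?b m)^2)" for m
    by (intro real_le_rsqrt; simp)+
  show ?thesis
  proof (intro iffI conjI)
    assume l: ?l
    show "?a ----> 0" by (rule tendsto_sandwich[OF always_eventually always_eventually tendsto_const l[unfolded H]])
        (use ab(1) L2_norm_nonneg in blast)+
    show "?b ----> 0" by (rule tendsto_sandwich[OF always_eventually always_eventually tendsto_const l[unfolded H]])
        (use ab(2) L2_norm_nonneg in blast)+
  next
    assume "?a ----> 0 \<and> ?b ----> 0"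
    then have "(\<lambda>m. sqrt ((?a m)^2 + (?b m)^2)) ----> sqrt (0^2 + 0^2)"
      by (intro tendsto_real_sqrt tendsto_add tendsto_power) auto
    then show ?l unfolding H by simp
  qed
qed

lemma annulus_Int_ball: "1 + \<delta> \<le> R \<Longrightarrow> annulus r R \<inter> ball 0 (1 + \<delta>) = annulus r (1 + \<delta>)"
  by (auto simp: annulus_def)

lemma open_annulus: "open (annulus r R)"
  by (simp add: annulus_def open_Diff)

text \<open>One sequence, \<open>\<eta> * w m\<close> plus the mollifications of \<open>r\<close>,
  serves both spheres. On the inner one both parts tend to zero, by the trace of \<open>v\<close>
  and by the vanishing of \<open>r\<close> inside; on the outer one \<open>\<eta>\<close> is zero
  and only the mollifications remain.\<close>

lemma has_trace_cutoff_add: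
  fixes \<eta> v vh r :: "'a::euclidean_space \<Rightarrow> real" and Vg G :: "'a \<Rightarrow> 'a"
  assumes \<delta>: "0 < \<delta>" "\<delta> < 1"
    and \<eta>: "test_function (ball 0 (1 + \<delta>)) \<eta>" "\<And>x. \<bar>\<eta> x\<bar> \<le> 1" "\<And>x. norm (grad \<eta> x) \<le> B"
    and v: "has_trace (annulus (1/2) (1 + \<delta>)) (1/2) v (\<lambda>x. 0)"
    and vh: "L2 vh" "L2 Vg" "weak_grad (annulus (1/2) (1 + \<delta>)) vh Vg"
      "AE x in lebesgue_on (annulus (1/2) (1 + \<delta>)). v x = vh x"
    and r: "L2 r" "L1 r" "L2 G" "weak_grad (ball 0 3) r G"
      "AE x in lborel. norm x \<le> 1/2 \<longrightarrow> r x = 0"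
    and g: "in_L2 (sphere_measure 2) g" "L2_lim (sphere_measure 2) (\<lambda>k. mollify k r) g"
  shows "has_trace (annulus (1/2) 2) (1/2) (\<lambda>x. \<eta> x * vh x + r x) (\<lambda>x. 0)"
    and "has_trace (annulus (1/2) 2) 2 (\<lambda>x. \<eta> x * vh x + r x) g"
proof -
  let ?C = "cut (cball 0 2)" and ?N = "L2_norm (sphere_measure (1/2))"
  define \<Omega> where "\<Omega> = (annulus (1/2) 2 :: 'a set)"
  define \<Omega>' where "\<Omega>' = (annulus (1/2) (1 + \<delta>) :: 'a set)"
  note v = v[folded \<Omega>'_def] and vh = vh[folded \<Omega>'_def]
  have Int: "\<Omega> \<inter> ball 0 (1 + \<delta>) = \<Omega>'" using annulus_Int_ball[of \<delta> 2 "1/2"] \<delta> by (simp add: \<Omega>_def \<Omega>'_def)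
  have o: "open \<Omega>" "open \<Omega>'" by (simp_all add: \<Omega>_def \<Omega>'_def open_annulus)
  have ob: "\<Omega> \<in> sets borel" "\<Omega>' \<in> sets borel" "ball (0::'a) 2 \<in> sets borel" "cball (0::'a) 2 \<in> sets borel" using o by simp_all
  have sub: "\<Omega> \<subseteq> ball 0 2" "\<Omega> \<subseteq> cball 0 2" "\<Omega> \<subseteq> ball 0 3" "\<Omega>' \<subseteq> \<Omega>"
    using \<delta> by (auto simp: \<Omega>_def \<Omega>'_def annulus_def)
  obtain w where w: "\<And>m. smooth (w m)" "(\<lambda>m. H1_norm \<Omega>' (\<lambda>x. w m x - v x)) ----> 0"
    "(\<lambda>m. ?N (w m)) ----> 0"
    using v unfolding has_trace_def by auto
  let ?M = "\<lambda>m. mollify m r"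
  have s: "smooth \<eta>" "\<And>m. smooth (?M m)" using test_smooth[OF \<eta>(1)] smooth_mollify[OF r(2)] by auto
  \<comment> \<open>The errors of the two approximations with their weak gradients. The indicators
    make the smooth parts square integrable on the whole space and change nothing on
    \<open>\<Omega>\<close>.\<close>
  define d where "d m x = indicator (ball 0 2) x *R w m x + (-1) * vh x" for m x
  define D where "D m x = indicator (ball 0 2) x *R grad (w m) x + (-1) *R Vg x" for m x
  define e where "e m x = indicator (cball 0 2) x *R ?M m x + (-1) * r x" for m x
  define E where "E m x = indicator (cball 0 2) x *R grad (?M m) x + (-1) *R G x" for m x
  have Lw: "L2 (cut (ball 0 2) (w m))" "L2 (cut (ball 0 2) (grad (w m)))" for m
    by (intro L2_continuous_ball smooth_continuous smooth_grad w)+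
  have LM: "L2 (?C (?M m))" "L2 (?C (grad (?M m)))" for m
    by (rule trace_L2(2,3)[OF s(2)], simp)+
  have dL: "L2 (d m)" "L2 (D m)" and dw: "weak_grad \<Omega>' (d m) (D m)" for m
    unfolding d_def[abs_def] D_def[abs_def]
    by (rule L2_add[OF Lw(1) L2_cmult[OF vh(1)]], rule L2_add[OF Lw(2) L2_scaleR[OF vh(2)]],
      rule weak_grad_add[OF weak_grad_smooth[OF w(1)] vh(3) Lw vh(1,2)]) (use sub in auto)
  have eL: "L2 (e m)" "L2 (E m)" and ew: "weak_grad \<Omega> (e m) (E m)" for m
    unfolding e_def[abs_def] E_def[abs_def]
    by (rule L2_add[OF LM(1) L2_cmult[OF r(1)]], rule L2_add[OF LM(2) L2_scaleR[OF r(3)]],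
      rule weak_grad_add[OF weak_grad_smooth[OF s(2)] weak_grad_mono[OF r(4)] LM r(1,3)]) (use sub in auto)
  have deq: "AE x in lebesgue_on \<Omega>'. w m x - v x = d m x" for m
    using vh(4) unfolding AE_lebesgue_on_iff[OF ob(2)] by eventually_elim (use sub in \<open>auto simp: d_def\<close>)
  have d0: "(\<lambda>m. norm2 (cut \<Omega>' (d m))) ----> 0" "(\<lambda>m. norm2 (cut \<Omega>' (D m))) ----> 0"
    using H1_norm_tendsto_iff[OF o(2) dL dw deq] w(2) by simp_all
  define f where "f m x = \<eta> x * d m x + 1 * e m x" for m x
  define F where "F m x = (\<eta> x *R D m x + d m x *R grad \<eta> x) + 1 *R E m x" for m x
  have c: "L2 (\<lambda>x. \<eta> x * d m x)" "L2 (\<lambda>x. \<eta> x *R D m x)" "L2 (\<lambda>x. d m x *R grad \<eta> x)" for m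
    using L2_scaleR_test_function(1)[OF \<eta>(1) dL(1) \<eta>(2)] L2_scaleR_test_function(1)[OF \<eta>(1) dL(2) \<eta>(2)]
      L2_mult_grad_test_function(1)[OF \<eta>(1) dL(1) \<eta>(3)] by simp_all
  have fL: "L2 (f m)" "L2 (F m)" and fw: "weak_grad \<Omega> (f m) (F m)" for m
    unfolding f_def[abs_def] F_def[abs_def]
    by (rule L2_add[OF c(1) L2_cmult[OF eL(1)]], rule L2_add[OF L2_add[OF c(2,3)] L2_scaleR[OF eL(2)]],
      rule weak_grad_add[OF weak_grad_cutoff[OF \<eta>(1) dw[folded Int] dL] ew c(1) L2_add[OF c(2,3)] eL])
  have out: "\<eta> x = 0" "grad \<eta> x = 0" if "norm x \<ge> 1 + \<delta>" for x
    using test_outside[OF \<eta>(1), of x] test_outside[OF test_dirderiv[OF \<eta>(1)], of x] that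
    by (simp_all add: grad_def)
  have ind: "indicator \<Omega> x *R h = indicator \<Omega>' x *R h" if "norm x \<ge> 1 + \<delta> \<Longrightarrow> h = 0" for x :: 'a and h :: "'b::real_vector"
    using that Int by (cases "norm x < 1 + \<delta>") (auto simp: indicator_def)
  have fb: "norm2 (cut \<Omega> (f m)) \<le> norm2 (cut \<Omega>' (d m))
      + dist2 (?C (?M m)) (?C r)" for m
  proof -
    note i = L2_scaleR_test_function[OF \<eta>(1) L2_indicator_mult(1)[OF ob(2) dL(1)] \<eta>(2), of m]
      L2_indicator_mult[OF ob(1) L2_diff[OF LM(1) L2_indicator_mult(1)[OF ob(4) r(1)]], of m]
    have eq: "indicator \<Omega> x *R f m x = \<eta> x *R (indicator \<Omega>' x *R d m x) +
        indicator \<Omega> x *R (indicator (cball 0 2) x *R ?M m x - indicator (cball 0 2) x *R r x)" for x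
      using ind[of x "\<eta> x * d m x"] out[of x] sub(2) by (auto simp: f_def e_def indicator_def)
    show ?thesis unfolding eq using L2_norm_triangle[OF i(1,3)] i(2,4) by linarith
  qed
  have Fb: "norm2 (cut \<Omega> (F m)) \<le> (norm2 (cut \<Omega>' (D m))
      + B * norm2 (cut \<Omega>' (d m)))
      + dist2 (?C (grad (?M m))) (?C G)" for m
  proof -
    note i = L2_scaleR_test_function[OF \<eta>(1) L2_indicator_mult(1)[OF ob(2) dL(2)] \<eta>(2), of m]
      L2_mult_grad_test_function[OF \<eta>(1) L2_indicator_mult(1)[OF ob(2) dL(1)] \<eta>(3), of m]
      L2_indicator_mult[OF ob(1) L2_diff[OF LM(2) L2_indicator_mult(1)[OF ob(4) r(3)]], of m]
    have eq: "indicator \<Omega> x *R F m x = (\<eta> x *R (indicator \<Omega>' x *R D m x) + (indicator \<Omega>' x *R d m x) *R grad \<eta> x) +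
        indicator \<Omega> x *R (indicator (cball 0 2) x *R grad (?M m) x - indicator (cball 0 2) x *R G x)" for x
      using ind[of x "\<eta> x *R D m x + d m x *R grad \<eta> x"] out[of x] sub(2) by (auto simp: F_def E_def indicator_def)
    show ?thesis unfolding eq
      using L2_norm_triangle[OF L2_add[OF i(1,3)] i(5)] L2_norm_triangle[OF i(1,3)] i(2,4,6) by linarith
  qed
  note Mc = mollify_cball_tendsto(1,2)[OF r(1,2,3,4), of 2, simplified]
  have f0: "(\<lambda>m. norm2 (cut \<Omega> (f m))) ----> 0"
  proof (rule tendsto_sandwich[OF always_eventually always_eventually tendsto_const])
    show "(\<lambda>m. norm2 (cut \<Omega>' (d m))
      + dist2 (?C (?M m)) (?C r)) ----> 0"
      using tendsto_add[OF d0(1) Mc(1)] by simp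
  qed (use fb L2_norm_nonneg in blast)+
  have F0: "(\<lambda>m. norm2 (cut \<Omega> (F m))) ----> 0"
  proof (rule tendsto_sandwich[OF always_eventually always_eventually tendsto_const])
    show "(\<lambda>m. (norm2 (cut \<Omega>' (D m)) + B * norm2 (cut \<Omega>' (d m)))
      + dist2 (?C (grad (?M m))) (?C G)) ----> 0"
      using tendsto_add[OF tendsto_add[OF d0(2) tendsto_mult_right_zero[OF d0(1), of B]] Mc(2)] by simp
  qed (use Fb L2_norm_nonneg in blast)+
  define W where "W m x = \<eta> x * w m x + ?M m x" for m x
  have sW: "smooth (W m)" for m unfolding W_def[abs_def] by (intro smooth_add smooth_mult s w)
  have Weq: "AE x in lebesgue_on \<Omega>. W m x - (\<eta> x * vh x + r x) = f m x" for m
    unfolding AE_lebesgue_on_iff[OF ob(1)] using sub(1,2)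
    by (intro AE_I2) (auto simp: W_def f_def d_def e_def indicator_def algebra_simps)
  have WH: "(\<lambda>m. H1_norm \<Omega> (\<lambda>x. W m x - (\<eta> x * vh x + r x))) ----> 0"
    using H1_norm_tendsto_iff[OF o(1) fL fw Weq] f0 F0 by simp
  have "L2 (\<lambda>x. \<eta> x * vh x)" and "L2 (\<lambda>x. \<eta> x *R Vg x + vh x *R grad \<eta> x)"
    using L2_scaleR_test_function(1)[OF \<eta>(1) vh(1) \<eta>(2)]
      L2_add[OF L2_scaleR_test_function(1)[OF \<eta>(1) vh(2) \<eta>(2)] L2_mult_grad_test_function(1)[OF \<eta>(1) vh(1) \<eta>(3)]] by simp_all
  note uL = this
  have H1: "in_H1 \<Omega> (\<lambda>x. \<eta> x * vh x + r x)"
    by (rule weak_grad_H1(1)[OF o(1) L2_add[OF uL(1) L2_cmult[OF r(1), of 1]] L2_add[OF uL(2) L2_scaleR[OF r(3), of 1]]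
          weak_grad_add[OF weak_grad_cutoff[OF \<eta>(1) vh(3)[folded Int] vh(1,2)] weak_grad_mono[OF r(4) sub(3)] uL r(1,3)]]) simp
  have "(\<lambda>m. ?N (W m)) ----> 0"
  proof (rule tendsto_sandwich[OF always_eventually always_eventually tendsto_const])
    have hw: "in_L2 (sphere_measure (1/2)) (w m)" "in_L2 (sphere_measure (1/2)) (?M m)" for m
      by (rule L2_sphere[OF w(1)], simp, rule L2_sphere[OF s(2)], simp)
    have hm: "\<eta> \<in> borel_measurable (sphere_measure (1/2))" using measurable_test_function[OF \<eta>(1)] by simp
    have "?N (W m) \<le> ?N (w m) + ?N (?M m)" for m
      using L2_norm_triangle[OF L2_bounded_mult(1)[OF hw(1)[of m] hm \<eta>(2)] hw(2)[of m]] L2_bounded_mult(2)[OF hw(1)[of m] hm \<eta>(2)]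
      unfolding W_def[abs_def] by linarith
    then show "\<forall>m. ?N (W m) \<le> ?N (w m) + ?N (?M m)" by blast
    show "(\<lambda>m. ?N (w m) + ?N (?M m)) ----> 0"
      using tendsto_add[OF w(3) trace_vanish[OF r(1,2,3,4) _ _ r(5)]] by simp
  qed (use L2_norm_nonneg in blast)
  then show "has_trace (annulus (1/2) 2) (1/2) (\<lambda>x. \<eta> x * vh x + r x) (\<lambda>x. 0)"
    unfolding has_trace_def using H1 sW WH L2_zero by (auto simp: \<Omega>_def intro!: exI[of _ W])
  have "L2_lim (sphere_measure 2) W g"
  proof -
    have "L2_dist (sphere_measure 2) (W m) g = L2_dist (sphere_measure 2) (?M m) g" for m
    proof (rule L2_norm_AE_cong)
      have [measurable]: "W m \<in> Borel" "?M m \<in> Borel" "g \<in> Borel"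
        using smooth_measurable sW s(2) L2_measurable[OF g(1)] by auto
      show "(\<lambda>x. W m x - g x) \<in> borel_measurable (sphere_measure 2)" "(\<lambda>x. ?M m x - g x) \<in> borel_measurable (sphere_measure 2)"
        by measurable
      show "AE x in sphere_measure 2. W m x - g x = ?M m x - g x"
        using AE_sphere_measure_norm[of 2, where 'a='a] out(1) \<delta> by (auto simp: W_def elim!: eventually_mono)
    qed
    then show ?thesis using g(2) by simp
  qed
  then show "has_trace (annulus (1/2) 2) 2 (\<lambda>x. \<eta> x * vh x + r x) g"
    unfolding has_trace_def using H1 sW WH g(1) by (auto simp: \<Omega>_def intro!: exI[of _ W])
qed

text \<open>\<open>u\<close> and \<open>g\<close> are arguments, so that they can be chosen one
  after the other for every component of a vector valued problem. Error and cost are plain numbers,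
  in which the statement is monotone.\<close>

definition approximates :: "'a::euclidean_space set \<Rightarrow> 'a set \<Rightarrow> ('a \<Rightarrow> real) \<Rightarrow> ('a \<Rightarrow> 'b::euclidean_space) \<Rightarrow> real \<Rightarrow> real \<Rightarrow> ('a \<Rightarrow> 'b) \<Rightarrow> ('a \<Rightarrow> 'b) \<Rightarrow> bool"
  where "approximates \<Omega> \<Omega>' a v e c u g \<longleftrightarrow> weak_solution \<Omega> a (\<lambda>x. 0) u \<and> has_trace \<Omega> (1/2) u (\<lambda>x. 0) \<and>
    L2_dist (lebesgue_on \<Omega>') u v \<le> e \<and> has_trace \<Omega> 2 u g \<and> in_Hhalf 2 g \<and> Hhalf_norm 2 g \<le> c"

definition approximable :: "'a::euclidean_space set \<Rightarrow> 'a set \<Rightarrow> ('a \<Rightarrow> real) \<Rightarrow> ('a \<Rightarrow> 'b::euclidean_space) \<Rightarrow> real \<Rightarrow> real \<Rightarrow> bool"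
  where "approximable \<Omega> \<Omega>' a v e c \<longleftrightarrow> (\<exists>u g. approximates \<Omega> \<Omega>' a v e c u g)"

section \<open>The extension in terms of the Carleman parameter\<close>

lemma approximable_mono:
  "approximable \<Omega> \<Omega>' a v e c \<Longrightarrow> e \<le> e' \<Longrightarrow> c \<le> c' \<Longrightarrow> approximable \<Omega> \<Omega>' a v e' c'"
  unfolding approximable_def approximates_def by (meson order_trans)

text \<open>\<open>F\<close> bounds the source of the correction: twice
  \<open>\<nabla>\<eta> \<bullet> \<nabla>v\<close> and once \<open>v \<Delta>\<eta>\<close>, each
  factor of \<open>\<eta>\<close> at most \<open>b\<close>, give \<open>3 b\<close> times the norm
  of \<open>v\<close> in \<open>H^1\<close>. The parameter \<open>t\<close> is left free
  here.\<close>

lemma runge_extension: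
  fixes \<eta> \<zeta> A Vh a v :: "'a::euclidean_space \<Rightarrow> real"
  assumes \<delta>: "0 < \<delta>" "\<delta> < 1"
    and \<eta>: "test_function (ball 0 (1 + \<delta>)) \<eta>" "\<And>x. \<bar>\<eta> x\<bar> \<le> 1" "\<And>x. norm x \<le> 1 + \<delta> / 4 \<Longrightarrow> \<eta> x = 1"
      "\<And>x. norm (grad \<eta> x) \<le> b" "\<And>x. \<bar>laplacian \<eta> x\<bar> \<le> b"
    and \<zeta>: "test_function UNIV \<zeta>" "\<And>x. \<zeta> x \<ge> 0" "\<And>x. \<zeta> x \<le> 1" "\<And>x. norm x < 3 \<Longrightarrow> \<zeta> x = 1"
      "\<And>x. norm x \<ge> 7/2 \<Longrightarrow> \<zeta> x = 0" "\<And>x. \<bar>laplacian \<zeta> x\<bar> \<le> C"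
    and A: "A \<in> Borel" "\<And>x. 0 \<le> A x" "\<And>x. A x \<le> B"
    and mono: "\<And>x l. l \<ge> 1 \<Longrightarrow> norm x > 1/2 \<Longrightarrow> A x \<le> A (l *R x)"
    and V: "Vh \<in> Borel" "\<And>x. \<bar>Vh x\<bar> \<le> N"
    and a: "AE x in lebesgue_on (annulus (1/2) 2). a x = A x + Vh x"
    and v: "weak_solution (annulus (1/2) (1 + \<delta>)) a (\<lambda>x. 0) v" "has_trace (annulus (1/2) (1 + \<delta>)) (1/2) v (\<lambda>x. 0)"
    and t: "t > 0" "N + 1 \<le> 4 * t"
    and K: "K \<ge> 0" "\<And>(r :: 'a \<Rightarrow> real) G. L2 r \<Longrightarrow> L1 r \<Longrightarrow>
      L2 G \<Longrightarrow> weak_grad (ball 0 3) r G \<Longrightarrow>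
      trace_le 2 r (K * sqrt ((norm2 r)^2 + (norm2 G)^2))"
  defines "F \<equiv> 3 * b * H1_norm (annulus (1/2) (1 + \<delta>)) v"
  shows "approximable (annulus (1/2) 2) (annulus (1/2) 1) a v (exp (- t * \<delta> / 2) * F)
    (K * sqrt ((exp (16 * t) * F)^2 + (1 + B + N + C) * ((exp (16 * t) * F)^2 + F^2)))"
proof -
  define \<Omega> where "\<Omega> = (annulus (1/2) 2 :: 'a set)"
  define \<Omega>' where "\<Omega>' = (annulus (1/2) (1 + \<delta>) :: 'a set)"
  define \<Omega>1 where "\<Omega>1 = (annulus (1/2) 1 :: 'a set)"
  have Int: "\<Omega> \<inter> ball 0 (1 + \<delta>) = \<Omega>'" using annulus_Int_ball[of \<delta> 2 "1/2"] \<delta> by (simp add: \<Omega>_def \<Omega>'_def)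
  have o: "open \<Omega>" "open \<Omega>'" by (simp_all add: \<Omega>_def \<Omega>'_def open_annulus)
  have ob: "\<Omega> \<in> sets borel" "\<Omega>' \<in> sets borel" "\<Omega>1 \<in> sets borel" using o by (simp_all add: \<Omega>1_def open_annulus)
  have sub: "\<Omega> \<subseteq> ball 0 3" "\<Omega>' \<subseteq> \<Omega>" "\<Omega>1 \<subseteq> \<Omega>'" "\<Omega>1 \<subseteq> ball 0 1" "\<Omega> \<subseteq> ball 0 4 - cball 0 (1/2)"
    using \<delta> by (auto simp: \<Omega>_def \<Omega>'_def \<Omega>1_def annulus_def)
  have vH: "in_H1 \<Omega>' v" using v(1) by (simp add: weak_solution_def \<Omega>'_def)
  obtain vh Vg where vh: "L2 vh" "L2 Vg" "weak_grad \<Omega>' vh Vg" "ae_eq \<Omega>' v vh"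
    "\<And>x. x \<notin> \<Omega>' \<Longrightarrow> vh x = 0" "\<And>x. x \<notin> \<Omega>' \<Longrightarrow> Vg x = 0"
    using in_H1_representatives[OF o(2) vH] by blast
  define D where "D = H1_norm \<Omega>' v"
  have D0: "D \<ge> 0" by (simp add: D_def H1_norm_def sum_nonneg)
  have DV: "norm2 vh \<le> D" "norm2 Vg \<le> D"
  proof -
    have "(cut \<Omega>' vh) = vh" "(cut \<Omega>' Vg) = Vg"
      using vh(5,6) by (auto simp: fun_eq_iff indicator_def)
    then have "D^2 = (norm2 vh)^2 + (norm2 Vg)^2"
      unfolding D_def weak_grad_H1(3)[OF o(2) vh(1,2,3,4)] by simp
    then show "norm2 vh \<le> D" "norm2 Vg \<le> D" by - (rule power2_le_imp_le[OF _ D0], simp)+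
  qed
  have b0: "b \<ge> 0" using \<eta>(5)[of 0] by linarith
  have F: "F = 3 * b * D" by (simp add: F_def D_def \<Omega>'_def)
  have F0: "F \<ge> 0" using b0 D0 by (simp add: F)
  define a' where "a' x = A x + Vh x" for x
  have a'm: "a' \<in> Borel" unfolding a'_def[abs_def] using A(1) V(1) by measurable
  have a'b: "\<bar>a' x\<bar> \<le> B + N" for x using A(2,3)[of x] V(2)[of x] by (simp add: a'_def)
  have aeq: "ae_eq \<Omega> a a'" using a unfolding \<Omega>_def a'_def .
  then have aeq': "ae_eq \<Omega>' a a'"
    unfolding AE_lebesgue_on_iff[OF ob(1)] AE_lebesgue_on_iff[OF ob(2)] by eventually_elim (use sub(2) in auto)
  have veq: "(\<integral>x. vh x * (laplacian \<phi> x + a' x * \<phi> x)) = 0" if "test_function \<Omega>' \<phi>" for \<phi>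
    using weak_solution_iff[OF o(2) vh(1,2,3,4) a'm a'b aeq'] v(1) that by (simp add: \<Omega>'_def)
  have s: "smooth \<eta>" by (rule test_smooth[OF \<eta>(1)])
  have [measurable]: "grad \<eta> \<in> Borel" "laplacian \<eta> \<in> Borel" "\<eta> \<in> Borel"
      "vh \<in> Borel" "Vg \<in> Borel"
    using smooth_measurable[OF smooth_grad[OF s]] smooth_measurable[OF smooth_laplacian[OF s]] smooth_measurable[OF s]
      L2_measurable[OF vh(1)] L2_measurable[OF vh(2)] by simp_all
  define f where "f x = - (2 * (grad \<eta> x \<bullet> Vg x) + laplacian \<eta> x * vh x)" for x
  have g1: "L2 (\<lambda>x. grad \<eta> x \<bullet> Vg x)" "norm2 (\<lambda>x. grad \<eta> x \<bullet> Vg x) \<le> b * norm2 Vg"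
  proof -
    have "norm (grad \<eta> x \<bullet> Vg x) \<le> b * norm (Vg x)" for x
      using Cauchy_Schwarz_ineq2[of "grad \<eta> x" "Vg x"] mult_right_mono[OF \<eta>(4)[of x] norm_ge_zero[of "Vg x"]] by simp
    then show "L2 (\<lambda>x. grad \<eta> x \<bullet> Vg x)" "norm2 (\<lambda>x. grad \<eta> x \<bullet> Vg x) \<le> b * norm2 Vg"
      using L2_bound[OF vh(2), of "\<lambda>x. grad \<eta> x \<bullet> Vg x" b] b0 by auto
  qed
  have g2: "L2 (\<lambda>x. laplacian \<eta> x * vh x)" "norm2 (\<lambda>x. laplacian \<eta> x * vh x) \<le> b * norm2 vh"
    using L2_bounded_mult[OF vh(1) _ \<eta>(5)] by simp_all
  have f_alt: "f x = (-2) *R (grad \<eta> x \<bullet> Vg x) - laplacian \<eta> x * vh x" for x by (simp add: f_def)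
  have fL: "L2 f" unfolding f_alt[abs_def] by (intro L2_diff L2_scaleR g1 g2)
  have fF: "norm2 f \<le> F"
  proof -
    have "norm2 f \<le> 2 * norm2 (\<lambda>x. grad \<eta> x \<bullet> Vg x) + norm2 (\<lambda>x. laplacian \<eta> x * vh x)"
      using L2_norm_triangle_diff[OF L2_scaleR[OF g1(1), of "-2"] g2(1)] unfolding f_alt[abs_def] L2_norm_scaleR by simp
    also have "\<dots> \<le> 2 * (b * D) + b * D"
      using g1(2) g2(2) mult_left_mono[OF DV(1) b0] mult_left_mono[OF DV(2) b0] by linarith
    also have "\<dots> = F" by (simp add: F)
    finally show ?thesis .
  qed
  have f0: "f x = 0" if "norm x < 1 + \<delta> / 4" for x
  proof -
    have "dirderiv c (\<lambda>x. \<eta> x - 1) x = 0" for c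
      by (rule dirderiv_zero_outside[of "- ball 0 (1 + \<delta> / 4)"]) (use that \<eta>(3) in \<open>auto simp: closed_Compl\<close>)
    then have "grad \<eta> x = 0" using smoothD[OF s] by (simp add: grad_def dirderiv_diff dirderiv_const)
    moreover have "dirderiv c (dirderiv c \<eta>) x = 0" for c
    proof (rule dirderiv_zero_outside[of "- ball 0 (1 + \<delta> / 4)"])
      fix y assume "y \<notin> - ball (0::'a) (1 + \<delta> / 4)"
      then have "dirderiv c (\<lambda>x. \<eta> x - 1) y = 0"
        by (intro dirderiv_zero_outside[of "- ball 0 (1 + \<delta> / 4)"]) (use \<eta>(3) in \<open>auto simp: closed_Compl\<close>)
      then show "dirderiv c \<eta> y = 0" using smoothD[OF s] by (simp add: dirderiv_diff dirderiv_const)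
    qed (use that in \<open>auto simp: closed_Compl\<close>)
    ultimately show ?thesis by (simp add: f_def laplacian_def)
  qed
  define Q where "Q = norm2 (\<lambda>x. gauss t x * f x)"
  \<comment> \<open>On the support of \<open>f\<close> the squared norm is at least
    \<open>(1 + \<delta>/4)^2\<close>, hence at least \<open>1 + \<delta>/2\<close>.\<close>
  have Q: "Q \<le> exp (- t * (1 + \<delta> / 2)) * F"
  proof -
    have p: "norm (gauss t x * f x) \<le> exp (- t * (1 + \<delta> / 2)) * norm (f x)" for x
    proof (cases "norm x < 1 + \<delta> / 4")
      case False
      then have "(1 + \<delta> / 4)^2 \<le> (norm x)^2" using \<delta> by (intro power_mono) auto
      moreover have "1 + \<delta> / 2 \<le> (1 + \<delta> / 4)^2" by (simp add: power2_eq_square algebra_simps)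
      ultimately have "t * (1 + \<delta> / 2) \<le> t * (norm x)^2" using t(1) by (intro mult_left_mono) auto
      then show ?thesis by (simp add: abs_mult mult_right_mono)
    qed (simp add: f0)
    have "(\<lambda>x. gauss t x * f x) \<in> borel_measurable lborel" using L2_measurable[OF fL] by measurable
    then have "Q \<le> exp (- t * (1 + \<delta> / 2)) * norm2 f"
      unfolding Q_def using p by (intro L2_bound(2)[OF fL]) auto
    also have "\<dots> \<le> exp (- t * (1 + \<delta> / 2)) * F" using fF by simp
    finally show ?thesis .
  qed
  have Q0: "Q \<ge> 0" by (simp add: Q_def L2_norm_nonneg)
  have QF: "Q \<le> F"
  proof -
    have "exp (- t * (1 + \<delta> / 2)) \<le> 1" using t \<delta> by (simp add: mult_nonneg_nonneg)
    then have "exp (- t * (1 + \<delta> / 2)) * F \<le> 1 * F" by (rule mult_right_mono[OF _ F0])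
    with Q show ?thesis by simp
  qed
  show ?thesis
  proof (rule corrector[OF A mono V fL t \<zeta>, folded Q_def], assumption+, goal_cases)
    case r: (1 r G)
    have ri: "L1 r" by (rule L2_integrable_bounded_support[OF r(1,3)])
    have rw: "weak_grad (ball 0 3) r G" using r(9) by (simp add: weak_grad_def)
    obtain g where g: "in_L2 (sphere_measure 2) g" "L2_lim (sphere_measure 2) (\<lambda>k. mollify k r) g"
      "in_Hhalf 2 g" "Hhalf_norm 2 g \<le> K * sqrt ((norm2 r)^2 + (norm2 G)^2)"
      using K(2)[OF r(1) ri r(2) rw] unfolding trace_le_def by blast
    define u where "u x = \<eta> x * vh x + r x" for x
    have u1: "u x = \<eta> x * vh x + 1 * r x" for x by (simp add: u_def)
    have \<eta>v: "L2 (\<lambda>x. \<eta> x * vh x)" "L2 (\<lambda>x. \<eta> x *R Vg x + vh x *R grad \<eta> x)"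
      using L2_scaleR_test_function(1)[OF \<eta>(1) vh(1) \<eta>(2)]
        L2_add[OF L2_scaleR_test_function(1)[OF \<eta>(1) vh(2) \<eta>(2)] L2_mult_grad_test_function(1)[OF \<eta>(1) vh(1) \<eta>(4)]] by simp_all
    have uL: "L2 u" unfolding u_def[abs_def] by (rule L2_add[OF \<eta>v(1) r(1)])
    have uw: "weak_grad \<Omega> u (\<lambda>x. (\<eta> x *R Vg x + vh x *R grad \<eta> x) + 1 *R G x)"
      unfolding u1[abs_def]
      by (rule weak_grad_add[OF weak_grad_cutoff[OF \<eta>(1) vh(3)[folded Int] vh(1,2)] weak_grad_mono[OF rw sub(1)] \<eta>v r(1,2)])
    have uG: "L2 (\<lambda>x. (\<eta> x *R Vg x + vh x *R grad \<eta> x) + 1 *R G x)"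
      by (rule L2_add[OF \<eta>v(2) L2_scaleR[OF r(2)]])
    have sol: "weak_solution \<Omega> a (\<lambda>x. 0) u"
    proof (subst weak_solution_iff[OF o(1) uL uG uw _ a'm a'b aeq], simp, intro allI impI)
      fix \<phi> :: "'a \<Rightarrow> real" assume \<phi>: "test_function \<Omega> \<phi>"
      have L: "L2 (\<lambda>x. laplacian \<phi> x + a' x * \<phi> x)"
        by (intro L2_add L2_test_function[OF test_laplacian[OF \<phi>]]
            L2_bounded_mult(1)[OF L2_test_function[OF \<phi>] _ a'b]) (use a'm in simp)
      have "(\<integral>x. u x * (laplacian \<phi> x + a' x * \<phi> x))
        = (\<integral>x. (\<eta> x * vh x) * (laplacian \<phi> x + a' x * \<phi> x)) + (\<integral>x. r x * (laplacian \<phi> x + a' x * \<phi> x))"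
        unfolding u_def distrib_right[of _ "r _"]
        by (rule Bochner_Integration.integral_add[OF L2_integrable_mult[OF \<eta>v(1) L] L2_integrable_mult[OF r(1) L]])
      also have "(\<integral>x. (\<eta> x * vh x) * (laplacian \<phi> x + a' x * \<phi> x))
          = (\<integral>x. (2 * (grad \<eta> x \<bullet> Vg x) + laplacian \<eta> x * vh x) * \<phi> x)"
        by (rule cutoff_equation[OF \<eta>(1) vh(3)[folded Int] vh(1,2) a'm a'b veq[folded Int] \<phi>])
      also have "\<dots> = (\<integral>x. - (f x * \<phi> x))"
        by (rule Bochner_Integration.integral_cong) (simp_all only: f_def mult_minus_left minus_minus)
      also have "(\<integral>x. r x * (laplacian \<phi> x + a' x * \<phi> x)) = (\<integral>x. f x * \<phi> x)"
        using r(8)[OF test_mono[OF \<phi> sub(5)]] by (simp add: a'_def)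
      finally show "(\<integral>x. u x * (laplacian \<phi> x + a' x * \<phi> x)) = 0" by simp
    qed
    have tr: "has_trace \<Omega> (1/2) u (\<lambda>x. 0)" "has_trace \<Omega> 2 u g"
      unfolding u_def[abs_def] \<Omega>_def
      by (rule has_trace_cutoff_add[OF \<delta> \<eta>(1,2,4) v(2) vh(1,2,3,4)[unfolded \<Omega>'_def] r(1) ri r(2) rw r(4) g(1,2)])+
    \<comment> \<open>In the inner annulus \<open>\<eta>\<close> is one and the error is
      \<open>r\<close>. Removing the weight in the unit ball costs \<open>exp t\<close>, against the
      gain \<open>exp (- t * (1 + \<delta>/2))\<close> from the position of the source.\<close>
    have err: "L2_dist (lebesgue_on \<Omega>1) u v \<le> exp (- t * \<delta> / 2) * F"
    proof -
      have ae: "AE x in lebesgue_on \<Omega>1. u x - v x = r x"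
        using vh(4) unfolding AE_lebesgue_on_iff[OF ob(2)] AE_lebesgue_on_iff[OF ob(3)]
      proof eventually_elim
        case (elim x)
        show ?case
        proof
          assume x: "x \<in> \<Omega>1"
          then have "\<eta> x = 1" using sub(4) \<delta> by (intro \<eta>(3)) auto
          then show "u x - v x = r x" using elim x sub(3) by (auto simp: u_def)
        qed
      qed
      have rm: "r \<in> Borel" using L2_measurable[OF r(1)] by simp
      have wr: "L2 (\<lambda>x. gauss t x * r x)"
        by (rule L2_bounded_mult(1)[OF r(1), where B=1]) (use t(1) in auto)
      have "L2_dist (lebesgue_on \<Omega>1) u v = norm2 (cut \<Omega>1 r)"
        by (rule L2_lebesgue_on(2)[OF ob(3) rm ae])
      also have "\<dots> \<le> exp t * norm2 (\<lambda>x. gauss t x * r x)"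
      proof (rule L2_bound(2)[OF wr])
        show "cut \<Omega>1 r \<in> borel_measurable lborel" using rm ob(3) by measurable
        have "norm (indicator \<Omega>1 x *R r x) \<le> exp t * norm (gauss t x * r x)" for x
        proof (cases "x \<in> \<Omega>1")
          case True
          then have "norm x \<le> 1" using sub(4) by auto
          then have "t * (norm x)^2 \<le> t" using t(1) by (simp add: power_le_one)
          then have "1 \<le> exp t * gauss t x" by (simp add: exp_add[symmetric])
          from mult_right_mono[OF this, of "\<bar>r x\<bar>"] show ?thesis using True by (simp add: abs_mult mult.assoc)
        qed simp
        then show "AE x in lborel. norm (indicator \<Omega>1 x *R r x) \<le> exp t * norm (gauss t x * r x)" by blast
      qed simp
      also have "\<dots> \<le> exp t * (exp (- t * (1 + \<delta> / 2)) * F)" using r(5) Q by simp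
      also have "\<dots> = exp (- t * \<delta> / 2) * F" by (simp add: exp_add[symmetric] mult.assoc[symmetric] algebra_simps)
      finally show ?thesis .
    qed
    have M0: "1 + B + N + C \<ge> 0" using A(2,3)[of 0] V(2)[of 0] \<zeta>(6)[of 0] by linarith
    have "(norm2 r)^2 \<le> (exp (16 * t) * F)^2"
      using r(6) QF by (intro power_mono L2_norm_nonneg) (meson dual_order.trans exp_ge_zero mult_left_mono)
    moreover have "(norm2 G)^2 \<le> (1 + B + N + C) * ((exp (16 * t) * F)^2 + F^2)"
      using r(7)
    proof (rule order_trans)
      show "(1 + B + N + C) * ((exp (16 * t) * Q)^2 + (norm2 f)^2) \<le> (1 + B + N + C) * ((exp (16 * t) * F)^2 + F^2)"
        by (intro mult_left_mono[OF _ M0] add_mono power_mono mult_left_mono QF fF L2_norm_nonneg mult_nonneg_nonneg Q0) simp_all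
    qed
    ultimately have "K * sqrt ((norm2 r)^2 + (norm2 G)^2)
        \<le> K * sqrt ((exp (16 * t) * F)^2 + (1 + B + N + C) * ((exp (16 * t) * F)^2 + F^2))"
      by (intro mult_left_mono[OF _ K(1)] real_sqrt_le_mono add_mono)
    with g(4) have Hh: "Hhalf_norm 2 g \<le> K * sqrt ((exp (16 * t) * F)^2 + (1 + B + N + C) * ((exp (16 * t) * F)^2 + F^2))"
      by linarith
    show ?case
      unfolding approximable_def approximates_def using sol tr g(3) err Hh by (auto simp: \<Omega>_def \<Omega>1_def)
  qed
qed

section \<open>Data for the extension and choice of parameters\<close>

lemma cutoff_bounds:
  assumes r: "0 < r1" "r1 < r2" "r2 < r3"
  obtains \<eta> :: "'a::euclidean_space \<Rightarrow> real" and b where "test_function (ball 0 r3) \<eta>" "\<And>x. 0 \<le> \<eta> x" "\<And>x. \<eta> x \<le> 1"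
    "\<And>x. norm x \<le> r1 \<Longrightarrow> \<eta> x = 1" "\<And>x. norm x \<ge> r2 \<Longrightarrow> \<eta> x = 0"
    "\<And>x. norm (grad \<eta> x) \<le> b" "\<And>x. \<bar>laplacian \<eta> x\<bar> \<le> b" "b \<ge> 1"
proof -
  obtain \<eta> :: "'a \<Rightarrow> real" where \<eta>: "test_function UNIV \<eta>" "\<And>x. 0 \<le> \<eta> x" "\<And>x. \<eta> x \<le> 1"
    "\<And>x. norm x \<le> r1 \<Longrightarrow> \<eta> x = 1" "\<And>x. norm x \<ge> r2 \<Longrightarrow> \<eta> x = 0"
    using smooth_cutoff[OF r(1,2)] by metis
  have s: "smooth \<eta>" by (rule test_smooth[OF \<eta>(1)])
  have t: "test_function (ball 0 r3) \<eta>"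
    by (rule test_functionI[OF s, of "cball 0 r2"]) (use r \<eta>(5) in auto)
  have "test_function (ball 0 r3) (grad \<eta>)"
  proof (rule test_functionI[OF smooth_grad[OF s], of "cball 0 r2"])
    fix x :: 'a assume x: "x \<notin> cball 0 r2"
    have "dirderiv b \<eta> x = 0" for b
      by (rule dirderiv_zero_outside[OF closed_cball _ x]) (use \<eta>(5) in auto)
    then show "grad \<eta> x = 0" by (simp add: grad_def)
  qed (use r in auto)
  then obtain b1 where b1: "\<And>x. norm (grad \<eta> x) \<le> b1" using test_bounded by blast
  obtain b2 where b2: "\<And>x. norm (laplacian \<eta> x) \<le> b2" using test_bounded[OF test_laplacian[OF t]] by blast
  show thesis
    by (rule that[of \<eta> "max 1 (max b1 b2)", OF t \<eta>(2,3,4,5)]) (use b1 b2 in \<open>auto simp: le_max_iff_disj\<close>)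
qed

text \<open>Along the ray the derivative in \<open>s\<close> is
  \<open>grad q (s *R x) \<bullet> x\<close>, which is the radial derivative at
  \<open>s *R x\<close> divided by \<open>s\<close>.\<close>

lemma radially_nondecreasing:
  fixes q :: "'a::euclidean_space \<Rightarrow> real"
  assumes q: "\<And>x. x \<in> annulus r R \<Longrightarrow> q differentiable (at x)" "\<And>x. x \<in> annulus r R \<Longrightarrow> grad q x \<bullet> x \<ge> 0"
    and x: "r < norm x" and l: "l \<ge> 1" "norm (l *R x) < R"
  shows "q x \<le> q (l *R x)"
proof -
  have an: "s *R x \<in> annulus r R" if "1 \<le> s" "s \<le> l" for s
  proof -
    have "norm x \<le> s * norm x" using that mult_right_mono[of 1 s "norm x"] by simp
    moreover have "s * norm x \<le> l * norm x" using that by (simp add: mult_right_mono)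
    ultimately show ?thesis using x l that by (simp add: annulus_def)
  qed
  have "\<exists>y. ((\<lambda>s. q (s *R x)) has_real_derivative y) (at s) \<and> y \<ge> 0" if s: "1 \<le> s" "s \<le> l" for s
  proof -
    note d = q(1)[OF an[OF s]]
    have "((\<lambda>s. q (s *R x)) has_derivative (\<lambda>h. dirderiv (h *R x) q (s *R x))) (at s)"
      using has_derivative_compose[OF bounded_linear_imp_has_derivative[OF bounded_linear_scaleR_left] has_derivative_dirderiv[OF d]] .
    moreover have "(\<lambda>h. dirderiv (h *R x) q (s *R x)) = (\<lambda>h. h * (grad q (s *R x) \<bullet> x))"
      using d by (simp add: fun_eq_iff grad_inner[symmetric])
    ultimately have "((\<lambda>s. q (s *R x)) has_real_derivative (grad q (s *R x) \<bullet> x)) (at s)"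
      by (simp add: has_field_derivative_def mult_commute_abs)
    moreover have "0 \<le> s * (grad q (s *R x) \<bullet> x)" using q(2)[OF an[OF s]] by simp
    then have "0 \<le> grad q (s *R x) \<bullet> x" using s by (simp add: zero_le_mult_iff)
    ultimately show ?thesis by blast
  qed
  from DERIV_nonneg_imp_nondecreasing[OF l(1) this] show ?thesis by simp
qed

text \<open>Outside the ball of radius 2 the value \<open>k^2 * \<kappa>\<close> is at least every
  value in the annulus, so a ray leaving the annulus sees no decrease. In the inner ball the
  extension is zero; that value is replaced by the well.\<close>

lemma extended_coefficient:
  fixes q :: "'a::euclidean_space \<Rightarrow> real"
  assumes q: "Ck_on 1 (annulus (1/2) 2) q" "\<forall>x\<in>annulus (1/2) 2. inverse \<kappa> \<le> q x \<and> q x \<le> \<kappa>"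
      "\<forall>x\<in>annulus (1/2) 2. grad q x \<bullet> x \<ge> 0" and \<kappa>: "\<kappa> > 0"
  obtains A where "A \<in> Borel" "\<And>x. 0 \<le> A x" "\<And>x. A x \<le> k^2 * \<kappa>"
    "\<And>x l. l \<ge> 1 \<Longrightarrow> norm x > 1/2 \<Longrightarrow> A x \<le> A (l *R x)" "\<And>x. x \<in> annulus (1/2) 2 \<Longrightarrow> A x = k^2 * q x"
proof -
  let ?\<Omega> = "annulus (1/2) 2 :: 'a set"
  define A where "A x = k^2 * (indicator ?\<Omega> x *R q x + indicator (- ball 0 2) x * \<kappa>)" for x
  have d: "q differentiable (at x)" if "x \<in> ?\<Omega>" for x using q(1) that by (simp add: numeral_eq_Suc)
  then have "continuous_on ?\<Omega> q" by (meson continuous_at_imp_continuous_on differentiable_imp_continuous_within)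
  then have [measurable]: "cut ?\<Omega> q \<in> Borel"
    by (intro borel_measurable_continuous_on_indicator) (simp add: open_annulus)
  have [measurable]: "- ball (0::'a) 2 \<in> sets borel" by simp
  have Am: "A \<in> Borel" unfolding A_def[abs_def] by measurable
  have q0: "0 \<le> q x" "q x \<le> \<kappa>" if "x \<in> ?\<Omega>" for x
    using q(2) that \<kappa> by (meson dual_order.trans inverse_nonnegative_iff_nonnegative less_imp_le)+
  have A1: "A x = k^2 * q x" if "x \<in> ?\<Omega>" for x using that by (simp add: A_def annulus_def)
  have A2: "A x = k^2 * \<kappa>" if "norm x \<ge> 2" for x using that by (simp add: A_def annulus_def)
  have A3: "A x = 0" if "norm x \<le> 1/2" for x using that by (simp add: A_def annulus_def)
  have cases: "x \<in> ?\<Omega> \<or> norm x \<ge> 2 \<or> norm x \<le> 1/2" for x by (auto simp: annulus_def)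
  have A0: "0 \<le> A x" "A x \<le> k^2 * \<kappa>" for x
    using cases[of x] A1[of x] A2[of x] A3[of x] q0[of x] \<kappa> by (auto intro!: mult_left_mono)
  have "A x \<le> A (l *R x)" if l: "l \<ge> 1" and x: "norm x > 1/2" for x l
  proof (cases "norm (l *R x) < 2")
    case True
    have "norm x \<le> norm (l *R x)" using l mult_right_mono[of 1 l "norm x"] by simp
    then have "x \<in> ?\<Omega>" "l *R x \<in> ?\<Omega>" using True x by (simp_all add: annulus_def)
    then show ?thesis
      using radially_nondecreasing[OF d _ x l True] q(3) by (simp add: A1 mult_left_mono)
  qed (use A2 A0 in simp)
  then show thesis using that Am A0 A1 by blast
qed

text \<open>Clamping a Borel representative to values between \<open>-N\<close> and \<open>N\<close>
  changes it only on a null set and makes the bound hold everywhere, as the Carleman estimate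
  asks.\<close>

lemma bounded_borel_representative:
  fixes V :: "'a::euclidean_space \<Rightarrow> real"
  assumes \<Omega>: "\<Omega> \<in> sets borel" and V: "in_Linf \<Omega> V" "Linf_norm \<Omega> V \<le> ereal N" and N: "N \<ge> 0"
  obtains h where "h \<in> Borel" "\<And>x. \<bar>h x\<bar> \<le> N" "ae_eq \<Omega> V h"
proof -
  obtain g where g: "g \<in> Borel" "ae_eq \<Omega> V g"
    using borel_representative[OF \<Omega>, of V] V(1) unfolding in_Linf_def by blast
  have b: "AE x in lebesgue_on \<Omega>. \<bar>V x\<bar> \<le> N"
    using esssup_AE[of "\<lambda>x. ereal \<bar>V x\<bar>" "lebesgue_on \<Omega>"]
  proof eventually_elim
    case (elim x)
    then have "ereal \<bar>V x\<bar> \<le> ereal N" using V(2) unfolding Linf_norm_def by (rule order_trans)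
    then show ?case by simp
  qed
  show thesis
  proof (rule that[of "\<lambda>x. max (- N) (min N (g x))"])
    show "(\<lambda>x. max (- N) (min N (g x))) \<in> Borel" using g(1) by measurable
    show "AE x in lebesgue_on \<Omega>. V x = max (- N) (min N (g x))" using g(2) b by eventually_elim auto
  qed (use N in auto)
qed

text \<open>The logarithmic term makes \<open>exp (- t * \<delta> / 2)\<close> at most
  \<open>\<epsilon> / c\<close>; the term \<open>(N + 1) / 4\<close> pays for the potential in the
  Carleman estimate. Sixteen times \<open>t\<close> then gives the power
  \<open>32 / \<delta>\<close>.\<close>

lemma parameter_choice:
  fixes \<delta> \<epsilon> c N :: real
  assumes \<delta>: "\<delta> > 0" and c: "c \<ge> 1" and \<epsilon>: "0 < \<epsilon>" "\<epsilon> < 1" and N: "N \<ge> 0"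
  defines "t \<equiv> 2 / \<delta> * ln (c / \<epsilon>) + (N + 1) / 4"
  shows "t > 0" "N + 1 \<le> 4 * t" "exp (- t * \<delta> / 2) * c \<le> \<epsilon>"
    "exp (16 * t) = (c / \<epsilon>) powr (32 / \<delta>) * exp (4 * (N + 1))"
proof -
  have ce: "c / \<epsilon> > 1" using c \<epsilon> by (simp add: field_simps)
  then have l: "ln (c / \<epsilon>) > 0" by simp
  define P where "P = 2 / \<delta> * ln (c / \<epsilon>)"
  have tP: "t = P + (N + 1) / 4" by (simp add: t_def P_def)
  have P: "P > 0" using l \<delta> by (simp add: P_def)
  have t4: "4 * t = 4 * P + (N + 1)" by (simp add: tP field_simps)
  show "N + 1 \<le> 4 * t" using P unfolding t4 by simp
  with N show "t > 0" by simp
  have "- t * \<delta> / 2 \<le> - ln (c / \<epsilon>)"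
    using \<delta> N by (simp add: t_def field_simps)
  then have "exp (- t * \<delta> / 2) \<le> exp (- ln (c / \<epsilon>))" by (simp only: exp_le_cancel_iff)
  also have "exp (- ln (c / \<epsilon>)) = \<epsilon> / c" using ce by (simp add: exp_minus)
  finally have "exp (- t * \<delta> / 2) * c \<le> \<epsilon> / c * c" using c by (intro mult_right_mono) auto
  then show "exp (- t * \<delta> / 2) * c \<le> \<epsilon>" using c by simp
  have "16 * t = 32 / \<delta> * ln (c / \<epsilon>) + 4 * (N + 1)" by (simp add: t_def algebra_simps)
  then show "exp (16 * t) = (c / \<epsilon>) powr (32 / \<delta>) * exp (4 * (N + 1))"
    using c \<epsilon> by (simp add: powr_def exp_add)
qed

text \<open>The coefficient of size \<open>k^2 * \<kappa>\<close> stands under a square root, so the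
  cost grows only linearly in \<open>k\<close>. The other terms are raised to multiples of
  \<open>k^2\<close>, and \<open>F\<close> to \<open>E * F\<close>.\<close>

lemma cost_bound:
  fixes k E F M :: real
  assumes k: "k \<ge> 1" and E: "E \<ge> 1" and F: "F \<ge> 0" and p: "\<kappa> \<ge> 0" "M \<ge> 0"
  shows "sqrt ((E * F)^2 + (1 + k^2 * \<kappa> + M) * ((E * F)^2 + F^2)) \<le> sqrt (3 + 2 * \<kappa> + 2 * M) * k * E * F"
proof -
  have k2: "k^2 \<ge> 1" using k by simp
  have EF: "F \<le> E * F" using mult_right_mono[OF E F] by simp
  have "(E * F)^2 + (1 + k^2 * \<kappa> + M) * ((E * F)^2 + F^2) \<le> (E * F)^2 + (1 + k^2 * \<kappa> + M) * ((E * F)^2 + (E * F)^2)"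
    using p EF F by (intro add_left_mono mult_left_mono power_mono) auto
  also have "\<dots> = (3 + 2 * (k^2 * \<kappa>) + 2 * M) * (E * F)^2" by (simp add: algebra_simps)
  also have "\<dots> \<le> (3 * k^2 + 2 * (k^2 * \<kappa>) + 2 * (M * k^2)) * (E * F)^2"
    using p k2 mult_left_mono[OF k2, of M] by (intro mult_right_mono) auto
  also have "\<dots> = (3 + 2 * \<kappa> + 2 * M) * (k * E * F)^2" by (simp add: power_mult_distrib algebra_simps)
  finally have "sqrt ((E * F)^2 + (1 + k^2 * \<kappa> + M) * ((E * F)^2 + F^2)) \<le> sqrt ((3 + 2 * \<kappa> + 2 * M) * (k * E * F)^2)"
    by (rule real_sqrt_le_mono)
  also have "\<dots> = sqrt (3 + 2 * \<kappa> + 2 * M) * k * E * F"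
    using k E F p by (simp add: real_sqrt_mult mult.assoc)
  finally show ?thesis .
qed

text \<open>Even for the zero function \<open>weak_deriv\<close> is a choice that vanishes only
  almost everywhere, so the equation is an almost everywhere argument.\<close>

lemma zero_solution:
  assumes "open (\<Omega> :: 'a::euclidean_space set)"
  shows "weak_solution \<Omega> a (\<lambda>x. 0) (\<lambda>x. 0 :: real)" "has_trace \<Omega> R (\<lambda>x. 0 :: real) (\<lambda>x. 0)"
    "in_Hhalf R (\<lambda>x::'a. 0 :: real)" "Hhalf_norm R (\<lambda>x::'a. 0 :: real) = 0"
proof -
  have w: "weak_grad \<Omega> (\<lambda>x. 0) (\<lambda>x. 0)" by (simp add: weak_grad_def)
  note z = weak_grad_H1[OF assms L2_zero L2_zero w, of "\<lambda>x. 0", simplified]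
  have "(\<integral>x. (\<Sum>b\<in>Basis. dirderiv b \<phi> x * weak_deriv \<Omega> b (\<lambda>x. 0) x) \<partial>lebesgue_on \<Omega>) = 0" for \<phi> :: "'a \<Rightarrow> real"
  proof (rule integral_eq_zero_AE)
    have "AE x in lebesgue_on \<Omega>. \<forall>b\<in>Basis. weak_deriv \<Omega> b (\<lambda>x. 0 :: real) x = 0"
      using z(2) by (intro AE_finite_allI) auto
    then show "AE x in lebesgue_on \<Omega>. (\<Sum>b\<in>Basis. dirderiv b \<phi> x * weak_deriv \<Omega> b (\<lambda>x. 0) x) = 0"
      by eventually_elim simp
  qed
  then show "weak_solution \<Omega> a (\<lambda>x. 0) (\<lambda>x. 0 :: real)" using z(1) by (simp add: weak_solution_def)
  have "H1_norm \<Omega> (\<lambda>x. 0 :: real) = 0" using z(3) by (simp add: L2_norm_zero)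
  then show "has_trace \<Omega> R (\<lambda>x. 0 :: real) (\<lambda>x. 0)"
    using z(1) smooth_const by (auto simp: has_trace_def L2_zero L2_norm_zero intro!: exI[of _ "\<lambda>m x. 0"])
  show "in_Hhalf R (\<lambda>x::'a. 0 :: real)" "Hhalf_norm R (\<lambda>x::'a. 0 :: real) = 0"
    by (simp_all add: in_Hhalf_def Hhalf_norm_def Hhalf_kernel_def L2_zero L2_norm_zero case_prod_unfold)
qed

lemma L2_lebesgue_on_subset:
  fixes f :: "'a::euclidean_space \<Rightarrow> 'b::euclidean_space"
  assumes S: "S \<in> sets borel" "T \<in> sets borel" "T \<subseteq> S" and f: "in_L2 (lebesgue_on S) f"
  shows "in_L2 (lebesgue_on T) f" "L2_norm (lebesgue_on T) f \<le> L2_norm (lebesgue_on S) f"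
proof -
  let ?g = "\<lambda>x. (norm (f x))^2"
  have m: "f \<in> borel_measurable (lebesgue_on T)"
    using measurable_restrict_mono[OF L2_measurable[OF f] S(3)] .
  have i: "integrable lebesgue (cut S ?g)" using f S(1) by (simp add: in_L2_def integrable_restrict_space)
  have eq: "(\<integral>x. ?g x \<partial>lebesgue_on U) = (\<integral>x. indicator U x *R ?g x \<partial>lebesgue)" if "U \<in> sets borel" for U
    using that by (simp add: integral_restrict_space)
  have "cut T ?g = cut T (cut S ?g)" using S(3) by (auto simp: fun_eq_iff indicator_def)
  then have "integrable lebesgue (cut T ?g)" using integrable_mult_indicator[OF _ i, of T] S(2) by simp
  moreover from this have "(\<integral>x. cut T ?g x \<partial>lebesgue) \<le> (\<integral>x. cut S ?g x \<partial>lebesgue)"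
    using S(3) by (intro integral_mono i) (auto simp: indicator_def)
  ultimately show "in_L2 (lebesgue_on T) f" "L2_norm (lebesgue_on T) f \<le> L2_norm (lebesgue_on S) f"
    using m S unfolding L2_norm_def eq[OF S(1)] eq[OF S(2)] by (simp_all add: in_L2_def integrable_restrict_space)
qed

text \<open>The cost is linear in \<open>k\<close>; the exponent \<open>4\<close> is a value above 3
  that dominates it. In \<open>32 / \<delta> + 1\<close> the first term comes from
  \<open>exp (16 * t)\<close>, the second from replacing \<open>D\<close> by
  \<open>L / \<epsilon>\<close>.\<close>

lemma runge_real:
  fixes \<delta> \<kappa> NV :: real
  assumes \<delta>: "0 < \<delta>" "\<delta> < 1" and \<kappa>: "\<kappa> > 1"
  defines "\<Omega>2 \<equiv> annulus (1/2) 2 :: 'a::euclidean_space set"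
    and "\<Omega>1 \<equiv> annulus (1/2) 1 :: 'a set"
    and "\<Omega>1' \<equiv> annulus (1/2) (1 + \<delta>) :: 'a set"
  obtains \<nu> s C where "\<nu> > 1" "s > 3" "C > 1"
    "\<And>V q k v \<epsilon>. in_Linf \<Omega>2 V \<Longrightarrow> Linf_norm \<Omega>2 V = ereal NV \<Longrightarrow> C1_bounded \<Omega>2 q \<Longrightarrow>
      \<forall>x\<in>\<Omega>2. inverse \<kappa> \<le> q x \<and> q x \<le> \<kappa> \<Longrightarrow> \<forall>x\<in>\<Omega>2. grad q x \<bullet> x \<ge> 0 \<Longrightarrow> k \<ge> 1 \<Longrightarrow>
      weak_solution \<Omega>1' (\<lambda>x. k^2 * q x + V x) (\<lambda>x. 0) (v :: 'a \<Rightarrow> real) \<Longrightarrow>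
      has_trace \<Omega>1' (1/2) v (\<lambda>x. 0) \<Longrightarrow> \<epsilon> > 0 \<Longrightarrow>
      approximable \<Omega>2 \<Omega>1 (\<lambda>x. k^2 * q x + V x) v (\<epsilon> * H1_norm \<Omega>1' v) (C * k powr s * \<epsilon> powr (-\<nu>) * L2_norm (lebesgue_on \<Omega>1) v)"
proof -
  \<comment> \<open>\<open>NV\<close> is an arbitrary real number here; the maximum provides a
    nonnegative bound.\<close>
  define N where "N = max NV 0"
  have d: "0 < 1 + \<delta> / 4" "1 + \<delta> / 4 < 1 + 3 / 4 * \<delta>" "1 + 3 / 4 * \<delta> < 1 + \<delta>"
    using \<delta> by simp_all
  obtain \<eta> :: "'a \<Rightarrow> real" and b where \<eta>: "test_function (ball 0 (1 + \<delta>)) \<eta>" "\<And>x. 0 \<le> \<eta> x" "\<And>x. \<eta> x \<le> 1"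
    "\<And>x. norm x \<le> 1 + \<delta> / 4 \<Longrightarrow> \<eta> x = 1" "\<And>x. norm (grad \<eta> x) \<le> b" "\<And>x. \<bar>laplacian \<eta> x\<bar> \<le> b" "b \<ge> 1"
    by (rule cutoff_bounds[OF d], rule that; blast)
  have \<eta>1: "\<bar>\<eta> x\<bar> \<le> 1" for x using \<eta>(2,3)[of x] by linarith
  obtain \<zeta> :: "'a \<Rightarrow> real" and CZ where \<zeta>: "test_function (ball 0 4) \<zeta>" "\<And>x. 0 \<le> \<zeta> x" "\<And>x. \<zeta> x \<le> 1"
    "\<And>x. norm x \<le> 3 \<Longrightarrow> \<zeta> x = 1" "\<And>x. norm x \<ge> 7/2 \<Longrightarrow> \<zeta> x = 0" "\<And>x. \<bar>laplacian \<zeta> x\<bar> \<le> CZ" "CZ \<ge> 1"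
    by (rule cutoff_bounds[of 3 "7/2" 4], simp, simp, simp, rule that; blast)
  obtain K where K: "K > 0" "\<And>(r :: 'a \<Rightarrow> real) G. L2 r \<Longrightarrow> L1 r \<Longrightarrow>
      L2 G \<Longrightarrow> weak_grad (ball 0 3) r G \<Longrightarrow>
      trace_le 2 r (K * sqrt ((norm2 r)^2 + (norm2 G)^2))"
    by (rule trace_exists[of 2 3, where 'a='a], simp, simp, rule that; blast)
  define c where "c = 3 * b"
  define S where "S = sqrt (3 + 2 * \<kappa> + 2 * (N + CZ))"
  define C where "C = max 2 (K * S * c powr (32 / \<delta>) * exp (4 * (N + 1)) * c)"
  show thesis
  proof (rule that[of "32 / \<delta> + 1" 4 C])
    show "32 / \<delta> + 1 > 1" "(4::real) > 3" "C > 1" using \<delta> by (auto simp: C_def)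
    fix V q k and v :: "'a \<Rightarrow> real" and \<epsilon> :: real
    assume V: "in_Linf \<Omega>2 V" "Linf_norm \<Omega>2 V = ereal NV" and q: "C1_bounded \<Omega>2 q"
      "\<forall>x\<in>\<Omega>2. inverse \<kappa> \<le> q x \<and> q x \<le> \<kappa>" "\<forall>x\<in>\<Omega>2. grad q x \<bullet> x \<ge> 0" and k: "k \<ge> 1"
      and v: "weak_solution \<Omega>1' (\<lambda>x. k^2 * q x + V x) (\<lambda>x. 0) v" "has_trace \<Omega>1' (1/2) v (\<lambda>x. 0)" and \<epsilon>: "\<epsilon> > 0"
    let ?p = "\<epsilon> powr (-(32 / \<delta> + 1))"
    define D where "D = H1_norm \<Omega>1' v"
    define L where "L = L2_norm (lebesgue_on \<Omega>1) v"
    have o: "open \<Omega>2" "open \<Omega>1'" "open \<Omega>1" by (simp_all add: \<Omega>2_def \<Omega>1'_def \<Omega>1_def open_annulus)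
    have D0: "D \<ge> 0" by (simp add: D_def H1_norm_def sum_nonneg)
    have LD: "L \<le> D"
    proof -
      have vL: "in_L2 (lebesgue_on \<Omega>1') v" using v(1) by (simp add: weak_solution_def in_H1_def)
      have sub: "\<Omega>1 \<subseteq> \<Omega>1'" using \<delta> by (auto simp: \<Omega>1_def \<Omega>1'_def annulus_def)
      have "L \<le> L2_norm (lebesgue_on \<Omega>1') v"
        unfolding L_def by (rule L2_lebesgue_on_subset(2)[OF _ _ sub vL]) (simp_all add: o)
      also have "\<dots> \<le> D" unfolding D_def H1_norm_def by (intro real_le_rsqrt) (simp add: sum_nonneg)
      finally show ?thesis .
    qed
    show "approximable \<Omega>2 \<Omega>1 (\<lambda>x. k^2 * q x + V x) v (\<epsilon> * H1_norm \<Omega>1' v) (C * k powr 4 * ?p * L2_norm (lebesgue_on \<Omega>1) v)"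
    proof (cases "L \<le> \<epsilon> * D")
      case True
      have "0 \<le> C * k powr 4 * ?p * L" by (simp add: C_def L_def L2_norm_nonneg)
      moreover have "L2_norm (lebesgue_on \<Omega>1) (\<lambda>x. 0 - v x) = L"
        unfolding L_def L2_norm_def by simp
      ultimately show ?thesis
        using zero_solution[OF o(1)] True unfolding L_def D_def approximable_def approximates_def
        by (intro exI[of _ "\<lambda>x. 0"] conjI) simp_all
    next
      case False
      \<comment> \<open>Since \<open>L \<le> D\<close>, this case excludes
        \<open>\<epsilon> \<ge> 1\<close>, and the logarithm in \<open>t\<close> is
        positive.\<close>
      then have "\<epsilon> * D < D" using LD by linarith
      then have \<epsilon>1: "\<epsilon> < 1" using D0 by (metis mult_le_cancel_right1 not_less)
      have DL: "D \<le> L / \<epsilon>" using False \<epsilon> by (simp add: field_simps)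
      define t where "t = 2 / \<delta> * ln (c / \<epsilon>) + (N + 1) / 4"
      have c1: "c \<ge> 1" using \<eta>(7) by (simp add: c_def)
      have N0: "N \<ge> 0" by (simp add: N_def)
      note t = parameter_choice[OF \<delta>(1) c1 \<epsilon> \<epsilon>1 N0, folded t_def]
      obtain A where A: "A \<in> Borel" "\<And>x. 0 \<le> A x" "\<And>x. A x \<le> k^2 * \<kappa>"
        "\<And>x l. l \<ge> 1 \<Longrightarrow> norm x > 1/2 \<Longrightarrow> A x \<le> A (l *R x)" "\<And>x. x \<in> \<Omega>2 \<Longrightarrow> A x = k^2 * q x"
        using extended_coefficient[of q \<kappa> k] q \<kappa> unfolding \<Omega>2_def C1_bounded_def by (smt (verit))
      obtain Vh where Vh: "Vh \<in> Borel" "\<And>x. \<bar>Vh x\<bar> \<le> N" "ae_eq \<Omega>2 V Vh"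
        using bounded_borel_representative[of \<Omega>2 V N] V o(1) N0 by (auto simp: N_def)
      have a: "AE x in lebesgue_on \<Omega>2. k^2 * q x + V x = A x + Vh x"
      proof -
        have ob: "\<Omega>2 \<in> sets borel" using o(1) by simp
        show ?thesis using Vh(3) unfolding AE_lebesgue_on_iff[OF ob] by eventually_elim (simp add: A(5))
      qed
      have \<zeta>': "test_function UNIV \<zeta>" "\<And>x. norm x < 3 \<Longrightarrow> \<zeta> x = 1"
        using test_mono[OF \<zeta>(1)] \<zeta>(4) by auto
      note u = runge_extension[OF \<delta> \<eta>(1) \<eta>1 \<eta>(4,5,6) \<zeta>'(1) \<zeta>(2,3) \<zeta>'(2) \<zeta>(5,6) A(1,2,3,4) Vh(1,2)
          a[unfolded \<Omega>2_def] v[unfolded \<Omega>1'_def] t(1,2) less_imp_le[OF K(1)] K(2), folded \<Omega>2_def \<Omega>1_def \<Omega>1'_def c_def D_def]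
      define E where "E = exp (16 * t)"
      have "t > 0" by (rule t(1))
      then have E1: "E \<ge> 1" by (simp add: E_def)
      have E: "E = (c powr (32 / \<delta>) * exp (4 * (N + 1))) * \<epsilon> powr (- (32 / \<delta>))"
        unfolding E_def t(4) using c1 \<epsilon> by (simp add: powr_divide powr_minus field_simps)
      have F0: "c * D \<ge> 0" using c1 D0 by simp
      have M: "N + CZ \<ge> 0" using N0 \<zeta>(7) by simp
      \<comment> \<open>\<open>D\<close> is traded for \<open>L / \<epsilon>\<close>, which supplies
        the last factor \<open>1 / \<epsilon>\<close> of \<open>?p\<close>.\<close>
      have "K * (S * k * E * (c * D)) \<le> K * (S * k * E * (c * (L / \<epsilon>)))"
        using K(1) k E1 c1 DL M \<kappa> by (intro mult_left_mono) (auto simp: S_def)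
      also have "\<dots> = (K * S * c powr (32 / \<delta>) * exp (4 * (N + 1)) * c) * k * (\<epsilon> powr (- (32 / \<delta>)) / \<epsilon>) * L"
        by (simp add: E)
      also have "\<epsilon> powr (- (32 / \<delta>)) / \<epsilon> = ?p"
        using \<epsilon> powr_diff[of \<epsilon> "- (32 / \<delta>)" 1] by simp
      also have "(K * S * c powr (32 / \<delta>) * exp (4 * (N + 1)) * c) * k * ?p * L
          \<le> C * k powr 4 * ?p * L"
      proof (intro mult_right_mono mult_mono)
        show "k \<le> k powr 4" using powr_mono[of 1 4 k] k by simp
      qed (use k in \<open>auto simp: C_def L_def L2_norm_nonneg\<close>)
      finally have cost: "K * (S * k * E * (c * D)) \<le> C * k powr 4 * ?p * L" .
      show ?thesis
      proof (rule approximable_mono[OF u], assumption+, goal_cases)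
        case 1
        show ?case using mult_right_mono[OF t(3) D0] by (simp add: mult.assoc D_def)
      next
        case 2
        show ?case
          using order_trans[OF mult_left_mono[OF cost_bound[OF k E1 F0 _ M, of \<kappa>] less_imp_le[OF K(1)]]] cost \<kappa>
          by (simp add: S_def E_def L_def add.assoc)
      qed
    qed
  qed
qed

section \<open>Vector valued functions\<close>

lemma L2_scaleR_integrable:
  assumes f: "in_L2 M (f :: _ \<Rightarrow> real)" and g: "in_L2 M g"
  shows "integrable M (\<lambda>x. f x *R g x)"
  by (rule Bochner_Integration.integrable_bound[OF L2_integrable_mult[OF f L2_norm[OF g]]])
     (use L2_measurable[OF f] L2_measurable[OF g] in auto)

lemma L2_Basis_iff:
  "in_L2 M u \<longleftrightarrow> (\<forall>e\<in>Basis. in_L2 M (\<lambda>x. u x \<bullet> e))"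
proof
  assume c: "\<forall>e\<in>Basis. in_L2 M (\<lambda>x. u x \<bullet> e)"
  have "in_L2 M (\<lambda>x. (u x \<bullet> e) *R e)" if e: "e \<in> Basis" for e
  proof (rule L2_bound(1)[of M "\<lambda>x. u x \<bullet> e" _ 1])
    show ue: "in_L2 M (\<lambda>x. u x \<bullet> e)" using c e by blast
    show "(\<lambda>x. (u x \<bullet> e) *R e) \<in> borel_measurable M"
      by (intro borel_measurable_scaleR L2_measurable[OF ue]) simp
  qed (use e in auto)
  then have "in_L2 M (\<lambda>x. \<Sum>e\<in>Basis. (u x \<bullet> e) *R e)" by (rule L2_sum)
  then show "in_L2 M u" by (simp add: euclidean_representation)
qed (blast intro: L2_inner_Basis)

lemma L2_test_function_lebesgue_on:
  fixes \<phi> :: "'a::euclidean_space \<Rightarrow> real"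
  assumes "\<Omega> \<in> sets borel" "test_function \<Omega> \<phi>"
  shows "in_L2 (lebesgue_on \<Omega>) \<phi>"
  using L2_lebesgue_on(1)[OF assms(1) measurable_test_function[OF assms(2)], of \<phi>]
    L2_indicator_mult(1)[OF assms(1) L2_test_function[OF assms(2)]] by simp

text \<open>Test functions are real, so pairing the integrals with \<open>e\<close> affects only
  \<open>u\<close> and \<open>g\<close>; square integrability lets the inner product pass through
  the Bochner integral.\<close>

lemma is_weak_deriv_Basis_iff:
  fixes u g :: "'a::euclidean_space \<Rightarrow> 'b::euclidean_space"
  assumes \<Omega>: "\<Omega> \<in> sets borel" and u: "in_L2 (lebesgue_on \<Omega>) u" and g: "in_L2 (lebesgue_on \<Omega>) g"
  shows "is_weak_deriv \<Omega> b u g \<longleftrightarrow> (\<forall>e\<in>Basis. is_weak_deriv \<Omega> b (\<lambda>x. u x \<bullet> e) (\<lambda>x. g x \<bullet> e))"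
proof -
  have "(\<integral>x. \<phi> x *R h x \<partial>lebesgue_on \<Omega>) \<bullet> e = (\<integral>x. \<phi> x *R (h x \<bullet> e) \<partial>lebesgue_on \<Omega>)"
    if "test_function \<Omega> \<phi>" "in_L2 (lebesgue_on \<Omega>) h" for \<phi> e and h :: "'a \<Rightarrow> 'b"
    using integral_inner_left[OF L2_scaleR_integrable[OF L2_test_function_lebesgue_on[OF \<Omega> that(1)] that(2)], of e] by simp
  note this[OF _ g, of _ e for e] this[OF test_dirderiv u, of _ _ e for e]
  then show ?thesis
    unfolding is_weak_deriv_def by (subst euclidean_eq_iff) (auto simp: inner_minus_left)
qed

lemma is_weak_deriv_diff:
  fixes u g :: "'a::euclidean_space \<Rightarrow> 'b::euclidean_space"
  assumes \<Omega>: "\<Omega> \<in> sets borel" and L: "in_L2 (lebesgue_on \<Omega>) u" "in_L2 (lebesgue_on \<Omega>) g"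
    "in_L2 (lebesgue_on \<Omega>) u'" "in_L2 (lebesgue_on \<Omega>) g'"
    and w: "is_weak_deriv \<Omega> b u g" "is_weak_deriv \<Omega> b u' g'"
  shows "is_weak_deriv \<Omega> b (\<lambda>x. u x - u' x) (\<lambda>x. g x - g' x)"
  unfolding is_weak_deriv_def
proof (intro allI impI)
  fix \<phi> :: "'a \<Rightarrow> real" assume \<phi>: "test_function \<Omega> \<phi>"
  note i = L2_scaleR_integrable[OF L2_test_function_lebesgue_on[OF \<Omega> \<phi>]]
    L2_scaleR_integrable[OF L2_test_function_lebesgue_on[OF \<Omega> test_dirderiv[OF \<phi>]]]
  show "(\<integral>x. dirderiv b \<phi> x *R (u x - u' x) \<partial>lebesgue_on \<Omega>) = - (\<integral>x. \<phi> x *R (g x - g' x) \<partial>lebesgue_on \<Omega>)"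
    unfolding scaleR_diff_right Bochner_Integration.integral_diff[OF i(2)[OF L(1)] i(2)[OF L(3)]]
      Bochner_Integration.integral_diff[OF i(1)[OF L(2)] i(1)[OF L(4)]]
    using w \<phi> by (simp add: is_weak_deriv_def)
qed

lemma in_H1_diff:
  assumes \<Omega>: "\<Omega> \<in> sets borel" and u: "in_H1 \<Omega> u" and v: "in_H1 \<Omega> v"
  shows "in_H1 \<Omega> (\<lambda>x. u x - v x)"
proof -
  have L: "in_L2 (lebesgue_on \<Omega>) u" "in_L2 (lebesgue_on \<Omega>) v" using u v by (simp_all add: in_H1_def)
  have "\<exists>g. in_L2 (lebesgue_on \<Omega>) g \<and> is_weak_deriv \<Omega> b (\<lambda>x. u x - v x) g" if b: "b \<in> Basis" for b
    using is_weak_deriv_diff[OF \<Omega> L(1) in_H1_weak_deriv(1)[OF u b] L(2) in_H1_weak_deriv(1)[OF v b]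
        in_H1_weak_deriv(2)[OF u b] in_H1_weak_deriv(2)[OF v b]]
      L2_diff[OF in_H1_weak_deriv(1)[OF u b] in_H1_weak_deriv(1)[OF v b]] by blast
  then show ?thesis using L2_diff[OF L] by (simp add: in_H1_def)
qed

lemma in_H1_Basis_iff:
  fixes u :: "'a::euclidean_space \<Rightarrow> 'b::euclidean_space"
  assumes \<Omega>: "\<Omega> \<in> sets borel"
  shows "in_H1 \<Omega> u \<longleftrightarrow> (\<forall>e\<in>Basis. in_H1 \<Omega> (\<lambda>x. u x \<bullet> e))"
proof
  assume u: "in_H1 \<Omega> u"
  then have uL: "in_L2 (lebesgue_on \<Omega>) u" by (simp add: in_H1_def)
  have "\<exists>g. in_L2 (lebesgue_on \<Omega>) g \<and> is_weak_deriv \<Omega> b (\<lambda>x. u x \<bullet> e) g" if "b \<in> Basis" "e \<in> Basis" for b and e :: 'b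
    using in_H1_weak_deriv[OF u that(1)] is_weak_deriv_Basis_iff[OF \<Omega> uL] that(2) L2_inner_Basis by blast
  then show "\<forall>e\<in>Basis. in_H1 \<Omega> (\<lambda>x. u x \<bullet> e)" using L2_inner_Basis[OF uL] by (simp add: in_H1_def)
next
  assume u: "\<forall>e\<in>Basis. in_H1 \<Omega> (\<lambda>x. u x \<bullet> e)"
  then have uL: "in_L2 (lebesgue_on \<Omega>) u" by (subst L2_Basis_iff) (simp add: in_H1_def)
  have "\<exists>g. in_L2 (lebesgue_on \<Omega>) g \<and> is_weak_deriv \<Omega> b u g" if b: "b \<in> Basis" for b
  proof -
    define g where "g x = (\<Sum>e\<in>Basis. weak_deriv \<Omega> b (\<lambda>x. u x \<bullet> e) x *R e)" for x
    have ge: "(\<lambda>x. g x \<bullet> e) = weak_deriv \<Omega> b (\<lambda>x. u x \<bullet> e)" if "e \<in> Basis" for e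
      using that by (simp add: g_def inner_sum_left_Basis)
    have d: "in_L2 (lebesgue_on \<Omega>) (\<lambda>x. g x \<bullet> e)" "is_weak_deriv \<Omega> b (\<lambda>x. u x \<bullet> e) (\<lambda>x. g x \<bullet> e)"
      if "e \<in> Basis" for e
      using in_H1_weak_deriv[of \<Omega> "\<lambda>x. u x \<bullet> e", OF _ b] u that unfolding ge[OF that] by blast+
    then have "in_L2 (lebesgue_on \<Omega>) g" by (subst L2_Basis_iff) blast
    moreover from is_weak_deriv_Basis_iff[OF \<Omega> uL this] d(2) have "is_weak_deriv \<Omega> b u g" by blast
    ultimately show ?thesis by blast
  qed
  then show "in_H1 \<Omega> u" unfolding in_H1_def using uL by blast
qed

lemma weak_deriv_inner_Basis:
  fixes u :: "'a::euclidean_space \<Rightarrow> 'b::euclidean_space"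
  assumes \<Omega>: "open \<Omega>" and u: "in_H1 \<Omega> u" and b: "b \<in> Basis" and e: "e \<in> Basis"
  shows "AE x in lebesgue_on \<Omega>. weak_deriv \<Omega> b (\<lambda>x. u x \<bullet> e) x = weak_deriv \<Omega> b u x \<bullet> e"
proof -
  have \<Omega>b: "\<Omega> \<in> sets borel" using \<Omega> by simp
  note d = in_H1_weak_deriv[OF u b]
  have ue: "in_H1 \<Omega> (\<lambda>x. u x \<bullet> e)" using in_H1_Basis_iff[OF \<Omega>b] u e by blast
  have "in_L2 (lebesgue_on \<Omega>) u" using u by (simp add: in_H1_def)
  from is_weak_deriv_Basis_iff[OF \<Omega>b this d(1)] have "is_weak_deriv \<Omega> b (\<lambda>x. u x \<bullet> e) (\<lambda>x. weak_deriv \<Omega> b u x \<bullet> e)"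
    using d(2) e by blast
  from weak_deriv_unique[OF \<Omega> in_H1_weak_deriv(1)[OF ue b] L2_inner_Basis[OF d(1) e] in_H1_weak_deriv(2)[OF ue b] this]
  show ?thesis .
qed

lemma H1_norm_sq_Basis:
  fixes u :: "'a::euclidean_space \<Rightarrow> 'b::euclidean_space"
  assumes \<Omega>: "open \<Omega>" and u: "in_H1 \<Omega> u"
  shows "(H1_norm \<Omega> u)^2 = (\<Sum>e\<in>Basis. (H1_norm \<Omega> (\<lambda>x. u x \<bullet> e))^2)"
proof -
  let ?M = "lebesgue_on \<Omega>"
  have \<Omega>b: "\<Omega> \<in> sets borel" using \<Omega> by simp
  have sq: "(H1_norm \<Omega> w)^2 = (L2_norm ?M w)^2 + (\<Sum>b\<in>Basis. (L2_norm ?M (weak_deriv \<Omega> b w))^2)" for w :: "'a \<Rightarrow> 'c::euclidean_space"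
    by (simp add: H1_norm_def sum_nonneg)
  have uL: "in_L2 ?M u" using u by (simp add: in_H1_def)
  have "(L2_norm ?M (weak_deriv \<Omega> b u))^2 = (\<Sum>e\<in>Basis. (L2_norm ?M (weak_deriv \<Omega> b (\<lambda>x. u x \<bullet> e)))^2)" if b: "b \<in> Basis" for b
  proof -
    note d = in_H1_weak_deriv(1)[OF u b]
    have "L2_norm ?M (weak_deriv \<Omega> b (\<lambda>x. u x \<bullet> e)) = L2_norm ?M (\<lambda>x. weak_deriv \<Omega> b u x \<bullet> e)" if e: "e \<in> Basis" for e
    proof (rule L2_norm_AE_cong)
      have "in_H1 \<Omega> (\<lambda>x. u x \<bullet> e)" using in_H1_Basis_iff[OF \<Omega>b] u e by blast
      then show "weak_deriv \<Omega> b (\<lambda>x. u x \<bullet> e) \<in> borel_measurable ?M" using in_H1_weak_deriv(1)[OF _ b] L2_measurable by blast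
    qed (use L2_measurable[OF L2_inner_Basis[OF d e]] weak_deriv_inner_Basis[OF \<Omega> u b e] in auto)
    then show ?thesis by (simp add: L2_norm_sq_Basis(1)[OF d])
  qed
  then show ?thesis
    unfolding sq L2_norm_sq_Basis(1)[OF uL] sum.distrib by (subst sum.swap) simp
qed

text \<open>The inner product with \<open>e\<close> may be moved inside only if the integrand is
  integrable, otherwise the integral defaults to zero; the bound on \<open>a\<close> provides this.
  The derivatives of the components agree with the components of the derivatives almost
  everywhere.\<close>

lemma weak_solution_Basis_iff:
  fixes u :: "'a::euclidean_space \<Rightarrow> 'b::euclidean_space"
  assumes \<Omega>: "open \<Omega>" and a: "a \<in> borel_measurable (lebesgue_on \<Omega>)" "AE x in lebesgue_on \<Omega>. \<bar>a x\<bar> \<le> B" "B \<ge> 0"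
  shows "weak_solution \<Omega> a (\<lambda>x. 0) u \<longleftrightarrow> (\<forall>e\<in>Basis. weak_solution \<Omega> a (\<lambda>x. 0) (\<lambda>x. u x \<bullet> e))"
proof -
  let ?M = "lebesgue_on \<Omega>"
  have \<Omega>b: "\<Omega> \<in> sets borel" using \<Omega> by simp
  let ?I = "\<lambda>\<phi> u x. (a x * \<phi> x) *R u x - (\<Sum>b\<in>Basis. dirderiv b \<phi> x *R weak_deriv \<Omega> b u x)"
  have int: "integrable ?M (?I \<phi> w)" if w: "in_H1 \<Omega> w" and \<phi>: "test_function \<Omega> \<phi>" for w :: "'a \<Rightarrow> 'c::euclidean_space" and \<phi>
  proof (intro Bochner_Integration.integrable_diff Bochner_Integration.integrable_sum L2_scaleR_integrable)
    note p = L2_test_function_lebesgue_on[OF \<Omega>b \<phi>]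
    show "in_L2 ?M (\<lambda>x. a x * \<phi> x)"
      by (rule L2_bound(1)[OF p borel_measurable_times[OF a(1) L2_measurable[OF p]] _ a(3)])
        (use a(2) in \<open>eventually_elim; auto simp: abs_mult intro!: mult_right_mono\<close>)
    show "in_L2 ?M w" using w by (simp add: in_H1_def)
  qed (use in_H1_weak_deriv(1)[OF w] L2_test_function_lebesgue_on[OF \<Omega>b test_dirderiv[OF \<phi>]] in auto)
  have "(\<integral>x. ?I \<phi> u x \<partial>?M) = 0 \<longleftrightarrow> (\<forall>e\<in>Basis. (\<integral>x. ?I \<phi> (\<lambda>x. u x \<bullet> e) x \<partial>?M) = 0)"
    if u: "in_H1 \<Omega> u" and \<phi>: "test_function \<Omega> \<phi>" for \<phi>
  proof -
    have "(\<integral>x. ?I \<phi> u x \<partial>?M) \<bullet> e = (\<integral>x. ?I \<phi> (\<lambda>x. u x \<bullet> e) x \<partial>?M)" if e: "e \<in> Basis" for e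
    proof -
      have ue: "in_H1 \<Omega> (\<lambda>x. u x \<bullet> e)" using in_H1_Basis_iff[OF \<Omega>b] u e by blast
      have "AE x in ?M. \<forall>b\<in>Basis. weak_deriv \<Omega> b (\<lambda>x. u x \<bullet> e) x = weak_deriv \<Omega> b u x \<bullet> e"
        using weak_deriv_inner_Basis[OF \<Omega> u _ e] by (intro AE_finite_allI) auto
      then have "AE x in ?M. ?I \<phi> u x \<bullet> e = ?I \<phi> (\<lambda>x. u x \<bullet> e) x"
        by eventually_elim (simp add: inner_diff_left inner_sum_left)
      then have "(\<integral>x. ?I \<phi> u x \<bullet> e \<partial>?M) = (\<integral>x. ?I \<phi> (\<lambda>x. u x \<bullet> e) x \<partial>?M)"
        using int[OF u \<phi>] int[OF ue \<phi>] by (intro integral_cong_AE borel_measurable_inner) auto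
      then show ?thesis using integral_inner_left[OF int[OF u \<phi>]] by simp
    qed
    then show ?thesis by (subst euclidean_eq_iff) simp
  qed
  then show ?thesis unfolding weak_solution_def using in_H1_Basis_iff[OF \<Omega>b, of u] by auto
qed

section \<open>Traces and boundary norms by components\<close>

lemma smooth_Basis_iff:
  fixes u :: "'a::euclidean_space \<Rightarrow> 'b::euclidean_space"
  shows "smooth u \<longleftrightarrow> (\<forall>e\<in>Basis. smooth (\<lambda>x. u x \<bullet> e))"
proof
  assume "smooth u" then show "\<forall>e\<in>Basis. smooth (\<lambda>x. u x \<bullet> e)"
    using smooth_compose_linear[OF bounded_linear_inner_left] by blast
next
  assume "\<forall>e\<in>Basis. smooth (\<lambda>x. u x \<bullet> e)"
  then have "smooth (\<lambda>x. \<Sum>e\<in>Basis. (u x \<bullet> e) *R e)"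
    by (intro smooth_sum smooth_compose_linear[OF bounded_linear_scaleR_left]) auto
  then show "smooth u" by (simp add: euclidean_representation)
qed

lemma smooth_in_H1:
  fixes w :: "'a::euclidean_space \<Rightarrow> 'b::euclidean_space"
  assumes \<Omega>: "open \<Omega>" "bounded \<Omega>" and w: "smooth w"
  shows "in_H1 \<Omega> w"
proof -
  obtain R where R: "\<Omega> \<subseteq> ball 0 R" using bounded_subset_ballD[OF \<Omega>(2)] by blast
  have \<Omega>b: "\<Omega> \<in> sets borel" using \<Omega> by simp
  have "in_H1 \<Omega> f" if f: "smooth f" for f :: "'a \<Rightarrow> real"
  proof (rule weak_grad_H1(1)[OF \<Omega>(1) _ _ weak_grad_smooth[OF f R]])
    show "AE x in lebesgue_on \<Omega>. f x = indicator (ball 0 R) x *R f x"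
      unfolding AE_lebesgue_on_iff[OF \<Omega>b] using R by (intro AE_I2) (auto simp: indicator_def)
  qed (intro L2_continuous_ball smooth_continuous smooth_grad f)+
  then show ?thesis using in_H1_Basis_iff[OF \<Omega>b] smooth_Basis_iff w by blast
qed

lemma sq_sum_tendsto_0_iff:
  fixes f :: "nat \<Rightarrow> real"
  assumes "finite I" "\<And>m. f m \<ge> 0" "\<And>i m. g i m \<ge> 0" and eq: "\<And>m. (f m)^2 = (\<Sum>i\<in>I. (g i m)^2)"
  shows "f ----> 0 \<longleftrightarrow> (\<forall>i\<in>I. g i ----> 0)"
proof (intro iffI ballI)
  fix i assume f: "f ----> 0" and i: "i \<in> I"
  have "g i m \<le> f m" for m
    by (rule power2_le_imp_le) (auto simp: eq assms(1,2) i intro: member_le_sum)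
  then show "g i ----> 0" using assms(3) by (intro tendsto_sandwich[OF _ _ tendsto_const f]) auto
next
  assume "\<forall>i\<in>I. g i ----> 0"
  then have "(\<lambda>m. sqrt (\<Sum>i\<in>I. (g i m)^2)) ----> sqrt (\<Sum>i\<in>I. 0^2)"
    by (intro tendsto_real_sqrt tendsto_sum tendsto_power) auto
  moreover have "(\<lambda>m. sqrt (\<Sum>i\<in>I. (g i m)^2)) = f" by (simp add: eq[symmetric] assms(2))
  ultimately show "f ----> 0" by simp
qed

lemma H1_norm_nonneg: "0 \<le> H1_norm \<Omega> u"
  by (simp add: H1_norm_def sum_nonneg)

text \<open>Approximating sequences of the components are chosen independently and reassembled;
  since squared norms add up over components, the joint sequence converges. If \<open>u\<close> or
  \<open>g\<close> lacks the required regularity, both sides are false.\<close>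

lemma has_trace_Basis_iff:
  fixes u g :: "'a::euclidean_space \<Rightarrow> 'b::euclidean_space"
  assumes \<Omega>: "open \<Omega>" "bounded \<Omega>" and R: "R > 0"
  shows "has_trace \<Omega> R u g \<longleftrightarrow> (\<forall>e\<in>Basis. has_trace \<Omega> R (\<lambda>x. u x \<bullet> e) (\<lambda>x. g x \<bullet> e))" (is "_ \<longleftrightarrow> ?C")
proof -
  let ?S = "sphere_measure R :: 'a measure"
  have \<Omega>b: "\<Omega> \<in> sets borel" using \<Omega> by simp
  show ?thesis
  proof (cases "in_H1 \<Omega> u \<and> in_L2 ?S g")
    case True
    have H: "(\<lambda>m. H1_norm \<Omega> (\<lambda>x. w m x - u x)) ----> 0 \<longleftrightarrow>
        (\<forall>e\<in>Basis. (\<lambda>m. H1_norm \<Omega> (\<lambda>x. w m x \<bullet> e - u x \<bullet> e)) ----> 0)" if "\<forall>m. smooth (w m)" for w :: "nat \<Rightarrow> 'a \<Rightarrow> 'b"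
      using H1_norm_sq_Basis[OF \<Omega>(1) in_H1_diff[OF \<Omega>b smooth_in_H1[OF \<Omega>(1,2)]]] that True
      by (intro sq_sum_tendsto_0_iff) (auto simp: H1_norm_nonneg inner_diff_left)
    have L: "L2_lim ?S w g \<longleftrightarrow>
        (\<forall>e\<in>Basis. (\<lambda>m. L2_norm ?S (\<lambda>x. w m x \<bullet> e - g x \<bullet> e)) ----> 0)" if w: "\<forall>m. smooth (w m)" for w :: "nat \<Rightarrow> 'a \<Rightarrow> 'b"
    proof (rule sq_sum_tendsto_0_iff)
      have wL: "in_L2 ?S (w m)" for m
        using w smooth_Basis_iff[of "w m"] L2_sphere[OF _ R] unfolding L2_Basis_iff[of _ "w m"] by blast
      show "(L2_dist ?S (w m) g)^2 = (\<Sum>e\<in>Basis. (L2_norm ?S (\<lambda>x. w m x \<bullet> e - g x \<bullet> e))^2)" for m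
        using L2_norm_sq_Basis(1)[OF L2_diff[OF wL conjunct2[OF True]]] by (simp add: inner_diff_left)
    qed (auto simp: L2_norm_nonneg)
    show ?thesis
    proof
      assume "has_trace \<Omega> R u g"
      then obtain w where w: "\<forall>m. smooth (w m)" "(\<lambda>m. H1_norm \<Omega> (\<lambda>x. w m x - u x)) ----> 0"
        "L2_lim ?S w g" unfolding has_trace_def by blast
      show "?C"
      proof
        fix e :: 'b assume e: "e \<in> Basis"
        show "has_trace \<Omega> R (\<lambda>x. u x \<bullet> e) (\<lambda>x. g x \<bullet> e)"
          unfolding has_trace_def
        proof (intro conjI exI[of _ "\<lambda>m x. w m x \<bullet> e"] allI)
          show "in_H1 \<Omega> (\<lambda>x. u x \<bullet> e)" using in_H1_Basis_iff[OF \<Omega>b, of u] True e by blast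
          show "in_L2 ?S (\<lambda>x. g x \<bullet> e)" using L2_inner_Basis[OF conjunct2[OF True] e] .
          show "smooth (\<lambda>x. w m x \<bullet> e)" for m using w(1) smooth_Basis_iff[of "w m"] e by blast
        qed (use w(2)[unfolded H[OF w(1)]] w(3)[unfolded L[OF w(1)]] e in blast)+
      qed
    next
      assume "?C"
      then have "\<forall>e\<in>Basis. \<exists>w. (\<forall>m. smooth (w m)) \<and> (\<lambda>m. H1_norm \<Omega> (\<lambda>x. w m x - u x \<bullet> e)) ----> 0 \<and>
        (\<lambda>m. L2_norm ?S (\<lambda>x. w m x - g x \<bullet> e)) ----> 0" unfolding has_trace_def by blast
      from bchoice[OF this] obtain w where w: "\<And>e m. e \<in> Basis \<Longrightarrow> smooth (w e m)"
        "\<And>e. e \<in> Basis \<Longrightarrow> (\<lambda>m. H1_norm \<Omega> (\<lambda>x. w e m x - u x \<bullet> e)) ----> 0"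
        "\<And>e. e \<in> Basis \<Longrightarrow> (\<lambda>m. L2_norm ?S (\<lambda>x. w e m x - g x \<bullet> e)) ----> 0" by blast
      define W where "W m x = (\<Sum>e\<in>Basis. w e m x *R e)" for m x
      have We: "W m x \<bullet> e = w e m x" if "e \<in> Basis" for e m x using that by (simp add: W_def inner_sum_left_Basis)
      have W: "\<forall>m. smooth (W m)" using w(1) unfolding smooth_Basis_iff[of "W _"] by (simp add: We)
      show "has_trace \<Omega> R u g"
        unfolding has_trace_def using True W H[OF W] L[OF W] w(2,3) by (intro conjI exI[of _ W]) (auto simp: We)
    qed
  next
    case False
    then have "\<not> has_trace \<Omega> R u g" unfolding has_trace_def by blast
    moreover have "\<not> ?C"
    proof
      assume "?C"
      then have "\<forall>e\<in>Basis. in_H1 \<Omega> (\<lambda>x. u x \<bullet> e)" "\<forall>e\<in>Basis. in_L2 ?S (\<lambda>x. g x \<bullet> e)"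
        unfolding has_trace_def by blast+
      with False show False unfolding in_H1_Basis_iff[OF \<Omega>b, of u] L2_Basis_iff[of ?S g] by blast
    qed
    ultimately show ?thesis by blast
  qed
qed

lemma Hhalf_norm_nonneg: "0 \<le> Hhalf_norm R g"
  and Hhalf_norm_sq: "(Hhalf_norm R g)^2 = (L2_norm (sphere_measure R) g)^2 +
    (\<integral>z. Hhalf_kernel g z \<partial>(sphere_measure R \<Otimes>\<^sub>M sphere_measure R))"
proof -
  have "0 \<le> (L2_norm (sphere_measure R) g)^2 + (\<integral>z. Hhalf_kernel g z \<partial>(sphere_measure R \<Otimes>\<^sub>M sphere_measure R))"
    by (intro add_nonneg_nonneg Bochner_Integration.integral_nonneg) (auto simp: Hhalf_kernel_def)
  then show "0 \<le> Hhalf_norm R g" "(Hhalf_norm R g)^2 = (L2_norm (sphere_measure R) g)^2 +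
    (\<integral>z. Hhalf_kernel g z \<partial>(sphere_measure R \<Otimes>\<^sub>M sphere_measure R))" by (simp_all add: Hhalf_norm_def)
qed

text \<open>The kernel is quadratic in the difference of values, so it splits exactly over an
  orthonormal basis of the target and no constant is lost on reassembly.\<close>

lemma Hhalf_norm_Basis:
  fixes g :: "'a::euclidean_space \<Rightarrow> 'b::euclidean_space"
  assumes g: "\<And>e. e \<in> Basis \<Longrightarrow> in_Hhalf R (\<lambda>x. g x \<bullet> e)"
  shows "in_Hhalf R g" "(Hhalf_norm R g)^2 = (\<Sum>e\<in>Basis. (Hhalf_norm R (\<lambda>x. g x \<bullet> e))^2)"
proof -
  have L: "in_L2 (sphere_measure R) g" using g by (subst L2_Basis_iff) (simp add: in_Hhalf_def)
  have sq: "(norm y)^2 = (\<Sum>e\<in>Basis. (norm (y \<bullet> e))^2)" for y :: 'b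
    unfolding power2_norm_eq_inner[of y] by (subst euclidean_inner) (simp add: power2_eq_square)
  have k: "Hhalf_kernel g = (\<lambda>z. \<Sum>e\<in>Basis. Hhalf_kernel (\<lambda>x. g x \<bullet> e) z)"
    by (auto simp: fun_eq_iff Hhalf_kernel_def sum_divide_distrib[symmetric] sq[of "_ - _"] inner_diff_left)
  show H: "in_Hhalf R g" using g L by (simp add: in_Hhalf_def k)
  show "(Hhalf_norm R g)^2 = (\<Sum>e\<in>Basis. (Hhalf_norm R (\<lambda>x. g x \<bullet> e))^2)"
    using g unfolding Hhalf_norm_sq L2_norm_sq_Basis(1)[OF L] k
    by (simp add: in_Hhalf_def sum.distrib)
qed

lemma bounded_annulus: "bounded (annulus r R)"
  unfolding annulus_def by (rule bounded_diff) simp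

text \<open>Coefficients and test functions are real, so each component of a vector valued, for
  instance complex, solution solves the same scalar problem. The scalar extensions are reassembled
  with the same constants.\<close>

theorem theorem3:
  fixes \<delta> c \<kappa> NV Nq :: real
  assumes "DIM('a::euclidean_space) \<ge> 2"
    and "0 < \<delta>" and "\<delta> < 1"
    and "0 < c" and "c < 1"
    and "\<kappa> > 1"
  defines "\<Omega>2 \<equiv> annulus (1/2) 2 :: 'a set"
    and "\<Omega>1 \<equiv> annulus (1/2) 1 :: 'a set"
    and "\<Omega>1' \<equiv> annulus (1/2) (1 + \<delta>) :: 'a set"
  shows "\<exists>\<nu> s C. \<nu> > 1 \<and> s > 3 \<and> C > 1 \<and>
    (\<forall>V q. in_Linf \<Omega>2 V \<and> Linf_norm \<Omega>2 V = ereal NV \<and> \<not> dirichlet_eigenvalue \<Omega>2 V 0 \<and>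
        C1_bounded \<Omega>2 q \<and> C1_norm \<Omega>2 q = Nq \<and>
        (\<forall>x\<in>\<Omega>2. inverse \<kappa> \<le> q x \<and> q x \<le> \<kappa>) \<and> (\<forall>x\<in>\<Omega>2. grad q x \<bullet> x \<ge> 0) \<longrightarrow>
      (\<forall>k\<ge>1. infdist (k\<^sup>2) (Sigma_spec \<Omega>2 V q) > c * k powr (2 - real DIM('a)) \<longrightarrow>
        (\<forall>v :: 'a \<Rightarrow> 'b::{real_normed_field, euclidean_space}.
            weak_solution \<Omega>1' (\<lambda>x. k\<^sup>2 * q x + V x) (\<lambda>x. 0) v \<and>
            has_trace \<Omega>1' (1/2) v (\<lambda>x. 0) \<longrightarrow>
          (\<forall>\<epsilon>>0. \<exists>(u :: 'a \<Rightarrow> 'b) g.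
            weak_solution \<Omega>2 (\<lambda>x. k\<^sup>2 * q x + V x) (\<lambda>x. 0) u \<and>
            has_trace \<Omega>2 (1/2) u (\<lambda>x. 0) \<and>
            L2_norm (lebesgue_on \<Omega>1) (\<lambda>x. u x - v x) \<le> \<epsilon> * H1_norm \<Omega>1' v \<and>
            has_trace \<Omega>2 2 u g \<and> in_Hhalf 2 g \<and>
            Hhalf_norm 2 g \<le> C * k powr s * \<epsilon> powr (-\<nu>) * L2_norm (lebesgue_on \<Omega>1) v))))"
proof (rule runge_real[OF assms(2,3,6), where ?'a='a and NV=NV], goal_cases)
  case (1 \<nu> s C)
  note C = 1(1-3) and ext = 1(4)[folded \<Omega>2_def \<Omega>1_def \<Omega>1'_def]
  have o: "open \<Omega>2" "open \<Omega>1'" "open \<Omega>1" "bounded \<Omega>2" "bounded \<Omega>1'"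
    by (simp_all add: \<Omega>2_def \<Omega>1_def \<Omega>1'_def open_annulus bounded_annulus)
  have b: "\<Omega>2 \<in> sets borel" "\<Omega>1' \<in> sets borel" "\<Omega>1 \<in> sets borel" using o by simp_all
  have sub: "\<Omega>1 \<subseteq> \<Omega>1'" "\<Omega>1' \<subseteq> \<Omega>2" using assms(2,3) by (auto simp: \<Omega>2_def \<Omega>1_def \<Omega>1'_def annulus_def)
  show ?case
  proof (rule exI[of _ \<nu>], rule exI[of _ s], rule exI[of _ C], intro conjI C allI impI, elim conjE)
    fix V q :: "'a \<Rightarrow> real" and k \<epsilon> :: real and v :: "'a \<Rightarrow> 'b"
    assume V: "in_Linf \<Omega>2 V" "Linf_norm \<Omega>2 V = ereal NV" and q: "C1_bounded \<Omega>2 q"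
      "\<forall>x\<in>\<Omega>2. inverse \<kappa> \<le> q x \<and> q x \<le> \<kappa>" "\<forall>x\<in>\<Omega>2. grad q x \<bullet> x \<ge> 0" and k: "1 \<le> k"
      and v: "weak_solution \<Omega>1' (\<lambda>x. k^2 * q x + V x) (\<lambda>x. 0) v" "has_trace \<Omega>1' (1/2) v (\<lambda>x. 0)" and \<epsilon>: "0 < \<epsilon>"
    let ?c = "C * k powr s * \<epsilon> powr (-\<nu>)"
    let ?L = "L2_norm (lebesgue_on \<Omega>1)" and ?v = "\<lambda>e x. v x \<bullet> e"
    let ?a = "\<lambda>x. k^2 * q x + V x"
    obtain Vh where Vh: "Vh \<in> Borel" "\<And>x. \<bar>Vh x\<bar> \<le> max NV 0" "ae_eq \<Omega>2 V Vh"
      using bounded_borel_representative[OF b(1) V(1), of "max NV 0"] V(2) by auto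
    have "continuous_on \<Omega>2 q"
      using q(1) unfolding C1_bounded_def
      by (auto simp: numeral_eq_Suc intro!: continuous_at_imp_continuous_on differentiable_imp_continuous_within)
    then have qm: "cut \<Omega>2 q \<in> Borel"
      by (intro borel_measurable_continuous_on_indicator b)
    \<comment> \<open>Measurability and a bound for the coefficient on both annuli, read off from
      Borel representatives; they permit passing between a vector valued solution and its
      components.\<close>
    have ae: "?a \<in> borel_measurable (lebesgue_on S) \<and> (AE x in lebesgue_on S. \<bar>?a x\<bar> \<le> k^2 * \<kappa> + max NV 0)"
      if S: "S \<in> sets borel" "S \<subseteq> \<Omega>2" for S
    proof
      have "AE x in lebesgue_on S. x \<in> \<Omega>2 \<and> V x = Vh x"
        using Vh(3) S(2) unfolding AE_lebesgue_on_iff[OF S(1)] AE_lebesgue_on_iff[OF b(1)] by (auto elim!: eventually_mono)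
      then have eq: "AE x in lebesgue_on S. x \<in> \<Omega>2 \<and> ?a x = k^2 * (indicator \<Omega>2 x *R q x) + Vh x"
        by eventually_elim simp
      show "?a \<in> borel_measurable (lebesgue_on S)"
        by (rule measurable_lebesgue_on_AE[OF S(1), of "\<lambda>x. k^2 * (indicator \<Omega>2 x *R q x) + Vh x"])
          (use qm Vh(1) eq in auto)
      show "AE x in lebesgue_on S. \<bar>?a x\<bar> \<le> k^2 * \<kappa> + max NV 0"
        using eq
      proof eventually_elim
        case (elim x)
        have "0 < inverse \<kappa>" using assms(6) by simp
        then have "\<bar>q x\<bar> \<le> \<kappa>" using q(2) elim by (smt (verit))
        then have "\<bar>k^2 * q x\<bar> \<le> k^2 * \<kappa>" by (simp add: abs_mult mult_left_mono)
        then show ?case using elim Vh(2)[of x] by simp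
      qed
    qed
    have B0: "0 \<le> k^2 * \<kappa> + max NV 0" using assms(6) by simp
    note ws = weak_solution_Basis_iff[OF o(1) conjunct1[OF ae[OF b(1) order_refl]] conjunct2[OF ae[OF b(1) order_refl]] B0]
      weak_solution_Basis_iff[OF o(2) conjunct1[OF ae[OF b(2) sub(2)]] conjunct2[OF ae[OF b(2) sub(2)]] B0]
    have "\<forall>e\<in>Basis. approximable \<Omega>2 \<Omega>1 ?a (?v e) (\<epsilon> * H1_norm \<Omega>1' (?v e))
        (?c * ?L (?v e))"
    proof (intro ballI ext[OF V q k _ _ \<epsilon>])
      fix e :: 'b assume e: "e \<in> Basis"
      show "weak_solution \<Omega>1' ?a (\<lambda>x. 0) (?v e)" using v(1) e unfolding ws(2)[of v] by blast
      show "has_trace \<Omega>1' (1/2) (?v e) (\<lambda>x. 0)"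
        using v(2) e unfolding has_trace_Basis_iff[OF o(2,5), of "1/2" v, simplified] by simp
    qed
    from bchoice[OF this[unfolded approximable_def]] obtain ue where "\<forall>e\<in>Basis. \<exists>g. approximates \<Omega>2 \<Omega>1 ?a (?v e)
        (\<epsilon> * H1_norm \<Omega>1' (?v e)) (?c * ?L (?v e)) (ue e) g" ..
    from bchoice[OF this] obtain ge where ue: "\<And>e. e \<in> Basis \<Longrightarrow> approximates \<Omega>2 \<Omega>1 ?a (?v e)
        (\<epsilon> * H1_norm \<Omega>1' (?v e)) (?c * ?L (?v e)) (ue e) (ge e)" by blast
    note ue = ue[unfolded approximates_def, THEN conjunct1] ue[unfolded approximates_def, THEN conjunct2, THEN conjunct1]
      ue[unfolded approximates_def, THEN conjunct2, THEN conjunct2]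
    define u where "u x = (\<Sum>e\<in>Basis. ue e x *R e)" for x
    define g where "g x = (\<Sum>e\<in>Basis. ge e x *R e)" for x
    have u: "(\<lambda>x. u x \<bullet> e) = ue e" and g: "(\<lambda>x. g x \<bullet> e) = ge e" if "e \<in> Basis" for e
      using that by (simp_all add: u_def g_def inner_sum_left_Basis)
    have sol: "weak_solution \<Omega>2 ?a (\<lambda>x. 0) u" using ue(1) unfolding ws(1)[of u] by (simp add: u)
    have gH: "in_Hhalf 2 (\<lambda>x. g x \<bullet> e)" if "e \<in> Basis" for e using ue(3) that by (simp add: g)
    have gin: "in_Hhalf 2 g" by (rule Hhalf_norm_Basis(1)) (rule gH)
    have vL: "in_L2 (lebesgue_on \<Omega>1) v" and uL: "in_L2 (lebesgue_on \<Omega>1) u"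
      using L2_lebesgue_on_subset(1)[OF b(2,3) sub(1), of v] L2_lebesgue_on_subset(1)[OF b(1,3) order_trans[OF sub], of u]
        v(1) sol by (auto simp: weak_solution_def in_H1_def)
    have vH: "in_H1 \<Omega>1' v" using v(1) by (simp add: weak_solution_def)
    \<comment> \<open>The squared component estimates are summed and their common factor is taken
      out, so the dimension of the target does not enter; the boundary norm below is treated in the
      same way.\<close>
    have err: "L2_dist (lebesgue_on \<Omega>1) u v \<le> \<epsilon> * H1_norm \<Omega>1' v"
    proof (rule power2_le_imp_le)
      have "(L2_dist (lebesgue_on \<Omega>1) u v)^2 = (\<Sum>e\<in>Basis. (?L (\<lambda>x. u x \<bullet> e - v x \<bullet> e))^2)"
        unfolding L2_norm_sq_Basis(1)[OF L2_diff[OF uL vL]] inner_diff_left ..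
      also have "\<dots> \<le> (\<Sum>e\<in>Basis. (\<epsilon> * H1_norm \<Omega>1' (?v e))^2)"
        using ue(3)[THEN conjunct1] by (intro sum_mono power_mono L2_norm_nonneg) (simp add: fun_cong[OF u])
      also have "\<dots> = (\<epsilon> * H1_norm \<Omega>1' v)^2"
        unfolding power_mult_distrib H1_norm_sq_Basis[OF o(2) vH] sum_distrib_left ..
      finally show "(L2_dist (lebesgue_on \<Omega>1) u v)^2 \<le> (\<epsilon> * H1_norm \<Omega>1' v)^2" .
    qed (use \<epsilon> in \<open>simp add: H1_norm_nonneg\<close>)
    have bd: "Hhalf_norm 2 g \<le> ?c * ?L v"
    proof (rule power2_le_imp_le)
      have "(Hhalf_norm 2 g)^2 = (\<Sum>e\<in>Basis. (Hhalf_norm 2 (ge e))^2)"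
        using Hhalf_norm_Basis(2)[of 2 g] gH by (simp add: g)
      also have "\<dots> \<le> (\<Sum>e\<in>Basis. (?c * ?L (?v e))^2)"
        using ue(3) by (intro sum_mono power_mono) (auto simp: Hhalf_norm_nonneg)
      also have "\<dots> = (?c * ?L v)^2"
        unfolding power_mult_distrib L2_norm_sq_Basis(1)[OF vL] sum_distrib_left ..
      finally show "(Hhalf_norm 2 g)^2 \<le> (?c * ?L v)^2" .
    qed (use C(3) in \<open>simp add: L2_norm_nonneg\<close>)
    have "has_trace \<Omega>2 (1/2) u (\<lambda>x. 0)"
      unfolding has_trace_Basis_iff[OF o(1,4), of "1/2" u "\<lambda>x. 0", simplified] using ue(2) by (simp add: u)
    moreover have "has_trace \<Omega>2 2 u g"
      unfolding has_trace_Basis_iff[OF o(1,4), of 2 u g, simplified] using ue(3) by (simp add: u g)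
    ultimately show "\<exists>u g. weak_solution \<Omega>2 ?a (\<lambda>x. 0) u \<and> has_trace \<Omega>2 (1/2) u (\<lambda>x. 0) \<and>
        L2_dist (lebesgue_on \<Omega>1) u v \<le> \<epsilon> * H1_norm \<Omega>1' v \<and>
        has_trace \<Omega>2 2 u g \<and> in_Hhalf 2 g \<and> Hhalf_norm 2 g \<le> ?c * ?L v"
      using sol err bd gin by blast
  qed
qed

end
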